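(* Let $(\mathbf U,\mathbf U^\imath)$ be either of the quantum symmetric pairs $(\mathbf U_q(\mathfrak{sl}_{2r+1}),\mathbf U^\imath_q(\mathfrak{sl}_{2r+1}))$, $(\mathbf U_q(\mathfrak{sl}_{2r+2}),\mathbf U^\imath_q(\mathfrak{sl}_{2r+2}))$ and let $m\ge1$; notation is as in the context. (1) The action of $\mathcal T^{-1}\otimes\mathrm{id}^{\otimes(m-1)}$ coincides with the action of $s_0\in\mathcal H^1_{B_m}$ on $\mathbb V^{\otimes m}$. (2) The actions of $\mathbf U^\imath$ and $\mathcal H^1_{B_m}$ on $\mathbb V^{\otimes m}$ commute with each other, and they form double centralizers (i.e. the images of $\mathbf U^\imath$ and of $\mathcal H^1_{B_m}$ in $\mathrm{End}_{\mathbb Q(q)}(\mathbb V^{\otimes m})$ are the full centralizers of each other).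
   Context: $q$ is an indeterminate. Case A ($\mathfrak{sl}_{2r+1}$, $r\ge1$): $\mathbb I=\{-r+\frac12,\dots,r-\frac12\}\subset\mathbb Z+\frac12$ and $I=\{-r,\dots,r\}$. Case B ($\mathfrak{sl}_{2r+2}$, $r\ge0$): $\mathbb I=\{-r,\dots,r\}$ and $I=\{-r-\frac12,\dots,r+\frac12\}\subset\mathbb Z+\frac12$. In both cases $I=\{a\pm\frac12:a\in\mathbb I\}$; $s=\max I$. Let $\Lambda=\bigoplus_{a\in I}\mathbb Z\varepsilon_a$, $(\varepsilon_a,\varepsilon_b)=\delta_{ab}$, $\alpha_i=\varepsilon_{i-\frac12}-\varepsilon_{i+\frac12}$ ($i\in\mathbb I$). $\mathbf U$ is the standard quantum group over $\mathbb Q(q)$ with generators $E_i,F_i,K_i^{\pm1}$ ($i\in\mathbb I$), $[E_i,F_j]=\delta_{ij}(K_i-K_i^{-1})/(q-q^{-1})$, coproduct $\Delta(E_i)=1\otimes E_i+E_i\otimes K_i^{-1}$, $\Delta(F_i)=F_i\otimes1+K_i\otimes F_i$, $\Delta(K_i)=K_i\otimes K_i$, and bar involution $\psi$ (antilinear for $q\mapsto q^{-1}$, fixing $E_i,F_i$, $K_i\mapsto K_i^{-1}$). $\mathbf U^\imath\subset\mathbf U$ is the subalgebra generated by, for $i\in\mathbb I$, $i>0$, $k_i^{\pm1}=(K_iK_{-i}^{-1})^{\pm1}$, $e_i=E_i+F_{-i}K_i^{-1}$, $f_i=K_{-i}^{-1}F_i+E_{-i}$, and in case B also $t=E_0+qF_0K_0^{-1}$.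 It has an antilinear involutive algebra automorphism $\psi_\imath$ fixing $e_i,f_i,t$ with $k_i\mapsto k_i^{-1}$. There is a unique $\Upsilon=\sum_{\mu\in\sum\mathbb N\alpha_i}\Upsilon_\mu$, $\Upsilon_\mu\in\mathbf U^-_{-\mu}$, $\Upsilon_0=1$, in the completion of $\mathbf U$ with respect to the subspaces $\mathbf U^+\mathbf U^0\big(\sum_{\mathrm{ht}(\mu)\ge N}\mathbf U^-_{-\mu}\big)$, such that $\psi_\imath(u)\Upsilon=\Upsilon\,\psi(u)$ for all $u\in\mathbf U^\imath$; it acts on finite-dimensional weight modules. $\mathbb V=\bigoplus_{a\in I}\mathbb Q(q)v_a$ is the natural $\mathbf U$-module: $E_iv_a=\delta_{i+\frac12,a}v_{a-1}$, $F_iv_a=\delta_{i-\frac12,a}v_{a+1}$, $K_iv_a=q^{(\alpha_i,\varepsilon_a)}v_a$. $\mathbb V^{\otimes m}$ is a $\mathbf U$-module via $\Delta$ and a $\mathbf U^\imath$-module by restriction. On a finite-dimensional $\mathbf U$-module $M$, for $x\in M_\lambda$, $T_i(x)=\sum_{a,b,c\ge0,\,-a+b-c=(\lambda,\alpha_i)}(-1)^bq^{b-ac}E_i^{(a)}F_i^{(b)}E_i^{(c)}x$ (divided powers); $T_{w_0}$ is the product of the $T_i$ along a reduced expression of the longest element $w_0$ of the Weyl group of $\mathbf U$. On $\mathbb V$ let $\widetilde\zeta(v_a)=(-q)^{-s-a}v_a$, and $\mathcal T=\Upsilon\circ\widetilde\zeta\circ T_{w_0}:\mathbb V\to\mathbb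 V$. $\mathcal H^1_{B_m}$ is the $\mathbb Q(q)$-algebra generated by $s_0,H_1,\dots,H_{m-1}$ with relations $s_0^2=1$, $(H_i-q^{-1})(H_i+q)=0$, $H_iH_{i+1}H_i=H_{i+1}H_iH_{i+1}$, $H_iH_j=H_jH_i$ ($|i-j|>1$), $s_0H_1s_0H_1=H_1s_0H_1s_0$, $s_0H_i=H_is_0$ ($i>1$). For $f=(f(1),\dots,f(m))\in I^m$ put $M_f=v_{f(1)}\otimes\cdots\otimes v_{f(m)}$; $f\cdot s_i$ ($i\ge1$) swaps $f(i),f(i+1)$, and $f\cdot s_0$ replaces $f(1)$ by $-f(1)$. The right action of $\mathcal H^1_{B_m}$ on $\mathbb V^{\otimes m}$ is: $M_f\cdot s_0=M_{f\cdot s_0}$ and, for $i\ge1$, $M_fH_i=q^{-1}M_f$ if $f(i)=f(i+1)$; $M_fH_i=M_{f\cdot s_i}$ if $f(i)<f(i+1)$; $M_fH_i=M_{f\cdot s_i}+(q^{-1}-q)M_f$ if $f(i)>f(i+1)$. *)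

theory Defs
  imports
    "HOL-Computational_Algebra.Polynomial_Factorial"
    "HOL-Computational_Algebra.Field_as_Ring"
    "HOL-Algebra.QuotRing"
    "HOL-Algebra.Generated_Rings"
    "HOL-Library.Poly_Mapping"
    "HOL-Library.Multiset"
    "HOL-Combinatorics.Transposition"
begin

section \<open>The ground field\<close>

type_synonym qf = "rat poly fract"

definition q :: qf where "q = to_fract [:0, 1:]"

definition qf_bar :: "qf \<Rightarrow> qf" where
  "qf_bar x = (let ev = (\<lambda>p. poly (map_poly (\<lambda>c. to_fract [:c:]) p) (inverse q))
     in ev (fst (quot_of_fract x)) / ev (snd (quot_of_fract x)))"

section \<open>Free algebras and algebras given by a presentation\<close>

text \<open>The free monoid is written additively: then finitely supported functions on it, with the
  convolution product of \<^theory>\<open>HOL-Library.Poly_Mapping\<close>, form the free associative algebra.\<close>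

datatype 'g fword = Word (letters: "'g list")

instantiation fword :: (type) monoid_add
begin
definition zero_fword :: "'g fword" where "zero_fword = Word []"
definition plus_fword :: "'g fword \<Rightarrow> 'g fword \<Rightarrow> 'g fword" where
  "plus_fword u v = Word (letters u @ letters v)"
instance by standard (simp_all add: zero_fword_def plus_fword_def)
end

type_synonym 'g falg = "'g fword \<Rightarrow>\<^sub>0 qf"

definition const :: "qf \<Rightarrow> 'g falg" where "const c = Poly_Mapping.single 0 c"

definition monomial :: "'g list \<Rightarrow> 'g falg" where
  "monomial ws = Poly_Mapping.single (Word ws) 1"

abbreviation var :: "'g \<Rightarrow> 'g falg" where "var g \<equiv> monomial [g]"

definition linext :: "('g fword \<Rightarrow> 'h falg) \<Rightarrow> 'g falg \<Rightarrow> 'h falg" where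
  "linext b x = (\<Sum>w\<in>Poly_Mapping.keys x. const (Poly_Mapping.lookup x w) * b w)"

definition free_algebra :: "'g set \<Rightarrow> 'g falg ring" where
  "free_algebra G =
     \<lparr>carrier = {x. \<forall>w\<in>Poly_Mapping.keys x. set (letters w) \<subseteq> G},
      mult = (*), one = 1, zero = 0, add = (+)\<rparr>"

text \<open>Being an ideal of a unital algebra containing the scalars, the ideal generated by the
  relators is a linear subspace; the elements of the quotient are cosets.\<close>

definition presented :: "'g set \<Rightarrow> 'g falg set \<Rightarrow> 'g falg set ring" where
  "presented G rels = free_algebra G Quot genideal (free_algebra G) rels"

definition pclass :: "'g set \<Rightarrow> 'g falg set \<Rightarrow> 'g falg \<Rightarrow> 'g falg set" where
  "pclass G rels x = genideal (free_algebra G) rels +>\<^bsub>free_algebra G\<^esub> x"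

text \<open>Left and right actions of the free algebra determined by operators for the generators. They
  are passed to the quotient by evaluating at the representatives of a coset.\<close>

definition lact :: "('g \<Rightarrow> 'h falg \<Rightarrow> 'h falg) \<Rightarrow> 'g falg \<Rightarrow> 'h falg \<Rightarrow> 'h falg" where
  "lact R a x = (\<Sum>w\<in>Poly_Mapping.keys a. const (Poly_Mapping.lookup a w) * foldr R (letters w) x)"

definition ract :: "('g \<Rightarrow> 'h falg \<Rightarrow> 'h falg) \<Rightarrow> 'h falg \<Rightarrow> 'g falg \<Rightarrow> 'h falg" where
  "ract R x a = (\<Sum>w\<in>Poly_Mapping.keys a. const (Poly_Mapping.lookup a w) * fold R (letters w) x)"

section \<open>Index sets and weights\<close>

definition II_A :: "nat \<Rightarrow> rat set" where
  "II_A r = (\<lambda>k. of_int k + 1/2) ` {- int r .. int r - 1}"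

definition II_B :: "nat \<Rightarrow> rat set" where
  "II_B r = of_int ` {- int r .. int r}"

text \<open>All notions below depend only on the index set \<open>J\<close> of the simple roots (\<open>II_A r\<close> or
  \<open>II_B r\<close>).\<close>

definition wtI :: "rat set \<Rightarrow> rat set" where
  "wtI J = (\<lambda>a. a - 1/2) ` J \<union> (\<lambda>a. a + 1/2) ` J"

type_synonym wt = "rat \<Rightarrow>\<^sub>0 int"

definition eps :: "rat \<Rightarrow> wt" where "eps a = Poly_Mapping.single a 1"

definition alpha :: "rat \<Rightarrow> wt" where "alpha i = eps (i - 1/2) - eps (i + 1/2)"

definition form :: "wt \<Rightarrow> wt \<Rightarrow> int" where
  "form x y = (\<Sum>a\<in>Poly_Mapping.keys x. Poly_Mapping.lookup x a * Poly_Mapping.lookup y a)"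

section \<open>The quantum group\<close>

datatype gen = GE rat | GF rat | GK rat | GKinv rat

abbreviation "xE i \<equiv> var (GE i)"
abbreviation "xF i \<equiv> var (GF i)"
abbreviation "xK i \<equiv> var (GK i)"
abbreviation "xKinv i \<equiv> var (GKinv i)"

definition Ugens :: "rat set \<Rightarrow> gen set" where
  "Ugens J = GE ` J \<union> GF ` J \<union> GK ` J \<union> GKinv ` J"

definition Urels :: "rat set \<Rightarrow> gen falg set" where
  "Urels J =
     {xK i * xKinv i - 1 | i. i \<in> J} \<union>
     {xKinv i * xK i - 1 | i. i \<in> J} \<union>
     {xK i * xK j - xK j * xK i | i j. i \<in> J \<and> j \<in> J} \<union>
     {xK i * xE j * xKinv i - const (q powi form (alpha i) (alpha j)) * xE j | i j. i \<in> J \<and> j \<in> J} \<union>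
     {xK i * xF j * xKinv i - const (q powi (- form (alpha i) (alpha j))) * xF j | i j. i \<in> J \<and> j \<in> J} \<union>
     {xE i * xF j - xF j * xE i -
        (if i = j then const (1 / (q - inverse q)) * (xK i - xKinv i) else 0) | i j. i \<in> J \<and> j \<in> J} \<union>
     {xE i ^ 2 * xE j - const (q + inverse q) * (xE i * xE j * xE i) + xE j * xE i ^ 2
        | i j. i \<in> J \<and> j \<in> J \<and> \<bar>i - j\<bar> = 1} \<union>
     {xF i ^ 2 * xF j - const (q + inverse q) * (xF i * xF j * xF i) + xF j * xF i ^ 2
        | i j. i \<in> J \<and> j \<in> J \<and> \<bar>i - j\<bar> = 1} \<union>
     {xE i * xE j - xE j * xE i | i j. i \<in> J \<and> j \<in> J \<and> \<bar>i - j\<bar> > 1} \<union>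
     {xF i * xF j - xF j * xF i | i j. i \<in> J \<and> j \<in> J \<and> \<bar>i - j\<bar> > 1}"

definition UU :: "rat set \<Rightarrow> gen falg set ring" where
  "UU J = presented (Ugens J) (Urels J)"

definition ucls :: "rat set \<Rightarrow> gen falg \<Rightarrow> gen falg set" where
  "ucls J = pclass (Ugens J) (Urels J)"

text \<open>The linear span in the quantum group of the monomials in a set of words.\<close>

definition mspan :: "rat set \<Rightarrow> gen list set \<Rightarrow> gen falg set set" where
  "mspan J W = ucls J ` {x. letters ` Poly_Mapping.keys x \<subseteq> W}"

fun gen_bar :: "gen \<Rightarrow> gen" where
  "gen_bar (GE i) = GE i"
| "gen_bar (GF i) = GF i"
| "gen_bar (GK i) = GKinv i"
| "gen_bar (GKinv i) = GK i"

definition falg_bar :: "gen falg \<Rightarrow> gen falg" where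
  "falg_bar x = (\<Sum>w\<in>Poly_Mapping.keys x.
     const (qf_bar (Poly_Mapping.lookup x w)) * monomial (map gen_bar (letters w)))"

text \<open>The antilinear involution \<open>falg_bar\<close> preserves the ideal of relations, so it maps cosets
  onto cosets.\<close>

definition U_bar :: "gen falg set \<Rightarrow> gen falg set" where
  "U_bar X = falg_bar ` X"

section \<open>The coideal subalgebra and its bar involution\<close>

definition ik :: "rat set \<Rightarrow> rat \<Rightarrow> gen falg set" where
  "ik J i = ucls J (xK i * xKinv (- i))"

definition ikinv :: "rat set \<Rightarrow> rat \<Rightarrow> gen falg set" where
  "ikinv J i = ucls J (xK (- i) * xKinv i)"

definition ie :: "rat set \<Rightarrow> rat \<Rightarrow> gen falg set" where
  "ie J i = ucls J (xE i + xF (- i) * xKinv i)"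

definition ifl :: "rat set \<Rightarrow> rat \<Rightarrow> gen falg set" where
  "ifl J i = ucls J (xKinv (- i) * xF i + xE (- i))"

definition it :: "rat set \<Rightarrow> gen falg set" where
  "it J = ucls J (xE 0 + const q * (xF 0 * xKinv 0))"

text \<open>The generator \<open>it\<close> is present exactly for the index sets \<open>II_B r\<close>, which contain 0, whereas
  the sets \<open>II_A r\<close> do not.\<close>

definition Ui :: "rat set \<Rightarrow> gen falg set set" where
  "Ui J = generate_ring (UU J)
     ({ucls J (const c) | c. True} \<union>
      (\<Union>i\<in>{i\<in>J. i > 0}. {ik J i, ikinv J i, ie J i, ifl J i}) \<union>
      (if 0 \<in> J then {it J} else {}))"

definition is_iota_bar :: "rat set \<Rightarrow> (gen falg set \<Rightarrow> gen falg set) \<Rightarrow> bool" where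
  "is_iota_bar J psi \<longleftrightarrow>
     psi \<in> ring_hom (UU J \<lparr>carrier := Ui J\<rparr>) (UU J \<lparr>carrier := Ui J\<rparr>) \<and>
     (\<forall>c. psi (ucls J (const c)) = ucls J (const (qf_bar c))) \<and>
     (\<forall>u\<in>Ui J. psi (psi u) = u) \<and>
     (\<forall>i\<in>J. i > 0 \<longrightarrow> psi (ik J i) = ikinv J i \<and> psi (ie J i) = ie J i \<and> psi (ifl J i) = ifl J i) \<and>
     (0 \<in> J \<longrightarrow> psi (it J) = it J)"

section \<open>The quasi-K-matrix\<close>

text \<open>Since the simple roots are linearly independent, \<open>\<mu> = \<Sum> n\<^sub>i \<alpha>\<^sub>i\<close> with natural \<open>n\<^sub>i\<close> is encoded
  as the multiset over \<open>J\<close> in which \<open>i\<close> has multiplicity \<open>n\<^sub>i\<close>; its size is the height.\<close>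

definition Uminus_wt :: "rat set \<Rightarrow> rat multiset \<Rightarrow> gen falg set set" where
  "Uminus_wt J \<mu> = mspan J {map GF is | is. mset is = \<mu>}"

text \<open>\<open>U\<^sup>+ U\<^sup>0 (\<Sum> U\<^sup>-\<^sub>-\<^sub>\<mu>)\<close>, the sum over all \<open>\<mu>\<close> of height at least \<open>N\<close>: the span of the products
  of a monomial in the \<open>E\<^sub>i\<close>, one in the \<open>K\<^sub>i\<close> and their inverses, and one in the \<open>F\<^sub>i\<close> of length at
  least \<open>N\<close>.\<close>

definition U_ge :: "rat set \<Rightarrow> nat \<Rightarrow> gen falg set set" where
  "U_ge J N = mspan J {map GE is @ ks @ map GF js | is ks js.
     set is \<subseteq> J \<and> set ks \<subseteq> GK ` J \<union> GKinv ` J \<and> set js \<subseteq> J \<and> length js \<ge> N}"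

text \<open>Elements of the completion of the quantum group along the subspaces \<open>U_ge J N\<close> are
  represented by Cauchy sequences; two of them represent the same element iff they satisfy
  \<open>Uhat_eq\<close>. Multiplication by elements of the quantum group is termwise.\<close>

definition Uhat_eq :: "rat set \<Rightarrow> (nat \<Rightarrow> gen falg set) \<Rightarrow> (nat \<Rightarrow> gen falg set) \<Rightarrow> bool" where
  "Uhat_eq J x y \<longleftrightarrow> (\<forall>N. \<exists>n0. \<forall>n\<ge>n0. x n \<ominus>\<^bsub>UU J\<^esub> y n \<in> U_ge J N)"

definition partial :: "rat set \<Rightarrow> (rat multiset \<Rightarrow> gen falg set) \<Rightarrow> nat \<Rightarrow> gen falg set" where
  "partial J \<Upsilon> n = finsum (UU J) \<Upsilon> {\<mu>. set_mset \<mu> \<subseteq> J \<and> size \<mu> < n}"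

definition is_quasi_K ::
  "rat set \<Rightarrow> (gen falg set \<Rightarrow> gen falg set) \<Rightarrow> (rat multiset \<Rightarrow> gen falg set) \<Rightarrow> bool" where
  "is_quasi_K J psi \<Upsilon> \<longleftrightarrow>
     (\<forall>\<mu>. set_mset \<mu> \<subseteq> J \<longrightarrow> \<Upsilon> \<mu> \<in> Uminus_wt J \<mu>) \<and>
     \<Upsilon> {#} = \<one>\<^bsub>UU J\<^esub> \<and>
     (\<forall>u\<in>Ui J. Uhat_eq J (\<lambda>n. psi u \<otimes>\<^bsub>UU J\<^esub> partial J \<Upsilon> n) (\<lambda>n. partial J \<Upsilon> n \<otimes>\<^bsub>UU J\<^esub> U_bar u))"

section \<open>The natural module and its tensor powers\<close>

text \<open>Tensors are elements of the tensor algebra of the span of all \<open>v\<^sub>a\<close>, i.e. of the free algebra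
  on the \<open>v\<^sub>a = var a\<close>; its product is the tensor product, and the standard basis vector \<open>M\<^sub>f\<close> is
  \<open>monomial f\<close>.\<close>

type_synonym tens = "rat falg"

definition tpow :: "rat set \<Rightarrow> nat \<Rightarrow> tens set" where
  "tpow J m = {x. \<forall>w\<in>Poly_Mapping.keys x. length (letters w) = m \<and> set (letters w) \<subseteq> wtI J}"

text \<open>\<open>tmap k \<phi> \<psi>\<close> is \<open>\<phi> \<otimes> \<psi>\<close>, with \<open>\<phi>\<close> acting on the first \<open>k\<close> tensor factors and \<open>\<psi>\<close> on the rest.\<close>

definition tmap :: "nat \<Rightarrow> (tens \<Rightarrow> tens) \<Rightarrow> (tens \<Rightarrow> tens) \<Rightarrow> tens \<Rightarrow> tens" where
  "tmap k \<phi> \<psi> = linext (\<lambda>w. \<phi> (monomial (take k (letters w))) * \<psi> (monomial (drop k (letters w))))"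

fun nat_basis :: "gen \<Rightarrow> rat \<Rightarrow> tens" where
  "nat_basis (GE i) a = (if i + 1/2 = a then var (a - 1) else 0)"
| "nat_basis (GF i) a = (if i - 1/2 = a then var (a + 1) else 0)"
| "nat_basis (GK i) a = const (q powi form (alpha i) (eps a)) * var a"
| "nat_basis (GKinv i) a = const (q powi (- form (alpha i) (eps a))) * var a"

definition nat_rep :: "gen \<Rightarrow> tens \<Rightarrow> tens" where
  "nat_rep g = linext (\<lambda>w. case letters w of [a] \<Rightarrow> nat_basis g a | _ \<Rightarrow> 0)"

text \<open>The coproduct of a generator, as a list of pure tensors. A module over an algebra given by
  generators and relations is determined by the operators of the generators, so this fixes the
  module structure on tensor products.\<close>

fun coprod :: "gen \<Rightarrow> (gen falg \<times> gen falg) list" where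
  "coprod (GE i) = [(1, xE i), (xE i, xKinv i)]"
| "coprod (GF i) = [(xF i, 1), (xK i, xF i)]"
| "coprod (GK i) = [(xK i, xK i)]"
| "coprod (GKinv i) = [(xKinv i, xKinv i)]"

fun tpow_rep :: "nat \<Rightarrow> gen \<Rightarrow> tens \<Rightarrow> tens" where
  "tpow_rep 0 g x = 0" \<comment> \<open>irrelevant: only positive tensor powers are considered\<close>
| "tpow_rep (Suc 0) g x = nat_rep g x"
| "tpow_rep (Suc (Suc m)) g x =
     (\<Sum>(a, b)\<leftarrow>coprod g. tmap 1 (lact nat_rep a) (lact (tpow_rep (Suc m)) b) x)"

definition uact :: "nat \<Rightarrow> gen falg set \<Rightarrow> tens \<Rightarrow> tens" where
  "uact m u x = the_elem ((\<lambda>a. lact (tpow_rep m) a x) ` u)"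

section \<open>The braid group operators and the map T on the natural module\<close>

definition qint :: "nat \<Rightarrow> qf" where
  "qint n = (q ^ n - inverse q ^ n) / (q - inverse q)"

definition divpow :: "(tens \<Rightarrow> tens) \<Rightarrow> nat \<Rightarrow> tens \<Rightarrow> tens" where
  "divpow f n x = const (inverse (\<Prod>k=1..n. qint k)) * (f ^^ n) x"

definition Tterm :: "rat \<Rightarrow> nat \<times> nat \<times> nat \<Rightarrow> tens \<Rightarrow> tens" where
  "Tterm i = (\<lambda>(a, b, c) x. const ((-1) ^ b * q powi (int b - int (a * c))) *
     divpow (nat_rep (GE i)) a (divpow (nat_rep (GF i)) b (divpow (nat_rep (GE i)) c x)))"

text \<open>The vector \<open>v\<^sub>a\<close> has weight \<open>\<epsilon>\<^sub>a\<close>. All but finitely many terms of the sum vanish.\<close>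

definition Top :: "rat \<Rightarrow> tens \<Rightarrow> tens" where
  "Top i = linext (\<lambda>w. case letters w of
       [e] \<Rightarrow> (\<Sum>p | (case p of (a, b, c) \<Rightarrow> - int a + int b - int c = form (eps e) (alpha i))
                    \<and> Tterm i p (var e) \<noteq> 0. Tterm i p (var e))
     | _ \<Rightarrow> 0)"

text \<open>The Weyl group, as the group of permutations of the \<open>\<epsilon>\<^sub>a\<close> generated by the simple
  reflections.\<close>

definition wprod :: "rat list \<Rightarrow> rat \<Rightarrow> rat" where
  "wprod ws = foldr (\<lambda>i w. transpose (i - 1/2) (i + 1/2) \<circ> w) ws id"

definition weyl_group :: "rat set \<Rightarrow> (rat \<Rightarrow> rat) set" where
  "weyl_group J = wprod ` lists J"

definition wlength :: "rat set \<Rightarrow> (rat \<Rightarrow> rat) \<Rightarrow> nat" where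
  "wlength J w = (LEAST n. \<exists>ws\<in>lists J. wprod ws = w \<and> length ws = n)"

definition reduced_longest :: "rat set \<Rightarrow> rat list \<Rightarrow> bool" where
  "reduced_longest J ws \<longleftrightarrow> ws \<in> lists J \<and> length ws = wlength J (wprod ws) \<and>
     (\<forall>w\<in>weyl_group J. wlength J w \<le> wlength J (wprod ws))"

definition Tw :: "rat list \<Rightarrow> tens \<Rightarrow> tens" where
  "Tw ws = foldr (\<lambda>i f. Top i \<circ> f) ws id"

definition zeta :: "rat set \<Rightarrow> tens \<Rightarrow> tens" where
  "zeta J = linext (\<lambda>w. case letters w of
      [a] \<Rightarrow> const ((- q) powi \<lfloor>- Max (wtI J) - a\<rfloor>) * var a | _ \<Rightarrow> 0)"

definition quasi_K_act :: "rat set \<Rightarrow> (rat multiset \<Rightarrow> gen falg set) \<Rightarrow> nat \<Rightarrow> tens \<Rightarrow> tens" where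
  "quasi_K_act J \<Upsilon> m x =
     (\<Sum>\<mu> | set_mset \<mu> \<subseteq> J \<and> uact m (\<Upsilon> \<mu>) x \<noteq> 0. uact m (\<Upsilon> \<mu>) x)"

definition TT :: "rat set \<Rightarrow> (rat multiset \<Rightarrow> gen falg set) \<Rightarrow> rat list \<Rightarrow> tens \<Rightarrow> tens" where
  "TT J \<Upsilon> ws = quasi_K_act J \<Upsilon> 1 \<circ> zeta J \<circ> Tw ws"

section \<open>The Hecke algebra of type B and its right action\<close>

text \<open>Generator \<open>0\<close> is \<open>s\<^sub>0\<close>, generator \<open>i \<ge> 1\<close> is \<open>H\<^sub>i\<close>.\<close>

definition Hrels :: "nat \<Rightarrow> nat falg set" where
  "Hrels m =
     {var 0 * var 0 - 1} \<union>
     {(var i - const (inverse q)) * (var i + const q) | i. 1 \<le> i \<and> i < m} \<union>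
     {var i * var (i+1) * var i - var (i+1) * var i * var (i+1) | i. 1 \<le> i \<and> i + 1 < m} \<union>
     {var i * var j - var j * var i | i j. 1 \<le> i \<and> i < m \<and> 1 \<le> j \<and> j < m \<and> \<bar>int i - int j\<bar> > 1} \<union>
     (if 1 < m then {var 0 * var 1 * var 0 * var 1 - var 1 * var 0 * var 1 * var 0} else {}) \<union>
     {var 0 * var i - var i * var 0 | i. 1 < i \<and> i < m}"

definition HB :: "nat \<Rightarrow> nat falg set ring" where
  "HB m = presented {..<m} (Hrels m)"

definition hcls :: "nat \<Rightarrow> nat falg \<Rightarrow> nat falg set" where
  "hcls m = pclass {..<m} (Hrels m)"

definition hgen :: "nat \<Rightarrow> tens \<Rightarrow> tens" where
  "hgen i = linext (\<lambda>w. let f = letters w in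
     if i = 0 then monomial (f[0 := - f ! 0])
     else let a = f ! (i - 1); b = f ! i; g = f[i - 1 := b, i := a] in
       if a = b then const (inverse q) * monomial f
       else if a < b then monomial g
       else monomial g + const (inverse q - q) * monomial f)"

definition hact :: "tens \<Rightarrow> nat falg set \<Rightarrow> tens" where
  "hact x h = the_elem (ract hgen x ` h)"

section \<open>Centralizers\<close>

definition endos :: "tens set \<Rightarrow> (tens \<Rightarrow> tens) set" where
  "endos V = {\<phi> \<in> V \<rightarrow>\<^sub>E V.
     (\<forall>x\<in>V. \<forall>y\<in>V. \<phi> (x + y) = \<phi> x + \<phi> y) \<and> (\<forall>c. \<forall>x\<in>V. \<phi> (const c * x) = const c * \<phi> x)}"

definition centralizer_in :: "tens set \<Rightarrow> (tens \<Rightarrow> tens) set \<Rightarrow> (tens \<Rightarrow> tens) set" where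
  "centralizer_in V S = {\<phi> \<in> endos V. \<forall>\<psi>\<in>S. compose V \<phi> \<psi> = compose V \<psi> \<phi>}"

definition Ui_image :: "rat set \<Rightarrow> nat \<Rightarrow> (tens \<Rightarrow> tens) set" where
  "Ui_image J m = (\<lambda>u. restrict (uact m u) (tpow J m)) ` Ui J"

definition HB_image :: "rat set \<Rightarrow> nat \<Rightarrow> (tens \<Rightarrow> tens) set" where
  "HB_image J m = (\<lambda>h. restrict (\<lambda>x. hact x h) (tpow J m)) ` carrier (HB m)"

end

theory Submission
  imports Defs "HOL-Combinatorics.Permutations" "HOL-Library.Function_Algebras"
begin

text \<open>On the natural module the quasi-K-matrix acts as the identity: it fixes the lowest weight vector
  and commutes with \<open>e\<^sub>i\<close>, \<open>f\<^sub>i\<close> and \<open>t\<close>, because their bar conjugates act there as they do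
  themselves, and these operators reach all the other weight vectors. The operator of \<open>w\<^sub>0\<close> sends
  \<open>v\<^sub>a\<close> to \<open>v\<close> with index \<open>- a\<close>, up to a power of \<open>- q\<close> counting the inversions \<open>(a, b)\<close> of \<open>w\<^sub>0\<close>,
  which the rescaling cancels.

  The double centralizer property is obtained by specialization to \<open>q = 1\<close>: a subspace \<open>A\<close> of \<open>C\<close> is
  all of \<open>C\<close> as soon as every specialization of an element of \<open>C\<close> is one of an element of \<open>A\<close>. At \<open>q = 1\<close> the
  coideal subalgebra becomes the enveloping algebra of the fixed subalgebra \<open>gl \<oplus> gl\<close> of the flip
  \<open>a \<mapsto> - a\<close> and the Hecke algebra becomes the group algebra of the hyperoctahedral group, for which
  the statement is classical (averaging over the group, and polarization of symmetric tensors).\<close>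

section \<open>Linear maps on free algebras\<close>

text \<open>The specialization of the centralizer is only known to lie inside the centralizer of the
  specialized operators. The comparison works because the image is contained in the centralizer from
  the start, so that linear algebra over the local ring at q = 1 suffices; neither complete
  reducibility nor dimensions at generic q enter. Specialized are all elements of the span over the
  field that are regular at q = 1, not those of an integral form. This is essential: k_i becomes the
  identity, and the Cartan part of gl + gl appears only through (k_i - 1) / (q - 1). That s_0
  commutes with the coideal subalgebra on higher tensor powers is due to the coideal property: the
  first tensor components of the coproducts of the generators are 1, the generator itself and powers
  of k_i, all of which commute with the flip. The other Hecke generators commute with the whole
  quantum group. The completion is harmless because a product of more than n operators F_i, where n
  is the number of simple roots, kills the natural module: there the identity defining the
  quasi-K-matrix holds exactly for a finite partial sum.\<close>

abbreviation "lookup \<equiv> Poly_Mapping.lookup"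
abbreviation "keys \<equiv> Poly_Mapping.keys"

lemma const_0 [simp]: "const 0 = 0"
  by (simp add: const_def)

lemma const_1 [simp]: "const 1 = 1"
  by (simp add: const_def single_one)

lemma const_add: "const (a + b) = const a + const b"
  by (simp add: const_def single_add)

lemma const_uminus: "const (- a) = - const a"
  by (simp add: const_def single_uminus)

lemma const_diff: "const (a - b) = const a - const b"
  by (simp add: const_def single_diff)

lemma const_mult: "const (a * b) = const a * const b"
  by (simp add: const_def mult_single)

lemma const_mult_left: "const a * (const b * x) = const (a * b) * x"
  by (simp add: const_mult mult.assoc)

lemma lookup_const_mult [simp]: "lookup (const c * x) w = c * lookup x w"
  by (simp add: const_def map.rep_eq when_def flip: mult_map_scale_conv_mult)

lemma monomial_Nil: "monomial [] = 1"
  by (simp add: monomial_def flip: single_one zero_fword_def)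

lemma monomial_append: "monomial (u @ v) = monomial u * monomial v"
  by (simp add: monomial_def mult_single plus_fword_def)

lemma monomial_Cons: "monomial (a # v) = var a * monomial v"
  using monomial_append[of "[a]" v] by simp

lemma lookup_monomial: "lookup (monomial u) w = (if w = Word u then 1 else 0)"
  by (auto simp: monomial_def lookup_single when_def)

lemma keys_monomial [simp]: "keys (monomial u) = {Word u}"
  by (simp add: monomial_def)

lemma keys_const_mult: "keys (const c * x) \<subseteq> keys x"
  by (auto simp: in_keys_iff)

lemma keys_const: "keys (const c) \<subseteq> {0}"
  by (simp add: const_def)

lemma falg_eq_sum: "(x :: 'g falg) = (\<Sum>w\<in>keys x. const (lookup x w) * monomial (letters w))"
proof (rule poly_mapping_eqI)
  fix w
  have "lookup (\<Sum>v\<in>keys x. const (lookup x v) * monomial (letters v)) w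
      = (\<Sum>v\<in>keys x. if w = v then lookup x v else 0)"
    by (simp add: lookup_sum lookup_monomial if_distrib cong: if_cong)
  then show "lookup x w = lookup (\<Sum>w\<in>keys x. const (lookup x w) * monomial (letters w)) w"
    by (simp add: in_keys_iff)
qed

lemma const_commute: "x * const c = const c * x"
proof -
  have *: "monomial u * const c = const c * monomial u" for u :: "'a list"
    by (simp add: monomial_def const_def mult_single)
  have "x * const c = (\<Sum>w\<in>keys x. const (lookup x w) * monomial (letters w) * const c)"
    by (subst falg_eq_sum) (simp add: sum_distrib_right)
  also have "\<dots> = (\<Sum>w\<in>keys x. const c * (const (lookup x w) * monomial (letters w)))"
    by (rule sum.cong) (simp_all add: * const_mult_left mult.assoc mult.commute)
  also have "\<dots> = const c * x"
    by (subst (3) falg_eq_sum) (simp add: sum_distrib_left)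
  finally show ?thesis .
qed

lemma mult_const_left: "x * (const c * y) = const c * (x * y)"
  by (metis const_commute mult.assoc)

text \<open>Linearity over the ground field, whose scalars enter a free algebra through the elements
  \<open>const c\<close>, central by \<open>const_commute\<close>.\<close>

definition lin :: "('g falg \<Rightarrow> 'h falg) \<Rightarrow> bool" where
  "lin \<phi> \<longleftrightarrow> (\<forall>x y. \<phi> (x + y) = \<phi> x + \<phi> y) \<and> (\<forall>c x. \<phi> (const c * x) = const c * \<phi> x)"

lemma linI:
  "(\<And>x y. \<phi> (x + y) = \<phi> x + \<phi> y) \<Longrightarrow> (\<And>c x. \<phi> (const c * x) = const c * \<phi> x) \<Longrightarrow> lin \<phi>"
  by (simp add: lin_def)

lemma lin_add: "lin \<phi> \<Longrightarrow> \<phi> (x + y) = \<phi> x + \<phi> y"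
  and lin_scale: "lin \<phi> \<Longrightarrow> \<phi> (const c * x) = const c * \<phi> x"
  by (simp_all add: lin_def)

lemma lin_0: "lin \<phi> \<Longrightarrow> \<phi> 0 = 0"
  using lin_scale[of \<phi> 0 0] by simp

lemma lin_uminus: "lin \<phi> \<Longrightarrow> \<phi> (- x) = - \<phi> x"
  using lin_scale[of \<phi> "-1" x] by (simp add: const_uminus)

lemma lin_diff: "lin \<phi> \<Longrightarrow> \<phi> (x - y) = \<phi> x - \<phi> y"
  using lin_add[of \<phi> x "- y"] by (simp add: lin_uminus)

lemma lin_sum: "lin \<phi> \<Longrightarrow> \<phi> (\<Sum>i\<in>A. f i) = (\<Sum>i\<in>A. \<phi> (f i))"
  by (induct A rule: infinite_finite_induct) (simp_all add: lin_0 lin_add)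

lemma lin_expand: "lin \<phi> \<Longrightarrow> \<phi> x = (\<Sum>w\<in>keys x. const (lookup x w) * \<phi> (monomial (letters w)))"
  by (subst falg_eq_sum) (simp add: lin_sum lin_scale)

text \<open>By \<open>lin_expand\<close> only the monomials occurring in \<open>x\<close> matter, so
  that identities valid on one tensor power can be checked on its words.\<close>

lemma lin_eqI:
  assumes "lin \<phi>" "lin \<psi>" "\<And>w. w \<in> keys x \<Longrightarrow> \<phi> (monomial (letters w)) = \<psi> (monomial (letters w))"
  shows "\<phi> x = \<psi> x"
  using assms by (simp add: lin_expand[of _ x])

lemma linext_superset:
  assumes "finite S" "keys x \<subseteq> S"
  shows "linext b x = (\<Sum>w\<in>S. const (lookup x w) * b w)"
  unfolding linext_def
  by (rule sum.mono_neutral_left) (use assms in \<open>auto simp: in_keys_iff\<close>)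

lemma lin_linext [simp]: "lin (linext b)"
proof (rule linI)
  fix x y :: "'a falg"
  let ?S = "keys x \<union> keys y"
  show "linext b (x + y) = linext b x + linext b y"
    using keys_add[of x y]
    by (simp add: linext_superset[of ?S] lookup_add const_add distrib_right sum.distrib)
next
  fix c and x :: "'a falg"
  show "linext b (const c * x) = const c * linext b x"
    using keys_const_mult[of c x]
    by (simp add: linext_superset[of "keys x"] sum_distrib_left const_mult mult.assoc)
qed

lemma linext_monomial [simp]: "linext b (monomial u) = b (Word u)"
  by (simp add: linext_def monomial_def)

lemma lin_compose: "lin \<phi> \<Longrightarrow> lin \<psi> \<Longrightarrow> lin (\<lambda>x. \<phi> (\<psi> x))"
  by (simp add: lin_def)

lemma lin_id: "lin (\<lambda>x. x)"
  by (simp add: lin_def)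

lemma lin_plus: "lin \<phi> \<Longrightarrow> lin \<psi> \<Longrightarrow> lin (\<lambda>x. \<phi> x + \<psi> x)"
  by (auto simp: lin_def algebra_simps)

lemma lin_minus: "lin \<phi> \<Longrightarrow> lin \<psi> \<Longrightarrow> lin (\<lambda>x. \<phi> x - \<psi> x)"
  by (auto simp: lin_def algebra_simps)

lemma lin_const_mult: "lin \<phi> \<Longrightarrow> lin (\<lambda>x. const c * \<phi> x)"
  by (auto simp: lin_def algebra_simps const_mult_left)

lemma lin_zero: "lin (\<lambda>x. 0)"
  by (simp add: lin_def)

lemma lin_mult_left: "lin \<phi> \<Longrightarrow> lin (\<lambda>x. y * \<phi> x)"
  by (auto simp: lin_def distrib_left mult_const_left)

lemma lin_mult_right: "lin \<phi> \<Longrightarrow> lin (\<lambda>x. \<phi> x * y)"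
  by (auto simp: lin_def distrib_right mult.assoc)

lemma lin_setsum: "(\<And>i. i \<in> A \<Longrightarrow> lin (\<phi> i)) \<Longrightarrow> lin (\<lambda>x. \<Sum>i\<in>A. \<phi> i x)"
  by (induct A rule: infinite_finite_induct) (simp_all add: lin_zero lin_plus)

lemma lin_funpow: "lin \<phi> \<Longrightarrow> lin (\<phi> ^^ n)" for \<phi> :: "'g falg \<Rightarrow> 'g falg"
  by (induct n) (simp_all add: lin_def)

lemmas lin_intros = lin_linext lin_id lin_plus lin_minus lin_const_mult lin_zero
  lin_mult_left lin_mult_right lin_setsum

lemma lact_linext: "lact R a x = linext (\<lambda>w. foldr R (letters w) x) a"
  by (simp add: lact_def linext_def)

lemma ract_linext: "ract R x a = linext (\<lambda>w. fold R (letters w) x) a"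
  by (simp add: ract_def linext_def)

lemma lin_foldr: "(\<And>g. lin (R g)) \<Longrightarrow> lin (foldr R ws)"
  by (induct ws) (simp_all add: lin_def)

lemma lin_fold: "(\<And>g. lin (R g)) \<Longrightarrow> lin (fold R ws)"
  by (induct ws) (simp_all add: lin_def)

lemma lin_lact_left: "lin (\<lambda>a. lact R a x)"
  by (simp add: lact_linext lin_intros)

lemma lin_ract_left: "lin (\<lambda>a. ract R x a)"
  by (simp add: ract_linext lin_intros)

lemma lin_lact: "(\<And>g. lin (R g)) \<Longrightarrow> lin (lact R a)"
  unfolding lact_def by (intro lin_setsum lin_const_mult lin_foldr)

lemma lin_ract: "(\<And>g. lin (R g)) \<Longrightarrow> lin (\<lambda>x. ract R x a)"
  unfolding ract_def by (intro lin_setsum lin_const_mult lin_fold)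

lemma lact_monomial: "lact R (monomial u) x = foldr R u x"
  by (simp add: lact_linext)

lemma ract_monomial: "ract R x (monomial u) = fold R u x"
  by (simp add: ract_linext)

lemma lact_add: "lact R (a + b) x = lact R a x + lact R b x"
  and lact_diff: "lact R (a - b) x = lact R a x - lact R b x"
  and lact_uminus: "lact R (- a) x = - lact R a x"
  and lact_0: "lact R 0 x = 0"
  and lact_scale: "lact R (const c * a) x = const c * lact R a x"
  by (simp_all add: lin_add[OF lin_lact_left] lin_diff[OF lin_lact_left] lin_uminus[OF lin_lact_left] lin_0[OF lin_lact_left] lin_scale[OF lin_lact_left])

lemma ract_add: "ract R x (a + b) = ract R x a + ract R x b"
  and ract_diff: "ract R x (a - b) = ract R x a - ract R x b"
  and ract_uminus: "ract R x (- a) = - ract R x a"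
  and ract_0: "ract R x 0 = 0"
  and ract_scale: "ract R x (const c * a) = const c * ract R x a"
  by (simp_all add: lin_add[OF lin_ract_left] lin_diff[OF lin_ract_left] lin_uminus[OF lin_ract_left] lin_0[OF lin_ract_left] lin_scale[OF lin_ract_left])

lemma lact_1: "lact R 1 x = x"
  using lact_monomial[of R "[]" x] by (simp add: monomial_Nil)

lemma ract_1: "ract R x 1 = x"
  using ract_monomial[of R x "[]"] by (simp add: monomial_Nil)

lemma lact_const: "lact R (const c) x = const c * x"
  using lact_scale[of R c 1 x] by (simp add: lact_1)

lemma ract_const: "ract R x (const c) = const c * x"
  using ract_scale[of R x c 1] by (simp add: ract_1)

lemma lact_var: "lact R (var g) x = R g x"
  by (simp add: lact_monomial)

lemma ract_var: "ract R x (var g) = R g x"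
  by (simp add: ract_monomial)

lemma lact_mult:
  assumes R: "\<And>g. lin (R g)"
  shows "lact R (a * b) x = lact R a (lact R b x)"
proof (rule lin_eqI[where x = a])
  show "lin (\<lambda>a. lact R (a * b) x)"
    by (auto intro!: linI simp: distrib_right mult.assoc lact_add lact_scale)
  show "lin (\<lambda>a. lact R a (lact R b x))"
    by (rule lin_lact_left)
  fix w
  show "lact R (monomial (letters w) * b) x = lact R (monomial (letters w)) (lact R b x)"
  proof (rule lin_eqI[where x = b])
    show "lin (\<lambda>b. lact R (monomial (letters w) * b) x)"
      by (auto intro!: linI simp: distrib_left mult_const_left lact_add lact_scale)
    show "lin (\<lambda>b. lact R (monomial (letters w)) (lact R b x))"
      using lin_lact[OF R] lin_lact_left by (rule lin_compose)
  qed (simp add: lact_monomial flip: monomial_append)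
qed

text \<open>\<open>fold\<close> applies the first letter of a word first, which makes
  \<open>ract\<close> a right action, whereas \<open>foldr\<close> makes \<open>lact\<close> a left
  one.\<close>

lemma ract_mult:
  assumes R: "\<And>g. lin (R g)"
  shows "ract R x (a * b) = ract R (ract R x a) b"
proof (rule lin_eqI[where x = b])
  show "lin (\<lambda>b. ract R x (a * b))"
    by (auto intro!: linI simp: distrib_left mult_const_left ract_add ract_scale)
  show "lin (\<lambda>b. ract R (ract R x a) b)"
    by (rule lin_ract_left)
  fix w
  show "ract R x (a * monomial (letters w)) = ract R (ract R x a) (monomial (letters w))"
  proof (rule lin_eqI[where x = a])
    show "lin (\<lambda>a. ract R x (a * monomial (letters w)))"
      by (auto intro!: linI simp: distrib_right mult.assoc ract_add ract_scale)
    show "lin (\<lambda>a. ract R (ract R x a) (monomial (letters w)))"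
      using lin_ract[OF R] lin_ract_left by (rule lin_compose)
  qed (simp add: ract_monomial flip: monomial_append)
qed

lemmas lact_simps = lact_add lact_diff lact_uminus lact_0 lact_scale lact_1 lact_var lact_const
lemmas ract_simps = ract_add ract_diff ract_uminus ract_0 ract_scale ract_1 ract_var ract_const

section \<open>Presented algebras\<close>

lemma carrier_free_algebra: "carrier (free_algebra G) = {x. \<forall>w\<in>keys x. set (letters w) \<subseteq> G}"
  by (simp add: free_algebra_def)

lemma free_algebra_simps [simp]:
  "mult (free_algebra G) = (*)" "one (free_algebra G) = 1"
  "zero (free_algebra G) = 0" "add (free_algebra G) = (+)"
  by (simp_all add: free_algebra_def)

lemma free_const [simp]: "const c \<in> carrier (free_algebra G)"
  using keys_const[of c] by (auto simp: carrier_free_algebra zero_fword_def)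

lemma free_1 [simp]: "1 \<in> carrier (free_algebra G)"
  using free_const[of 1] by simp

lemma free_0 [simp]: "0 \<in> carrier (free_algebra G)"
  by (simp add: carrier_free_algebra)

lemma free_add [simp]:
  "x \<in> carrier (free_algebra G) \<Longrightarrow> y \<in> carrier (free_algebra G) \<Longrightarrow> x + y \<in> carrier (free_algebra G)"
  using keys_add[of x y] by (auto simp: carrier_free_algebra)

lemma free_uminus [simp]:
  "x \<in> carrier (free_algebra G) \<Longrightarrow> - x \<in> carrier (free_algebra G)"
  by (simp add: carrier_free_algebra)

lemma free_diff [simp]:
  "x \<in> carrier (free_algebra G) \<Longrightarrow> y \<in> carrier (free_algebra G) \<Longrightarrow> x - y \<in> carrier (free_algebra G)"
  using free_add[of x G "- y"] by simp

lemma free_mult [simp]: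
  assumes "x \<in> carrier (free_algebra G)" "y \<in> carrier (free_algebra G)"
  shows "x * y \<in> carrier (free_algebra G)"
proof -
  have "set (letters w) \<subseteq> G" if w: "w \<in> keys (x * y)" for w
  proof -
    obtain u v where "u \<in> keys x" "v \<in> keys y" "w = u + v"
      using w keys_mult[of x y] by blast
    then show ?thesis
      using assms by (fastforce simp: carrier_free_algebra plus_fword_def)
  qed
  then show ?thesis
    by (auto simp: carrier_free_algebra)
qed

lemma free_monomial [simp]: "monomial u \<in> carrier (free_algebra G) \<longleftrightarrow> set u \<subseteq> G"
  by (simp add: carrier_free_algebra)

lemma free_power [simp]: "x \<in> carrier (free_algebra G) \<Longrightarrow> x ^ n \<in> carrier (free_algebra G)"
  by (induct n) simp_all

lemma free_sum [simp]:
  "(\<And>i. i \<in> A \<Longrightarrow> f i \<in> carrier (free_algebra G)) \<Longrightarrow> sum f A \<in> carrier (free_algebra G)"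
  by (induct A rule: infinite_finite_induct) simp_all

lemma ring_free_algebra: "ring (free_algebra G)"
proof (intro ringI abelian_groupI monoidI)
  fix x assume "x \<in> carrier (free_algebra G)"
  then show "\<exists>y\<in>carrier (free_algebra G). y \<oplus>\<^bsub>free_algebra G\<^esub> x = \<zero>\<^bsub>free_algebra G\<^esub>"
    by (intro bexI[of _ "- x"]) simp_all
qed (simp_all add: algebra_simps)

lemma free_a_inv [simp]: "x \<in> carrier (free_algebra G) \<Longrightarrow> \<ominus>\<^bsub>free_algebra G\<^esub> x = - x"
proof -
  interpret ring "free_algebra G" by (rule ring_free_algebra)
  show "x \<in> carrier (free_algebra G) \<Longrightarrow> \<ominus>\<^bsub>free_algebra G\<^esub> x = - x"
    by (rule minus_equality) simp_all
qed

lemma free_idealI: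
  assumes "Z \<subseteq> carrier (free_algebra G)" "0 \<in> Z"
    and "\<And>x y. x \<in> Z \<Longrightarrow> y \<in> Z \<Longrightarrow> x + y \<in> Z" "\<And>x. x \<in> Z \<Longrightarrow> - x \<in> Z"
    and "\<And>x y. x \<in> Z \<Longrightarrow> y \<in> carrier (free_algebra G) \<Longrightarrow> x * y \<in> Z"
    and "\<And>x y. x \<in> Z \<Longrightarrow> y \<in> carrier (free_algebra G) \<Longrightarrow> y * x \<in> Z"
  shows "ideal Z (free_algebra G)"
proof (rule idealI[OF ring_free_algebra])
  interpret ring "free_algebra G" by (rule ring_free_algebra)
  show "subgroup Z (add_monoid (free_algebra G))"
  proof (rule add.subgroupI)
    fix x assume "x \<in> Z"
    then have "x \<in> carrier (free_algebra G)" using assms(1) by blast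
    then show "\<ominus>\<^bsub>free_algebra G\<^esub> x \<in> Z" using assms(4)[OF \<open>x \<in> Z\<close>] by simp
  qed (use assms in auto)
qed (use assms in auto)

locale presentation =
  fixes G :: "'g set" and rels :: "'g falg set"
  assumes rels: "rels \<subseteq> carrier (free_algebra G)"
begin

abbreviation "I \<equiv> genideal (free_algebra G) rels"

lemma ideal_I: "ideal I (free_algebra G)"
  using rels by (intro ring.genideal_ideal[OF ring_free_algebra])

lemma rels_I: "rels \<subseteq> I"
  using rels by (intro ring.genideal_self[OF ring_free_algebra])

lemma I_minimal: "ideal Z (free_algebra G) \<Longrightarrow> rels \<subseteq> Z \<Longrightarrow> I \<subseteq> Z"
  by (intro ring.genideal_minimal[OF ring_free_algebra])

lemma I_0: "0 \<in> I"
  using ideal_I additive_subgroup.zero_closed[of I "free_algebra G"] by (simp add: ideal.axioms)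

lemma I_add: "x \<in> I \<Longrightarrow> y \<in> I \<Longrightarrow> x + y \<in> I"
  using ideal_I additive_subgroup.a_closed[of I "free_algebra G"] by (simp add: ideal.axioms)

lemma I_left: "x \<in> carrier (free_algebra G) \<Longrightarrow> y \<in> I \<Longrightarrow> x * y \<in> I"
  using ideal.I_l_closed[OF ideal_I] by simp

lemma I_right: "x \<in> carrier (free_algebra G) \<Longrightarrow> y \<in> I \<Longrightarrow> y * x \<in> I"
  using ideal.I_r_closed[OF ideal_I] by simp

lemma I_uminus: "x \<in> I \<Longrightarrow> - x \<in> I"
  using I_right[of "const (-1)" x] by (simp add: const_commute const_uminus)

lemma I_diff: "x \<in> I \<Longrightarrow> y \<in> I \<Longrightarrow> x - y \<in> I"
  using I_add[OF _ I_uminus, of x y] by simp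

lemma pclass_eq: "pclass G rels x = {i + x | i. i \<in> I}"
  by (auto simp: pclass_def a_r_coset_def r_coset_def)

lemma pclass_self: "x \<in> pclass G rels x"
  using I_0 by (force simp: pclass_eq)

lemma ring_presented: "ring (presented G rels)"
  unfolding presented_def by (rule ideal.quotient_is_ring[OF ideal_I])

lemma pclass_hom: "pclass G rels \<in> ring_hom (free_algebra G) (presented G rels)"
proof -
  have "(+>\<^bsub>free_algebra G\<^esub>) I \<in> ring_hom (free_algebra G) (free_algebra G Quot I)"
    by (rule ideal.rcos_ring_hom[OF ideal_I])
  then show ?thesis
    by (simp add: presented_def pclass_def[abs_def])
qed

lemma carrier_presented: "carrier (presented G rels) = pclass G rels ` carrier (free_algebra G)"
  by (auto simp: presented_def FactRing_def A_RCOSETS_def RCOSETS_def pclass_def a_r_coset_def r_coset_def)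

lemma pclass_add:
  "x \<in> carrier (free_algebra G) \<Longrightarrow> y \<in> carrier (free_algebra G) \<Longrightarrow>
    pclass G rels (x + y) = pclass G rels x \<oplus>\<^bsub>presented G rels\<^esub> pclass G rels y"
  using ring_hom_add[OF pclass_hom] by simp

lemma pclass_mult:
  "x \<in> carrier (free_algebra G) \<Longrightarrow> y \<in> carrier (free_algebra G) \<Longrightarrow>
    pclass G rels (x * y) = pclass G rels x \<otimes>\<^bsub>presented G rels\<^esub> pclass G rels y"
  using ring_hom_mult[OF pclass_hom] by simp

lemma pclass_one: "pclass G rels 1 = \<one>\<^bsub>presented G rels\<^esub>"
  using ring_hom_one[OF pclass_hom] by simp

lemma pclass_zero: "pclass G rels 0 = \<zero>\<^bsub>presented G rels\<^esub>"
  using ring_hom_zero[OF pclass_hom ring_free_algebra ring_presented] by simp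

lemma pclass_uminus:
  assumes "x \<in> carrier (free_algebra G)"
  shows "pclass G rels (- x) = \<ominus>\<^bsub>presented G rels\<^esub> pclass G rels x"
proof -
  interpret R: ring "presented G rels" by (rule ring_presented)
  have "pclass G rels (- x) \<oplus>\<^bsub>presented G rels\<^esub> pclass G rels x = \<zero>\<^bsub>presented G rels\<^esub>"
    using assms pclass_add[of "- x" x] by (simp add: pclass_zero)
  then show ?thesis
    using assms by (intro R.minus_equality[symmetric]) (auto simp: carrier_presented)
qed

lemma pclass_diff:
  "x \<in> carrier (free_algebra G) \<Longrightarrow> y \<in> carrier (free_algebra G) \<Longrightarrow>
    pclass G rels (x - y) = pclass G rels x \<ominus>\<^bsub>presented G rels\<^esub> pclass G rels y"
  using pclass_add[of x "- y"] by (simp add: a_minus_def pclass_uminus)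

text \<open>An additive map that kills the ideal is constant on cosets, so that evaluation at all
  representatives, as in \<open>uact\<close> and \<open>hact\<close>, yields a singleton.\<close>

lemma the_elem_pclass:
  assumes "\<And>a b. f (a + b) = f a + (f b :: 'b :: ab_group_add)" "\<And>a. a \<in> I \<Longrightarrow> f a = 0"
  shows "the_elem (f ` pclass G rels x) = f x"
proof -
  have "f ` pclass G rels x = {f x}"
    using assms pclass_self[of x] by (auto simp: pclass_eq)
  then show ?thesis by simp
qed

text \<open>The operators live on a whole free algebra but satisfy the relations only on a subspace
  \<open>V\<close>, such as a tensor power. As \<open>V\<close> is stable under the generators, its
  annihilator is still a two-sided ideal.\<close>

lemma lact_I:
  assumes R: "\<And>g. lin (R g)" and V: "\<And>g x. g \<in> G \<Longrightarrow> x \<in> V \<Longrightarrow> R g x \<in> V"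
    and V0: "0 \<in> V" "\<And>x y. x \<in> V \<Longrightarrow> y \<in> V \<Longrightarrow> x + y \<in> V" "\<And>c x. x \<in> V \<Longrightarrow> const c * x \<in> V"
    and rel: "\<And>a x. a \<in> rels \<Longrightarrow> x \<in> V \<Longrightarrow> lact R a x = 0"
    and a: "a \<in> I" and x: "x \<in> V"
  shows "lact R a x = 0"
proof -
  have lactV: "lact R b x \<in> V" if "b \<in> carrier (free_algebra G)" "x \<in> V" for b x
  proof -
    have fr: "foldr R u x \<in> V" if "set u \<subseteq> G" for u
      using that \<open>x \<in> V\<close> by (induct u) (simp_all add: V)
    have sm: "sum f A \<in> V" if "\<And>i. i \<in> A \<Longrightarrow> f i \<in> V" for A :: "'g fword set" and f
      using that by (induct A rule: infinite_finite_induct) (simp_all add: V0)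
    show ?thesis
      unfolding lact_def using \<open>b \<in> _\<close> by (auto intro!: sm V0(3) fr simp: carrier_free_algebra)
  qed
  define Z where "Z = {a \<in> carrier (free_algebra G). \<forall>x\<in>V. lact R a x = 0}"
  have "ideal Z (free_algebra G)"
    by (rule free_idealI) (auto simp: Z_def lact_simps lact_mult[OF R] lactV lin_0[OF lin_lact[OF R]])
  then have "I \<subseteq> Z"
    using rel rels by (intro I_minimal) (auto simp: Z_def)
  then show ?thesis
    using a x by (auto simp: Z_def)
qed

lemma ract_I:
  assumes R: "\<And>g. lin (R g)" and V: "\<And>g x. g \<in> G \<Longrightarrow> x \<in> V \<Longrightarrow> R g x \<in> V"
    and V0: "0 \<in> V" "\<And>x y. x \<in> V \<Longrightarrow> y \<in> V \<Longrightarrow> x + y \<in> V" "\<And>c x. x \<in> V \<Longrightarrow> const c * x \<in> V"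
    and rel: "\<And>a x. a \<in> rels \<Longrightarrow> x \<in> V \<Longrightarrow> ract R x a = 0"
    and a: "a \<in> I" and x: "x \<in> V"
  shows "ract R x a = 0"
proof -
  have ractV: "ract R x b \<in> V" if "b \<in> carrier (free_algebra G)" "x \<in> V" for b x
  proof -
    have fr: "fold R u x \<in> V" if "set u \<subseteq> G" for u
      using that \<open>x \<in> V\<close> by (induct u arbitrary: x) (simp_all add: V)
    have sm: "sum f A \<in> V" if "\<And>i. i \<in> A \<Longrightarrow> f i \<in> V" for A :: "'g fword set" and f
      using that by (induct A rule: infinite_finite_induct) (simp_all add: V0)
    show ?thesis
      unfolding ract_def using \<open>b \<in> _\<close> by (auto intro!: sm V0(3) fr simp: carrier_free_algebra)
  qed
  define Z where "Z = {a \<in> carrier (free_algebra G). \<forall>x\<in>V. ract R x a = 0}"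
  have "ideal Z (free_algebra G)"
    by (rule free_idealI) (auto simp: Z_def ract_simps ract_mult[OF R] ractV lin_0[OF lin_ract[OF R]])
  then have "I \<subseteq> Z"
    using rel rels by (intro I_minimal) (auto simp: Z_def)
  then show ?thesis
    using a x by (auto simp: Z_def)
qed

end

section \<open>Rational functions regular at 1, and the bar involution of the scalars\<close>

definition emb :: "rat \<Rightarrow> qf" where "emb c = to_fract [:c:]"

lemma emb_hom [simp]: "emb 0 = 0" "emb 1 = 1" "emb (a + b) = emb a + emb b" "emb (a * b) = emb a * emb b"
  by (simp_all add: emb_def one_pCons[symmetric] flip: to_fract_add to_fract_mult)

lemma emb_eq_0 [simp]: "emb c = 0 \<longleftrightarrow> c = 0"
  by (simp add: emb_def)

lemma q_neq_0 [simp]: "q \<noteq> 0"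
  by (simp add: q_def)

lemma to_fract_poly: "poly (map_poly emb p) q = to_fract p"
proof (induct p)
  case (pCons a p)
  have "to_fract (pCons a p) = to_fract ([:a:] + [:0, 1:] * p)"
    by simp
  also have "\<dots> = emb a + q * to_fract p"
    unfolding to_fract_add to_fract_mult by (simp add: emb_def q_def)
  finally show ?case
    using pCons by (simp add: map_poly_pCons)
qed simp

lemma q_power_neq_1: "n > 0 \<Longrightarrow> q ^ n \<noteq> 1"
proof
  assume n: "n > 0" and "q ^ n = 1"
  have "to_fract (Polynomial.monom 1 n) = q ^ n"
    by (simp add: map_poly_monom poly_monom flip: to_fract_poly)
  also have "\<dots> = to_fract 1"
    using \<open>q ^ n = 1\<close> by simp
  finally have "Polynomial.monom (1 :: rat) n = 1"
    by (simp only: to_fract_eq_iff)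
  then have "Polynomial.degree (Polynomial.monom (1 :: rat) n) = Polynomial.degree (1 :: rat poly)"
    by simp
  then show False
    using n by (simp add: degree_monom_eq)
qed

lemma q_minus_inverse [simp]: "q - inverse q \<noteq> 0"
proof
  assume "q - inverse q = 0"
  then have "q ^ 2 = 1"
    by (simp add: power2_eq_square field_simps)
  then show False using q_power_neq_1[of 2] by simp
qed

lemma q_minus_1 [simp]: "q - 1 \<noteq> 0"
  using q_power_neq_1[of 1] by simp

lemma q_neq_1 [simp]: "q \<noteq> 1"
  using q_minus_1 by (metis diff_self)

definition ev :: "rat poly \<Rightarrow> qf" where
  "ev p = poly (map_poly emb p) (inverse q)"

lemma ev_pCons: "ev (pCons a p) = emb a + inverse q * ev p"
  by (simp add: ev_def map_poly_pCons)

lemma ev_0 [simp]: "ev 0 = 0"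
  by (simp add: ev_def)

lemma ev_add: "ev (p + p') = ev p + ev p'"
  by (induct p p' rule: poly_induct2) (simp_all add: ev_pCons algebra_simps)

lemma ev_smult: "ev (Polynomial.smult a p) = emb a * ev p"
  by (induct p) (simp_all add: ev_pCons algebra_simps)

lemma ev_mult: "ev (p * p') = ev p * ev p'"
  by (induct p) (simp_all add: ev_pCons ev_add ev_smult algebra_simps)

text \<open>A power of \<open>q\<close> turns the value of \<open>p\<close> at the inverse of
  \<open>q\<close> into the reflected polynomial at \<open>q\<close>, and \<open>q\<close> is
  transcendental. Hence the bar involution keeps denominators nonzero.\<close>

lemma ev_eq_0: "ev p = 0 \<longleftrightarrow> p = 0"
proof
  assume "ev p = 0"
  have "reflect_poly (map_poly emb p) = map_poly emb (reflect_poly p)"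
    by (rule poly_eqI) (simp add: coeff_reflect_poly coeff_map_poly degree_map_poly)
  then have "to_fract (reflect_poly p) = poly (reflect_poly (map_poly emb p)) q"
    by (simp flip: to_fract_poly)
  also have "\<dots> = 0"
    using \<open>ev p = 0\<close> by (simp add: poly_reflect_poly_nz ev_def)
  finally show "p = 0" by simp
qed simp

lemma fract_cases: fixes x :: qf obtains a b where "x = to_fract a / to_fract b" "b \<noteq> 0"
  using snd_quot_of_fract_nonzero[of x] by (metis Fract_conv_to_fract Fract_quot_of_fract)

lemma qf_bar_ev: "qf_bar x = ev (fst (quot_of_fract x)) / ev (snd (quot_of_fract x))"
  by (simp add: qf_bar_def ev_def emb_def[abs_def])

text \<open>Cross multiplication and multiplicativity of \<open>ev\<close> free the bar involution
  from the normalized fraction in its definition.\<close>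

lemma qf_bar_quot: assumes "b \<noteq> 0" shows "qf_bar (to_fract a / to_fract b) = ev a / ev b"
proof -
  let ?x = "to_fract a / to_fract b"
  define n d where "n = fst (quot_of_fract ?x)" and "d = snd (quot_of_fract ?x)"
  have d: "d \<noteq> 0"
    by (simp add: d_def snd_quot_of_fract_nonzero)
  have "?x = to_fract n / to_fract d"
    unfolding n_def d_def by (metis Fract_conv_to_fract Fract_quot_of_fract)
  then have "to_fract (a * d) = to_fract (n * b)"
    using assms d by (simp add: field_simps)
  then have "a * d = n * b"
    by (simp only: to_fract_eq_iff)
  then have "ev a * ev d = ev n * ev b"
    by (simp flip: ev_mult)
  then show ?thesis
    using assms d by (simp add: qf_bar_ev frac_eq_eq ev_eq_0 flip: n_def d_def)
qed

lemma qf_bar_add: "qf_bar (x + y) = qf_bar x + qf_bar y"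
proof -
  obtain a b where x: "x = to_fract a / to_fract b" "b \<noteq> 0" by (rule fract_cases)
  obtain c d where y: "y = to_fract c / to_fract d" "d \<noteq> 0" by (rule fract_cases)
  have "x + y = to_fract (a * d + c * b) / to_fract (b * d)"
    using x y by (simp add: field_simps)
  then show ?thesis
    using x y by (simp add: qf_bar_quot ev_mult ev_add ev_eq_0 add_frac_eq del: to_fract_add to_fract_mult)
qed

lemma qf_bar_mult: "qf_bar (x * y) = qf_bar x * qf_bar y"
proof -
  obtain a b where x: "x = to_fract a / to_fract b" "b \<noteq> 0" by (rule fract_cases)
  obtain c d where y: "y = to_fract c / to_fract d" "d \<noteq> 0" by (rule fract_cases)
  have "x * y = to_fract (a * c) / to_fract (b * d)"
    using x y by (simp add: field_simps)
  then show ?thesis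
    using x y by (simp add: qf_bar_quot ev_mult ev_eq_0 del: to_fract_add to_fract_mult)
qed

lemma qf_bar_0 [simp]: "qf_bar 0 = 0"
  using qf_bar_quot[of 1 0] by simp

lemma qf_bar_1 [simp]: "qf_bar 1 = 1"
  using qf_bar_quot[of 1 1] by (simp add: ev_eq_0)

lemma qf_bar_uminus: "qf_bar (- x) = - qf_bar x"
  using qf_bar_add[of x "- x"] by (simp add: eq_neg_iff_add_eq_0 add.commute)

lemma qf_bar_diff: "qf_bar (x - y) = qf_bar x - qf_bar y"
  using qf_bar_add[of x "- y"] by (simp add: qf_bar_uminus)

lemma qf_bar_q [simp]: "qf_bar q = inverse q"
proof -
  have "q = to_fract [:0, 1:] / to_fract 1"
    by (simp add: q_def)
  then have "qf_bar q = ev [:0, 1:] / ev 1"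
    using qf_bar_quot[of 1 "[:0, 1:]"] by simp
  then show ?thesis
    by (simp add: ev_pCons one_pCons)
qed

lemma qf_bar_inverse: "qf_bar (inverse x) = inverse (qf_bar x)"
  by (cases "x = 0") (auto intro!: inverse_unique[symmetric] simp flip: qf_bar_mult)

lemma qf_bar_power: "qf_bar (x ^ n) = qf_bar x ^ n"
  by (induct n) (simp_all add: qf_bar_mult)

lemma qf_bar_powi: "qf_bar (q powi k) = q powi (- k)"
  by (simp add: power_int_def qf_bar_power qf_bar_inverse power_inverse)

text \<open>\<open>x\<close> lies in the localization of the polynomial ring at
  \<open>q - 1\<close>, and \<open>c\<close> is its residue. As a relation this is compatible with
  sums and products without separate regularity conditions.\<close>

definition reg :: "qf \<Rightarrow> rat \<Rightarrow> bool" where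
  "reg x c \<longleftrightarrow> (\<exists>p d. x = to_fract p / to_fract d \<and> poly d 1 \<noteq> 0 \<and> c = poly p 1 / poly d 1)"

lemma reg_emb: "reg (emb c) c"
  unfolding reg_def emb_def by (rule exI[of _ "[:c:]"], rule exI[of _ 1]) simp

lemma reg_0 [simp]: "reg 0 0"
  using reg_emb[of 0] by simp

lemma reg_1 [simp]: "reg 1 1"
  using reg_emb[of 1] by simp

lemma reg_q: "reg q 1"
  unfolding reg_def q_def by (rule exI[of _ "[:0, 1:]"], rule exI[of _ 1]) simp

lemma reg_add: assumes "reg x a" "reg y b" shows "reg (x + y) (a + b)"
proof -
  obtain p d where x: "x = to_fract p / to_fract d" "poly d 1 \<noteq> 0" "a = poly p 1 / poly d 1"
    using assms(1) by (auto simp: reg_def)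
  obtain p' d' where y: "y = to_fract p' / to_fract d'" "poly d' 1 \<noteq> 0" "b = poly p' 1 / poly d' 1"
    using assms(2) by (auto simp: reg_def)
  have nz: "d \<noteq> 0" "d' \<noteq> 0" using x y by auto
  show ?thesis
    unfolding reg_def
    by (rule exI[of _ "p * d' + p' * d"], rule exI[of _ "d * d'"]) (use x y nz in \<open>simp add: add_frac_eq\<close>)
qed

lemma reg_mult: assumes "reg x a" "reg y b" shows "reg (x * y) (a * b)"
proof -
  obtain p d where x: "x = to_fract p / to_fract d" "poly d 1 \<noteq> 0" "a = poly p 1 / poly d 1"
    using assms(1) by (auto simp: reg_def)
  obtain p' d' where y: "y = to_fract p' / to_fract d'" "poly d' 1 \<noteq> 0" "b = poly p' 1 / poly d' 1"
    using assms(2) by (auto simp: reg_def)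
  show ?thesis
    unfolding reg_def
    by (rule exI[of _ "p * p'"], rule exI[of _ "d * d'"]) (use x y in simp)
qed

lemma reg_uminus: "reg x a \<Longrightarrow> reg (- x) (- a)"
  using reg_mult[OF reg_emb[of "-1"], of x a] emb_hom(3)[of 1 "-1"]
  by (simp add: add_eq_0_iff del: emb_hom(3))

lemma reg_diff: "reg x a \<Longrightarrow> reg y b \<Longrightarrow> reg (x - y) (a - b)"
  using reg_add[OF _ reg_uminus, of x a y b] by simp

lemma reg_inverse: assumes "reg x a" "a \<noteq> 0" shows "reg (inverse x) (inverse a)"
proof -
  obtain p d where "x = to_fract p / to_fract d" "poly d 1 \<noteq> 0" "a = poly p 1 / poly d 1"
    using assms(1) by (auto simp: reg_def)
  then show ?thesis
    unfolding reg_def using assms(2) by (intro exI[of _ d] exI[of _ p]) auto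
qed

lemma reg_sum: "(\<And>i. i \<in> A \<Longrightarrow> reg (f i) (g i)) \<Longrightarrow> reg (\<Sum>i\<in>A. f i) (\<Sum>i\<in>A. g i)"
  by (induct A rule: infinite_finite_induct) (simp_all add: reg_add)

lemma reg_power: "reg x a \<Longrightarrow> reg (x ^ n) (a ^ n)"
  by (induct n) (simp_all add: reg_mult)

lemma reg_q_powi: "reg (q powi k) 1"
  using reg_power[OF reg_q] reg_power[OF reg_inverse[OF reg_q]] by (auto simp: power_int_def)

lemma reg_unique: assumes "reg x a" "reg x b" shows "a = b"
proof -
  obtain p d where x: "x = to_fract p / to_fract d" "poly d 1 \<noteq> 0" "a = poly p 1 / poly d 1"
    using assms(1) by (auto simp: reg_def)
  obtain p' d' where y: "x = to_fract p' / to_fract d'" "poly d' 1 \<noteq> 0" "b = poly p' 1 / poly d' 1"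
    using assms(2) by (auto simp: reg_def)
  have "d \<noteq> 0" "d' \<noteq> 0" using x y by auto
  then have "to_fract (p * d') = to_fract (p' * d)"
    using x(1) y(1) by (simp add: field_simps)
  then have "p * d' = p' * d" by (simp only: to_fract_eq_iff)
  then have "poly p 1 * poly d' 1 = poly p' 1 * poly d 1"
    by (simp flip: poly_mult)
  then show ?thesis using x y by (simp add: frac_eq_eq)
qed

lemma q_minus_1_fract: "(q - 1) ^ n = to_fract ([:-1, 1:] ^ n)"
proof -
  have "q - 1 = to_fract ([:0, 1:] - [:1:])"
    by (simp add: q_def one_pCons[symmetric] del: diff_pCons)
  then have *: "q - 1 = to_fract [:-1, 1:]" by simp
  show ?thesis
    unfolding * by (induct n) (simp_all del: mult_pCons_left flip: to_fract_mult)
qed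

text \<open>The maximal ideal of the local ring is generated by \<open>q - 1\<close>, since the
  numerator has the root 1.\<close>

lemma reg_zero_divisible: assumes "reg x 0" obtains y c where "x = (q - 1) * y" "reg y c"
proof -
  obtain p d where x: "x = to_fract p / to_fract d" "poly d 1 \<noteq> 0" "poly p 1 = 0"
    using assms by (auto simp: reg_def)
  then obtain p' where "p = [:-1, 1:] * p'"
    by (metis dvdE poly_eq_0_iff_dvd)
  then have "x = (q - 1) * (to_fract p' / to_fract d)"
    using x q_minus_1_fract[of 1] by (simp del: mult_pCons_left)
  moreover have "reg (to_fract p' / to_fract d) (poly p' 1 / poly d 1)"
    using x by (auto simp: reg_def)
  ultimately show thesis by (rule that)
qed

text \<open>The exponent is the multiplicity of 1 as a root of the denominator.\<close>

lemma reg_scale: obtains d c where "reg ((q - 1) ^ d * x) c"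
proof -
  obtain a b where x: "x = to_fract a / to_fract b" "b \<noteq> 0" by (rule fract_cases)
  obtain b' where b': "b = [:-1, 1:] ^ Polynomial.order 1 b * b'" "poly b' 1 \<noteq> 0"
    using order_decomp[OF x(2), of 1] by (metis dvdE poly_eq_0_iff_dvd)
  have "b' \<noteq> 0" using b' by auto
  have "(q - 1) ^ Polynomial.order 1 b * x = to_fract a / to_fract b'"
  proof -
    have "to_fract b = (q - 1) ^ Polynomial.order 1 b * to_fract b'"
      by (subst b'(1)) (simp only: to_fract_mult q_minus_1_fract)
    then show ?thesis using x \<open>b' \<noteq> 0\<close> by simp
  qed
  then show thesis using b'(2) that[of "Polynomial.order 1 b"] by (auto simp: reg_def)
qed

lemma reg_scale_mono:
  assumes "reg ((q - 1) ^ d * x) c" "d \<le> e" shows "\<exists>c'. reg ((q - 1) ^ e * x) c'"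
proof -
  have "(q - 1) ^ e = (q - 1) ^ (e - d) * (q - 1) ^ d"
    using assms(2) by (simp flip: power_add)
  then show ?thesis
    using reg_mult[OF reg_power[OF reg_diff[OF reg_q reg_1], of "e - d"] assms(1)]
    by (auto simp: mult.assoc)
qed

lemma reg_scale_finite:
  assumes "finite P" shows "\<exists>d::nat. \<forall>x\<in>P. \<exists>c. reg ((q - 1) ^ d * f x) c"
proof -
  have "\<exists>d. \<exists>c. reg ((q - 1) ^ d * f x) c" for x
    by (metis reg_scale)
  then obtain d where d: "\<exists>c. reg ((q - 1) ^ d x * f x) c" for x
    by metis
  show ?thesis
  proof (intro exI[of _ "Max (d ` P)"] ballI)
    fix x assume "x \<in> P"
    then have "d x \<le> Max (d ` P)" using assms by simp
    with d[of x] show "\<exists>c. reg ((q - 1) ^ (Max (d ` P)) * f x) c"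
      using reg_scale_mono by blast
  qed
qed

text \<open>In a discrete valuation ring only 0 is divisible by all powers of the uniformizer; here
  the multiplicity of the root 1 in a numerator bounds the exponent.\<close>

lemma infinitely_divisible_0:
  assumes "\<And>k. \<exists>y c. x = (q - 1) ^ k * y \<and> reg y c" shows "x = 0"
proof (rule ccontr)
  assume "x \<noteq> 0"
  obtain a b where x: "x = to_fract a / to_fract b" "b \<noteq> 0" by (rule fract_cases)
  with \<open>x \<noteq> 0\<close> have a: "a \<noteq> 0" by auto
  define k where "k = Suc (Polynomial.order 1 a)"
  obtain y c where y: "x = (q - 1) ^ k * y" "reg y c" using assms by blast
  then obtain p d where p: "y = to_fract p / to_fract d" "poly d 1 \<noteq> 0"
    by (auto simp: reg_def)
  have "d \<noteq> 0" using p by auto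
  have "to_fract (a * d) = to_fract ([:-1, 1:] ^ k * (p * b))"
    using x y p \<open>d \<noteq> 0\<close> q_minus_1_fract[of k] by (simp add: field_simps)
  then have eq: "a * d = [:-1, 1:] ^ k * (p * b)" by (simp only: to_fract_eq_iff)
  then have "[:-1, 1:] ^ k dvd a * d" by simp
  then have "k \<le> Polynomial.order 1 (a * d)"
    using a \<open>d \<noteq> 0\<close> by (simp add: order_divides)
  also have "\<dots> = Polynomial.order 1 a"
    using a \<open>d \<noteq> 0\<close> p(2) by (simp add: order_mult order_0I)
  finally show False by (simp add: k_def)
qed

section \<open>Lifting from the specialization at q = 1 to the field of rational functions\<close>

lemma sum_fun_apply: "(\<Sum>y\<in>S. f y) x = (\<Sum>y\<in>S. f y x)"
  by (induct S rule: infinite_finite_induct) simp_all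

text \<open>\<open>t y x\<close> is the value at \<open>x\<close> of the image of the delta function
  at \<open>y\<close> under a linear projection onto \<open>A\<close>. Explicit coefficients serve
  two purposes: clearing denominators in \<open>specialization_lifting\<close> and averaging over a
  group in \<open>bicommutant\<close>.\<close>

lemma projection_coefficients:
  fixes A :: "('p \<Rightarrow> 'k :: field) set"
  assumes P: "finite P"
    and A: "(\<lambda>_. 0) \<in> A" "\<And>f g. f \<in> A \<Longrightarrow> g \<in> A \<Longrightarrow> (\<lambda>x. f x + g x) \<in> A" "\<And>c f. f \<in> A \<Longrightarrow> (\<lambda>x. c * f x) \<in> A"
  obtains t where "\<And>c. (\<lambda>x. \<Sum>y\<in>P. c y * t y x) \<in> A"
    and "\<And>a x. a \<in> A \<Longrightarrow> (\<And>y. y \<notin> P \<Longrightarrow> a y = 0) \<Longrightarrow> (\<Sum>y\<in>P. a y * t y x) = a x"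
proof -
  define sc where "sc = (\<lambda>(c :: 'k) (f :: 'p \<Rightarrow> 'k) x. c * f x)"
  interpret vs: vector_space sc
    by unfold_locales (auto simp: sc_def fun_eq_iff algebra_simps)
  interpret vp: vector_space_pair sc sc ..
  have "vs.subspace A"
    unfolding vs.subspace_def using A by (auto simp: sc_def plus_fun_def zero_fun_def)
  then obtain \<pi> where \<pi>: "range \<pi> \<subseteq> A" "Vector_Spaces.linear sc sc \<pi>" "\<And>a. a \<in> A \<Longrightarrow> \<pi> a = a"
    using vp.linear_exists_left_inverse_on[OF vs.linear_id, of A] by auto
  interpret \<pi>: Vector_Spaces.linear sc sc \<pi> by fact
  define \<delta> where "\<delta> y = (\<lambda>x. if x = y then 1 else 0 :: 'k)" for y :: 'p
  have exp: "\<pi> (\<Sum>y\<in>P. sc (c y) (\<delta> y)) = (\<lambda>x. \<Sum>y\<in>P. c y * \<pi> (\<delta> y) x)" for c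
    unfolding \<pi>.sum \<pi>.scale by (rule ext) (simp add: sum_fun_apply sc_def)
  show thesis
  proof (rule that)
    show "(\<lambda>x. \<Sum>y\<in>P. c y * \<pi> (\<delta> y) x) \<in> A" for c
      using \<pi>(1) by (simp flip: exp) blast
    fix a x assume a: "a \<in> A" "\<And>y. y \<notin> P \<Longrightarrow> a y = 0"
    have "(\<Sum>y\<in>P. sc (a y) (\<delta> y)) = a"
    proof
      fix z
      have "(\<Sum>y\<in>P. sc (a y) (\<delta> y)) z = (\<Sum>y\<in>P. if z = y then a y else 0)"
        by (simp add: sum_fun_apply sc_def \<delta>_def if_distrib cong: if_cong)
      then show "(\<Sum>y\<in>P. sc (a y) (\<delta> y)) z = a z"
        using P a(2)[of z] by simp
    qed
    then show "(\<Sum>y\<in>P. a y * \<pi> (\<delta> y) x) = a x"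
      using exp[of a] \<pi>(3)[OF a(1)] by metis
  qed
qed

text \<open>A subspace \<open>A\<close> of \<open>C\<close> over the field of rational functions is all of \<open>C\<close> if every
  specialization at 1 of an element of \<open>C\<close> is also one of an element of \<open>A\<close>: by induction,
  \<open>C\<close> is contained in \<open>A\<close> up to an arbitrarily high power of \<open>q - 1\<close>.\<close>

lemma specialization_lifting:
  fixes A C :: "('p \<Rightarrow> qf) set"
  assumes P: "finite P" and supp: "\<And>c x. c \<in> C \<Longrightarrow> x \<notin> P \<Longrightarrow> c x = 0" and AC: "A \<subseteq> C"
    and A: "(\<lambda>_. 0) \<in> A" "\<And>f g. f \<in> A \<Longrightarrow> g \<in> A \<Longrightarrow> (\<lambda>x. f x + g x) \<in> A" "\<And>c f. f \<in> A \<Longrightarrow> (\<lambda>x. c * f x) \<in> A"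
    and C: "\<And>f g. f \<in> C \<Longrightarrow> g \<in> C \<Longrightarrow> (\<lambda>x. f x + g x) \<in> C" "\<And>c f. f \<in> C \<Longrightarrow> (\<lambda>x. c * f x) \<in> C"
    and core: "\<And>c c'. c \<in> C \<Longrightarrow> (\<And>x. reg (c x) (c' x)) \<Longrightarrow> \<exists>a\<in>A. \<forall>x. reg (a x) (c' x)"
  shows "C \<subseteq> A"
proof
  obtain t where t: "\<And>c. (\<lambda>x. \<Sum>y\<in>P. c y * t y x) \<in> A"
    and tA: "\<And>a x. a \<in> A \<Longrightarrow> (\<And>y. y \<notin> P \<Longrightarrow> a y = 0) \<Longrightarrow> (\<Sum>y\<in>P. a y * t y x) = a x"
    using projection_coefficients[OF P A] by blast
  \<comment> \<open>The identity minus the projection onto \<open>A\<close>: among the elements of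
    \<open>C\<close> it kills exactly those of \<open>A\<close>. The number \<open>d\<close> below
    bounds the poles at 1 of its coefficients.\<close>
  define \<rho> where "\<rho> c x = (\<Sum>y\<in>P. c y * ((if x = y then 1 else 0) - t y x))" for c x
  have \<rho>: "\<rho> c x = c x - (\<Sum>y\<in>P. c y * t y x)" if "c \<in> C" for c x
  proof -
    have "(\<Sum>y\<in>P. c y * (if x = y then 1 else 0)) = (\<Sum>y\<in>P. if x = y then c y else 0)"
      by (rule sum.cong) auto
    then show ?thesis
      using P supp[OF that, of x] by (simp only: \<rho>_def right_diff_distrib sum_subtractf) auto
  qed
  obtain d where d: "\<And>y x. y \<in> P \<Longrightarrow> x \<in> P \<Longrightarrow> \<exists>c. reg ((q - 1) ^ d * ((if x = y then 1 else 0) - t y x)) c"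
    using reg_scale_finite[of "P \<times> P" "\<lambda>(y, x). (if x = y then 1 else 0) - t y x"] P by fastforce
  \<comment> \<open>Successive approximation: an element of \<open>A\<close> with the same value at
    1 is subtracted and the difference divided by \<open>q - 1\<close>. The quotient is regular and
    again in \<open>C\<close>, which is a subspace over the field.\<close>
  have approx: "\<exists>a c1. a \<in> A \<and> c1 \<in> C \<and> (\<forall>x. \<exists>v. reg (c1 x) v) \<and> (\<forall>x. c x = a x + (q - 1) ^ k * c1 x)"
    if c: "c \<in> C" "\<And>x. \<exists>v. reg (c x) v" for c k
  proof (induct k)
    case 0
    show ?case
      using c A(1) by (intro exI[of _ "\<lambda>_. 0"] exI[of _ c]) simp
  next
    case (Suc k)
    then obtain a c1 where ac: "a \<in> A" "c1 \<in> C" "\<And>x. \<exists>v. reg (c1 x) v" "\<And>x. c x = a x + (q - 1) ^ k * c1 x"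
      by blast
    from ac(3) obtain v where v: "\<And>x. reg (c1 x) (v x)" by metis
    obtain a1 where a1: "a1 \<in> A" "\<And>x. reg (a1 x) (v x)" using core[OF ac(2) v] by blast
    have "\<exists>y w. c1 x - a1 x = (q - 1) * y \<and> reg y w" for x
      using reg_diff[OF v a1(2), of x x] reg_zero_divisible by (metis diff_self)
    then obtain c2 where c2: "\<And>x. c1 x - a1 x = (q - 1) * c2 x" "\<And>x. \<exists>w. reg (c2 x) w"
      by metis
    have c2C: "c2 \<in> C"
    proof -
      have "(\<lambda>x. inverse (q - 1) * (c1 x + (-1) * a1 x)) \<in> C"
        using ac(2) a1(1) AC by (intro C) auto
      moreover have "inverse (q - 1) * (c1 x + (-1) * a1 x) = c2 x" for x
        using c2(1)[of x] by (simp add: field_simps)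
      ultimately show ?thesis by (simp add: fun_eq_iff)
    qed
    have "c x = (a x + (q - 1) ^ k * a1 x) + (q - 1) ^ Suc k * c2 x" for x
    proof -
      have "c1 x = a1 x + (q - 1) * c2 x" using c2(1)[of x] by (simp add: algebra_simps)
      then show ?thesis using ac(4)[of x] by (simp add: distrib_left mult_ac add_ac)
    qed
    moreover have "(\<lambda>x. a x + (q - 1) ^ k * a1 x) \<in> A"
      using ac(1) a1(1) by (intro A)
    ultimately show ?case using c2C c2(2) by blast
  qed
  have regular: "c \<in> A" if c: "c \<in> C" "\<And>x. \<exists>v. reg (c x) v" for c
  proof -
    \<comment> \<open>Since \<open>\<rho>\<close> kills the approximants from \<open>A\<close>, this
      function is divisible by every power of \<open>q - 1\<close> with a regular quotient.\<close>
    have "(q - 1) ^ d * \<rho> c x = 0" if "x \<in> P" for x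
    proof (rule infinitely_divisible_0)
      fix k
      obtain a c1 where ac: "a \<in> A" "c1 \<in> C" "\<And>x. \<exists>v. reg (c1 x) v" "\<And>x. c x = a x + (q - 1) ^ k * c1 x"
        using approx[OF c, of k] by blast
      have "\<rho> a x = 0"
        using tA[OF ac(1)] supp ac(1) AC by (subst \<rho>) auto
      then have "\<rho> c x = (q - 1) ^ k * \<rho> c1 x"
        by (simp add: \<rho>_def ac(4) distrib_right sum.distrib sum_distrib_left mult.assoc)
      then have "(q - 1) ^ d * \<rho> c x
          = (q - 1) ^ k * (\<Sum>y\<in>P. c1 y * ((q - 1) ^ d * ((if x = y then 1 else 0) - t y x)))"
        by (simp add: \<rho>_def sum_distrib_left mult_ac)
      moreover have "\<exists>v. reg (\<Sum>y\<in>P. c1 y * ((q - 1) ^ d * ((if x = y then 1 else 0) - t y x))) v"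
      proof -
        have "\<forall>y\<in>P. \<exists>v. reg (c1 y * ((q - 1) ^ d * ((if x = y then 1 else 0) - t y x))) v"
          using d[OF _ \<open>x \<in> P\<close>] ac(3) reg_mult by blast
        then obtain v where "\<And>y. y \<in> P \<Longrightarrow>
            reg (c1 y * ((q - 1) ^ d * ((if x = y then 1 else 0) - t y x))) (v y)"
          by metis
        then have "reg (\<Sum>y\<in>P. c1 y * ((q - 1) ^ d * ((if x = y then 1 else 0) - t y x))) (\<Sum>y\<in>P. v y)"
          by (rule reg_sum)
        then show ?thesis ..
      qed
      ultimately show "\<exists>y v. (q - 1) ^ d * \<rho> c x = (q - 1) ^ k * y \<and> reg y v" by blast
    qed
    then have "c x = (\<Sum>y\<in>P. c y * t y x)" if "x \<in> P" for x
      using that \<rho>[OF c(1), of x] by simp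
    moreover have "c x = (\<Sum>y\<in>P. c y * t y x)" if "x \<notin> P" for x
      using supp[OF c(1) that] supp[OF _ that] t[of c] AC by auto
    ultimately have "c = (\<lambda>x. \<Sum>y\<in>P. c y * t y x)" by blast
    then show ?thesis using t[of c] by metis
  qed
  fix c assume "c \<in> C"
  \<comment> \<open>Poles of an arbitrary element are cleared by a power of \<open>q - 1\<close>,
    which is invertible in the field and so does not affect membership in \<open>A\<close>.\<close>
  obtain e where e: "\<And>x. x \<in> P \<Longrightarrow> \<exists>v. reg ((q - 1) ^ e * c x) v"
    using reg_scale_finite[OF P, of c] by blast
  have "\<exists>v. reg ((q - 1) ^ e * c x) v" for x
    by (cases "x \<in> P") (use e[of x] supp[OF \<open>c \<in> C\<close>, of x] in \<open>auto intro: exI[of _ 0]\<close>)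
  then have "(\<lambda>x. (q - 1) ^ e * c x) \<in> A"
    using \<open>c \<in> C\<close> by (intro regular C)
  from A(3)[OF this, of "inverse ((q - 1) ^ e)"] show "c \<in> A"
    by (simp add: mult.assoc[symmetric])
qed

section \<open>The classical double centralizer theorem\<close>

definition mm :: "'a set \<Rightarrow> ('a \<Rightarrow> 'a \<Rightarrow> 'k) \<Rightarrow> ('a \<Rightarrow> 'a \<Rightarrow> 'k) \<Rightarrow> 'a \<Rightarrow> 'a \<Rightarrow> 'k :: comm_semiring_1" where
  "mm X A B f g = (\<Sum>h\<in>X. A f h * B h g)"

definition idm :: "'a \<Rightarrow> 'a \<Rightarrow> 'k :: comm_semiring_1" where
  "idm f g = (if f = g then 1 else 0)"

lemma mm_idm_left: "finite X \<Longrightarrow> f \<in> X \<Longrightarrow> mm X idm A f g = A f g"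
  by (simp add: mm_def idm_def if_distrib[of "\<lambda>z. z * _"] cong: if_cong)

lemma mm_idm_right: "finite X \<Longrightarrow> g \<in> X \<Longrightarrow> mm X A idm f g = A f g"
  by (simp add: mm_def idm_def if_distrib[of "(*) _"] cong: if_cong)

text \<open>Matrices are functions of arbitrary indices of which only the entries on
  \<open>X\<close> count; \<open>cong\<close> makes \<open>\<A>\<close> insensitive to the
  others.\<close>

locale matrix_algebra =
  fixes X :: "'x set" and \<A> :: "('x \<Rightarrow> 'x \<Rightarrow> 'k :: field_char_0) set"
  assumes finX: "finite X"
    and cong: "M \<in> \<A> \<Longrightarrow> (\<And>f g. f \<in> X \<Longrightarrow> g \<in> X \<Longrightarrow> M f g = N f g) \<Longrightarrow> N \<in> \<A>"
    and add: "M \<in> \<A> \<Longrightarrow> N \<in> \<A> \<Longrightarrow> (\<lambda>f g. M f g + N f g) \<in> \<A>"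
    and scale: "M \<in> \<A> \<Longrightarrow> (\<lambda>f g. c * M f g) \<in> \<A>"
    and mult: "M \<in> \<A> \<Longrightarrow> N \<in> \<A> \<Longrightarrow> mm X M N \<in> \<A>"
    and one: "idm \<in> \<A>"
begin

lemma zero: "(\<lambda>f g. 0) \<in> \<A>"
  using scale[OF one, of 0] by simp

lemma diff: "M \<in> \<A> \<Longrightarrow> N \<in> \<A> \<Longrightarrow> (\<lambda>f g. M f g - N f g) \<in> \<A>"
  using add[OF _ scale[of N "-1"], of M] by simp

lemma sum: "(\<And>i. i \<in> S \<Longrightarrow> M i \<in> \<A>) \<Longrightarrow> (\<lambda>f g. \<Sum>i\<in>S. M i f g) \<in> \<A>"
  by (induct S rule: infinite_finite_induct) (simp_all add: zero add)

text \<open>The average over \<open>w\<close> of the conjugates of a projection onto \<open>\<A>\<close> is a projection whose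
  blocks are invariant under \<open>G\<close>, so they commute with \<open>\<phi>\<close>, and then the identity matrix being
  fixed implies that \<open>\<phi>\<close> is fixed.\<close>

lemma bicommutant:
  fixes \<phi> :: "'x \<Rightarrow> 'x \<Rightarrow> 'k"
  assumes S: "\<And>s. s \<in> S \<Longrightarrow> bij_betw s X X" "\<And>s. s \<in> S \<Longrightarrow> (\<lambda>f h. idm (s f) h) \<in> \<A>"
    and comm: "\<And>M f h. (\<And>s f g. s \<in> S \<Longrightarrow> f \<in> X \<Longrightarrow> g \<in> X \<Longrightarrow> M (s f) (s g) = M f g) \<Longrightarrow>
        f \<in> X \<Longrightarrow> h \<in> X \<Longrightarrow> mm X M \<phi> f h = mm X \<phi> M f h"
  shows "\<phi> \<in> \<A>"
proof -
  \<comment> \<open>\<open>G\<close> replaces the group generated by \<open>S\<close>: it consists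
    of all permutations of \<open>X\<close> whose matrix lies in \<open>\<A>\<close>. It is finite
    and closed under composition, hence a group.\<close>
  define G where "G = {w \<in> X \<rightarrow>\<^sub>E X. bij_betw w X X \<and> (\<lambda>f h. idm (w f) h) \<in> \<A>}"
  have finG: "finite G"
    by (rule finite_subset[OF _ finite_PiE[OF finX, of "\<lambda>_. X"]]) (auto simp: G_def finX)
  have G_X: "w f \<in> X" if "w \<in> G" "f \<in> X" for w f
    using that by (auto simp: G_def)
  have idG: "restrict id X \<in> G"
    using one by (auto simp: G_def bij_betw_def inj_on_def intro: cong)
  have compG: "compose X v w \<in> G" if "v \<in> G" "w \<in> G" for v w
  proof -
    have "(\<lambda>f h. idm (compose X v w f) h) \<in> \<A>"
    proof (rule cong)
      show "mm X (\<lambda>f h. idm (w f) h) (\<lambda>f h. idm (v f) h) \<in> \<A>"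
        using that by (intro mult) (auto simp: G_def)
      fix f g assume "f \<in> X" "g \<in> X"
      then show "mm X (\<lambda>f h. idm (w f) h) (\<lambda>f h. idm (v f) h) f g = idm (compose X v w f) g"
        using G_X[OF that(2)] finX
        by (simp add: mm_def compose_def) (simp add: idm_def if_distrib[of "\<lambda>z. z * _"] cong: if_cong)
    qed
    moreover have "bij_betw (compose X v w) X X"
      using that bij_betw_compose[of w X X v X] by (auto simp: G_def)
    ultimately show ?thesis
      using that by (auto simp: G_def compose_def)
  qed
  have right_mult: "bij_betw (\<lambda>v. compose X v w) G G" if w: "w \<in> G" for w
  proof -
    have "inj_on (\<lambda>v. compose X v w) G"
    proof (rule inj_onI)
      fix u v assume uv: "u \<in> G" "v \<in> G" "compose X u w = compose X v w"
      show "u = v"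
      proof (rule extensionalityI)
        show "u \<in> extensional X" "v \<in> extensional X" using uv by (auto simp: G_def PiE_def)
        fix x assume "x \<in> X"
        then have "x \<in> w ` X" using w by (simp add: G_def bij_betw_def)
        then obtain y where "x = w y" "y \<in> X" by (rule imageE)
        then show "u x = v x"
          using fun_cong[OF uv(3), of y] by (simp add: compose_eq)
      qed
    qed
    moreover have "(\<lambda>v. compose X v w) ` G \<subseteq> G" using compG[OF _ w] by blast
    ultimately show ?thesis
      using endo_inj_surj[OF finG] by (simp add: bij_betw_def)
  qed
  have inv: "\<exists>v\<in>G. \<forall>f\<in>X. v (w f) = f \<and> w (v f) = f" if w: "w \<in> G" for w
  proof -
    have "restrict id X \<in> (\<lambda>v. compose X v w) ` G"
      using right_mult[OF w] idG by (simp add: bij_betw_def)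
    then obtain v where v: "restrict id X = compose X v w" "v \<in> G" by (rule imageE)
    have l: "v (w f) = f" if "f \<in> X" for f
      using fun_cong[OF v(1), of f] that by (simp add: compose_eq)
    have r: "w (v f) = f" if "f \<in> X" for f
    proof -
      have "f \<in> w ` X" using w that by (simp add: G_def bij_betw_def)
      then obtain g where "f = w g" "g \<in> X" by (rule imageE)
      then show ?thesis by (simp add: l)
    qed
    with l v show ?thesis by blast
  qed
  have SG: "restrict s X \<in> G" if "s \<in> S" for s
  proof -
    have "(\<lambda>f h. idm (restrict s X f) h) \<in> \<A>"
      using S(2)[OF that] by (rule cong) simp
    moreover have "bij_betw (restrict s X) X X"
      using S(1)[OF that] by (simp cong: bij_betw_cong)
    ultimately show ?thesis
      using S(1)[OF that] by (auto simp: G_def bij_betw_def)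
  qed

  define P where "P = X \<times> X"
  define A where "A = {a. (\<lambda>f g. a (f, g)) \<in> \<A>}"
  have finP: "finite P" using finX by (simp add: P_def)
  have A0: "(\<lambda>_. 0) \<in> A" and A1: "\<And>f g. f \<in> A \<Longrightarrow> g \<in> A \<Longrightarrow> (\<lambda>x. f x + g x) \<in> A"
    and A2: "\<And>c f. f \<in> A \<Longrightarrow> (\<lambda>x. c * f x) \<in> A"
    using zero add scale by (auto simp: A_def)
  obtain t where t: "\<And>c. (\<lambda>x. \<Sum>y\<in>P. c y * t y x) \<in> A"
    and tA: "\<And>a x. a \<in> A \<Longrightarrow> (\<And>y. y \<notin> P \<Longrightarrow> a y = 0) \<Longrightarrow> (\<Sum>y\<in>P. a y * t y x) = a x"
    using projection_coefficients[OF finP A0 A1 A2] by blast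
  \<comment> \<open>Multiplication on the left by the permutation matrix of \<open>w\<close> moves
    the row index. So \<open>p\<close> is the sum over \<open>w\<close> of the conjugates of the
    projection by these multiplications, and \<open>\<theta> g g'\<close> is its block from column
    \<open>g'\<close> to column \<open>g\<close>, a matrix in the rows.\<close>
  define \<theta> where "\<theta> g g' f f' = (\<Sum>w\<in>G. t (w f', g') (w f, g))" for g g' f f'
  define p where "p a f g = (\<Sum>f'\<in>X. \<Sum>g'\<in>X. a f' g' * \<theta> g g' f f')" for a f g
  have p_sum: "p a f g = (\<Sum>w\<in>G. \<Sum>f'\<in>X. \<Sum>g'\<in>X. a f' g' * t (w f', g') (w f, g))" for a f g
    unfolding p_def \<theta>_def sum_distrib_left
    by (simp only: sum.swap[of _ G X])
  have reindex: "(\<Sum>f'\<in>X. \<Sum>g'\<in>X. a f' g' * t (w f', g') (w f, g))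
      = (\<Sum>y\<in>P. a (v (fst y)) (snd y) * t y (w f, g))"
    if w: "w \<in> G" and v: "\<forall>f\<in>X. v (w f) = f \<and> w (v f) = f" "v \<in> G" for a f g w v
  proof -
    have "(\<Sum>f'\<in>X. \<Sum>g'\<in>X. a f' g' * t (w f', g') (w f, g))
        = (\<Sum>f'\<in>X. \<Sum>g'\<in>X. a (v f') g' * t (f', g') (w f, g))"
      by (rule sum.reindex_bij_witness[of _ v w]) (use v G_X[OF w] G_X[OF v(2)] in auto)
    then show ?thesis
      by (simp add: sum.cartesian_product P_def split_def)
  qed
  have pA: "p a \<in> \<A>" for a
  proof -
    have "(\<lambda>f g. \<Sum>f'\<in>X. \<Sum>g'\<in>X. a f' g' * t (w f', g') (w f, g)) \<in> \<A>" if w: "w \<in> G" for w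
    proof -
      obtain v where v: "v \<in> G" "\<forall>f\<in>X. v (w f) = f \<and> w (v f) = f" using inv[OF w] by blast
      define N where "N f g = (\<Sum>y\<in>P. a (v (fst y)) (snd y) * t y (f, g))" for f g
      have "N \<in> \<A>"
        using t[of "\<lambda>y. a (v (fst y)) (snd y)"] by (simp add: A_def N_def[abs_def])
      then have "mm X (\<lambda>f h. idm (w f) h) N \<in> \<A>"
        using w by (intro mult) (auto simp: G_def)
      then show ?thesis
      proof (rule cong)
        fix f g assume "f \<in> X" "g \<in> X"
        have "mm X (\<lambda>f h. idm (w f) h) N f g = N (w f) g"
          using mm_idm_left[OF finX G_X[OF w \<open>f \<in> X\<close>], of N g] by (simp add: mm_def)
        then show "mm X (\<lambda>f h. idm (w f) h) N f g
            = (\<Sum>f'\<in>X. \<Sum>g'\<in>X. a f' g' * t (w f', g') (w f, g))"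
          using reindex[OF w v(2,1)] by (simp add: N_def)
      qed
    qed
    then have "(\<lambda>f g. \<Sum>w\<in>G. \<Sum>f'\<in>X. \<Sum>g'\<in>X. a f' g' * t (w f', g') (w f, g)) \<in> \<A>"
      by (rule sum)
    then show ?thesis by (simp add: p_sum[abs_def])
  qed
  have p1: "p idm f g = of_nat (card G) * idm f g" if fg: "f \<in> X" "g \<in> X" for f g
  proof -
    \<comment> \<open>Each conjugate fixes the identity: inside, the projection is applied to the
      permutation matrix of the inverse \<open>v\<close> of \<open>w\<close>, which already lies in
      \<open>\<A>\<close>.\<close>
    have "(\<Sum>f'\<in>X. \<Sum>g'\<in>X. idm f' g' * t (w f', g') (w f, g)) = idm f g" if w: "w \<in> G" for w
    proof -
      obtain v where v: "v \<in> G" "\<forall>f\<in>X. v (w f) = f \<and> w (v f) = f" using inv[OF w] by blast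
      define a :: "'x \<times> 'x \<Rightarrow> 'k" where "a y = (if y \<in> P then idm (v (fst y)) (snd y) else 0)" for y
      have "(\<lambda>f h. idm (v f) h) \<in> \<A>" using v by (simp add: G_def)
      then have "a \<in> A"
        unfolding A_def mem_Collect_eq by (rule cong) (simp add: a_def P_def)
      then have "(\<Sum>y\<in>P. a y * t y (w f, g)) = a (w f, g)"
        by (rule tA) (simp add: a_def)
      moreover have "(\<Sum>y\<in>P. a y * t y (w f, g)) = (\<Sum>y\<in>P. idm (v (fst y)) (snd y) * t y (w f, g))"
        by (rule sum.cong) (simp_all add: a_def)
      ultimately show ?thesis
        using reindex[OF w v(2,1), of idm f g] v(2) fg G_X[OF w] by (simp add: a_def P_def)
    qed
    then show ?thesis by (simp add: p_sum)
  qed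
  have \<theta>_inv: "\<theta> g g' (s f) (s f') = \<theta> g g' f f'" if "s \<in> S" "f \<in> X" "f' \<in> X" for g g' f f' s
  proof -
    have "\<theta> g g' f f' = (\<Sum>w\<in>G. t (compose X w (restrict s X) f', g') (compose X w (restrict s X) f, g))"
      unfolding \<theta>_def by (rule sum.reindex_bij_betw[OF right_mult[OF SG[OF that(1)]], symmetric])
    then show ?thesis
      using that by (simp add: compose_eq \<theta>_def)
  qed
  have \<theta>_comm: "mm X (\<theta> g g') \<phi> f h = mm X \<phi> (\<theta> g g') f h" if "f \<in> X" "h \<in> X" for g g' f h
    by (rule comm) (simp_all add: \<theta>_inv that)
  \<comment> \<open>As its blocks commute with \<open>\<phi>\<close>, the map \<open>p\<close>
    commutes with left multiplication by \<open>\<phi>\<close>, so that \<open>p \<phi>\<close> is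
    \<open>\<phi>\<close> times \<open>p idm\<close>.\<close>
  have "p \<phi> f g = of_nat (card G) * \<phi> f g" if fg: "f \<in> X" "g \<in> X" for f g
  proof -
    have "p \<phi> f g = (\<Sum>g'\<in>X. mm X (\<theta> g g') \<phi> f g')"
      unfolding p_def mm_def by (subst sum.swap) (simp add: mult.commute)
    also have "\<dots> = (\<Sum>g'\<in>X. \<Sum>h\<in>X. \<phi> f h * \<theta> g g' h g')"
      using fg by (intro sum.cong) (simp_all add: \<theta>_comm, simp add: mm_def)
    also have "\<dots> = (\<Sum>h\<in>X. \<phi> f h * (\<Sum>g'\<in>X. \<theta> g g' h g'))"
      by (subst sum.swap) (simp add: sum_distrib_left)
    also have "\<dots> = (\<Sum>h\<in>X. \<phi> f h * p idm h g)"
      unfolding p_def idm_def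
      by (rule sum.cong[OF refl], rule arg_cong[where f = "(*) _"], rule sum.cong[OF refl])
        (simp add: finX if_distrib[of "\<lambda>z. z * _"] cong: if_cong)
    also have "\<dots> = (\<Sum>h\<in>X. of_nat (card G) * (\<phi> f h * idm h g))"
      using fg by (intro sum.cong) (simp_all add: p1 mult_ac)
    also have "\<dots> = of_nat (card G) * \<phi> f g"
      using mm_idm_right[OF finX fg(2), of \<phi> f] by (simp add: mm_def flip: sum_distrib_left)
    finally show ?thesis .
  qed
  moreover have "card G > 0"
    using finG idG by (auto simp: card_gt_0_iff)
  ultimately have "\<phi> f g = inverse (of_nat (card G)) * p \<phi> f g" if "f \<in> X" "g \<in> X" for f g
    using that by simp
  then show ?thesis
    using scale[OF pA, of "inverse (of_nat (card G))" \<phi>] by (auto intro: cong)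
qed

end

section \<open>Matrices on words: Kronecker products and the Lie algebra action on tensor
  powers\<close>

definition words :: "'a set \<Rightarrow> nat \<Rightarrow> 'a list set" where
  "words I m = {f. length f = m \<and> set f \<subseteq> I}"

lemma words_0 [simp]: "words I 0 = {[]}"
  by (auto simp: words_def)

lemma words_Suc: "words I (Suc m) = (\<lambda>(a, f). a # f) ` (I \<times> words I m)"
  by (auto simp: words_def length_Suc_conv image_iff)

lemma Cons_words [simp]: "a # f \<in> words I (Suc m) \<longleftrightarrow> a \<in> I \<and> f \<in> words I m"
  by (auto simp: words_def)

lemma finite_words [simp]: "finite I \<Longrightarrow> finite (words I m)"
  unfolding words_def using finite_lists_length_eq[of I m] by (simp add: conj_commute)

lemma words_nth: "f \<in> words I m \<Longrightarrow> p < m \<Longrightarrow> f ! p \<in> I"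
  by (auto simp: words_def)

lemma words_length: "f \<in> words I m \<Longrightarrow> length f = m"
  by (simp add: words_def)

lemma sum_words_Suc: "(\<Sum>f\<in>words I (Suc m). F f) = (\<Sum>a\<in>I. \<Sum>f\<in>words I m. F (a # f))"
  by (simp add: words_Suc sum.reindex inj_on_def sum.cartesian_product split_def)

text \<open>Expansion of a product of sums: a word selects one summand from each factor.\<close>

lemma sum_words_prod:
  fixes F :: "nat \<Rightarrow> 'a \<Rightarrow> 'k :: comm_semiring_1"
  shows "(\<Sum>h\<in>words I m. \<Prod>p<m. F p (h ! p)) = (\<Prod>p<m. \<Sum>z\<in>I. F p z)"
proof (induct m arbitrary: F)
  case (Suc m)
  have "(\<Sum>h\<in>words I (Suc m). \<Prod>p<Suc m. F p (h ! p))
      = (\<Sum>a\<in>I. \<Sum>f\<in>words I m. F 0 a * (\<Prod>p<m. F (Suc p) (f ! p)))"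
    by (simp add: sum_words_Suc prod.lessThan_Suc_shift del: prod.lessThan_Suc)
  also have "\<dots> = (\<Sum>z\<in>I. F 0 z) * (\<Prod>p<m. \<Sum>z\<in>I. F (Suc p) z)"
    by (simp add: sum_product Suc[of "\<lambda>p. F (Suc p)", symmetric])
  finally show ?case
    by (simp add: prod.lessThan_Suc_shift del: prod.lessThan_Suc)
qed simp

text \<open>The Kronecker product of the matrices \<open>c 0\<close>, ...,
  \<open>c (m - 1)\<close>.\<close>

definition tensor :: "nat \<Rightarrow> (nat \<Rightarrow> 'a \<Rightarrow> 'a \<Rightarrow> 'k :: comm_semiring_1) \<Rightarrow> 'a list \<Rightarrow> 'a list \<Rightarrow> 'k" where
  "tensor m c f g = (\<Prod>p<m. c p (f ! p) (g ! p))"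

text \<open>The action of \<open>b\<close>, as an element of the general linear Lie algebra, on the
  \<open>m\<close>-th tensor power of the defining module.\<close>

definition deriv :: "nat \<Rightarrow> ('a \<Rightarrow> 'a \<Rightarrow> 'k :: comm_semiring_1) \<Rightarrow> 'a list \<Rightarrow> 'a list \<Rightarrow> 'k" where
  "deriv m b f g = (\<Sum>p<m. tensor m ((\<lambda>_. idm)(p := b)) f g)"

lemma tensor_cong:
  assumes "f \<in> words I m" "g \<in> words I m"
    and "\<And>p x y. p < m \<Longrightarrow> x \<in> I \<Longrightarrow> y \<in> I \<Longrightarrow> c p x y = d p x y"
  shows "tensor m c f g = tensor m d f g"
  unfolding tensor_def using assms by (intro prod.cong) (auto intro: words_nth)

text \<open>The mixed product property; the sum over intermediate words factors by
  \<open>sum_words_prod\<close>.\<close>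

lemma mm_tensor: "mm (words I m) (tensor m c) (tensor m d) f g = tensor m (\<lambda>p. mm I (c p) (d p)) f g"
  unfolding mm_def tensor_def
  by (simp flip: prod.distrib sum_words_prod[of "\<lambda>p z. c p (f ! p) z * d p z (g ! p)" for f g])

lemma tensor_idm: "length f = m \<Longrightarrow> length g = m \<Longrightarrow> tensor m (\<lambda>_. idm) f g = idm f g"
  by (auto simp: tensor_def idm_def list_eq_iff_nth_eq intro!: prod_zero)

lemma tensor_Suc: "tensor (Suc m) c (a # f) (b # g) = c 0 a b * tensor m (\<lambda>p. c (Suc p)) f g"
  by (simp add: tensor_def prod.lessThan_Suc_shift del: prod.lessThan_Suc)

lemma deriv_Suc:
  assumes "length f = m" "length g = m"
  shows "deriv (Suc m) b (x # f) (y # g) = b x y * idm f g + idm x y * deriv m b f g"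
proof -
  have "(\<lambda>p. ((\<lambda>_. idm)(Suc k := b)) (Suc p)) = (\<lambda>_. idm)(k := b)" for k
    by auto
  then show ?thesis
    using assms unfolding deriv_def
    by (simp add: sum.lessThan_Suc_shift tensor_Suc tensor_idm sum_distrib_left del: sum.lessThan_Suc)
qed

lemma deriv_0 [simp]: "deriv 0 b f g = 0"
  by (simp add: deriv_def)

lemma tensor_update:
  assumes "p < m"
  shows "tensor m (c(p := b)) f g = b (f ! p) (g ! p) * (\<Prod>r\<in>{..<m} - {p}. c r (f ! r) (g ! r))"
  unfolding tensor_def using assms by (simp add: prod.remove[of _ p])

lemma deriv_linear:
  fixes b c :: "'a \<Rightarrow> 'a \<Rightarrow> 'k :: comm_ring_1"
  shows "deriv m (\<lambda>x y. b x y + c x y) f g = deriv m b f g + deriv m c f g"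
    and "deriv m (\<lambda>x y. b x y - c x y) f g = deriv m b f g - deriv m c f g"
    and "deriv m (\<lambda>x y. k * b x y) f g = k * deriv m b f g"
  unfolding deriv_def
  by (simp_all add: tensor_update algebra_simps sum.distrib sum_subtractf sum_distrib_left)

lemma deriv_cong:
  assumes "f \<in> words I m" "g \<in> words I m" "\<And>x y. x \<in> I \<Longrightarrow> y \<in> I \<Longrightarrow> b x y = c x y"
  shows "deriv m b f g = deriv m c f g"
  unfolding deriv_def by (intro sum.cong refl tensor_cong) (use assms in auto)

lemma deriv_idm:
  "length f = m \<Longrightarrow> length g = m \<Longrightarrow> deriv m idm f g = (of_nat m * idm f g :: 'k :: comm_ring_1)"
  unfolding deriv_def by (simp add: fun_upd_idem tensor_idm)

lemma mm_sum_left: "mm X (\<lambda>f g. \<Sum>i\<in>S. M i f g) N f g = (\<Sum>i\<in>S. mm X (M i) N f g)"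
  unfolding mm_def sum_distrib_right by (rule sum.swap)

lemma mm_sum_right: "mm X N (\<lambda>f g. \<Sum>i\<in>S. M i f g) f g = (\<Sum>i\<in>S. mm X N (M i) f g)"
  unfolding mm_def sum_distrib_left by (rule sum.swap)

lemma mm_deriv_tensor:
  assumes "finite I" "f \<in> words I m" "g \<in> words I m"
  shows "mm (words I m) (deriv m b) (tensor m c) f g = (\<Sum>p<m. tensor m (c(p := mm I b (c p))) f g)"
proof -
  have "mm (words I m) (deriv m b) (tensor m c) f g
      = (\<Sum>p<m. mm (words I m) (tensor m ((\<lambda>_. idm)(p := b))) (tensor m c) f g)"
    by (simp only: deriv_def[abs_def] mm_sum_left)
  also have "\<dots> = (\<Sum>p<m. tensor m (c(p := mm I b (c p))) f g)"
    unfolding mm_tensor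
    by (intro sum.cong refl tensor_cong[OF assms(2,3)]) (simp add: mm_idm_left assms)
  finally show ?thesis .
qed

text \<open>Factors at different positions commute and cancel, those at the same position give the
  commutator there: \<open>deriv m\<close> is a homomorphism of Lie algebras.\<close>

lemma deriv_commutator:
  fixes b c :: "'a \<Rightarrow> 'a \<Rightarrow> 'k :: comm_ring_1"
  assumes I: "finite I" "f \<in> words I m" "g \<in> words I m"
  shows "mm (words I m) (deriv m b) (deriv m c) f g - mm (words I m) (deriv m c) (deriv m b) f g
    = deriv m (\<lambda>x y. mm I b c x y - mm I c b x y) f g"
proof -
  \<comment> \<open>The Kronecker product with \<open>b\<close> at position \<open>p\<close> and
    \<open>c\<close> at position \<open>r\<close>; for \<open>p = r\<close> this position carries
    the product of \<open>b\<close> and \<open>c\<close> in this order.\<close>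
  define C where "C b c p r = tensor m (((\<lambda>_. idm)(r := c))(p := mm I b (((\<lambda>_. idm)(r := c)) p))) f g"
    for b c :: "'a \<Rightarrow> 'a \<Rightarrow> 'k" and p r
  have exp: "mm (words I m) (deriv m b) (deriv m c) f g = (\<Sum>r<m. \<Sum>p<m. C b c p r)" for b c
  proof -
    have "mm (words I m) (deriv m b) (deriv m c) f g
        = (\<Sum>r<m. mm (words I m) (deriv m b) (tensor m ((\<lambda>_. idm)(r := c))) f g)"
      by (subst (2) deriv_def[abs_def]) (simp only: mm_sum_right)
    then show ?thesis by (simp add: mm_deriv_tensor[OF I] C_def)
  qed
  have C_diag: "C b c p p = tensor m ((\<lambda>_. idm)(p := mm I b c)) f g" for b c p
    by (simp add: C_def)
  have C_off: "C b c p r = C c b r p" if "p \<noteq> r" for p r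
  proof -
    have "C b c p r = tensor m ((\<lambda>_. idm)(r := c, p := b)) f g"
      unfolding C_def using that by (intro tensor_cong[OF I(2,3)]) (auto simp: mm_idm_right I)
    moreover have "C c b r p = tensor m ((\<lambda>_. idm)(p := b, r := c)) f g"
      unfolding C_def using that by (intro tensor_cong[OF I(2,3)]) (auto simp: mm_idm_right I)
    ultimately show ?thesis using that by (simp add: fun_upd_twist)
  qed
  have "mm (words I m) (deriv m b) (deriv m c) f g - mm (words I m) (deriv m c) (deriv m b) f g
      = (\<Sum>r<m. \<Sum>p<m. C b c p r - C c b r p)"
    unfolding exp by (subst (2) sum.swap) (simp add: sum_subtractf)
  also have "\<dots> = (\<Sum>r<m. \<Sum>p<m. if r = p then C b c p p - C c b p p else 0)"
    by (intro sum.cong refl) (simp add: C_off)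
  also have "\<dots> = deriv m (mm I b c) f g - deriv m (mm I c b) f g"
    by (simp add: deriv_def C_diag sum_subtractf)
  finally show ?thesis by (simp only: deriv_linear)
qed

section \<open>Symmetric tensors\<close>

text \<open>Symmetrized Kronecker product, without division by \<open>fact m\<close>.\<close>

definition symm :: "nat \<Rightarrow> (nat \<Rightarrow> 'a \<Rightarrow> 'a \<Rightarrow> 'k :: comm_semiring_1) \<Rightarrow> 'a list \<Rightarrow> 'a list \<Rightarrow> 'k" where
  "symm m c f g = (\<Sum>\<pi> | \<pi> permutes {..<m}. tensor m (c \<circ> \<pi>) f g)"

lemma symm_permute: "\<sigma> permutes {..<m} \<Longrightarrow> symm m (c \<circ> \<sigma>) f g = symm m c f g"
  unfolding symm_def comp_assoc
  by (rule sum.reindex_bij_betw[where h = "\<lambda>\<pi>. \<sigma> \<circ> \<pi>", of _ _ "\<lambda>\<pi>. tensor m (c \<circ> \<pi>) f g"])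
     (rule bij_betw_byWitness[where f' = "\<lambda>\<pi>. inv_into UNIV \<sigma> \<circ> \<pi>"],
      auto simp: fun_eq_iff permutes_inverses intro!: permutes_compose permutes_inv)

lemma symm_cong:
  assumes "f \<in> words I m" "g \<in> words I m"
    and "\<And>p x y. p < m \<Longrightarrow> x \<in> I \<Longrightarrow> y \<in> I \<Longrightarrow> c p x y = d p x y"
  shows "symm m c f g = symm m d f g"
  unfolding symm_def using assms
  by (intro sum.cong refl tensor_cong[OF assms(1,2)]) (auto dest: permutes_in_image)

text \<open>Leibniz rule, after replacing the position at which \<open>b\<close> acts by the number
  of the factor that the permutation puts there.\<close>

lemma mm_deriv_symm:
  assumes I: "finite I" "f \<in> words I m" "g \<in> words I m"
  shows "mm (words I m) (deriv m b) (symm m c) f g = (\<Sum>r<m. symm m (c(r := mm I b (c r))) f g)"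
proof -
  have "mm (words I m) (deriv m b) (symm m c) f g
      = (\<Sum>\<pi> | \<pi> permutes {..<m}. \<Sum>p<m. tensor m ((c \<circ> \<pi>)(p := mm I b (c (\<pi> p)))) f g)"
    by (simp add: symm_def[abs_def] mm_sum_right mm_deriv_tensor[OF I])
  also have "\<dots> = (\<Sum>\<pi> | \<pi> permutes {..<m}. \<Sum>r<m. tensor m ((c(r := mm I b (c r))) \<circ> \<pi>) f g)"
  proof (rule sum.cong[OF refl])
    fix \<pi> assume "\<pi> \<in> {\<pi>. \<pi> permutes {..<m}}"
    then have \<pi>: "\<pi> permutes {..<m}" by simp
    have "(c \<circ> \<pi>)(p := mm I b (c (\<pi> p))) = (c(\<pi> p := mm I b (c (\<pi> p)))) \<circ> \<pi>" for p
      using permutes_inj[OF \<pi>] by (auto simp: fun_eq_iff inj_eq)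
    then show "(\<Sum>p<m. tensor m ((c \<circ> \<pi>)(p := mm I b (c (\<pi> p)))) f g)
        = (\<Sum>r<m. tensor m ((c(r := mm I b (c r))) \<circ> \<pi>) f g)"
      using sum.reindex_bij_betw[OF permutes_imp_bij[OF \<pi>], of "\<lambda>r. tensor m ((c(r := mm I b (c r))) \<circ> \<pi>) f g"]
      by simp
  qed
  finally show ?thesis
    unfolding symm_def by (subst sum.swap) simp
qed

text \<open>Polarization, by induction on the number of factors different from the identity. When
  one such factor \<open>b\<close> is replaced by the identity, multiplication by
  \<open>deriv m b\<close> puts \<open>b\<close> into each position in turn: positions carrying the
  identity all give the wanted product, and the other positions give products with fewer nontrivial
  factors.\<close>

lemma symm_in_algebra:
  fixes \<B> :: "('a \<Rightarrow> 'a \<Rightarrow> 'k :: field_char_0) set"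
  assumes I: "finite I" and A: "matrix_algebra (words I m) \<A>"
    and \<B>: "idm \<in> \<B>" "\<And>b c. b \<in> \<B> \<Longrightarrow> c \<in> \<B> \<Longrightarrow> mm I b c \<in> \<B>" "\<And>b. b \<in> \<B> \<Longrightarrow> deriv m b \<in> \<A>"
  shows "(\<And>p. p < m \<Longrightarrow> c p \<in> \<B>) \<Longrightarrow> symm m c \<in> \<A>"
proof (induct "card {p. p < m \<and> c p \<noteq> idm}" arbitrary: c rule: less_induct)
  case less
  interpret matrix_algebra "words I m" \<A> by (rule A)
  define N where "N c = {p. p < m \<and> c p \<noteq> idm}" for c :: "nat \<Rightarrow> 'a \<Rightarrow> 'a \<Rightarrow> 'k"
  have finN: "finite (N c)" for c by (simp add: N_def)
  show ?case
  proof (cases "N c = {}")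
    case True
    have "symm m c f g = fact m * idm f g" if fg: "f \<in> words I m" "g \<in> words I m" for f g
    proof -
      have "symm m c f g = symm m (\<lambda>_. idm) f g"
        using True by (intro symm_cong[OF fg]) (auto simp: N_def)
      also have "\<dots> = fact m * idm f g"
        using fg by (simp add: symm_def comp_def tensor_idm words_length card_permutations)
      finally show ?thesis .
    qed
    then show ?thesis
      using scale[OF one, of "fact m"] by (auto intro: cong)
  next
    case False
    then obtain p where p: "p < m" "c p \<noteq> idm" by (auto simp: N_def)
    \<comment> \<open>The factor \<open>b\<close> is taken out of position \<open>p\<close>;
      \<open>deriv m b\<close> will put it back.\<close>
    define b c' where "b = c p" and "c' = c(p := idm)"
    have b: "b \<in> \<B>" using less(2) p by (simp add: b_def)
    have c': "c' r \<in> \<B>" if "r < m" for r using less(2) \<B>(1) that by (simp add: c'_def)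
    have Nc': "N c = insert p (N c')" "p \<notin> N c'" using p by (auto simp: N_def c'_def)
    then have card: "card (N c) = Suc (card (N c'))" using finN by simp
    have "symm m c' \<in> \<A>"
      using card c' by (intro less(1)) (simp_all add: N_def)
    then have prod: "mm (words I m) (deriv m b) (symm m c') \<in> \<A>"
      using \<B>(3)[OF b] by (rule mult[rotated])
    have low: "(\<lambda>f g. \<Sum>r\<in>N c'. symm m (c'(r := mm I b (c' r))) f g) \<in> \<A>"
    proof (rule sum)
      fix r assume r: "r \<in> N c'"
      have "N (c'(r := mm I b (c' r))) \<subseteq> N c'" using r by (auto simp: N_def)
      then have "card (N (c'(r := mm I b (c' r)))) \<le> card (N c')" by (intro card_mono finN)
      then show "symm m (c'(r := mm I b (c' r))) \<in> \<A>"
        using card c' b \<B>(2) r by (intro less(1)) (auto simp: N_def)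
    qed
    \<comment> \<open>The number of positions at which \<open>c'\<close> carries the identity;
      \<open>p\<close> is one of them, so that division by \<open>n\<close> is possible.\<close>
    define n where "n = card ({..<m} - N c')"
    have "p \<in> {..<m} - N c'" using Nc' p by auto
    then have "n > 0" unfolding n_def by (metis card_gt_0_iff empty_iff finite_Diff finite_lessThan)
    have same: "symm m (c'(r := mm I b (c' r))) f g = symm m c f g"
      if r: "r \<in> {..<m} - N c'" and fg: "f \<in> words I m" "g \<in> words I m" for r f g
    proof -
      have "c' r = idm" using r by (auto simp: N_def)
      then have "symm m (c'(r := mm I b (c' r))) f g = symm m (c'(r := b)) f g"
        by (intro symm_cong[OF fg]) (simp add: mm_idm_right I)
      also have "c'(r := b) = c \<circ> transpose p r"
        using \<open>c' r = idm\<close> by (auto simp: fun_eq_iff c'_def b_def transpose_def split: if_splits)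
      also have "symm m (c \<circ> transpose p r) f g = symm m c f g"
        using p r by (intro symm_permute permutes_swap_id) auto
      finally show ?thesis .
    qed
    have eq: "mm (words I m) (deriv m b) (symm m c') f g
        - (\<Sum>r\<in>N c'. symm m (c'(r := mm I b (c' r))) f g) = of_nat n * symm m c f g"
      if fg: "f \<in> words I m" "g \<in> words I m" for f g
    proof -
      have "N c' \<subseteq> {..<m}" by (auto simp: N_def)
      then have "mm (words I m) (deriv m b) (symm m c') f g
        = (\<Sum>r\<in>{..<m} - N c'. symm m (c'(r := mm I b (c' r))) f g)
          + (\<Sum>r\<in>N c'. symm m (c'(r := mm I b (c' r))) f g)"
        by (simp add: mm_deriv_symm[OF I fg] sum.subset_diff)
      also have "(\<Sum>r\<in>{..<m} - N c'. symm m (c'(r := mm I b (c' r))) f g) = of_nat n * symm m c f g"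
        using same[OF _ fg] by (simp add: n_def)
      finally show ?thesis by (simp only: add_diff_cancel_right')
    qed
    have "(\<lambda>f g. inverse (of_nat n) * (mm (words I m) (deriv m b) (symm m c') f g
        - (\<Sum>r\<in>N c'. symm m (c'(r := mm I b (c' r))) f g))) \<in> \<A>"
      by (rule scale[OF diff[OF prod low]])
    then show ?thesis
      by (rule cong) (use \<open>n > 0\<close> in \<open>simp add: eq\<close>)
  qed
qed

text \<open>Every rearrangement is a product of adjacent transpositions, none of which leaves the
  alphabet \<open>Z\<close>.\<close>

lemma mset_invariant:
  fixes F :: "'a list \<Rightarrow> 'b"
  assumes swap: "\<And>us a b vs. set (us @ a # b # vs) \<subseteq> Z \<Longrightarrow> F (us @ a # b # vs) = F (us @ b # a # vs)"
    and "mset xs = mset ys" "set xs \<subseteq> Z"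
  shows "F xs = F ys"
proof -
  have move: "F (us @ a # xs @ vs) = F (us @ xs @ a # vs)" if "set (us @ a # xs @ vs) \<subseteq> Z" for us a xs vs
    using that
  proof (induct xs arbitrary: us)
    case (Cons x xs)
    then have "F (us @ a # x # xs @ vs) = F ((us @ [x]) @ a # xs @ vs)"
      using swap[of us a x "xs @ vs"] by simp
    also have "\<dots> = F ((us @ [x]) @ xs @ a # vs)"
      using Cons by (intro Cons) auto
    finally show ?case by simp
  qed simp
  have "F (us @ xs) = F (us @ ys)" if "mset xs = mset ys" "set (us @ xs) \<subseteq> Z" for us
    using that
  proof (induct xs arbitrary: us ys)
    case (Cons x xs)
    then have "x \<in> set ys" by (metis list.set_intros(1) mset_eq_setD)
    then obtain y1 y2 where ys: "ys = y1 @ x # y2" by (meson split_list)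
    have m: "mset xs = mset (y1 @ y2)" using Cons ys by simp
    have "F (us @ x # xs) = F ((us @ [x]) @ xs)" by simp
    also have "\<dots> = F ((us @ [x]) @ (y1 @ y2))"
      using Cons(3) m by (intro Cons) auto
    also have "\<dots> = F (us @ x # y1 @ y2)" by simp
    also have "\<dots> = F (us @ y1 @ x # y2)"
      using mset_eq_setD[OF m] Cons(3) by (intro move) auto
    finally show ?case using ys by simp
  qed simp
  from this[of "[]"] assms show ?thesis by simp
qed

text \<open>The matrix units of the fixed subalgebra of the flip \<open>a \<mapsto> - a\<close>.\<close>

definition Bmat :: "rat \<Rightarrow> rat \<Rightarrow> rat \<Rightarrow> rat \<Rightarrow> rat" where
  "Bmat a b x y = of_bool (x = a \<and> y = b) + of_bool (x = - a \<and> y = - b)"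

lemma Bmat_minus: "Bmat (- a) (- b) = Bmat a b"
  by (auto simp: Bmat_def fun_eq_iff)

lemma Bmat_sym: "Bmat a b (- x) (- y) = Bmat a b x y"
  by (auto simp: Bmat_def minus_equation_iff[of x] minus_equation_iff[of y])

text \<open>Each \<open>Bmat\<close> is a matrix unit plus its flip, so that a product can match
  indices in two ways; for \<open>b = c = 0\<close> both matches occur.\<close>

lemma mm_Bmat:
  assumes "finite I" "b \<in> I" "- b \<in> I"
  shows "mm I (Bmat a b) (Bmat c d) x y = of_bool (b = c) * Bmat a d x y + of_bool (b = - c) * Bmat a (- d) x y"
proof -
  have "mm I (Bmat a b) (Bmat c d) x y
      = (\<Sum>h\<in>I. of_bool (h = b) * of_bool (x = a) * Bmat c d h y + of_bool (h = - b) * of_bool (x = - a) * Bmat c d h y)"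
    unfolding mm_def by (intro sum.cong refl) (auto simp: Bmat_def)
  also have "\<dots> = of_bool (x = a) * Bmat c d b y + of_bool (x = - a) * Bmat c d (- b) y"
    using assms by (simp add: sum.distrib of_bool_def if_distrib[of "\<lambda>z. z * _"] cong: if_cong)
  finally show ?thesis
    by (auto simp: Bmat_def of_bool_def minus_equation_iff[of b])
qed

lemma sum_double_delta:
  assumes "finite I" "x \<in> I" "y \<in> I"
  shows "(\<Sum>u\<in>I. \<Sum>v\<in>I. if x = u then if y = v then F u v else 0 else 0) = (F x y :: rat)"
proof -
  have "(\<Sum>v\<in>I. if x = u then if y = v then F u v else 0 else 0) = (if x = u then F u y else 0)" for u
    using assms by simp
  then show ?thesis using assms by simp
qed

section \<open>Matrices invariant under the hyperoctahedral group\<close>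

locale flip_index =
  fixes I :: "rat set" and m :: nat
  assumes finI: "finite I" and symI: "a \<in> I \<Longrightarrow> - a \<in> I"
begin

text \<open>Invariance under the generators of the hyperoctahedral group acting on row and column
  words simultaneously, that is, commutation with their permutation matrices.\<close>

definition W_invariant :: "(rat list \<Rightarrow> rat list \<Rightarrow> rat) \<Rightarrow> bool" where
  "W_invariant M \<longleftrightarrow>
     (\<forall>us us' a b a' b' vs vs'. us @ a # b # vs \<in> words I m \<longrightarrow> us' @ a' # b' # vs' \<in> words I m \<longrightarrow> length us = length us' \<longrightarrow>
        M (us @ b # a # vs) (us' @ b' # a' # vs') = M (us @ a # b # vs) (us' @ a' # b' # vs')) \<and>
     (\<forall>a a' vs vs'. a # vs \<in> words I m \<longrightarrow> a' # vs' \<in> words I m \<longrightarrow>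
        M (- a # vs) (- a' # vs') = M (a # vs) (a' # vs'))"

text \<open>The two words are read as one list of pairs of letters, on which the group acts by
  permuting pairs and negating both entries of a pair. The relation between the words says that the
  lists lie in one orbit.\<close>

lemma W_invariantD:
  assumes M: "W_invariant M" and f: "f \<in> words I m" "g \<in> words I m" "f' \<in> words I m" "g' \<in> words I m"
    and \<pi>: "\<pi> permutes {..<m}"
    and rel: "\<And>p. p < m \<Longrightarrow> (f' ! \<pi> p = f ! p \<and> g' ! \<pi> p = g ! p) \<or> (f' ! \<pi> p = - f ! p \<and> g' ! \<pi> p = - g ! p)"
  shows "M f' g' = M f g"
proof -
  \<comment> \<open>The value 0 at other lengths makes the invariance under swaps hold for all lists
    of pairs over \<open>I\<close>, as \<open>mset_invariant\<close> demands.\<close>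
  define F where "F zs = (if length zs = m then M (map fst zs) (map snd zs) else 0)" for zs
  have sw: "M (us @ b # a # vs) (us' @ b' # a' # vs') = M (us @ a # b # vs) (us' @ a' # b' # vs')"
    if "us @ a # b # vs \<in> words I m" "us' @ a' # b' # vs' \<in> words I m" "length us = length us'"
    for us us' a b a' b' vs vs'
    using M that unfolding W_invariant_def by blast
  have F_swap: "F (us @ z # z' # vs) = F (us @ z' # z # vs)" if "set (us @ z # z' # vs) \<subseteq> I \<times> I" for us z z' vs
  proof (cases "length (us @ z # z' # vs) = m")
    case True
    have "map fst us @ fst z # fst z' # map fst vs \<in> words I m"
      "map snd us @ snd z # snd z' # map snd vs \<in> words I m"
      using that True by (auto simp: words_def)
    from sw[OF this] show ?thesis
      using True by (simp add: F_def)
  qed (simp add: F_def)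
  have F_mset: "F xs = F ys" if "mset xs = mset ys" "set xs \<subseteq> I \<times> I" for xs ys
    using F_swap that by (rule mset_invariant)
  define neg where "neg z = (- fst z, - snd z)" for z :: "rat \<times> rat"
  have neg_I: "neg z \<in> I \<times> I" if "z \<in> I \<times> I" for z
    using that symI by (cases z) (simp add: neg_def)
  have F_neg0: "F (neg z # vs) = F (z # vs)" if "set (z # vs) \<subseteq> I \<times> I" for z vs
  proof (cases "length (z # vs) = m")
    case True
    have "fst z # map fst vs \<in> words I m" "snd z # map snd vs \<in> words I m"
      using that True by (auto simp: words_def)
    then show ?thesis
      using M True unfolding W_invariant_def F_def by (simp add: neg_def)
  qed (simp add: F_def)
  \<comment> \<open>The pair is moved to the front, where the second invariance negates it, and then
    back.\<close>
  have F_neg: "F (us @ neg z # vs) = F (us @ z # vs)" if "set (us @ z # vs) \<subseteq> I \<times> I" for us z vs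
  proof -
    have "F (us @ neg z # vs) = F (neg z # us @ vs)"
      using that neg_I[of z] by (intro F_mset) simp_all
    also have "\<dots> = F (z # us @ vs)" using that by (intro F_neg0) auto
    also have "\<dots> = F (us @ z # vs)"
      using that by (intro F_mset) simp_all
    finally show ?thesis .
  qed
  have F_negs: "F (us @ zs') = F (us @ zs)"
    if "list_all2 (\<lambda>z' z. z' = z \<or> z' = neg z) zs' zs" "set (us @ zs) \<subseteq> I \<times> I" for us zs zs'
    using that
  proof (induct arbitrary: us rule: list_all2_induct)
    case (Cons z' zs' z zs)
    have z': "z' \<in> I \<times> I" using Cons neg_I by auto
    have "F ((us @ [z']) @ zs') = F ((us @ [z']) @ zs)" using Cons(3)[of "us @ [z']"] Cons(4) z' by simp
    also have "\<dots> = F (us @ z # zs)" using Cons(1,4) F_neg by auto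
    finally show ?case by simp
  qed simp
  define zs zs' where "zs = zip f g" and "zs' = zip f' g'"
  have len: "length f = m" "length g = m" "length f' = m" "length g' = m"
    using f by (auto simp: words_def)
  have sub: "set zs \<subseteq> I \<times> I" "set zs' \<subseteq> I \<times> I"
    using f by (auto simp: zs_def zs'_def words_def dest: set_zip_leftD set_zip_rightD)
  have lz: "length zs' = m" "length zs = m" using len by (simp_all add: zs_def zs'_def)
  have \<pi>': "\<pi> permutes {..<length zs'}" using \<pi> lz by simp
  have "M f' g' = F zs'" using len by (simp add: F_def zs'_def)
  also have "\<dots> = F (permute_list \<pi> zs')"
    using sub mset_permute_list[OF \<pi>'] by (intro F_mset) simp_all
  also have "\<dots> = F ([] @ zs)"
  proof -
    have "list_all2 (\<lambda>z' z. z' = z \<or> z' = neg z) (permute_list \<pi> zs') zs"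
    proof (rule list_all2_all_nthI)
      fix p assume "p < length (permute_list \<pi> zs')"
      then have p: "p < m" using lz by simp
      then have "\<pi> p < m" using permutes_in_image[OF \<pi>, of p] by simp
      then show "permute_list \<pi> zs' ! p = zs ! p \<or> permute_list \<pi> zs' ! p = neg (zs ! p)"
        using rel[OF p] p len by (simp add: permute_list_nth[OF \<pi>'] lz) (simp add: zs_def zs'_def neg_def)
    qed (simp add: lz)
    from F_negs[OF this, of "[]"] sub show ?thesis by simp
  qed
  also have "\<dots> = M f g" using len by (simp add: F_def zs_def)
  finally show ?thesis .
qed

text \<open>A term vanishes unless \<open>(f', g')\<close> lies in the orbit of
  \<open>(f, g)\<close>, where \<open>M\<close> takes the same value. Each of the
  \<open>fact m\<close> permutations contributes \<open>2 ^ m\<close>; together this is the order of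
  the group.\<close>

lemma W_invariant_eq_sum:
  assumes M: "W_invariant M" and f: "f \<in> words I m" "g \<in> words I m"
  shows "(\<Sum>f'\<in>words I m. \<Sum>g'\<in>words I m. M f' g' * symm m (\<lambda>p. Bmat (f' ! p) (g' ! p)) f g)
    = fact m * 2 ^ m * M f g"
proof -
  let ?X = "words I m"
  have M_eq: "M f' g' * tensor m ((\<lambda>p. Bmat (f' ! p) (g' ! p)) \<circ> \<pi>) f g
      = M f g * tensor m ((\<lambda>p. Bmat (f' ! p) (g' ! p)) \<circ> \<pi>) f g"
    if f': "f' \<in> ?X" "g' \<in> ?X" and \<pi>: "\<pi> permutes {..<m}" for f' g' \<pi>
  proof (cases "tensor m ((\<lambda>p. Bmat (f' ! p) (g' ! p)) \<circ> \<pi>) f g = 0")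
    case False
    have "M f' g' = M f g"
    proof (rule W_invariantD[OF M f f' \<pi>])
      fix p assume "p < m"
      then have "Bmat (f' ! \<pi> p) (g' ! \<pi> p) (f ! p) (g ! p) \<noteq> 0"
        using False by (auto simp: tensor_def)
      then show "(f' ! \<pi> p = f ! p \<and> g' ! \<pi> p = g ! p) \<or> (f' ! \<pi> p = - f ! p \<and> g' ! \<pi> p = - g ! p)"
        by (auto simp: Bmat_def of_bool_def split: if_splits)
    qed
    then show ?thesis by simp
  qed simp
  have count: "(\<Sum>f'\<in>?X. \<Sum>g'\<in>?X. tensor m ((\<lambda>p. Bmat (f' ! p) (g' ! p)) \<circ> \<pi>) f g) = 2 ^ m"
    if \<pi>: "\<pi> permutes {..<m}" for \<pi>
  proof -
    define \<rho> where "\<rho> = inv_into UNIV \<pi>"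
    have \<rho>: "\<rho> permutes {..<m}" unfolding \<rho>_def by (rule permutes_inv[OF \<pi>])
    have "tensor m ((\<lambda>p. Bmat (f' ! p) (g' ! p)) \<circ> \<pi>) f g
        = (\<Prod>p<m. Bmat (f' ! p) (g' ! p) (f ! \<rho> p) (g ! \<rho> p))" for f' g'
      unfolding tensor_def
      by (subst prod.reindex_bij_betw[OF permutes_imp_bij[OF \<rho>], symmetric])
         (simp add: \<rho>_def permutes_inverses[OF \<pi>])
    then have "(\<Sum>f'\<in>?X. \<Sum>g'\<in>?X. tensor m ((\<lambda>p. Bmat (f' ! p) (g' ! p)) \<circ> \<pi>) f g)
        = (\<Prod>p<m. \<Sum>a\<in>I. \<Sum>b\<in>I. Bmat a b (f ! \<rho> p) (g ! \<rho> p))"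
      by (simp add: sum_words_prod[of "\<lambda>p b. Bmat (f' ! p) b (f ! \<rho> p) (g ! \<rho> p)" for f']
          sum_words_prod[of "\<lambda>p a. \<Sum>b\<in>I. Bmat a b (f ! \<rho> p) (g ! \<rho> p)"])
    \<comment> \<open>The factor is 2 also when both letters are 0: then only one pair
      \<open>(a, b)\<close> counts, but \<open>Bmat 0 0\<close> has the value 2 there.\<close>
    also have "\<dots> = (\<Prod>p<m. 2)"
    proof (rule prod.cong[OF refl])
      fix p assume "p \<in> {..<m}"
      then have "\<rho> p < m" using permutes_in_image[OF \<rho>, of p] by simp
      then have I: "f ! \<rho> p \<in> I" "g ! \<rho> p \<in> I" using f by (auto intro: words_nth)
      define x y where "x = f ! \<rho> p" and "y = g ! \<rho> p"
      have "(\<Sum>a\<in>I. \<Sum>b\<in>I. Bmat a b x y)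
          = (\<Sum>a\<in>I. \<Sum>b\<in>I. (if x = a then if y = b then 1 else 0 else 0)
                             + (if - x = a then if - y = b then 1 else 0 else 0))"
        by (intro sum.cong refl) (auto simp: Bmat_def)
      also have "\<dots> = 2"
        using I symI finI by (simp add: sum.distrib sum_double_delta x_def y_def)
      finally show "(\<Sum>a\<in>I. \<Sum>b\<in>I. Bmat a b (f ! \<rho> p) (g ! \<rho> p)) = 2" by (simp add: x_def y_def)
    qed
    finally show ?thesis by simp
  qed
  have "(\<Sum>f'\<in>?X. \<Sum>g'\<in>?X. M f' g' * symm m (\<lambda>p. Bmat (f' ! p) (g' ! p)) f g)
      = (\<Sum>f'\<in>?X. \<Sum>g'\<in>?X. \<Sum>\<pi> | \<pi> permutes {..<m}.
           M f g * tensor m ((\<lambda>p. Bmat (f' ! p) (g' ! p)) \<circ> \<pi>) f g)"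
    unfolding symm_def sum_distrib_left by (intro sum.cong refl M_eq) auto
  also have "\<dots> = (\<Sum>\<pi> | \<pi> permutes {..<m}. \<Sum>f'\<in>?X. \<Sum>g'\<in>?X.
           M f g * tensor m ((\<lambda>p. Bmat (f' ! p) (g' ! p)) \<circ> \<pi>) f g)"
    by (simp only: sum.swap[of _ "{\<pi>. \<pi> permutes {..<m}}" ?X])
  also have "\<dots> = (\<Sum>\<pi> | \<pi> permutes {..<m}. M f g * 2 ^ m)"
    by (intro sum.cong refl) (simp add: count flip: sum_distrib_left)
  also have "\<dots> = fact m * 2 ^ m * M f g"
    by (simp add: card_permutations)
  finally show ?thesis .
qed

lemma W_invariant_in_algebra:
  assumes A: "matrix_algebra (words I m) \<A>"
    and B: "\<And>a b. a \<in> I \<Longrightarrow> b \<in> I \<Longrightarrow> deriv m (Bmat a b) \<in> \<A>"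
    and M: "W_invariant M"
  shows "M \<in> \<A>"
proof -
  interpret matrix_algebra "words I m" \<A> by (rule A)
  \<comment> \<open>The algebra of matrices on \<open>I\<close> that commute with the flip. It is
    spanned by the \<open>Bmat u v\<close>; the factor 1/2 below makes up for the coincidence of
    \<open>Bmat u v\<close> with \<open>Bmat (- u) (- v)\<close>.\<close>
  define \<B> where "\<B> = {b. \<forall>x\<in>I. \<forall>y\<in>I. b (- x) (- y) = b x (y :: rat) \<and> (b x y :: rat) = b x y}"
  have deriv: "deriv m b \<in> \<A>" if b: "b \<in> \<B>" for b
  proof -
    have b_exp: "b x y = (\<Sum>u\<in>I. \<Sum>v\<in>I. b u v / 2 * Bmat u v x y)" if xy: "x \<in> I" "y \<in> I" for x y
    proof -
      have "(\<Sum>u\<in>I. \<Sum>v\<in>I. b u v / 2 * Bmat u v x y)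
          = (\<Sum>u\<in>I. \<Sum>v\<in>I. (if x = u then if y = v then b u v / 2 else 0 else 0)
                             + (if - x = u then if - y = v then b u v / 2 else 0 else 0))"
        by (intro sum.cong refl) (auto simp: Bmat_def)
      also have "\<dots> = b x y / 2 + b (- x) (- y) / 2"
        using xy symI finI by (simp only: sum.distrib sum_double_delta)
      finally show ?thesis using b xy by (simp add: \<B>_def)
    qed
    have lin: "deriv m (\<lambda>x y. \<Sum>u\<in>S. F u x y) f g = (\<Sum>u\<in>S. deriv m (F u) f g)"
      for S :: "rat set" and F :: "rat \<Rightarrow> rat \<Rightarrow> rat \<Rightarrow> rat" and f g
    proof (induct S rule: infinite_finite_induct)
      case (insert x S)
      then show ?case by (simp add: deriv_linear)
    qed (use deriv_linear(3)[of m 0] in simp_all)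
    have "(\<lambda>f g. \<Sum>u\<in>I. \<Sum>v\<in>I. b u v / 2 * deriv m (Bmat u v) f g) \<in> \<A>"
      by (intro sum scale B)
    then show ?thesis
    proof (rule cong)
      fix f g assume fg: "f \<in> words I m" "g \<in> words I m"
      have "deriv m b f g = deriv m (\<lambda>x y. \<Sum>u\<in>I. \<Sum>v\<in>I. b u v / 2 * Bmat u v x y) f g"
        using b_exp by (intro deriv_cong[OF fg])
      then show "(\<Sum>u\<in>I. \<Sum>v\<in>I. b u v / 2 * deriv m (Bmat u v) f g) = deriv m b f g"
        by (simp only: lin deriv_linear(3))
    qed
  qed
  have "symm m (\<lambda>p. Bmat (f' ! p) (g' ! p)) \<in> \<A>" for f' g'
  proof (rule symm_in_algebra[OF finI A, of \<B>])
    show "idm \<in> \<B>" by (simp add: \<B>_def idm_def)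
    show "mm I b c \<in> \<B>" if "b \<in> \<B>" "c \<in> \<B>" for b c
    proof -
      have "mm I b c (- x) (- y) = mm I b c x y" if "x \<in> I" "y \<in> I" for x y
      proof -
        have neg: "b (- x) (- y) = b x y" "c (- x) (- y) = c x y" if "x \<in> I" "y \<in> I" for x y
          using \<open>b \<in> \<B>\<close> \<open>c \<in> \<B>\<close> that by (auto simp: \<B>_def)
        have "(\<Sum>h\<in>I. b (- x) h * c h (- y)) = (\<Sum>h\<in>I. b (- x) (- h) * c (- h) (- y))"
          by (rule sum.reindex_bij_witness[of _ uminus uminus]) (simp_all add: symI)
        also have "\<dots> = (\<Sum>h\<in>I. b x h * c h y)"
          using that by (intro sum.cong refl) (simp add: neg)
        finally show ?thesis by (simp add: mm_def)
      qed
      then show ?thesis by (simp add: \<B>_def)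
    qed
    show "deriv m b \<in> \<A>" if "b \<in> \<B>" for b using that by (rule deriv)
  qed (simp add: \<B>_def Bmat_sym)
  moreover define N :: rat where "N = fact m * 2 ^ m"
  moreover have N: "N \<noteq> 0" by (simp add: N_def)
  ultimately have "(\<lambda>f g. inverse N * (\<Sum>f'\<in>words I m. \<Sum>g'\<in>words I m.
      M f' g' * symm m (\<lambda>p. Bmat (f' ! p) (g' ! p)) f g)) \<in> \<A>"
    by (intro scale sum)
  then show ?thesis
    by (rule cong) (simp add: W_invariant_eq_sum[OF M, folded N_def] N)
qed

end

text \<open>The Lie algebra generated by the specializations of the generators of the coideal subalgebra
  contains all \<open>Bmat a b\<close>.\<close>

locale coideal_algebra = matrix_algebra "words I m" \<A>
  for I m and \<A> :: "(rat list \<Rightarrow> rat list \<Rightarrow> rat) set" +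
  fixes n :: nat
  assumes I_def: "I = (\<lambda>k. of_nat k - of_nat n / 2) ` {..n}" and n: "n \<ge> 1"
    and E: "a \<ge> 0 \<Longrightarrow> a \<in> I \<Longrightarrow> a + 1 \<in> I \<Longrightarrow> deriv m (Bmat a (a + 1)) \<in> \<A>"
    and F: "a \<ge> 0 \<Longrightarrow> a \<in> I \<Longrightarrow> a + 1 \<in> I \<Longrightarrow> deriv m (Bmat (a + 1) a) \<in> \<A>"
    and H: "a \<ge> 0 \<Longrightarrow> a \<in> I \<Longrightarrow> a + 1 \<in> I \<Longrightarrow>
      deriv m (\<lambda>x y. Bmat a a x y - Bmat (a + 1) (a + 1) x y) \<in> \<A>"
    and T: "odd n \<Longrightarrow> deriv m (Bmat (- 1/2) (1/2)) \<in> \<A>"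
begin

lemma finI: "finite I"
  by (simp add: I_def)

lemma symI: "a \<in> I \<Longrightarrow> - a \<in> I"
proof -
  assume "a \<in> I"
  then obtain k where "k \<le> n" "a = of_nat k - of_nat n / 2" by (auto simp: I_def)
  then show ?thesis
    by (auto simp: I_def of_nat_diff intro!: image_eqI[of _ _ "n - k"])
qed

sublocale flip_index I m
  by unfold_locales (rule finI, rule symI)

lemma I_convex: "a \<in> I \<Longrightarrow> a + of_nat k \<in> I \<Longrightarrow> j \<le> k \<Longrightarrow> a + of_nat j \<in> I"
proof -
  assume "a \<in> I" "a + of_nat k \<in> I" "j \<le> k"
  then obtain i i' where i: "a = of_nat i - of_nat n / 2" "i' \<le> n" "a + of_nat k = of_nat i' - of_nat n / 2"
    by (auto simp: I_def)
  then have "(of_nat (i + k) :: rat) = of_nat i'" by simp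
  then have "i + k = i'" by (simp only: of_nat_eq_iff)
  then show ?thesis
    using i \<open>j \<le> k\<close> by (auto simp: I_def intro!: image_eqI[of _ _ "i + j"])
qed

lemma I_diff: "a \<in> I \<Longrightarrow> b \<in> I \<Longrightarrow> a < b \<Longrightarrow> \<exists>k. b = a + of_nat (Suc k)"
proof -
  assume "a \<in> I" "b \<in> I" "a < b"
  then obtain i j where "a = of_nat i - of_nat n / 2" "b = of_nat j - of_nat n / 2" by (auto simp: I_def)
  with \<open>a < b\<close> have "i < j" "b = a + of_nat (j - i)" by (auto simp: of_nat_diff)
  then show ?thesis by (metis Suc_diff_Suc)
qed

text \<open>By \<open>L_commutator\<close> a Lie algebra of matrices on \<open>I\<close>, in which
  brackets replace computations on tensor powers.\<close>

definition L :: "(rat \<Rightarrow> rat \<Rightarrow> rat) set" where "L = {b. deriv m b \<in> \<A>}"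

lemma L_cong: "b \<in> L \<Longrightarrow> (\<And>x y. x \<in> I \<Longrightarrow> y \<in> I \<Longrightarrow> b x y = c x y) \<Longrightarrow> c \<in> L"
  unfolding L_def mem_Collect_eq by (erule cong) (rule deriv_cong)

lemma L_add: "b \<in> L \<Longrightarrow> c \<in> L \<Longrightarrow> (\<lambda>x y. b x y + c x y) \<in> L"
  using add by (simp add: L_def deriv_linear[abs_def])

lemma L_diff: "b \<in> L \<Longrightarrow> c \<in> L \<Longrightarrow> (\<lambda>x y. b x y - c x y) \<in> L"
  using diff by (simp add: L_def deriv_linear[abs_def])

lemma L_scale: "b \<in> L \<Longrightarrow> (\<lambda>x y. k * b x y) \<in> L"
  using scale by (simp add: L_def deriv_linear[abs_def])

lemma L_idm: "idm \<in> L"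
  unfolding L_def mem_Collect_eq
  by (rule cong[OF scale[OF one, of "of_nat m"]]) (simp add: deriv_idm words_length)

lemma L_sum: "(\<And>i. i \<in> S \<Longrightarrow> b i \<in> L) \<Longrightarrow> (\<lambda>x y. \<Sum>i\<in>S. b i x y) \<in> L"
proof (induct S rule: infinite_finite_induct)
  case (insert i S)
  then show ?case using L_add by simp
qed (use L_scale[OF L_idm, of 0] in simp_all)

lemma L_commutator: "b \<in> L \<Longrightarrow> c \<in> L \<Longrightarrow> (\<lambda>x y. mm I b c x y - mm I c b x y) \<in> L"
  unfolding L_def mem_Collect_eq
  by (rule cong[OF diff[OF mult mult]], assumption+) (rule deriv_commutator[OF finI])

lemma L_Bmat:
  assumes "Bmat a b \<in> L" "Bmat c d \<in> L" "a \<in> I" "b \<in> I" "c \<in> I" "d \<in> I"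
  shows "(\<lambda>x y. of_bool (b = c) * Bmat a d x y + of_bool (b = - c) * Bmat a (- d) x y
      - (of_bool (d = a) * Bmat c b x y + of_bool (d = - a) * Bmat c (- b) x y)) \<in> L"
  using L_commutator[OF assms(1,2)] assms symI by (simp add: mm_Bmat finI)

text \<open>Brackets of neighbouring units, as for upper triangular matrices. Since
  \<open>a \<ge> 0\<close>, the intermediate index \<open>b\<close> is positive and the flipped
  terms of \<open>L_Bmat\<close> drop out.\<close>

lemma L_up: "a \<ge> 0 \<Longrightarrow> a \<in> I \<Longrightarrow> a + of_nat (Suc k) \<in> I \<Longrightarrow> Bmat a (a + of_nat (Suc k)) \<in> L"
proof (induct k)
  case 0
  then show ?case using E[of a] by (simp add: L_def)
next
  case (Suc k)
  define b where "b = a + of_nat (Suc k)"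
  have b: "b \<in> I" "b > 0" "b + 1 \<in> I" "a < b"
    using Suc I_convex[of a "Suc (Suc k)" "Suc k"] by (auto simp: b_def add_ac)
  have "Bmat a b \<in> L" using Suc b by (simp add: b_def)
  moreover have "Bmat b (b + 1) \<in> L" using E[of b] b by (simp add: L_def)
  ultimately have "Bmat a (b + 1) \<in> L"
    using L_Bmat[of a b b "b + 1"] b Suc(2,3) by simp
  then show ?case by (simp add: b_def add_ac)
qed

lemma L_down: "a \<ge> 0 \<Longrightarrow> a \<in> I \<Longrightarrow> a + of_nat (Suc k) \<in> I \<Longrightarrow> Bmat (a + of_nat (Suc k)) a \<in> L"
proof (induct k)
  case 0
  then show ?case using F[of a] by (simp add: L_def)
next
  case (Suc k)
  define b where "b = a + of_nat (Suc k)"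
  have b: "b \<in> I" "b > 0" "b + 1 \<in> I" "a < b"
    using Suc I_convex[of a "Suc (Suc k)" "Suc k"] by (auto simp: b_def add_ac)
  have "Bmat b a \<in> L" using Suc b by (simp add: b_def)
  moreover have "Bmat (b + 1) b \<in> L" using F[of b] b by (simp add: L_def)
  ultimately have "Bmat (b + 1) a \<in> L"
    using L_Bmat[of "b + 1" b b a] b Suc(2,3) by simp
  then show ?case by (simp add: b_def add_ac)
qed

lemma L_diag_diff: "a \<ge> 0 \<Longrightarrow> a \<in> I \<Longrightarrow> a + of_nat k \<in> I \<Longrightarrow>
  (\<lambda>x y. Bmat a a x y - Bmat (a + of_nat k) (a + of_nat k) x y) \<in> L"
proof (induct k)
  case 0
  then show ?case using L_scale[OF L_idm, of 0] by simp
next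
  case (Suc k)
  define b where "b = a + of_nat k"
  have b: "b \<in> I" "b \<ge> 0" "b + 1 \<in> I"
    using Suc I_convex[of a "Suc k" k] by (auto simp: b_def add_ac)
  have "(\<lambda>x y. Bmat a a x y - Bmat b b x y) \<in> L" using Suc b by (simp add: b_def)
  moreover have "(\<lambda>x y. Bmat b b x y - Bmat (b + 1) (b + 1) x y) \<in> L" using H[of b] b by (simp add: L_def)
  ultimately have "(\<lambda>x y. Bmat a a x y - Bmat (b + 1) (b + 1) x y) \<in> L"
    using L_add by fastforce
  then show ?case by (simp add: b_def add_ac)
qed

lemma L_offdiag_pos: "0 \<le> a \<Longrightarrow> 0 \<le> b \<Longrightarrow> a \<noteq> b \<Longrightarrow> a \<in> I \<Longrightarrow> b \<in> I \<Longrightarrow> Bmat a b \<in> L"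
  using I_diff[of a b] I_diff[of b a] L_up[of a] L_down[of b] by (cases a b rule: linorder_cases) auto

lemma L_diag_diff': "0 \<le> a \<Longrightarrow> 0 \<le> b \<Longrightarrow> a \<in> I \<Longrightarrow> b \<in> I \<Longrightarrow>
  (\<lambda>x y. Bmat a a x y - Bmat b b x y) \<in> L"
proof (induct a b rule: linorder_wlog)
  case (le a b)
  show ?case
  proof (cases "a = b")
    case False
    with le obtain k where "b = a + of_nat (Suc k)" using I_diff[of a b] by auto
    then show ?thesis using L_diag_diff[of a "Suc k"] le by simp
  qed (use L_scale[OF L_idm, of 0] in simp)
next
  case (sym a b)
  then show ?case using L_scale[of "\<lambda>x y. Bmat b b x y - Bmat a a x y" "-1"] by simp
qed

text \<open>The sum of all \<open>Bmat b b\<close> is twice the identity, so that the differences of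
  diagonal elements and \<open>idm\<close> together determine each of them after division by
  \<open>card I\<close>.\<close>

lemma L_diag: "a \<in> I \<Longrightarrow> Bmat a a \<in> L"
proof -
  assume a: "a \<in> I"
  have abs: "Bmat b b = Bmat \<bar>b\<bar> \<bar>b\<bar>" "\<bar>b\<bar> \<in> I" if "b \<in> I" for b
    using that symI Bmat_minus[of b b] by (auto simp: abs_if)
  have "(\<lambda>x y. (\<Sum>b\<in>I. Bmat a a x y - Bmat b b x y) + 2 * idm x y) \<in> L"
  proof (intro L_add L_sum L_scale L_idm)
    fix b assume "b \<in> I"
    then show "(\<lambda>x y. Bmat a a x y - Bmat b b x y) \<in> L"
      using L_diag_diff'[of "\<bar>a\<bar>" "\<bar>b\<bar>"] abs[of a] abs[of b] a by simp
  qed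
  then have "(\<lambda>x y. inverse (of_nat (card I)) * ((\<Sum>b\<in>I. Bmat a a x y - Bmat b b x y) + 2 * idm x y)) \<in> L"
    by (rule L_scale)
  then show ?thesis
  proof (rule L_cong)
    fix x y assume "x \<in> I" "y \<in> I"
    have "(\<Sum>b\<in>I. Bmat b b x y)
        = (\<Sum>b\<in>I. (if x = b then of_bool (x = y) else 0) + (if - x = b then of_bool (x = y) else 0))"
      by (intro sum.cong refl) (auto simp: Bmat_def)
    also have "\<dots> = 2 * idm x y"
      using \<open>x \<in> I\<close> symI finI by (simp add: sum.distrib idm_def)
    finally have "(\<Sum>b\<in>I. Bmat a a x y - Bmat b b x y) + 2 * idm x y = of_nat (card I) * Bmat a a x y"
      by (simp add: sum_subtractf)
    moreover have "card I \<noteq> 0" using a finI by auto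
    ultimately show "inverse (of_nat (card I)) * ((\<Sum>b\<in>I. Bmat a a x y - Bmat b b x y) + 2 * idm x y) = Bmat a a x y"
      by simp
  qed
qed

text \<open>A bridge between positive and negative indices. For odd \<open>n\<close> it is the
  specialization of t. For even \<open>n\<close> it comes from the index 0, fixed by the flip: the
  bracket of \<open>Bmat 0 1\<close> and \<open>Bmat 1 0\<close> contains the extra term
  \<open>- Bmat 1 (-1)\<close>.\<close>

lemma L_negative: "\<exists>\<mu>\<in>I. \<mu> > 0 \<and> Bmat \<mu> (- \<mu>) \<in> L"
proof (cases "odd n")
  case True
  then obtain k where k: "n = 2 * k + 1" by (rule oddE)
  then have "(of_nat n :: rat) = 2 * of_nat k + 1" by simp
  then have "1/2 = of_nat (k + 1) - (of_nat n / 2 :: rat)" by (simp add: add_divide_distrib)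
  moreover have "k + 1 \<le> n" using k by simp
  ultimately have "1/2 \<in> I" unfolding I_def by (intro image_eqI[of _ _ "k + 1"]) (assumption, simp)
  moreover have "Bmat (1/2) (- (1/2)) \<in> L"
    using T[OF True] Bmat_minus[of "1/2" "- (1/2)"] by (simp add: L_def)
  ultimately show ?thesis by (intro bexI[of _ "1/2"]) simp_all
next
  case False
  then obtain k where k: "n = 2 * k" by (auto elim: evenE)
  then have 0: "0 = of_nat k - (of_nat n / 2 :: rat)" "k \<le> n"
    and 1: "1 = of_nat (k + 1) - (of_nat n / 2 :: rat)" "k + 1 \<le> n"
    using n by simp_all
  have "0 \<in> I" unfolding I_def using 0 by (intro image_eqI[of _ _ k]) (assumption, simp)
  moreover have "1 \<in> I" unfolding I_def using 1 by (intro image_eqI[of _ _ "k + 1"]) (assumption, simp)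
  ultimately have I: "0 \<in> I" "1 \<in> I" .
  have "Bmat 0 1 \<in> L" "Bmat 1 0 \<in> L" using E[of 0] F[of 0] I by (simp_all add: L_def)
  then have "(\<lambda>x y. Bmat 0 0 x y - (Bmat 1 1 x y + Bmat 1 (-1) x y)) \<in> L"
    using L_Bmat[of 0 1 1 0] I by simp
  then have "(\<lambda>x y. Bmat 0 0 x y - (Bmat 1 1 x y + Bmat 1 (-1) x y)
      - (Bmat 0 0 x y - Bmat 1 1 x y)) \<in> L"
    by (rule L_diff[OF _ L_diff[OF L_diag[OF I(1)] L_diag[OF I(2)]]])
  then have "(\<lambda>x y. (-1) * (Bmat 0 0 x y - (Bmat 1 1 x y + Bmat 1 (-1) x y)
      - (Bmat 0 0 x y - Bmat 1 1 x y))) \<in> L"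
    by (rule L_scale)
  then have "Bmat 1 (-1) \<in> L" by (simp add: algebra_simps)
  then show ?thesis using I by (intro bexI[of _ 1]) auto
qed

text \<open>Brackets of one bridge \<open>Bmat \<mu> (- \<mu>)\<close> with units of positive
  indices yield all units from positive to negative indices; the rest follows by simultaneous
  negation of both indices.\<close>

lemma L_all: assumes ab: "a \<in> I" "b \<in> I" shows "Bmat a b \<in> L"
proof -
  obtain \<mu> where \<mu>: "\<mu> \<in> I" "\<mu> > 0" "Bmat \<mu> (- \<mu>) \<in> L" using L_negative by blast
  have left: "Bmat a (- \<mu>) \<in> L" if a: "a > 0" "a \<in> I" for a
  proof (cases "a = \<mu>")
    case False
    then have "Bmat a \<mu> \<in> L" using a \<mu> L_offdiag_pos by simp
    from L_Bmat[OF this \<mu>(3)] show ?thesis using a \<mu> symI False by simp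
  qed (use \<mu> in simp)
  have right: "Bmat \<mu> (- b) \<in> L" if b: "b > 0" "b \<in> I" for b
  proof (cases "b = \<mu>")
    case False
    then have "Bmat \<mu> b \<in> L" using b \<mu> L_offdiag_pos by simp
    from L_Bmat[OF \<mu>(3) this] show ?thesis using b \<mu> symI False by simp
  qed (use \<mu> in simp)
  have mixed: "Bmat a (- b) \<in> L" if a: "a > 0" "a \<in> I" and b: "b > 0" "b \<in> I" for a b
  proof -
    consider "a = \<mu>" | "b = \<mu>" | "a \<noteq> \<mu>" "b \<noteq> \<mu>" by blast
    then show ?thesis
    proof cases
      case 3
      have "Bmat \<mu> b \<in> L" using 3 b \<mu> L_offdiag_pos by simp
      \<comment> \<open>For \<open>a = b\<close> the bracket also contains the bridge itself, which
        is added back.\<close>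
      from L_Bmat[OF left[OF a] this]
      have *: "(\<lambda>x y. Bmat a (- b) x y - of_bool (b = a) * Bmat \<mu> (- \<mu>) x y) \<in> L"
        using a b \<mu> symI 3 by simp
      have "(\<lambda>x y. (Bmat a (- b) x y - of_bool (b = a) * Bmat \<mu> (- \<mu>) x y)
          + of_bool (b = a) * Bmat \<mu> (- \<mu>) x y) \<in> L"
        by (rule L_add[OF * L_scale[OF \<mu>(3)]])
      then show ?thesis by simp
    qed (use left right a b in auto)
  qed
  have pos: "Bmat a b \<in> L" if "0 \<le> a" "0 \<le> b" "a \<in> I" "b \<in> I" for a b
    using L_diag L_offdiag_pos that by (cases "a = b") auto
  have half: "Bmat a b \<in> L" if "0 \<le> a" "a \<in> I" "b \<in> I" for a b
  proof (cases "0 \<le> b")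
    case False
    show ?thesis
    proof (cases "a = 0")
      case True
      then show ?thesis
        using pos[of a "- b"] Bmat_minus[of a b] False that symI by simp
    qed (use mixed[of a "- b"] False that symI in auto)
  qed (use pos that in auto)
  show ?thesis
  proof (cases "0 \<le> a")
    case False
    then show ?thesis using half[of "- a" "- b"] symI ab by (simp add: Bmat_minus)
  qed (use half ab in auto)
qed

theorem W_invariant_mem: "W_invariant M \<Longrightarrow> M \<in> \<A>"
  using W_invariant_in_algebra[OF matrix_algebra_axioms] L_all by (simp add: L_def)

end

section \<open>The natural module and its tensor powers\<close>

lemma tpow_words: "x \<in> tpow J m \<longleftrightarrow> letters ` keys x \<subseteq> words (wtI J) m"
  by (auto simp: tpow_def words_def)

lemma tpow_0 [simp]: "0 \<in> tpow J m"
  by (simp add: tpow_def)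

lemma tpow_add [simp]: "x \<in> tpow J m \<Longrightarrow> y \<in> tpow J m \<Longrightarrow> x + y \<in> tpow J m"
  using keys_add[of x y] by (auto simp: tpow_def)

lemma tpow_const_mult [simp]: "x \<in> tpow J m \<Longrightarrow> const c * x \<in> tpow J m"
  using keys_const_mult[of c x] by (auto simp: tpow_def)

lemma tpow_sum: "(\<And>i. i \<in> A \<Longrightarrow> f i \<in> tpow J m) \<Longrightarrow> sum f A \<in> tpow J m"
  by (induct A rule: infinite_finite_induct) simp_all

lemma tpow_monomial [simp]: "monomial f \<in> tpow J m \<longleftrightarrow> f \<in> words (wtI J) m"
  by (simp add: tpow_words)

lemma tpow_mult: "x \<in> tpow J m \<Longrightarrow> y \<in> tpow J n \<Longrightarrow> x * y \<in> tpow J (m + n)"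
  using keys_mult[of x y] by (fastforce simp: tpow_def plus_fword_def)

lemma tpow_var_mult [simp]: "v \<in> tpow J (Suc 0) \<Longrightarrow> y \<in> tpow J m \<Longrightarrow> v * y \<in> tpow J (Suc m)"
  using tpow_mult[of v J "Suc 0" y m] by simp

lemma lin_eq_tpow:
  assumes "lin \<phi>" "lin \<psi>" "x \<in> tpow J m" "\<And>f. f \<in> words (wtI J) m \<Longrightarrow> \<phi> (monomial f) = \<psi> (monomial f)"
  shows "\<phi> x = \<psi> x"
  by (rule lin_eqI[OF assms(1,2)]) (use assms(3,4) in \<open>auto simp: tpow_words\<close>)

lemma lin_tpow_closed:
  assumes "lin \<phi>" "x \<in> tpow J m" "\<And>f. f \<in> words (wtI J) m \<Longrightarrow> \<phi> (monomial f) \<in> tpow J n"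
  shows "\<phi> x \<in> tpow J n"
proof (subst lin_expand[OF assms(1)], intro tpow_sum tpow_const_mult assms(3))
  fix w assume "w \<in> keys x"
  then show "letters w \<in> words (wtI J) m" using assms(2) by (auto simp: tpow_words)
qed

lemma words_Suc_cases:
  assumes "f \<in> words I (Suc m)" obtains a g where "f = a # g" "a \<in> I" "g \<in> words I m"
  using assms by (auto simp: words_Suc)

text \<open>The product of the free algebra is the tensor product, so that identities may be checked
  on a vector times a shorter tensor, the form on which the coproduct acts.\<close>

lemma lin_eq_tpow_Suc:
  assumes "lin \<phi>" "lin \<psi>" "x \<in> tpow J (Suc m)"
    and "\<And>v y. v \<in> tpow J (Suc 0) \<Longrightarrow> y \<in> tpow J m \<Longrightarrow> \<phi> (v * y) = \<psi> (v * y)"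
  shows "\<phi> x = \<psi> x"
proof (rule lin_eq_tpow[OF assms(1-3)])
  fix f assume "f \<in> words (wtI J) (Suc m)"
  then obtain a g where "f = a # g" "a \<in> wtI J" "g \<in> words (wtI J) m" by (rule words_Suc_cases)
  then show "\<phi> (monomial f) = \<psi> (monomial f)"
    using assms(4)[of "var a" "monomial g"] by (simp add: monomial_Cons[of a g])
qed

lemma lin_tpow_Suc_closed:
  assumes "lin \<phi>" "x \<in> tpow J (Suc m)"
    and "\<And>v y. v \<in> tpow J (Suc 0) \<Longrightarrow> y \<in> tpow J m \<Longrightarrow> \<phi> (v * y) \<in> tpow J n"
  shows "\<phi> x \<in> tpow J n"
proof (rule lin_tpow_closed[OF assms(1,2)])
  fix f assume "f \<in> words (wtI J) (Suc m)"
  then obtain a g where "f = a # g" "a \<in> wtI J" "g \<in> words (wtI J) m" by (rule words_Suc_cases)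
  then show "\<phi> (monomial f) \<in> tpow J n"
    using assms(3)[of "var a" "monomial g"] by (simp add: monomial_Cons[of a g])
qed

lemma form_eps: "form (eps a) y = lookup y a"
  by (simp add: form_def eps_def)

lemma form_diff: "form (x - x') y = form x y - form x' y"
proof -
  have *: "form z y = (\<Sum>a\<in>S. lookup z a * lookup y a)" if "keys z \<subseteq> S" "finite S" for z S
    unfolding form_def using that by (intro sum.mono_neutral_left) (auto simp: in_keys_iff)
  have "keys (x - x') \<subseteq> keys x \<union> keys x'"
    by (auto simp: in_keys_iff lookup_minus)
  then show ?thesis
    using *[of x "keys x \<union> keys x'"] *[of x' "keys x \<union> keys x'"] *[of "x - x'" "keys x \<union> keys x'"]
    by (simp add: lookup_minus left_diff_distrib sum_subtractf)
qed

lemma form_alpha: "form (alpha i) y = lookup y (i - 1/2) - lookup y (i + 1/2)"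
  by (simp add: alpha_def form_diff form_eps)

lemma lookup_alpha: "lookup (alpha i) a = of_bool (a = i - 1/2) - of_bool (a = i + 1/2)"
  by (auto simp: alpha_def eps_def lookup_minus lookup_single when_def)

lemma form_alpha_eps: "form (alpha i) (eps a) = of_bool (a = i - 1/2) - of_bool (a = i + 1/2)"
  by (auto simp: form_alpha eps_def lookup_single when_def)

lemma form_alpha_alpha_eps:
  "form (alpha i) (alpha j) = form (alpha i) (eps (j - 1/2)) - form (alpha i) (eps (j + 1/2))"
  unfolding form_alpha by (simp add: alpha_def lookup_minus eps_def)

lemma form_alpha_alpha:
  "form (alpha i) (alpha j) = 2 * of_bool (i = j) - of_bool (i = j + 1) - of_bool (i + 1 = j)"
proof -
  have "i - 1/2 = j - 1/2 \<longleftrightarrow> i = j" "i + 1/2 = j + 1/2 \<longleftrightarrow> i = j" by simp_all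
  moreover have "i - 1/2 = j + 1/2 \<longleftrightarrow> i = j + 1" "i + 1/2 = j - 1/2 \<longleftrightarrow> i + 1 = j"
    by (rule iffI; linarith)+
  ultimately show ?thesis
    by (simp only: form_alpha lookup_alpha)
qed

lemma form_alpha_self: "form (alpha i) (alpha i) = 2"
  by (simp add: form_alpha_alpha)

lemma adjacent_cases: "\<bar>i - j\<bar> = 1 \<Longrightarrow> i = j + 1 \<or> j = i + 1" for i j :: rat
  by linarith

lemma form_alpha_adjacent: "\<bar>i - j\<bar> = 1 \<Longrightarrow> form (alpha i) (alpha j) = - 1"
  using adjacent_cases[of i j] by (auto simp: form_alpha_alpha)

lemma form_alpha_far: "\<bar>i - j\<bar> > 1 \<Longrightarrow> form (alpha i) (alpha j) = 0"
  by (auto simp: form_alpha_alpha)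

text \<open>The defining relations, required only on the tensor power and oriented so that the K
  operators move to the right.\<close>

locale qmodule =
  fixes J :: "rat set" and m :: nat and R :: "gen \<Rightarrow> tens \<Rightarrow> tens"
  assumes lin_R: "lin (R g)"
    and closed: "g \<in> Ugens J \<Longrightarrow> x \<in> tpow J m \<Longrightarrow> R g x \<in> tpow J m"
    and K_Kinv: "i \<in> J \<Longrightarrow> x \<in> tpow J m \<Longrightarrow> R (GK i) (R (GKinv i) x) = x"
    and Kinv_K: "i \<in> J \<Longrightarrow> x \<in> tpow J m \<Longrightarrow> R (GKinv i) (R (GK i) x) = x"
    and K_K: "i \<in> J \<Longrightarrow> j \<in> J \<Longrightarrow> x \<in> tpow J m \<Longrightarrow> R (GK i) (R (GK j) x) = R (GK j) (R (GK i) x)"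
    and K_E: "i \<in> J \<Longrightarrow> j \<in> J \<Longrightarrow> x \<in> tpow J m \<Longrightarrow>
      R (GK i) (R (GE j) x) = const (q powi form (alpha i) (alpha j)) * R (GE j) (R (GK i) x)"
    and K_F: "i \<in> J \<Longrightarrow> j \<in> J \<Longrightarrow> x \<in> tpow J m \<Longrightarrow>
      R (GK i) (R (GF j) x) = const (q powi (- form (alpha i) (alpha j))) * R (GF j) (R (GK i) x)"
    and E_F: "i \<in> J \<Longrightarrow> j \<in> J \<Longrightarrow> x \<in> tpow J m \<Longrightarrow>
      R (GE i) (R (GF j) x) = R (GF j) (R (GE i) x) +
        (if i = j then const (1 / (q - inverse q)) * (R (GK i) x - R (GKinv i) x) else 0)"
    and E_Serre: "i \<in> J \<Longrightarrow> j \<in> J \<Longrightarrow> \<bar>i - j\<bar> = 1 \<Longrightarrow> x \<in> tpow J m \<Longrightarrow>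
      R (GE i) (R (GE i) (R (GE j) x)) = const (q + inverse q) * R (GE i) (R (GE j) (R (GE i) x))
        - R (GE j) (R (GE i) (R (GE i) x))"
    and F_Serre: "i \<in> J \<Longrightarrow> j \<in> J \<Longrightarrow> \<bar>i - j\<bar> = 1 \<Longrightarrow> x \<in> tpow J m \<Longrightarrow>
      R (GF i) (R (GF i) (R (GF j) x)) = const (q + inverse q) * R (GF i) (R (GF j) (R (GF i) x))
        - R (GF j) (R (GF i) (R (GF i) x))"
    and E_E: "i \<in> J \<Longrightarrow> j \<in> J \<Longrightarrow> \<bar>i - j\<bar> > 1 \<Longrightarrow> x \<in> tpow J m \<Longrightarrow>
      R (GE i) (R (GE j) x) = R (GE j) (R (GE i) x)"
    and F_F: "i \<in> J \<Longrightarrow> j \<in> J \<Longrightarrow> \<bar>i - j\<bar> > 1 \<Longrightarrow> x \<in> tpow J m \<Longrightarrow>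
      R (GF i) (R (GF j) x) = R (GF j) (R (GF i) x)"
begin

lemmas R_simps = lin_add[OF lin_R] lin_diff[OF lin_R] lin_scale[OF lin_R] lin_0[OF lin_R] lin_uminus[OF lin_R]

lemma closed' [simp]:
  assumes "i \<in> J" "x \<in> tpow J m"
  shows "R (GE i) x \<in> tpow J m" "R (GF i) x \<in> tpow J m" "R (GK i) x \<in> tpow J m" "R (GKinv i) x \<in> tpow J m"
  using assms by (auto intro!: closed simp: Ugens_def)

text \<open>Insert K_i and its inverse to the right of \<open>A\<close>, and pull K_i through
  \<open>A\<close> to the left, where it cancels.\<close>

lemma Kinv_commute:
  assumes i: "i \<in> J" and A: "lin A" "\<And>x. x \<in> tpow J m \<Longrightarrow> A x \<in> tpow J m" and c: "c \<noteq> 0"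
    and K: "\<And>x. x \<in> tpow J m \<Longrightarrow> R (GK i) (A x) = const c * A (R (GK i) x)" and x: "x \<in> tpow J m"
  shows "R (GKinv i) (A x) = const (inverse c) * A (R (GKinv i) x)"
proof -
  have "R (GKinv i) (A (R (GK i) (R (GKinv i) x)))
      = R (GKinv i) (const (inverse c) * R (GK i) (A (R (GKinv i) x)))"
    using i x c by (simp add: K const_mult_left)
  also have "\<dots> = const (inverse c) * A (R (GKinv i) x)"
    using i x by (simp add: R_simps Kinv_K A)
  finally show ?thesis using i x by (simp add: K_Kinv)
qed

lemma Kinv_E: "i \<in> J \<Longrightarrow> j \<in> J \<Longrightarrow> x \<in> tpow J m \<Longrightarrow>
    R (GKinv i) (R (GE j) x) = const (q powi (- form (alpha i) (alpha j))) * R (GE j) (R (GKinv i) x)"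
  unfolding power_int_minus by (rule Kinv_commute) (auto simp: lin_R K_E)

lemma Kinv_F: "i \<in> J \<Longrightarrow> j \<in> J \<Longrightarrow> x \<in> tpow J m \<Longrightarrow>
    R (GKinv i) (R (GF j) x) = const (q powi form (alpha i) (alpha j)) * R (GF j) (R (GKinv i) x)"
  using Kinv_commute[of i "R (GF j)" "q powi (- form (alpha i) (alpha j))" x]
  by (simp add: lin_R K_F power_int_minus)

lemma Kinv_Kj: "i \<in> J \<Longrightarrow> j \<in> J \<Longrightarrow> x \<in> tpow J m \<Longrightarrow>
    R (GKinv i) (R (GK j) x) = R (GK j) (R (GKinv i) x)"
  using Kinv_commute[of i "R (GK j)" 1 x] by (simp add: lin_R K_K[of i j])

lemma Kinv_Kinv: "i \<in> J \<Longrightarrow> j \<in> J \<Longrightarrow> x \<in> tpow J m \<Longrightarrow>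
    R (GKinv i) (R (GKinv j) x) = R (GKinv j) (R (GKinv i) x)"
  using Kinv_commute[of i "R (GKinv j)" 1 x] by (simp add: lin_R Kinv_Kj[of j i])

lemma lact_rels:
  assumes "a \<in> Urels J" "x \<in> tpow J m"
  shows "lact R a x = 0"
  using assms unfolding Urels_def
  by (elim UnE; clarify;
      simp add: lact_simps lact_mult[OF lin_R] power2_eq_square R_simps K_Kinv Kinv_K K_K K_E K_F E_F
        E_Serre F_Serre E_E F_F const_mult_left)

end

section \<open>The natural module satisfies the relations\<close>

lemma nat_rep_var [simp]: "nat_rep g (var a) = nat_basis g a"
  by (simp add: nat_rep_def)

lemma lin_nat_rep [simp]: "lin (nat_rep g)"
  by (simp add: nat_rep_def)

lemma wtI_minus [simp]: "i \<in> J \<Longrightarrow> i - 1/2 \<in> wtI J"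
  and wtI_plus [simp]: "i \<in> J \<Longrightarrow> i + 1/2 \<in> wtI J"
  by (auto simp: wtI_def)

lemma words_1_cases: assumes "f \<in> words I (Suc 0)" obtains a where "f = [a]" "a \<in> I"
  using assms by (auto simp: words_Suc)

lemma nat_basis_E: "nat_basis (GE i) (i + 1/2) = var (i - 1/2)" "a \<noteq> i + 1/2 \<Longrightarrow> nat_basis (GE i) a = 0"
  and nat_basis_F: "nat_basis (GF i) (i - 1/2) = var (i + 1/2)" "a \<noteq> i - 1/2 \<Longrightarrow> nat_basis (GF i) a = 0"
proof -
  have "i + 1/2 - 1 = i - 1/2" "i - 1/2 + 1 = i + 1/2" by simp_all
  then show "nat_basis (GE i) (i + 1/2) = var (i - 1/2)" "nat_basis (GF i) (i - 1/2) = var (i + 1/2)"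
    by (simp_all only: not_False_eq_True nat_basis.simps if_True refl)
qed auto

lemmas lin_nat_rep_compose = lin_compose[OF lin_nat_rep]
lemma lin_if: "lin \<phi> \<Longrightarrow> lin \<psi> \<Longrightarrow> lin (\<lambda>x. if b then \<phi> x else \<psi> x)"
  by (cases b) simp_all

lemmas lin_nat_intros = lin_if lin_intros lin_nat_rep lin_nat_rep_compose

lemmas nat_simps = lin_add[OF lin_nat_rep] lin_diff[OF lin_nat_rep] lin_scale[OF lin_nat_rep] lin_0[OF lin_nat_rep]

text \<open>The image of E_j is spanned by the vector of index \<open>j - 1/2\<close>, which E_i
  kills unless it is \<open>i + 1/2\<close>. Consequently all three terms of the Serre relation
  vanish on the natural module.\<close>

lemma nat_rep_E_E: "j \<noteq> i + 1 \<Longrightarrow> x \<in> tpow J (Suc 0) \<Longrightarrow> nat_rep (GE i) (nat_rep (GE j) x) = 0"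
proof (erule lin_eq_tpow[rotated 2])
  fix f assume f: "f \<in> words (wtI J) (Suc 0)" and "j \<noteq> i + 1"
  obtain a where a: "f = [a]" using f by (rule words_1_cases)
  have "j - 1/2 \<noteq> i + 1/2" using \<open>j \<noteq> i + 1\<close> by linarith
  then show "nat_rep (GE i) (nat_rep (GE j) (monomial f)) = 0"
    unfolding a nat_rep_var by (cases "a = j + 1/2") (simp_all only: not_False_eq_True nat_basis_E nat_rep_var nat_simps)
qed (intro lin_nat_intros)+

lemma nat_rep_F_F: "i \<noteq> j + 1 \<Longrightarrow> x \<in> tpow J (Suc 0) \<Longrightarrow> nat_rep (GF i) (nat_rep (GF j) x) = 0"
proof (erule lin_eq_tpow[rotated 2])
  fix f assume f: "f \<in> words (wtI J) (Suc 0)" and "i \<noteq> j + 1"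
  obtain a where a: "f = [a]" using f by (rule words_1_cases)
  have "j + 1/2 \<noteq> i - 1/2" using \<open>i \<noteq> j + 1\<close> by linarith
  then show "nat_rep (GF i) (nat_rep (GF j) (monomial f)) = 0"
    unfolding a nat_rep_var by (cases "a = j - 1/2") (simp_all only: not_False_eq_True nat_basis_F nat_rep_var nat_simps)
qed (intro lin_nat_intros)+

lemma nat_rep_closed: "g \<in> Ugens J \<Longrightarrow> x \<in> tpow J (Suc 0) \<Longrightarrow> nat_rep g x \<in> tpow J (Suc 0)"
proof (rule lin_tpow_closed[OF lin_nat_rep])
  fix f assume "g \<in> Ugens J" and f: "f \<in> words (wtI J) (Suc 0)"
  obtain a where a: "f = [a]" "a \<in> wtI J" using f by (rule words_1_cases)
  have [simp]: "[b] \<in> words I (Suc 0) \<longleftrightarrow> b \<in> I" for b :: rat and I by simp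
  consider i where "i \<in> J" "g = GE i" | i where "i \<in> J" "g = GF i"
    | i where "g = GK i" | i where "g = GKinv i"
    using \<open>g \<in> Ugens J\<close> by (auto simp: Ugens_def)
  then have "nat_basis g a \<in> tpow J (Suc 0)"
  proof cases
    case (1 i)
    then show ?thesis by (cases "a = i + 1/2") (simp_all only: not_False_eq_True nat_basis_E tpow_0, simp)
  next
    case (2 i)
    then show ?thesis by (cases "a = i - 1/2") (simp_all only: not_False_eq_True nat_basis_F tpow_0, simp)
  qed (use a in simp_all)
  then show "nat_rep g (monomial f) \<in> tpow J (Suc 0)" using a by simp
qed

lemma nat_basis_commutator:
  "nat_rep (GE i) (nat_basis (GF j) a) = nat_rep (GF j) (nat_basis (GE i) a) +
    (if i = j then const (1 / (q - inverse q)) * (nat_basis (GK i) a - nat_basis (GKinv i) a) else 0)"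
proof -
  consider "i = j" "a = i - 1/2" | "i = j" "a = i + 1/2" | "i = j" "a \<noteq> i - 1/2" "a \<noteq> i + 1/2" | "i \<noteq> j"
    by blast
  then show ?thesis
  proof cases
    case 1
    have "const (1 / (q - inverse q)) * (nat_basis (GK i) a - nat_basis (GKinv i) a) = var a"
      using 1 by (simp add: form_alpha_eps power_int_minus const_mult_left q_minus_inverse[simplified] flip: left_diff_distrib const_diff)
    moreover have "i - 1/2 \<noteq> i + 1/2" by simp
    ultimately show ?thesis using 1 by (simp only: not_False_eq_True nat_basis_E nat_basis_F nat_rep_var nat_simps) simp
  next
    case 2
    have "const (1 / (q - inverse q)) * (nat_basis (GK i) a - nat_basis (GKinv i) a)
        = const (1 / (q - inverse q) * (inverse q - q)) * var a"
      using 2 by (simp add: form_alpha_eps power_int_minus const_mult_left flip: left_diff_distrib const_diff)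
    also have "1 / (q - inverse q) * (inverse q - q) = - 1"
      using q_minus_inverse by (simp add: divide_eq_eq)
    finally have "const (1 / (q - inverse q)) * (nat_basis (GK i) a - nat_basis (GKinv i) a) = - var a"
      by (simp add: const_uminus)
    moreover have "i + 1/2 \<noteq> i - 1/2" by simp
    ultimately show ?thesis using 2 by (simp only: not_False_eq_True nat_basis_E nat_basis_F nat_rep_var nat_simps) simp
  next
    case 3
    then have "const (1 / (q - inverse q)) * (nat_basis (GK i) a - nat_basis (GKinv i) a) = 0"
      by (simp add: form_alpha_eps)
    then show ?thesis using 3 by (simp only: not_False_eq_True nat_basis_E nat_basis_F nat_rep_var nat_simps) simp
  next
    case 4
    then have *: "j + 1/2 \<noteq> i + 1/2" "i - 1/2 \<noteq> j - 1/2" by simp_all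
    have "nat_rep (GE i) (nat_basis (GF j) a) = 0"
      by (cases "a = j - 1/2") (simp_all only: not_False_eq_True * nat_basis_E nat_basis_F nat_rep_var nat_simps not_False_eq_True)
    moreover have "nat_rep (GF j) (nat_basis (GE i) a) = 0"
      by (cases "a = i + 1/2") (simp_all only: not_False_eq_True * nat_basis_E nat_basis_F nat_rep_var nat_simps not_False_eq_True)
    ultimately show ?thesis using 4 by simp
  qed
qed

lemma nat_basis_K: "nat_rep (GK i) (nat_basis (GE j) a) = const (q powi form (alpha i) (alpha j)) * nat_rep (GE j) (nat_basis (GK i) a)"
  "nat_rep (GK i) (nat_basis (GF j) a) = const (q powi (- form (alpha i) (alpha j))) * nat_rep (GF j) (nat_basis (GK i) a)"
proof -
  have K: "nat_rep (GK i) (var b) = const (q powi form (alpha i) (eps b)) * var b" for b by simp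
  show "nat_rep (GK i) (nat_basis (GE j) a) = const (q powi form (alpha i) (alpha j)) * nat_rep (GE j) (nat_basis (GK i) a)"
  proof (cases "a = j + 1/2")
    case True
    have "q powi form (alpha i) (eps (j - 1/2)) = q powi form (alpha i) (alpha j) * q powi form (alpha i) (eps (j + 1/2))"
      by (simp add: form_alpha_alpha_eps flip: power_int_add)
    then show ?thesis
      unfolding True by (simp only: nat_basis_E nat_basis.simps(3) nat_rep_var nat_simps K const_mult_left)
  next
    case False
    then show ?thesis
      by (simp only: nat_basis_E nat_basis.simps(3) nat_rep_var nat_simps mult_zero_right not_False_eq_True)
  qed
  show "nat_rep (GK i) (nat_basis (GF j) a) = const (q powi (- form (alpha i) (alpha j))) * nat_rep (GF j) (nat_basis (GK i) a)"
  proof (cases "a = j - 1/2")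
    case True
    have "q powi form (alpha i) (eps (j + 1/2)) = q powi (- form (alpha i) (alpha j)) * q powi form (alpha i) (eps (j - 1/2))"
      by (simp add: form_alpha_alpha_eps flip: power_int_add)
    then show ?thesis
      unfolding True by (simp only: nat_basis_F nat_basis.simps(3) nat_rep_var nat_simps K const_mult_left)
  next
    case False
    then show ?thesis
      by (simp only: nat_basis_F nat_basis.simps(3) nat_rep_var nat_simps mult_zero_right not_False_eq_True)
  qed
qed

lemma qmodule_nat_rep: "qmodule J (Suc 0) nat_rep"
proof
  fix i j x assume x: "x \<in> tpow J (Suc 0)"
  have ind: "\<phi> x = \<psi> x" if "lin \<phi>" "lin \<psi>" "\<And>a. \<phi> (var a) = \<psi> (var a)" for \<phi> \<psi>
    using x by (rule lin_eq_tpow[OF that(1,2)]) (auto elim!: words_1_cases simp: that(3))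
  have inv: "q powi k * q powi (- k) = 1" "q powi (- k) * q powi k = 1" for k
    by (simp_all flip: power_int_add)
  show "nat_rep (GK i) (nat_rep (GKinv i) x) = x"
    by (rule ind; (intro lin_nat_intros)?) (simp add: nat_simps const_mult_left inv)
  show "nat_rep (GKinv i) (nat_rep (GK i) x) = x"
    by (rule ind; (intro lin_nat_intros)?) (simp add: nat_simps const_mult_left inv)
  show "nat_rep (GK i) (nat_rep (GK j) x) = nat_rep (GK j) (nat_rep (GK i) x)"
    by (rule ind; (intro lin_nat_intros)?; simp add: nat_simps const_mult_left mult.commute)
  show "nat_rep (GK i) (nat_rep (GE j) x) = const (q powi form (alpha i) (alpha j)) * nat_rep (GE j) (nat_rep (GK i) x)"
    by (rule ind; (intro lin_nat_intros)?; simp only: nat_rep_var nat_basis_K)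
  show "nat_rep (GK i) (nat_rep (GF j) x) = const (q powi (- form (alpha i) (alpha j))) * nat_rep (GF j) (nat_rep (GK i) x)"
    by (rule ind; (intro lin_nat_intros)?; simp only: nat_rep_var nat_basis_K)
  show "nat_rep (GE i) (nat_rep (GF j) x) = nat_rep (GF j) (nat_rep (GE i) x) +
    (if i = j then const (1 / (q - inverse q)) * (nat_rep (GK i) x - nat_rep (GKinv i) x) else 0)"
    by (rule ind; (intro lin_nat_intros)?) (simp only: nat_rep_var nat_basis_commutator)
  assume ij: "i \<in> J" "j \<in> J"
  have cl: "nat_rep (GE k) x \<in> tpow J (Suc 0)" "nat_rep (GF k) x \<in> tpow J (Suc 0)" if "k \<in> J" for k
    using that x by (auto intro!: nat_rep_closed simp: Ugens_def)
  have sq: "k \<noteq> k + 1" for k :: rat by simp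
  show "nat_rep (GE i) (nat_rep (GE i) (nat_rep (GE j) x)) = const (q + inverse q) * nat_rep (GE i) (nat_rep (GE j) (nat_rep (GE i) x))
        - nat_rep (GE j) (nat_rep (GE i) (nat_rep (GE i) x))" if "\<bar>i - j\<bar> = 1"
  proof -
    have "nat_rep (GE i) (nat_rep (GE j) (nat_rep (GE i) x)) = 0"
    proof (cases "j = i + 1")
      case True
      then have "i \<noteq> j + 1" by simp
      then show ?thesis using nat_rep_E_E x by (simp add: nat_simps)
    qed (use nat_rep_E_E[OF _ cl(1)[OF ij(1)]] in simp)
    then show ?thesis using nat_rep_E_E[OF sq x] nat_rep_E_E[OF sq cl(1)[OF ij(2)]] by (simp add: nat_simps)
  qed
  show "nat_rep (GF i) (nat_rep (GF i) (nat_rep (GF j) x)) = const (q + inverse q) * nat_rep (GF i) (nat_rep (GF j) (nat_rep (GF i) x))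
        - nat_rep (GF j) (nat_rep (GF i) (nat_rep (GF i) x))" if "\<bar>i - j\<bar> = 1"
  proof -
    have "nat_rep (GF i) (nat_rep (GF j) (nat_rep (GF i) x)) = 0"
    proof (cases "i = j + 1")
      case True
      then have "j \<noteq> i + 1" by simp
      then show ?thesis using nat_rep_F_F x by (simp add: nat_simps)
    qed (use nat_rep_F_F[OF _ cl(2)[OF ij(1)]] in simp)
    then show ?thesis using nat_rep_F_F[OF sq x] nat_rep_F_F[OF sq cl(2)[OF ij(2)]] by (simp add: nat_simps)
  qed
  show "nat_rep (GE i) (nat_rep (GE j) x) = nat_rep (GE j) (nat_rep (GE i) x)" if "\<bar>i - j\<bar> > 1"
  proof -
    have "j \<noteq> i + 1" "i \<noteq> j + 1" using that by auto
    then show ?thesis using nat_rep_E_E x by simp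
  qed
  show "nat_rep (GF i) (nat_rep (GF j) x) = nat_rep (GF j) (nat_rep (GF i) x)" if "\<bar>i - j\<bar> > 1"
  proof -
    have "j \<noteq> i + 1" "i \<noteq> j + 1" using that by auto
    then show ?thesis using nat_rep_F_F x by simp
  qed
qed (simp_all add: nat_rep_closed)

lemma form_alpha_sym: "form (alpha i) (alpha j) = form (alpha j) (alpha i)"
  by (auto simp: form_alpha_alpha)

section \<open>Tensor products of modules and the coproduct\<close>

lemma lin_tmap [simp]: "lin (tmap k \<phi> \<psi>)"
  by (simp add: tmap_def)

lemma tmap_mult:
  assumes "lin \<phi>" "lin \<psi>" "v \<in> tpow J (Suc 0)"
  shows "tmap 1 \<phi> \<psi> (v * y) = \<phi> v * \<psi> y"
proof (rule lin_eqI[where x = y])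
  show "lin (\<lambda>y. tmap 1 \<phi> \<psi> (v * y))"
    by (rule lin_compose[OF lin_tmap]) (intro lin_intros)
  show "lin (\<lambda>y. \<phi> v * \<psi> y)"
    using assms(2) by (intro lin_intros)
  fix w
  show "tmap 1 \<phi> \<psi> (v * monomial (letters w)) = \<phi> v * \<psi> (monomial (letters w))"
  proof (rule lin_eq_tpow[OF _ _ assms(3)])
    show "lin (\<lambda>v. tmap 1 \<phi> \<psi> (v * monomial (letters w)))"
      by (rule lin_compose[OF lin_tmap]) (intro lin_intros)
    show "lin (\<lambda>v. \<phi> v * \<psi> (monomial (letters w)))"
      using assms(1) by (intro lin_intros)
    fix f assume "f \<in> words (wtI J) (Suc 0)"
    then obtain a where "f = [a]" by (rule words_1_cases)
    then show "tmap 1 \<phi> \<psi> (monomial f * monomial (letters w)) = \<phi> (monomial f) * \<psi> (monomial (letters w))"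
      by (simp add: tmap_def flip: monomial_append)
  qed
qed

text \<open>In other words, the coproduct respects the defining relations. They are checked on pure
  tensors, after the K operators have been moved to the right within each factor.\<close>

lemma qmodule_tensor:
  assumes N: "qmodule J (Suc 0) N" and R: "qmodule J m R" and lin_T: "\<And>g. lin (T g)"
    and T: "\<And>i v y. v \<in> tpow J (Suc 0) \<Longrightarrow> T (GE i) (v * y) = v * R (GE i) y + N (GE i) v * R (GKinv i) y"
      "\<And>i v y. v \<in> tpow J (Suc 0) \<Longrightarrow> T (GF i) (v * y) = N (GF i) v * y + N (GK i) v * R (GF i) y"
      "\<And>i v y. v \<in> tpow J (Suc 0) \<Longrightarrow> T (GK i) (v * y) = N (GK i) v * R (GK i) y"
      "\<And>i v y. v \<in> tpow J (Suc 0) \<Longrightarrow> T (GKinv i) (v * y) = N (GKinv i) v * R (GKinv i) y"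
  shows "qmodule J (Suc m) T"
proof
  interpret N: qmodule J "Suc 0" N by (rule N)
  interpret R: qmodule J m R by (rule R)
  note T_simps = lin_add[OF lin_T] lin_diff[OF lin_T] lin_scale[OF lin_T] lin_0[OF lin_T]
  note ring_simps = distrib_left distrib_right left_diff_distrib right_diff_distrib const_mult_left
    mult_const_left[of "N _ _"] mult.assoc[of "const _"]
  note lin = lin_if lin_intros lin_T lin_compose[OF lin_T]
  note lookup_simps = lookup_add lookup_minus
  show "lin (T g)" for g by (rule lin_T)
  show "T g x \<in> tpow J (Suc m)" if "g \<in> Ugens J" "x \<in> tpow J (Suc m)" for g x
    by (rule lin_tpow_Suc_closed[OF lin_T that(2)]) (use that(1) in \<open>auto simp: Ugens_def T\<close>)
  fix i j x assume x: "x \<in> tpow J (Suc m)" and i: "i \<in> J"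
  have ind: "\<phi> x = \<psi> x" if "lin \<phi>" "lin \<psi>"
    "\<And>v y. v \<in> tpow J (Suc 0) \<Longrightarrow> y \<in> tpow J m \<Longrightarrow> \<phi> (v * y) = \<psi> (v * y)" for \<phi> \<psi>
    using that(1,2) x that(3) by (rule lin_eq_tpow_Suc)
  show "T (GK i) (T (GKinv i) x) = x"
    by (rule ind; (intro lin)?) (simp add: i T N.K_Kinv R.K_Kinv)
  show "T (GKinv i) (T (GK i) x) = x"
    by (rule ind; (intro lin)?) (simp add: i T N.Kinv_K R.Kinv_K)
  assume j: "j \<in> J"
  show "T (GK i) (T (GK j) x) = T (GK j) (T (GK i) x)"
    by (rule ind; (intro lin)?) (simp add: i j T N.K_K[of i j] R.K_K[of i j])
  show "T (GK i) (T (GE j) x) = const (q powi form (alpha i) (alpha j)) * T (GE j) (T (GK i) x)"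
    by (rule ind; (intro lin)?) (simp add: i j T T_simps N.K_E R.K_E R.Kinv_Kj[of j i] ring_simps)
  show "T (GK i) (T (GF j) x) = const (q powi (- form (alpha i) (alpha j))) * T (GF j) (T (GK i) x)"
    by (rule ind; (intro lin)?) (simp add: i j T T_simps N.K_F R.K_F N.K_K[of i j] ring_simps)
  show "T (GE i) (T (GF j) x) = T (GF j) (T (GE i) x) +
    (if i = j then const (1 / (q - inverse q)) * (T (GK i) x - T (GKinv i) x) else 0)"
  proof (rule ind; (intro lin)?)
    fix v y assume vy: "v \<in> tpow J (Suc 0)" "y \<in> tpow J m"
    show "T (GE i) (T (GF j) (v * y)) = T (GF j) (T (GE i) (v * y)) +
        (if i = j then const (1 / (q - inverse q)) * (T (GK i) (v * y) - T (GKinv i) (v * y)) else 0)"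
      by (cases "i = j"; simp add: i j vy T T_simps N.E_F R.E_F N.K_E R.Kinv_F form_alpha_sym[of j i] ring_simps)
  qed
  show "T (GE i) (T (GE i) (T (GE j) x)) = const (q + inverse q) * T (GE i) (T (GE j) (T (GE i) x))
      - T (GE j) (T (GE i) (T (GE i) x))" if ij: "\<bar>i - j\<bar> = 1"
  proof (rule ind; (intro lin)?)
    fix v y assume vy: "v \<in> tpow J (Suc 0)" "y \<in> tpow J m"
    have ji: "\<bar>j - i\<bar> = 1" using ij by linarith
    \<comment> \<open>These are the powers of \<open>q\<close> that arise when K operators pass the
      E operators. With them the relation is an identity of Laurent polynomials in \<open>q\<close>
      for the coefficients of each tensor that occurs, and it is checked coordinatewise.\<close>
    have qpow: "q powi (- form (alpha i) (alpha j)) = q" "q powi (- form (alpha j) (alpha i)) = q"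
      "q powi (- form (alpha i) (alpha i)) = inverse q * inverse q"
      by (simp_all add: form_alpha_self form_alpha_adjacent[OF ij] form_alpha_adjacent[OF ji]
          power_int_minus power2_eq_square)
    show "T (GE i) (T (GE i) (T (GE j) (v * y))) = const (q + inverse q) * T (GE i) (T (GE j) (T (GE i) (v * y)))
        - T (GE j) (T (GE i) (T (GE i) (v * y)))"
      by (simp only: T T_simps N.R_simps R.R_simps N.closed' R.closed' vy i j
          N.E_Serre[OF i j ij] R.E_Serre[OF i j ij] R.Kinv_E[OF i j] R.Kinv_E[OF j i] R.Kinv_E[OF i i] R.Kinv_Kinv[OF j i] qpow ring_simps mult_const_left[of v], rule poly_mapping_eqI, simp only: lookup_simps lookup_const_mult)
        (simp add: field_simps)
  qed
  show "T (GF i) (T (GF i) (T (GF j) x)) = const (q + inverse q) * T (GF i) (T (GF j) (T (GF i) x))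
      - T (GF j) (T (GF i) (T (GF i) x))" if ij: "\<bar>i - j\<bar> = 1"
  proof (rule ind; (intro lin)?)
    fix v y assume vy: "v \<in> tpow J (Suc 0)" "y \<in> tpow J m"
    have ji: "\<bar>j - i\<bar> = 1" using ij by linarith
    have qpow: "q powi (- form (alpha i) (alpha j)) = q" "q powi (- form (alpha j) (alpha i)) = q"
      "q powi (- form (alpha i) (alpha i)) = inverse q * inverse q"
      by (simp_all add: form_alpha_self form_alpha_adjacent[OF ij] form_alpha_adjacent[OF ji]
          power_int_minus power2_eq_square)
    show "T (GF i) (T (GF i) (T (GF j) (v * y))) = const (q + inverse q) * T (GF i) (T (GF j) (T (GF i) (v * y)))
        - T (GF j) (T (GF i) (T (GF i) (v * y)))"
      by (simp only: T T_simps N.R_simps R.R_simps N.closed' R.closed' vy i j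
          N.F_Serre[OF i j ij] R.F_Serre[OF i j ij] N.K_F[OF i j] N.K_F[OF j i] N.K_F[OF i i] N.K_K[OF j i] qpow ring_simps mult_const_left[of v], rule poly_mapping_eqI, simp only: lookup_simps lookup_const_mult)
        (simp add: field_simps)
  qed
  show "T (GE i) (T (GE j) x) = T (GE j) (T (GE i) x)" if ij: "\<bar>i - j\<bar> > 1"
  proof (rule ind; (intro lin)?)
    fix v y assume vy: "v \<in> tpow J (Suc 0)" "y \<in> tpow J m"
    have ji: "\<bar>j - i\<bar> > 1" using ij by linarith
    note forms = form_alpha_far[OF ij] form_alpha_far[OF ji]
    show "T (GE i) (T (GE j) (v * y)) = T (GE j) (T (GE i) (v * y))"
      by (simp add: i j vy T T_simps N.E_E[OF i j ij] R.E_E[OF i j ij] R.Kinv_E forms R.Kinv_Kinv[of j i])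
  qed
  show "T (GF i) (T (GF j) x) = T (GF j) (T (GF i) x)" if ij: "\<bar>i - j\<bar> > 1"
  proof (rule ind; (intro lin)?)
    fix v y assume vy: "v \<in> tpow J (Suc 0)" "y \<in> tpow J m"
    have ji: "\<bar>j - i\<bar> > 1" using ij by linarith
    note forms = form_alpha_far[OF ij] form_alpha_far[OF ji]
    show "T (GF i) (T (GF j) (v * y)) = T (GF j) (T (GF i) (v * y))"
      by (simp add: i j vy T T_simps N.F_F[OF i j ij] R.F_F[OF i j ij] N.K_F forms N.K_K[of j i])
  qed
qed

lemma lin_tpow_rep [simp]: "lin (tpow_rep m g)"
proof -
  consider "m = 0" | "m = Suc 0" | m' where "m = Suc (Suc m')"
    by (metis not0_implies_Suc)
  then show ?thesis
  proof cases
    case (3 m')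
    have "lin (\<lambda>x. \<Sum>(a, b)\<leftarrow>xs. tmap 1 (lact nat_rep a) (lact (tpow_rep (Suc m')) b) x)" for xs
      by (induct xs) (auto intro!: lin_plus simp: lin_zero split_def)
    moreover have "tpow_rep m g = (\<lambda>x. \<Sum>(a, b)\<leftarrow>coprod g. tmap 1 (lact nat_rep a) (lact (tpow_rep (Suc m')) b) x)"
      using 3 by (intro ext) simp
    ultimately show ?thesis by simp
  qed (auto simp: lin_def nat_simps)
qed

lemma tpow_rep_mult:
  assumes "v \<in> tpow J (Suc 0)"
  shows "tpow_rep (Suc (Suc m)) (GE i) (v * y) = v * tpow_rep (Suc m) (GE i) y + nat_rep (GE i) v * tpow_rep (Suc m) (GKinv i) y"
    "tpow_rep (Suc (Suc m)) (GF i) (v * y) = nat_rep (GF i) v * y + nat_rep (GK i) v * tpow_rep (Suc m) (GF i) y"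
    "tpow_rep (Suc (Suc m)) (GK i) (v * y) = nat_rep (GK i) v * tpow_rep (Suc m) (GK i) y"
    "tpow_rep (Suc (Suc m)) (GKinv i) (v * y) = nat_rep (GKinv i) v * tpow_rep (Suc m) (GKinv i) y"
proof -
  have "tmap (Suc 0) (lact nat_rep a) (lact (tpow_rep (Suc m)) b) (v * y) = lact nat_rep a v * lact (tpow_rep (Suc m)) b y" for a b y
    using tmap_mult[OF lin_lact[of nat_rep] lin_lact[of "tpow_rep (Suc m)"] assms] by simp
  then show
    "tpow_rep (Suc (Suc m)) (GE i) (v * y) = v * tpow_rep (Suc m) (GE i) y + nat_rep (GE i) v * tpow_rep (Suc m) (GKinv i) y"
    "tpow_rep (Suc (Suc m)) (GF i) (v * y) = nat_rep (GF i) v * y + nat_rep (GK i) v * tpow_rep (Suc m) (GF i) y"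
    "tpow_rep (Suc (Suc m)) (GK i) (v * y) = nat_rep (GK i) v * tpow_rep (Suc m) (GK i) y"
    "tpow_rep (Suc (Suc m)) (GKinv i) (v * y) = nat_rep (GKinv i) v * tpow_rep (Suc m) (GKinv i) y"
    by (simp_all add: lact_simps)
qed

lemma qmodule_tpow_rep: "m \<ge> 1 \<Longrightarrow> qmodule J m (tpow_rep m)"
proof (induct m rule: nat_induct_at_least)
  case base
  have "tpow_rep (Suc 0) = nat_rep" by (intro ext) simp
  then show ?case using qmodule_nat_rep by simp
next
  case (Suc m)
  then obtain k where k: "m = Suc k" by (cases m) auto
  show ?case
    unfolding k by (rule qmodule_tensor[OF qmodule_nat_rep Suc(2)[unfolded k] lin_tpow_rep tpow_rep_mult])
qed

section \<open>The action of the quantum group on tensor powers\<close>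

lemma Ugens_simps [simp]:
  "GE i \<in> Ugens J \<longleftrightarrow> i \<in> J" "GF i \<in> Ugens J \<longleftrightarrow> i \<in> J"
  "GK i \<in> Ugens J \<longleftrightarrow> i \<in> J" "GKinv i \<in> Ugens J \<longleftrightarrow> i \<in> J"
  by (auto simp: Ugens_def)

lemma Urels_carrier: "Urels J \<subseteq> carrier (free_algebra (Ugens J))"
  unfolding Urels_def by (intro Un_least; clarify; simp)

interpretation U: presentation "Ugens J" "Urels J" for J
  by unfold_locales (rule Urels_carrier)

lemma uact_ucls:
  assumes "m \<ge> 1" "x \<in> tpow J m"
  shows "uact m (ucls J a) x = lact (tpow_rep m) a x"
proof -
  interpret qmodule J m "tpow_rep m" by (rule qmodule_tpow_rep[OF assms(1)])
  show ?thesis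
    unfolding uact_def ucls_def
  proof (rule U.the_elem_pclass)
    show "lact (tpow_rep m) b x = 0" if "b \<in> U.I J" for b
      by (rule U.lact_I[where V = "tpow J m",
            OF lin_tpow_rep closed tpow_0 tpow_add tpow_const_mult lact_rels that assms(2)])
  qed (rule lact_add)
qed

lemma carrier_UU: "carrier (UU J) = ucls J ` carrier (free_algebra (Ugens J))"
  by (simp add: UU_def U.carrier_presented ucls_def[abs_def])

lemma UU_cases: assumes "u \<in> carrier (UU J)" obtains a where "a \<in> carrier (free_algebra (Ugens J))" "u = ucls J a"
  using assms by (auto simp: carrier_UU)

lemma ring_UU: "ring (UU J)"
  unfolding UU_def by (rule U.ring_presented)

lemma ucls_hom:
  assumes "a \<in> carrier (free_algebra (Ugens J))" "b \<in> carrier (free_algebra (Ugens J))"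
  shows "ucls J a \<oplus>\<^bsub>UU J\<^esub> ucls J b = ucls J (a + b)" "ucls J a \<otimes>\<^bsub>UU J\<^esub> ucls J b = ucls J (a * b)"
    "ucls J a \<ominus>\<^bsub>UU J\<^esub> ucls J b = ucls J (a - b)" "\<ominus>\<^bsub>UU J\<^esub> ucls J a = ucls J (- a)"
  using assms by (simp_all add: UU_def ucls_def U.pclass_add U.pclass_mult U.pclass_diff U.pclass_uminus)

lemma ucls_one: "\<one>\<^bsub>UU J\<^esub> = ucls J 1" and ucls_zero: "\<zero>\<^bsub>UU J\<^esub> = ucls J 0"
  by (simp_all add: UU_def ucls_def U.pclass_one U.pclass_zero)

lemma lact_tpow_closed:
  assumes m: "m \<ge> 1" and a: "a \<in> carrier (free_algebra (Ugens J))" and x: "x \<in> tpow J m"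
  shows "lact (tpow_rep m) a x \<in> tpow J m"
proof -
  interpret qmodule J m "tpow_rep m" by (rule qmodule_tpow_rep[OF m])
  have "foldr (tpow_rep m) u x \<in> tpow J m" if "set u \<subseteq> Ugens J" for u
    using that x by (induct u) (simp_all add: closed)
  then show ?thesis
    using a unfolding lact_def by (intro tpow_sum tpow_const_mult) (auto simp: carrier_free_algebra)
qed

lemma uact_closed: "m \<ge> 1 \<Longrightarrow> u \<in> carrier (UU J) \<Longrightarrow> x \<in> tpow J m \<Longrightarrow> uact m u x \<in> tpow J m"
  by (auto elim!: UU_cases simp: uact_ucls lact_tpow_closed)

lemma uact_lin:
  assumes "m \<ge> 1" "u \<in> carrier (UU J)" "x \<in> tpow J m" "y \<in> tpow J m"
  shows "uact m u (x + y) = uact m u x + uact m u y" "uact m u (const c * x) = const c * uact m u x"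
  using assms by (auto elim!: UU_cases simp: uact_ucls lin_add[OF lin_lact] lin_scale[OF lin_lact])

lemma uact_hom:
  assumes "m \<ge> 1" "u \<in> carrier (UU J)" "v \<in> carrier (UU J)" "x \<in> tpow J m"
  shows "uact m (u \<oplus>\<^bsub>UU J\<^esub> v) x = uact m u x + uact m v x"
    "uact m (u \<otimes>\<^bsub>UU J\<^esub> v) x = uact m u (uact m v x)"
    "uact m (u \<ominus>\<^bsub>UU J\<^esub> v) x = uact m u x - uact m v x"
    "uact m (\<ominus>\<^bsub>UU J\<^esub> u) x = - uact m u x"
  using assms
  by (auto elim!: UU_cases simp: ucls_hom uact_ucls lact_tpow_closed lact_simps lact_mult)

lemma uact_one: "m \<ge> 1 \<Longrightarrow> x \<in> tpow J m \<Longrightarrow> uact m \<one>\<^bsub>UU J\<^esub> x = x"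
  by (simp add: ucls_one uact_ucls lact_1)

definition Ui_gens :: "rat set \<Rightarrow> gen falg set set" where
  "Ui_gens J = {ucls J (const c) | c. True} \<union>
      (\<Union>i\<in>{i\<in>J. i > 0}. {ik J i, ikinv J i, ie J i, ifl J i}) \<union> (if 0 \<in> J then {it J} else {})"

lemma Ui_generate: "Ui J = generate_ring (UU J) (Ui_gens J)"
  by (simp add: Ui_def Ui_gens_def)

locale symmetric_index =
  fixes J :: "rat set"
  assumes J_minus: "i \<in> J \<Longrightarrow> - i \<in> J"
begin

lemma Ui_gens_carrier: "Ui_gens J \<subseteq> carrier (UU J)"
proof -
  have "ucls J a \<in> carrier (UU J)" if "a \<in> carrier (free_algebra (Ugens J))" for a
    using that by (simp add: carrier_UU)
  then show ?thesis
    using J_minus by (auto simp: Ui_gens_def ik_def ikinv_def ie_def ifl_def it_def)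
qed

lemma Ui_carrier: "Ui J \<subseteq> carrier (UU J)"
  unfolding Ui_generate by (rule ring.generate_ring_in_carrier[OF ring_UU Ui_gens_carrier, THEN subsetI])

lemma Ui_closed:
  "ucls J (const c) \<in> Ui J" "u \<in> Ui J \<Longrightarrow> v \<in> Ui J \<Longrightarrow> u \<oplus>\<^bsub>UU J\<^esub> v \<in> Ui J"
  "u \<in> Ui J \<Longrightarrow> v \<in> Ui J \<Longrightarrow> u \<otimes>\<^bsub>UU J\<^esub> v \<in> Ui J"
  "i \<in> J \<Longrightarrow> i > 0 \<Longrightarrow> ik J i \<in> Ui J" "i \<in> J \<Longrightarrow> i > 0 \<Longrightarrow> ie J i \<in> Ui J" "i \<in> J \<Longrightarrow> i > 0 \<Longrightarrow> ifl J i \<in> Ui J"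
  "0 \<in> J \<Longrightarrow> it J \<in> Ui J"
proof -
  have incl: "u \<in> Ui J" if "u \<in> Ui_gens J" for u
    unfolding Ui_generate using that by (rule generate_ring.incl)
  show "ucls J (const c) \<in> Ui J" "i \<in> J \<Longrightarrow> i > 0 \<Longrightarrow> ik J i \<in> Ui J" "i \<in> J \<Longrightarrow> i > 0 \<Longrightarrow> ie J i \<in> Ui J"
    "i \<in> J \<Longrightarrow> i > 0 \<Longrightarrow> ifl J i \<in> Ui J" "0 \<in> J \<Longrightarrow> it J \<in> Ui J"
    by (rule incl; auto simp: Ui_gens_def)+
qed (simp_all add: Ui_generate generate_ring.eng_add generate_ring.eng_mult)

end

section \<open>The right action of the Hecke algebra\<close>

lemma lin_hgen [simp]: "lin (hgen i)"
  by (simp add: hgen_def)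

lemmas hgen_simps = lin_add[OF lin_hgen] lin_diff[OF lin_hgen] lin_scale[OF lin_hgen] lin_0[OF lin_hgen]
lemmas lin_hgen_intros = lin_intros lin_hgen lin_compose[OF lin_hgen]

lemma hgen_0: "hgen 0 (monomial (a # f)) = monomial (- a # f)"
  by (simp add: hgen_def)

text \<open>The value of H_i with \<open>i = Suc (length us)\<close>, written with explicit letters
  so that the relations become case distinctions on their order.\<close>

definition hswap :: "rat list \<Rightarrow> rat \<Rightarrow> rat \<Rightarrow> rat list \<Rightarrow> tens" where
  "hswap us a b vs = (if a = b then const (inverse q) * monomial (us @ a # b # vs)
     else if a < b then monomial (us @ b # a # vs)
     else monomial (us @ b # a # vs) + const (inverse q - q) * monomial (us @ a # b # vs))"

lemma hgen_pos: "i = Suc (length us) \<Longrightarrow> hgen i (monomial (us @ a # b # vs)) = hswap us a b vs"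
  by (simp add: hgen_def hswap_def Let_def nth_append list_update_append)

lemma hgen_Suc_pos: "i = Suc (length us) \<Longrightarrow> hgen (Suc i) (monomial (us @ a # b # c # vs)) = hswap (us @ [a]) b c vs"
  using hgen_pos[of "Suc i" "us @ [a]" b c vs] by simp

lemma split_pos:
  assumes "f \<in> words I m" "1 \<le> i" "i < m"
  obtains us a b vs where "f = us @ a # b # vs" "i = Suc (length us)"
proof -
  have "length f = m" using assms by (simp add: words_def)
  then have "f = take (i - 1) f @ f ! (i - 1) # f ! i # drop (Suc i) f"
    using assms Cons_nth_drop_Suc[of "i - 1" f] Cons_nth_drop_Suc[of i f] append_take_drop_id[of "i - 1" f] by simp
  moreover have "i = Suc (length (take (i - 1) f))" using assms \<open>length f = m\<close> by simp
  ultimately show thesis by (rule that)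
qed

lemma hgen_closed:
  assumes i: "i < m" and sym: "\<And>a. a \<in> wtI J \<Longrightarrow> - a \<in> wtI J" and x: "x \<in> tpow J m"
  shows "hgen i x \<in> tpow J m"
proof (rule lin_tpow_closed[OF lin_hgen x])
  fix f assume f: "f \<in> words (wtI J) m"
  show "hgen i (monomial f) \<in> tpow J m"
  proof (cases "i = 0")
    case True
    then obtain a g where "f = a # g" using f i by (cases f) (auto simp: words_def)
    then show ?thesis using True f sym by (auto simp: hgen_0 words_def)
  next
    case False
    then obtain us a b vs where *: "f = us @ a # b # vs" "i = Suc (length us)"
      using split_pos[OF f, of i] i by (metis One_nat_def Suc_leI neq0_conv)
    show ?thesis
      unfolding * using f by (subst hgen_pos[OF refl]) (auto simp: * hswap_def words_def)
  qed
qed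

lemma hgen_quadratic:
  assumes "1 \<le> i" "i < m" "x \<in> tpow J m"
  shows "hgen i (hgen i x) = const (inverse q - q) * hgen i x + x"
proof (rule lin_eq_tpow[OF _ _ assms(3)])
  fix f assume "f \<in> words (wtI J) m"
  then obtain us a b vs where *: "f = us @ a # b # vs" "i = Suc (length us)" by (rule split_pos[OF _ assms(1,2)])
  show "hgen i (hgen i (monomial f)) = const (inverse q - q) * hgen i (monomial f) + monomial f"
    unfolding * hgen_pos[OF refl]
    by (cases a b rule: linorder_cases; simp add: hswap_def hgen_simps hgen_pos;
        rule poly_mapping_eqI; simp add: lookup_add lookup_minus; simp add: field_simps)
qed (intro lin_hgen_intros)+

text \<open>Only the relative order of three neighbouring letters matters; in each case both sides
  are the same combination of words with Laurent polynomials in \<open>q\<close> as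
  coefficients.\<close>

lemma hgen_braid:
  assumes "1 \<le> i" "i + 1 < m" "x \<in> tpow J m"
  shows "hgen i (hgen (i + 1) (hgen i x)) = hgen (i + 1) (hgen i (hgen (i + 1) x))"
proof (rule lin_eq_tpow[OF _ _ assms(3)])
  fix f assume f: "f \<in> words (wtI J) m"
  then obtain us a b vs' where 1: "f = us @ a # b # vs'" "i = Suc (length us)"
    by (rule split_pos[of f _ m i]) (use assms in auto)
  then have "length vs' > 0" using f assms by (auto simp: words_def)
  then obtain c vs where 2: "f = us @ a # b # c # vs" using 1 by (cases vs') auto
  have lo: "hgen i (monomial (us @ a # b # c # vs)) = hswap us a b (c # vs)" for a b c
    using hgen_pos[OF 1(2)] by simp
  have hi: "hgen (i + 1) (monomial (us @ a # b # c # vs)) = hswap (us @ [a]) b c vs" for a b c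
    using hgen_Suc_pos[OF 1(2)] by simp
  show "hgen i (hgen (i + 1) (hgen i (monomial f))) = hgen (i + 1) (hgen i (hgen (i + 1) (monomial f)))"
    unfolding 2 lo hi
    by (cases a b rule: linorder_cases; cases b c rule: linorder_cases; cases a c rule: linorder_cases;
        simp add: hswap_def hgen_simps lo hi[simplified] const_mult_left distrib_left;
        (rule poly_mapping_eqI; simp add: lookup_add lookup_minus; simp add: field_simps)?)
qed (intro lin_hgen_intros)+

lemma hgen_commute_lt:
  assumes "1 \<le> i" "i + 1 < j" "j < m" "x \<in> tpow J m"
  shows "hgen i (hgen j x) = hgen j (hgen i x)"
proof (rule lin_eq_tpow[OF _ _ assms(4)])
  fix f assume f: "f \<in> words (wtI J) m"
  obtain us' c d vs where 1: "f = us' @ c # d # vs" "j = Suc (length us')"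
    by (rule split_pos[OF f, of j]) (use assms in auto)
  have "us' \<in> words UNIV (length us')" by (simp add: words_def)
  then obtain us a b ws where 2: "us' = us @ a # b # ws" "i = Suc (length us)"
    by (rule split_pos[of us' _ _ i]) (use assms 1 in auto)
  have f2: "f = us @ a # b # ws @ c # d # vs" using 1 2 by simp
  have lo: "hgen i (monomial (us @ a # b # ws @ c # d # vs)) = hswap us a b (ws @ c # d # vs)" for a b c d
    using hgen_pos[OF 2(2)] by simp
  have hi: "hgen j (monomial (us @ a # b # ws @ c # d # vs)) = hswap (us @ a # b # ws) c d vs" for a b c d
    using hgen_pos[of j "us @ a # b # ws" c d vs] 1 2 by simp
  show "hgen i (hgen j (monomial f)) = hgen j (hgen i (monomial f))"
    unfolding f2
    by (cases a b rule: linorder_cases; cases c d rule: linorder_cases;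
        simp add: lo hi hswap_def hgen_simps const_mult_left distrib_left mult.commute)
qed (intro lin_hgen_intros)+

lemma hgen_commute:
  assumes "1 \<le> i" "1 \<le> j" "i < m" "j < m" "\<bar>int i - int j\<bar> > 1" "x \<in> tpow J m"
  shows "hgen i (hgen j x) = hgen j (hgen i x)"
  using hgen_commute_lt[of i j m x J] hgen_commute_lt[of j i m x J] assms by (cases "i < j") auto

lemma hgen_0_0:
  assumes "1 \<le> m" "x \<in> tpow J m" shows "hgen 0 (hgen 0 x) = x"
proof (rule lin_eq_tpow[OF _ _ assms(2)])
  fix f assume "f \<in> words (wtI J) m"
  then obtain a g where "f = a # g" using assms(1) by (cases f) (auto simp: words_def)
  then show "hgen 0 (hgen 0 (monomial f)) = monomial f" by (simp add: hgen_0)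
qed (intro lin_hgen_intros)+

lemma hgen_0_commute:
  assumes "1 < i" "i < m" "x \<in> tpow J m" shows "hgen 0 (hgen i x) = hgen i (hgen 0 x)"
proof (rule lin_eq_tpow[OF _ _ assms(3)])
  fix f assume f: "f \<in> words (wtI J) m"
  obtain us' a b vs where 1: "f = us' @ a # b # vs" "i = Suc (length us')"
    by (rule split_pos[OF f, of i]) (use assms in auto)
  then obtain c us where 2: "us' = c # us" using assms by (cases us') auto
  have hi: "hgen i (monomial (c # us @ a # b # vs)) = hswap (c # us) a b vs" for a b c
    using hgen_pos[of i "c # us" a b vs] 1 2 by simp
  have f2: "f = c # us @ a # b # vs" using 1 2 by simp
  show "hgen 0 (hgen i (monomial f)) = hgen i (hgen 0 (monomial f))"
    unfolding f2 by (simp add: hi hgen_0) (simp add: hswap_def hgen_simps hgen_0)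
qed (intro lin_hgen_intros)+

text \<open>Only signed arrangements of the first two letters \<open>a\<close>, \<open>b\<close>
  occur, and every comparison of neighbours in them amounts to comparing \<open>a\<close> with
  \<open>b\<close> or \<open>a\<close> with \<open>- b\<close>.\<close>

lemma hgen_0_braid:
  assumes "1 < m" "x \<in> tpow J m"
  shows "hgen 1 (hgen 0 (hgen 1 (hgen 0 x))) = hgen 0 (hgen 1 (hgen 0 (hgen 1 x)))"
proof (rule lin_eq_tpow[OF _ _ assms(2)])
  fix f assume f: "f \<in> words (wtI J) m"
  obtain us' a b vs where 1: "f = us' @ a # b # vs" "1 = Suc (length us')"
    by (rule split_pos[OF f, of 1]) (use assms in auto)
  have h1: "hgen (Suc 0) (monomial (a # b # vs)) = hswap [] a b vs" for a b
    using hgen_pos[of "Suc 0" "[]" a b vs] by simp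
  have neg: "- x < y \<longleftrightarrow> - y < x" "x < - y \<longleftrightarrow> y < - x" "- x = y \<longleftrightarrow> x = - y" for x y :: rat by auto
  have c: "a < - b \<Longrightarrow> b < - a \<and> \<not> - a < b \<and> \<not> - b < a \<and> a \<noteq> - b \<and> - a \<noteq> b \<and> b \<noteq> - a \<and> - b \<noteq> a"
    "a = - b \<Longrightarrow> b = - a \<and> - a = b \<and> - b = a \<and> \<not> - a < b \<and> \<not> - b < a \<and> \<not> b < - a \<and> \<not> a < - b"
    "- b < a \<Longrightarrow> \<not> b < - a \<and> - a < b \<and> \<not> a < - b \<and> a \<noteq> - b \<and> - a \<noteq> b \<and> b \<noteq> - a \<and> - b \<noteq> a"
    by auto
  have f: "f = a # b # vs" using 1 by simp
  consider "a < - b" | "a = - b" | "- b < a" by linarith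
  then show "hgen 1 (hgen 0 (hgen 1 (hgen 0 (monomial f)))) = hgen 0 (hgen 1 (hgen 0 (hgen 1 (monomial f))))"
  proof cases
    case 1
    with c(1)[OF 1] show ?thesis
      unfolding f by (cases a b rule: linorder_cases; simp add: h1 hgen_0 hswap_def hgen_simps const_mult_left distrib_left mult.commute[of "inverse q" "inverse q - q"];
          (rule poly_mapping_eqI; simp add: lookup_add lookup_minus; simp add: field_simps)?)
  next
    case 2
    show ?thesis unfolding f 2
      by (cases "- b" b rule: linorder_cases; simp add: h1 hgen_0 hswap_def hgen_simps const_mult_left distrib_left mult.commute[of "inverse q" "inverse q - q"];
          (rule poly_mapping_eqI; simp add: lookup_add lookup_minus; simp add: field_simps)?)
  next
    case 3
    with c(3)[OF 3] show ?thesis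
      unfolding f by (cases a b rule: linorder_cases; simp add: h1 hgen_0 hswap_def hgen_simps const_mult_left distrib_left mult.commute[of "inverse q" "inverse q - q"];
          (rule poly_mapping_eqI; simp add: lookup_add lookup_minus; simp add: field_simps)?)
  qed
qed (intro lin_hgen_intros)+

lemma presentation_H: "m \<ge> 1 \<Longrightarrow> presentation {..<m} (Hrels m)"
  unfolding Hrels_def by unfold_locales (intro Un_least; clarify?; simp split: if_splits)

lemma ract_Hrels:
  assumes m: "m \<ge> 1" and a: "a \<in> Hrels m" and x: "x \<in> tpow J m"
  shows "ract hgen x a = 0"
proof -
  note simps = ract_simps ract_mult[OF lin_hgen] hgen_simps
  from a consider "a = var 0 * var 0 - 1"
    | i where "1 \<le> i" "i < m" "a = (var i - const (inverse q)) * (var i + const q)"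
    | i where "1 \<le> i" "i + 1 < m" "a = var i * var (i+1) * var i - var (i+1) * var i * var (i+1)"
    | i j where "1 \<le> i" "i < m" "1 \<le> j" "j < m" "\<bar>int i - int j\<bar> > 1" "a = var i * var j - var j * var i"
    | "1 < m" "a = var 0 * var 1 * var 0 * var 1 - var 1 * var 0 * var 1 * var 0"
    | i where "1 < i" "i < m" "a = var 0 * var i - var i * var 0"
    unfolding Hrels_def by (auto split: if_splits)
  then show ?thesis
  proof cases
    case 1
    then show ?thesis using hgen_0_0[OF m x] by (simp add: simps)
  next
    case (2 i)
    have "ract hgen x a = hgen i (hgen i x) - const (inverse q) * hgen i x + const q * (hgen i x - const (inverse q) * x)"
      using 2 by (simp add: simps)
    also have "\<dots> = 0"
      unfolding hgen_quadratic[OF 2(1,2) x]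
      by (rule poly_mapping_eqI) (simp add: lookup_add lookup_minus, simp add: field_simps)
    finally show ?thesis .
  next
    case (3 i)
    then show ?thesis using hgen_braid[OF 3(1,2) x] by (simp add: simps)
  next
    case (4 i j)
    then show ?thesis using hgen_commute[OF 4(1,3,2,4,5) x] by (simp add: simps)
  next
    case 5
    then show ?thesis using hgen_0_braid[OF 5(1) x] by (simp add: simps)
  next
    case (6 i)
    then show ?thesis using hgen_0_commute[OF 6(1,2) x] by (simp add: simps)
  qed
qed

lemma hact_hcls:
  assumes m: "m \<ge> 1" and sym: "\<And>a. a \<in> wtI J \<Longrightarrow> - a \<in> wtI J" and x: "x \<in> tpow J m"
  shows "hact x (hcls m a) = ract hgen x a"
  unfolding hact_def hcls_def
proof (rule presentation.the_elem_pclass[OF presentation_H[OF m]])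
  have closed: "hgen i y \<in> tpow J m" if "i \<in> {..<m}" "y \<in> tpow J m" for i y
    using that sym by (intro hgen_closed) auto
  show "ract hgen x b = 0" if "b \<in> genideal (free_algebra {..<m}) (Hrels m)" for b
    by (rule presentation.ract_I[where V = "tpow J m",
          OF presentation_H[OF m] lin_hgen closed tpow_0 tpow_add tpow_const_mult ract_Hrels[OF m] that x])
qed (rule ract_add)

lemma carrier_HB: "m \<ge> 1 \<Longrightarrow> carrier (HB m) = hcls m ` carrier (free_algebra {..<m})"
  by (simp add: HB_def presentation.carrier_presented[OF presentation_H] hcls_def[abs_def])

section \<open>The commuting actions\<close>

lemma hgen_shift:
  assumes v: "v \<in> tpow J (Suc 0)" and y: "y \<in> tpow J m" and j: "1 \<le> j" "j < m"
  shows "hgen (Suc j) (v * y) = v * hgen j y"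
proof (rule lin_eq_tpow[OF _ _ y])
  show "lin (\<lambda>y. hgen (Suc j) (v * y))" by (rule lin_compose[OF lin_hgen]) (intro lin_intros)
  show "lin (\<lambda>y. v * hgen j y)" by (intro lin_hgen_intros)
  fix f assume f: "f \<in> words (wtI J) m"
  obtain us a b vs where *: "f = us @ a # b # vs" "j = Suc (length us)" by (rule split_pos[OF f j])
  show "hgen (Suc j) (v * monomial f) = v * hgen j (monomial f)"
  proof (rule lin_eq_tpow[OF _ _ v])
    show "lin (\<lambda>v. hgen (Suc j) (v * monomial f))" by (rule lin_compose[OF lin_hgen]) (intro lin_intros)
    show "lin (\<lambda>v. v * hgen j (monomial f))" by (intro lin_intros)
    fix g assume "g \<in> words (wtI J) (Suc 0)"
    then obtain c where c: "g = [c]" by (rule words_1_cases)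
    have "hgen (Suc j) (monomial ((c # us) @ a # b # vs)) = hswap (c # us) a b vs"
      using * by (intro hgen_pos) simp
    moreover have "hgen j (monomial f) = hswap us a b vs" using * by (simp add: hgen_pos)
    ultimately show "hgen (Suc j) (monomial g * monomial f) = monomial g * hgen j (monomial f)"
      by (simp add: c * hswap_def distrib_left mult_const_left flip: monomial_append)
  qed
qed

lemma hgen_0_mult:
  assumes v: "v \<in> tpow J (Suc 0)"
  shows "hgen 0 (v * y) = hgen 0 v * y"
proof (rule lin_eqI[where x = y])
  show "lin (\<lambda>y. hgen 0 (v * y))" by (rule lin_compose[OF lin_hgen]) (intro lin_intros)
  show "lin (\<lambda>y. hgen 0 v * y)" by (intro lin_intros)
  fix w
  show "hgen 0 (v * monomial (letters w)) = hgen 0 v * monomial (letters w)"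
  proof (rule lin_eq_tpow[OF _ _ v])
    show "lin (\<lambda>v. hgen 0 (v * monomial (letters w)))" by (rule lin_compose[OF lin_hgen]) (intro lin_intros)
    show "lin (\<lambda>v. hgen 0 v * monomial (letters w))" by (intro lin_hgen_intros)
    fix g assume "g \<in> words (wtI J) (Suc 0)"
    then obtain c where "g = [c]" by (rule words_1_cases)
    then show "hgen 0 (monomial g * monomial (letters w)) = hgen 0 (monomial g) * monomial (letters w)"
      by (simp add: hgen_0 flip: monomial_append)
  qed
qed

lemma hgen_1_mult:
  assumes z: "z \<in> tpow J (Suc (Suc 0))"
  shows "hgen (Suc 0) (z * y) = hgen (Suc 0) z * y"
proof (rule lin_eqI[where x = y])
  show "lin (\<lambda>y. hgen (Suc 0) (z * y))" by (rule lin_compose[OF lin_hgen]) (intro lin_intros)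
  show "lin (\<lambda>y. hgen (Suc 0) z * y)" by (intro lin_intros)
  fix w
  show "hgen (Suc 0) (z * monomial (letters w)) = hgen (Suc 0) z * monomial (letters w)"
  proof (rule lin_eq_tpow[OF _ _ z])
    show "lin (\<lambda>z. hgen (Suc 0) (z * monomial (letters w)))" by (rule lin_compose[OF lin_hgen]) (intro lin_intros)
    show "lin (\<lambda>z. hgen (Suc 0) z * monomial (letters w))" by (intro lin_hgen_intros)
    fix g assume "g \<in> words (wtI J) (Suc (Suc 0))"
    then obtain a b where g: "g = [a, b]" by (auto elim!: words_Suc_cases)
    show "hgen (Suc 0) (monomial g * monomial (letters w)) = hgen (Suc 0) (monomial g) * monomial (letters w)"
      using hgen_pos[of "Suc 0" "[]" a b "letters w"] hgen_pos[of "Suc 0" "[]" a b "[]"]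
      by (simp add: g hswap_def distrib_right mult.assoc flip: monomial_append)
  qed
qed

lemma hgen_1_var:
  "hgen (Suc 0) (var a * var b) = (if a = b then const (inverse q) * (var a * var b)
     else if a < b then var b * var a else var b * var a + const (inverse q - q) * (var a * var b))"
  using hgen_pos[of "Suc 0" "[]" a b "[]"] by (simp add: hswap_def flip: monomial_append)

text \<open>\<open>n\<close> is the number of simple roots: \<open>2 * r\<close> for
  \<open>II_A r\<close> and \<open>2 * r + 1\<close> for \<open>II_B r\<close>. The indices of the
  natural module run from \<open>- n / 2\<close> to \<open>n / 2\<close>, and 0 belongs to
  \<open>J\<close> exactly for odd \<open>n\<close>, which treats both cases at once.\<close>

locale weight_index =
  fixes J :: "rat set" and n :: nat
  assumes J_eq: "J = (\<lambda>k. of_nat k - of_nat n / 2 + 1/2) ` {..<n}" and n: "n \<ge> 1"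
begin

lemma wtI_eq: "wtI J = (\<lambda>k. of_nat k - of_nat n / 2) ` {..n}"
proof -
  have "(\<lambda>a. a - 1/2) ` J = (\<lambda>k. of_nat k - of_nat n / 2) ` {..<n}"
    unfolding J_eq image_image by simp
  moreover have "(\<lambda>a. a + 1/2) ` J = (\<lambda>k. of_nat k - of_nat n / 2) ` Suc ` {..<n}"
    unfolding J_eq image_image by (rule image_cong) simp_all
  ultimately have "wtI J = (\<lambda>k. of_nat k - of_nat n / 2) ` ({..<n} \<union> Suc ` {..<n})"
    by (simp only: wtI_def image_Un)
  also have "{..<n} \<union> Suc ` {..<n} = {..n}"
  proof
    show "{..n} \<subseteq> {..<n} \<union> Suc ` {..<n}"
    proof
      fix x assume "x \<in> {..n}"
      then show "x \<in> {..<n} \<union> Suc ` {..<n}" using n by (cases x) auto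
    qed
  qed auto
  finally show ?thesis .
qed

lemma wtI_cases: assumes "a \<in> wtI J" obtains k where "k \<le> n" "a = of_nat k - of_nat n / 2"
  using assms by (auto simp: wtI_eq)

lemma J_cases: assumes "i \<in> J" obtains k where "k < n" "i = of_nat k - of_nat n / 2 + 1/2"
  using assms by (auto simp: J_eq)

lemma J_minus: assumes "i \<in> J" shows "- i \<in> J"
proof -
  obtain k where k: "k < n" "i = of_nat k - of_nat n / 2 + 1/2" using assms by (rule J_cases)
  then have "- i = of_nat (n - Suc k) - of_nat n / 2 + 1/2" by (simp add: of_nat_diff)
  moreover have "n - Suc k \<in> {..<n}" using k by simp
  ultimately show ?thesis unfolding J_eq by (rule image_eqI)
qed

lemma wtI_uminus: assumes "a \<in> wtI J" shows "- a \<in> wtI J"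
  using assms unfolding wtI_def using J_minus
proof (elim UnE imageE)
  fix i assume "a = i - 1/2" "i \<in> J"
  then have "- a = - i + 1/2" "- i \<in> J" using J_minus by simp_all
  then show "- a \<in> (\<lambda>a. a - 1/2) ` J \<union> (\<lambda>a. a + 1/2) ` J" by blast
next
  fix i assume "a = i + 1/2" "i \<in> J"
  then have "- a = - i - 1/2" "- i \<in> J" using J_minus by simp_all
  then show "- a \<in> (\<lambda>a. a - 1/2) ` J \<union> (\<lambda>a. a + 1/2) ` J" by blast
qed

sublocale symmetric_index J
  by unfold_locales (rule J_minus)

lemma finite_wtI: "finite (wtI J)"
  by (simp add: wtI_eq)

text \<open>Weights differ by integers, so that none lies strictly between \<open>i - 1/2\<close>
  and \<open>i + 1/2\<close>.\<close>

lemma wt_cases: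
  assumes "a \<in> wtI J" "i \<in> J"
  obtains "a = i + 1/2" | "a = i - 1/2" | "a < i - 1/2" "a < i + 1/2" | "i + 1/2 < a" "i - 1/2 < a"
proof -
  obtain k where k: "a = of_nat k - of_nat n / 2" using assms(1) by (rule wtI_cases)
  obtain l where l: "i = of_nat l - of_nat n / 2 + 1/2" using assms(2) by (rule J_cases)
  consider "k = Suc l" | "k = l" | "k < l" | "Suc l < k" by linarith
  then show thesis
  proof cases
    case 1
    then have "a = i + 1/2" unfolding k l by simp
    then show thesis by (rule that)
  next
    case 2
    then have "a = i - 1/2" unfolding k l by simp
    then show thesis by (rule that)
  next
    case 3
    then have "(of_nat k :: rat) < of_nat l" by simp
    then have "a < i - 1/2" "a < i + 1/2" unfolding k l by linarith+
    then show thesis by (rule that)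
  next
    case 4
    then have "(of_nat (Suc l) :: rat) < of_nat k" by (simp only: of_nat_less_iff)
    then have "i + 1/2 < a" "i - 1/2 < a" unfolding k l by simp_all
    then show thesis by (rule that)
  qed
qed

text \<open>The case of two tensor factors. Each letter is one of the two indices moved by the root
  \<open>i\<close>, or lies below both or above both, and these cases are computed.\<close>

lemma nat_rep_hgen_commute:
  assumes g: "g \<in> Ugens J" and z: "z \<in> tpow J (Suc (Suc 0))"
  shows "tpow_rep (Suc (Suc 0)) g (hgen (Suc 0) z) = hgen (Suc 0) (tpow_rep (Suc (Suc 0)) g z)"
proof (rule lin_eq_tpow[OF _ _ z])
  show "lin (\<lambda>z. tpow_rep (Suc (Suc 0)) g (hgen (Suc 0) z))" by (rule lin_compose[OF lin_tpow_rep lin_hgen])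
  show "lin (\<lambda>z. hgen (Suc 0) (tpow_rep (Suc (Suc 0)) g z))" by (rule lin_compose[OF lin_hgen lin_tpow_rep])
  fix f assume "f \<in> words (wtI J) (Suc (Suc 0))"
  then obtain a b where f: "f = [a, b]" and ab: "a \<in> wtI J" "b \<in> wtI J" by (auto elim!: words_Suc_cases)
  have mono: "monomial f = var a * var b" by (simp add: f flip: monomial_append)
  obtain i where i: "i \<in> J" "g = GE i \<or> g = GF i \<or> g = GK i \<or> g = GKinv i"
    using g by (auto simp: Ugens_def)
  define p n where "p = i + 1/2" and "n = i - 1/2"
  have E: "nat_rep (GE i) (var p) = var n" "\<And>c. c \<noteq> p \<Longrightarrow> nat_rep (GE i) (var c) = 0"
    unfolding p_def n_def by (simp_all only: nat_rep_var nat_basis_E not_False_eq_True)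
  have F: "nat_rep (GF i) (var n) = var p" "\<And>c. c \<noteq> n \<Longrightarrow> nat_rep (GF i) (var c) = 0"
    unfolding p_def n_def by (simp_all only: nat_rep_var nat_basis_F not_False_eq_True)
  have np: "n < p" by (simp add: n_def p_def)
  have K: "nat_rep (GK i) (var p) = const (inverse q) * var p" "nat_rep (GK i) (var n) = const q * var n"
    "\<And>c. c \<noteq> n \<Longrightarrow> c \<noteq> p \<Longrightarrow> nat_rep (GK i) (var c) = var c"
    "nat_rep (GKinv i) (var p) = const q * var p" "nat_rep (GKinv i) (var n) = const (inverse q) * var n"
    "\<And>c. c \<noteq> n \<Longrightarrow> c \<noteq> p \<Longrightarrow> nat_rep (GKinv i) (var c) = var c"
    using np by (simp_all add: form_alpha_eps power_int_minus flip: n_def p_def)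
  have T: "tpow_rep (Suc (Suc 0)) (GE i) (var c * y) = var c * nat_rep (GE i) y + nat_rep (GE i) (var c) * nat_rep (GKinv i) y"
    "tpow_rep (Suc (Suc 0)) (GF i) (var c * y) = nat_rep (GF i) (var c) * y + nat_rep (GK i) (var c) * nat_rep (GF i) y"
    "tpow_rep (Suc (Suc 0)) (GK i) (var c * y) = nat_rep (GK i) (var c) * nat_rep (GK i) y"
    "tpow_rep (Suc (Suc 0)) (GKinv i) (var c * y) = nat_rep (GKinv i) (var c) * nat_rep (GKinv i) y"
    if "c \<in> wtI J" for c y
    using tpow_rep_mult[of "var c" J 0 i y] that by simp_all
  note T_simps = lin_add[OF lin_tpow_rep] lin_diff[OF lin_tpow_rep] lin_scale[OF lin_tpow_rep] lin_0[OF lin_tpow_rep]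
  have wt_pn: "p \<in> wtI J" "n \<in> wtI J" using i(1) by (simp_all add: p_def n_def)
  note simps = T[OF ab(1)] T[OF ab(2)] T[OF wt_pn(1)] T[OF wt_pn(2)] T_simps E F K hgen_1_var hgen_simps nat_simps distrib_left const_mult_left
    mult_const_left[of "var _"] mult.assoc[of "const _"] np[THEN less_imp_neq] np[THEN less_imp_neq, symmetric]
    np[THEN less_not_sym]
  have wt: "c = p \<or> c = n \<or> (c < n \<and> c < p \<and> c \<noteq> n \<and> c \<noteq> p \<and> n \<noteq> c \<and> p \<noteq> c \<and> \<not> n < c \<and> \<not> p < c) \<or>
      (n < c \<and> p < c \<and> c \<noteq> n \<and> c \<noteq> p \<and> n \<noteq> c \<and> p \<noteq> c \<and> \<not> c < n \<and> \<not> c < p)" if "c \<in> wtI J" for c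
    using wt_cases[OF that i(1)] unfolding p_def n_def by fastforce
  have "tpow_rep (Suc (Suc 0)) (GE i) (hgen (Suc 0) (monomial f)) = hgen (Suc 0) (tpow_rep (Suc (Suc 0)) (GE i) (monomial f))"
    unfolding mono using wt[OF ab(1)] wt[OF ab(2)]
    apply (elim disjE conjE)
                   apply (simp_all add: simps np del: nat_rep_var tpow_rep.simps)
    apply ((rule poly_mapping_eqI; simp add: lookup_add lookup_minus; simp add: field_simps)+)?
    done
  moreover have "tpow_rep (Suc (Suc 0)) (GF i) (hgen (Suc 0) (monomial f)) = hgen (Suc 0) (tpow_rep (Suc (Suc 0)) (GF i) (monomial f))"
    unfolding mono using wt[OF ab(1)] wt[OF ab(2)]
    apply (elim disjE conjE)
                   apply (simp_all add: simps np del: nat_rep_var tpow_rep.simps)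
    apply ((rule poly_mapping_eqI; simp add: lookup_add lookup_minus; simp add: field_simps)+)?
    done
  moreover have "tpow_rep (Suc (Suc 0)) (GK i) (hgen (Suc 0) (monomial f)) = hgen (Suc 0) (tpow_rep (Suc (Suc 0)) (GK i) (monomial f))"
    unfolding mono using wt[OF ab(1)] wt[OF ab(2)]
    apply (elim disjE conjE)
                   apply (simp_all add: simps np del: nat_rep_var tpow_rep.simps)
    apply ((rule poly_mapping_eqI; simp add: lookup_add lookup_minus; simp add: field_simps)+)?
    done
  moreover have "tpow_rep (Suc (Suc 0)) (GKinv i) (hgen (Suc 0) (monomial f)) = hgen (Suc 0) (tpow_rep (Suc (Suc 0)) (GKinv i) (monomial f))"
    unfolding mono using wt[OF ab(1)] wt[OF ab(2)]
    apply (elim disjE conjE)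
                   apply (simp_all add: simps np del: nat_rep_var tpow_rep.simps)
    apply ((rule poly_mapping_eqI; simp add: lookup_add lookup_minus; simp add: field_simps)+)?
    done
  ultimately show "tpow_rep (Suc (Suc 0)) g (hgen (Suc 0) (monomial f)) = hgen (Suc 0) (tpow_rep (Suc (Suc 0)) g (monomial f))"
    using i(2) by auto
qed

lemma hgen_closed': "i < m \<Longrightarrow> x \<in> tpow J m \<Longrightarrow> hgen i x \<in> tpow J m"
  using hgen_closed wtI_uminus by blast

text \<open>Coassociativity: the first two factors are split off together, as needed for H_1, which
  acts on both.\<close>

lemma tpow_rep_mult_2:
  assumes z: "z \<in> tpow J (Suc (Suc 0))"
  shows "tpow_rep (Suc (Suc (Suc m))) (GE i) (z * y) = z * tpow_rep (Suc m) (GE i) y + tpow_rep (Suc (Suc 0)) (GE i) z * tpow_rep (Suc m) (GKinv i) y"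
    "tpow_rep (Suc (Suc (Suc m))) (GF i) (z * y) = tpow_rep (Suc (Suc 0)) (GF i) z * y + tpow_rep (Suc (Suc 0)) (GK i) z * tpow_rep (Suc m) (GF i) y"
    "tpow_rep (Suc (Suc (Suc m))) (GK i) (z * y) = tpow_rep (Suc (Suc 0)) (GK i) z * tpow_rep (Suc m) (GK i) y"
    "tpow_rep (Suc (Suc (Suc m))) (GKinv i) (z * y) = tpow_rep (Suc (Suc 0)) (GKinv i) z * tpow_rep (Suc m) (GKinv i) y"
proof -
  note lin = lin_intros lin_tpow_rep lin_compose[OF lin_tpow_rep]
  show "tpow_rep (Suc (Suc (Suc m))) (GE i) (z * y) = z * tpow_rep (Suc m) (GE i) y + tpow_rep (Suc (Suc 0)) (GE i) z * tpow_rep (Suc m) (GKinv i) y"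
    by (rule lin_eq_tpow_Suc[OF _ _ z]; (intro lin)?)
      (simp add: tpow_rep_mult[where J = J] mult.assoc distrib_left distrib_right add.assoc del: tpow_rep.simps(3))
  show "tpow_rep (Suc (Suc (Suc m))) (GF i) (z * y) = tpow_rep (Suc (Suc 0)) (GF i) z * y + tpow_rep (Suc (Suc 0)) (GK i) z * tpow_rep (Suc m) (GF i) y"
    by (rule lin_eq_tpow_Suc[OF _ _ z]; (intro lin)?)
      (simp add: tpow_rep_mult[where J = J] mult.assoc distrib_left distrib_right add.assoc del: tpow_rep.simps(3))
  show "tpow_rep (Suc (Suc (Suc m))) (GK i) (z * y) = tpow_rep (Suc (Suc 0)) (GK i) z * tpow_rep (Suc m) (GK i) y"
    by (rule lin_eq_tpow_Suc[OF _ _ z]; (intro lin)?)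
      (simp add: tpow_rep_mult[where J = J] mult.assoc del: tpow_rep.simps(3))
  show "tpow_rep (Suc (Suc (Suc m))) (GKinv i) (z * y) = tpow_rep (Suc (Suc 0)) (GKinv i) z * tpow_rep (Suc m) (GKinv i) y"
    by (rule lin_eq_tpow_Suc[OF _ _ z]; (intro lin)?)
      (simp add: tpow_rep_mult[where J = J] mult.assoc del: tpow_rep.simps(3))
qed

text \<open>For \<open>j > 1\<close> the first factor is split off and H_j acts on the rest; for
  \<open>j = 1\<close> the first two factors are split off, which reduces to
  \<open>nat_rep_hgen_commute\<close>.\<close>

lemma tpow_rep_hgen_commute:
  assumes "g \<in> Ugens J" "1 \<le> j" "j < m" "x \<in> tpow J m"
  shows "tpow_rep m g (hgen j x) = hgen j (tpow_rep m g x)"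
  using assms
proof (induct m arbitrary: g j x)
  case (Suc m)
  obtain i where i: "i \<in> J" and g: "g = GE i \<or> g = GF i \<or> g = GK i \<or> g = GKinv i"
    using Suc(2) by (auto simp: Ugens_def)
  have gens: "GE i \<in> Ugens J" "GF i \<in> Ugens J" "GK i \<in> Ugens J" "GKinv i \<in> Ugens J" using i by simp_all
  have m: "m \<ge> 1" using Suc by simp
  then obtain m' where m': "m = Suc m'" by (cases m) auto
  interpret qmodule J m "tpow_rep m" by (rule qmodule_tpow_rep[OF m])
  interpret N: qmodule J "Suc 0" nat_rep by (rule qmodule_nat_rep)
  have lin1: "lin (\<lambda>x. tpow_rep (Suc m) g (hgen j x))" by (rule lin_compose[OF lin_tpow_rep lin_hgen])
  have lin2: "lin (\<lambda>x. hgen j (tpow_rep (Suc m) g x))" by (rule lin_compose[OF lin_hgen lin_tpow_rep])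
  show ?case
  proof (cases "j = 1")
    case False
    then obtain k where k: "j = Suc k" "1 \<le> k" "k < m" using Suc by (cases j) auto
    show ?thesis
    proof (rule lin_eq_tpow_Suc[OF lin1 lin2 Suc(5)])
      fix v y assume v: "v \<in> tpow J (Suc 0)" and y: "y \<in> tpow J m"
      have IH: "tpow_rep m g (hgen k y) = hgen k (tpow_rep m g y)" if "g \<in> Ugens J" for g
        using Suc(1)[OF that k(2,3) y] .
      have hy: "hgen k y \<in> tpow J m" by (rule hgen_closed'[OF k(3) y])
      note shift = hgen_shift[OF _ _ k(2,3), where J = J]
      note T = tpow_rep_mult[of _ J m', folded m']
      show "tpow_rep (Suc m) g (hgen j (v * y)) = hgen j (tpow_rep (Suc m) g (v * y))"
        using g v y hy i
        by (elim disjE) (simp_all add: k(1) shift T IH hgen_simps closed' N.closed' del: tpow_rep.simps(3))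
    qed
  next
    case True
    show ?thesis
    proof (cases m')
      case 0
      then show ?thesis using nat_rep_hgen_commute[OF Suc(2)] Suc(5) True by (simp add: m' del: tpow_rep.simps)
    next
      case (Suc m'')
      show ?thesis
      proof (rule lin_eq_tpow_Suc[OF lin1 lin2 Suc.prems(4)])
        fix v y assume v: "v \<in> tpow J (Suc 0)" and y: "y \<in> tpow J m"
        show "tpow_rep (Suc m) g (hgen j (v * y)) = hgen j (tpow_rep (Suc m) g (v * y))"
        proof (rule lin_eq_tpow_Suc[OF _ _ y[unfolded m']])
          show "lin (\<lambda>y. tpow_rep (Suc m) g (hgen j (v * y)))"
            by (rule lin_compose[OF lin_tpow_rep lin_compose[OF lin_hgen]]) (intro lin_intros)
          show "lin (\<lambda>y. hgen j (tpow_rep (Suc m) g (v * y)))"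
            by (rule lin_compose[OF lin_hgen lin_compose[OF lin_tpow_rep]]) (intro lin_intros)
          fix w y assume w: "w \<in> tpow J (Suc 0)" and y: "y \<in> tpow J m'"
          define z where "z = v * w"
          have z: "z \<in> tpow J (Suc (Suc 0))" using v w by (simp add: z_def)
          have hz: "hgen (Suc 0) z \<in> tpow J (Suc (Suc 0))" using hgen_closed'[OF _ z] by simp
          interpret T2: qmodule J "Suc (Suc 0)" "tpow_rep (Suc (Suc 0))" by (rule qmodule_tpow_rep) simp
          have "tpow_rep (Suc (Suc (Suc m''))) g (hgen (Suc 0) (z * y)) = hgen (Suc 0) (tpow_rep (Suc (Suc (Suc m''))) g (z * y))"
            using g i z hz
            by (elim disjE) (simp_all add: hgen_1_mult[where J = J] tpow_rep_mult_2 nat_rep_hgen_commute hgen_simps T2.closed' del: tpow_rep.simps)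
          then show "tpow_rep (Suc m) g (hgen j (v * (w * y))) = hgen j (tpow_rep (Suc m) g (v * (w * y)))"
            by (simp only: z_def mult.assoc True m' Suc One_nat_def)
        qed
      qed
    qed
  qed
qed simp

end

context weight_index
begin

section \<open>The generators of the coideal subalgebra on the natural module, and the flip\<close>

lemma nat_rep_GK: "nat_rep (GK i) (var a) = const (q powi (of_bool (a = i - 1/2) - of_bool (a = i + 1/2))) * var a"
  and nat_rep_GKinv: "nat_rep (GKinv i) (var a) = const (q powi (of_bool (a = i + 1/2) - of_bool (a = i - 1/2))) * var a"
  by (simp_all only: nat_rep_var nat_basis.simps form_alpha_eps minus_diff_eq)

lemma nat_rep_GE: "nat_rep (GE i) (var a) = (if a = i + 1/2 then var (i - 1/2) else 0)"
  and nat_rep_GF: "nat_rep (GF i) (var a) = (if a = i - 1/2 then var (i + 1/2) else 0)"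
  by (cases "a = i + 1/2", simp_all only: nat_rep_var nat_basis_E not_False_eq_True if_True if_False simp_thms)
    (cases "a = i - 1/2", simp_all only: nat_rep_var nat_basis_F not_False_eq_True if_True if_False simp_thms)

lemma hgen_0_var: "hgen 0 (var a) = var (- a)"
  using hgen_0[of a "[]"] by simp

text \<open>For \<open>i > 0\<close> the operator K_i fixes the vector that F of index
  \<open>- i\<close> moves. No power of \<open>q\<close> appears, and the resulting matrix is
  symmetric under the flip.\<close>

lemma nat_e:
  assumes "i > 0"
  shows "nat_rep (GE i) (var a) + nat_rep (GF (- i)) (nat_rep (GKinv i) (var a))
    = (if a = i + 1/2 then var (i - 1/2) else 0) + (if - a = i + 1/2 then var (- (i - 1/2)) else 0)"
proof (cases "- a = i + 1/2")
  case True
  then have "a = - i - 1/2" "a \<noteq> i + 1/2" "a \<noteq> i - 1/2" using assms by auto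
  moreover have "- i + 1/2 = - (i - 1/2)" by simp
  ultimately show ?thesis
    using True by (simp only: nat_rep_GE nat_rep_GF nat_rep_GKinv nat_simps if_False if_True of_bool_eq) simp
next
  case False
  then have "a \<noteq> - i - 1/2" by auto
  then show ?thesis
    using False by (simp only: nat_rep_GE nat_rep_GF nat_rep_GKinv nat_simps if_False mult_zero_right)
qed

lemma nat_f:
  assumes "i > 0"
  shows "nat_rep (GKinv (- i)) (nat_rep (GF i) (var a)) + nat_rep (GE (- i)) (var a)
    = (if a = i - 1/2 then var (i + 1/2) else 0) + (if - a = i - 1/2 then var (- (i + 1/2)) else 0)"
proof -
  have 1: "i + 1/2 \<noteq> - i + 1/2" "i + 1/2 \<noteq> - i - 1/2" using assms by auto
  have 2: "nat_rep (GKinv (- i)) (nat_rep (GF i) (var a)) = (if a = i - 1/2 then var (i + 1/2) else 0)"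
    by (cases "a = i - 1/2") (simp_all only: nat_rep_GF nat_rep_GKinv nat_simps if_True if_False simp_thms 1 of_bool_eq
        diff_self power_int_0_right const_1 mult_1_left)
  have 3: "a = - i + 1/2 \<longleftrightarrow> - a = i - 1/2" "- i - 1/2 = - (i + 1/2)" by auto
  show ?thesis unfolding 2 by (simp only: nat_rep_GE 3)
qed

lemma nat_k:
  "nat_rep (GK i) (nat_rep (GKinv (- i)) (var a)) =
    const (q powi (of_bool (a = i - 1/2) + of_bool (- a = i - 1/2) - (of_bool (a = i + 1/2) + of_bool (- a = i + 1/2)))) * var a"
proof -
  have 1: "a = - i + 1/2 \<longleftrightarrow> - a = i - 1/2" "a = - i - 1/2 \<longleftrightarrow> - a = i + 1/2" by auto
  show ?thesis
    unfolding nat_rep_GKinv nat_rep_GK nat_simps const_mult_left 1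
    by (simp flip: power_int_add)
qed

lemma nat_kinv:
  "nat_rep (GK (- i)) (nat_rep (GKinv i) (var a)) =
    const (q powi (of_bool (a = i + 1/2) + of_bool (- a = i + 1/2) - (of_bool (a = i - 1/2) + of_bool (- a = i - 1/2)))) * var a"
proof -
  have 1: "a = - i + 1/2 \<longleftrightarrow> - a = i - 1/2" "a = - i - 1/2 \<longleftrightarrow> - a = i + 1/2" by auto
  show ?thesis
    unfolding nat_rep_GKinv nat_rep_GK nat_simps const_mult_left 1
    by (simp flip: power_int_add)
qed

text \<open>The coefficient \<open>q\<close> in \<open>it\<close> cancels the factor by which the
  inverse of K_0 scales \<open>var (- 1/2)\<close>, so that the two middle basis vectors are
  interchanged exactly.\<close>

lemma nat_t:
  "nat_rep (GE 0) (var a) + const q * nat_rep (GF 0) (nat_rep (GKinv 0) (var a))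
    = (if a = 1/2 \<or> - a = 1/2 then var (- a) else 0)"
proof -
  consider "a = 1/2" | "a = - 1/2" | "a \<noteq> 1/2" "a \<noteq> - 1/2" by blast
  then show ?thesis
  proof cases
    case 2
    then show ?thesis
      by (simp add: nat_rep_GE nat_rep_GF nat_rep_GKinv nat_simps const_mult_left power_int_minus del: nat_rep_var)
  next
    case 3
    then have "- a \<noteq> 1/2" by auto
    with 3 show ?thesis
      by (simp add: nat_rep_GE nat_rep_GF nat_rep_GKinv nat_simps const_mult_left del: nat_rep_var)
  next
    case 1
    show ?thesis unfolding 1 by (simp add: nat_rep_GE nat_rep_GF nat_rep_GKinv nat_simps del: nat_rep_var)
  qed
qed

lemma lin_eq_var:
  assumes "lin \<phi>" "lin \<psi>" "v \<in> tpow J (Suc 0)" "\<And>a. a \<in> wtI J \<Longrightarrow> \<phi> (var a) = \<psi> (var a)"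
  shows "\<phi> v = \<psi> v"
  using assms by (intro lin_eq_tpow[OF assms(1-3)]) (auto elim!: words_1_cases)

lemmas lin_nat_hgen_intros = lin_nat_intros lin_hgen lin_compose[OF lin_hgen]

text \<open>The flip of the natural module commutes with the components on the first tensor factor of the
  coproducts of the generators of the coideal subalgebra.\<close>

lemma flip_e:
  assumes "i > 0" "v \<in> tpow J (Suc 0)"
  shows "nat_rep (GE i) (hgen 0 v) + nat_rep (GF (- i)) (nat_rep (GKinv i) (hgen 0 v))
    = hgen 0 (nat_rep (GE i) v) + hgen 0 (nat_rep (GF (- i)) (nat_rep (GKinv i) v))"
proof (rule lin_eq_var[OF _ _ assms(2)]; (intro lin_nat_hgen_intros)?)
  fix a
  have "hgen 0 (nat_rep (GE i) (var a)) + hgen 0 (nat_rep (GF (- i)) (nat_rep (GKinv i) (var a)))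
      = hgen 0 (nat_rep (GE i) (var a) + nat_rep (GF (- i)) (nat_rep (GKinv i) (var a)))"
    by (simp only: hgen_simps)
  then show "nat_rep (GE i) (hgen 0 (var a)) + nat_rep (GF (- i)) (nat_rep (GKinv i) (hgen 0 (var a)))
    = hgen 0 (nat_rep (GE i) (var a)) + hgen 0 (nat_rep (GF (- i)) (nat_rep (GKinv i) (var a)))"
    by (simp only: hgen_0_var nat_e[OF assms(1)] hgen_simps if_distrib[of "hgen 0"] minus_minus) (rule add.commute)
qed

lemma flip_f:
  assumes "i > 0" "v \<in> tpow J (Suc 0)"
  shows "nat_rep (GKinv (- i)) (nat_rep (GF i) (hgen 0 v)) + nat_rep (GE (- i)) (hgen 0 v)
    = hgen 0 (nat_rep (GKinv (- i)) (nat_rep (GF i) v)) + hgen 0 (nat_rep (GE (- i)) v)"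
proof (rule lin_eq_var[OF _ _ assms(2)]; (intro lin_nat_hgen_intros)?)
  fix a
  have "hgen 0 (nat_rep (GKinv (- i)) (nat_rep (GF i) (var a))) + hgen 0 (nat_rep (GE (- i)) (var a))
      = hgen 0 (nat_rep (GKinv (- i)) (nat_rep (GF i) (var a)) + nat_rep (GE (- i)) (var a))"
    by (simp only: hgen_simps)
  then show "nat_rep (GKinv (- i)) (nat_rep (GF i) (hgen 0 (var a))) + nat_rep (GE (- i)) (hgen 0 (var a))
    = hgen 0 (nat_rep (GKinv (- i)) (nat_rep (GF i) (var a))) + hgen 0 (nat_rep (GE (- i)) (var a))"
    by (simp only: hgen_0_var nat_f[OF assms(1)] hgen_simps if_distrib[of "hgen 0"] minus_minus) (rule add.commute)
qed

lemma flip_k: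
  assumes "v \<in> tpow J (Suc 0)"
  shows "nat_rep (GK i) (nat_rep (GKinv (- i)) (hgen 0 v)) = hgen 0 (nat_rep (GK i) (nat_rep (GKinv (- i)) v))"
    and "nat_rep (GK (- i)) (nat_rep (GKinv i) (hgen 0 v)) = hgen 0 (nat_rep (GK (- i)) (nat_rep (GKinv i) v))"
proof -
  show "nat_rep (GK i) (nat_rep (GKinv (- i)) (hgen 0 v)) = hgen 0 (nat_rep (GK i) (nat_rep (GKinv (- i)) v))"
    by (rule lin_eq_var[OF _ _ assms]; (intro lin_nat_hgen_intros)?)
      (simp only: hgen_0_var nat_k hgen_simps minus_minus, simp only: add.commute)
  show "nat_rep (GK (- i)) (nat_rep (GKinv i) (hgen 0 v)) = hgen 0 (nat_rep (GK (- i)) (nat_rep (GKinv i) v))"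
    by (rule lin_eq_var[OF _ _ assms]; (intro lin_nat_hgen_intros)?)
      (simp only: hgen_0_var nat_kinv hgen_simps minus_minus, simp only: add.commute)
qed

lemma flip_t:
  assumes "v \<in> tpow J (Suc 0)"
  shows "nat_rep (GE 0) (hgen 0 v) + const q * nat_rep (GF 0) (nat_rep (GKinv 0) (hgen 0 v))
    = hgen 0 (nat_rep (GE 0) v) + const q * hgen 0 (nat_rep (GF 0) (nat_rep (GKinv 0) v))"
proof (rule lin_eq_var[OF _ _ assms]; (intro lin_nat_hgen_intros)?)
  fix a
  have "hgen 0 (nat_rep (GE 0) (var a)) + const q * hgen 0 (nat_rep (GF 0) (nat_rep (GKinv 0) (var a)))
      = hgen 0 (nat_rep (GE 0) (var a) + const q * nat_rep (GF 0) (nat_rep (GKinv 0) (var a)))"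
    by (simp only: hgen_simps)
  then show "nat_rep (GE 0) (hgen 0 (var a)) + const q * nat_rep (GF 0) (nat_rep (GKinv 0) (hgen 0 (var a)))
    = hgen 0 (nat_rep (GE 0) (var a)) + const q * hgen 0 (nat_rep (GF 0) (nat_rep (GKinv 0) (var a)))"
    by (simp only: hgen_0_var nat_t hgen_simps if_distrib[of "hgen 0"] minus_minus disj_commute)
qed

lemma uact_gens:
  assumes "m \<ge> 1" "x \<in> tpow J m"
  shows "uact m (ucls J (const c)) x = const c * x"
    "uact m (ik J i) x = tpow_rep m (GK i) (tpow_rep m (GKinv (- i)) x)"
    "uact m (ikinv J i) x = tpow_rep m (GK (- i)) (tpow_rep m (GKinv i) x)"
    "uact m (ie J i) x = tpow_rep m (GE i) x + tpow_rep m (GF (- i)) (tpow_rep m (GKinv i) x)"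
    "uact m (ifl J i) x = tpow_rep m (GKinv (- i)) (tpow_rep m (GF i) x) + tpow_rep m (GE (- i)) x"
    "uact m (it J) x = tpow_rep m (GE 0) x + const q * tpow_rep m (GF 0) (tpow_rep m (GKinv 0) x)"
  using assms by (simp_all add: uact_ucls ik_def ikinv_def ie_def ifl_def it_def lact_simps lact_mult)

lemma tpow_rep_1: "tpow_rep (Suc 0) = nat_rep"
  by (intro ext) simp

text \<open>The coideal property: the first tensor components of the coproduct of a generator are 1,
  the generator itself and powers of k_i, and by the preceding lemmas all of these commute with the
  flip of the natural module.\<close>

lemma flip_uact_gens:
  assumes m: "m \<ge> 1" and u: "u \<in> Ui_gens J" and x: "x \<in> tpow J m"
  shows "uact m u (hgen 0 x) = hgen 0 (uact m u x)"
proof -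
  have hx: "hgen 0 x \<in> tpow J m" using hgen_closed'[of 0 m x] m x by simp
  note gens = uact_gens[OF m x] uact_gens[OF m hx]
  interpret N: qmodule J "Suc 0" nat_rep by (rule qmodule_nat_rep)
  show ?thesis
  proof (cases "m = Suc 0")
    case True
    have x1: "x \<in> tpow J (Suc 0)" using x True by simp
    show ?thesis
      using u unfolding Ui_gens_def
      by (auto simp: gens[unfolded True] hgen_simps flip_e[OF _ x1] flip_f[OF _ x1] flip_k[OF x1] flip_t[OF x1] tpow_rep_1 True
          simp del: tpow_rep.simps split: if_splits)
  next
    case False
    then obtain m' where m': "m = Suc (Suc m')" using m by (cases m; cases "m - 1") auto
    interpret R: qmodule J "Suc m'" "tpow_rep (Suc m')" by (rule qmodule_tpow_rep) simp
    note T = tpow_rep_mult[where J = J and m = m']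
    note lin = lin_intros lin_tpow_rep lin_hgen lin_compose[OF lin_hgen] lin_compose[OF lin_tpow_rep]
    note ind = lin_eq_tpow_Suc[OF _ _ x[unfolded m']]
    note simps = T hgen_simps hgen_0_mult[where J = J] N.closed' R.closed' distrib_left distrib_right
      lin_add[OF lin_tpow_rep] lin_scale[OF lin_tpow_rep]
    have hv: "hgen 0 v \<in> tpow J (Suc 0)" if "v \<in> tpow J (Suc 0)" for v
      using hgen_closed'[of 0 "Suc 0" v] that by simp
    let ?T = "tpow_rep (Suc (Suc m'))"
    have k: "?T (GK i) (?T (GKinv (- i)) (hgen 0 x)) = hgen 0 (?T (GK i) (?T (GKinv (- i)) x))"
      "?T (GK (- i)) (?T (GKinv i) (hgen 0 x)) = hgen 0 (?T (GK (- i)) (?T (GKinv i) x))" if "i \<in> J" for i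
      by (rule ind; (intro lin)?; simp add: simps hv flip_k that J_minus del: tpow_rep.simps)+
    have e: "?T (GE i) (hgen 0 x) + ?T (GF (- i)) (?T (GKinv i) (hgen 0 x))
        = hgen 0 (?T (GE i) x) + hgen 0 (?T (GF (- i)) (?T (GKinv i) x))" if i: "i \<in> J" "i > 0" for i
    proof (rule ind; (intro lin)?)
      fix v y assume v: "v \<in> tpow J (Suc 0)" and y: "y \<in> tpow J (Suc m')"
      let ?K = "tpow_rep (Suc m') (GKinv i) y"
      have "nat_rep (GE i) (hgen 0 v) * ?K + nat_rep (GF (- i)) (nat_rep (GKinv i) (hgen 0 v)) * ?K
          = hgen 0 (nat_rep (GE i) v) * ?K + hgen 0 (nat_rep (GF (- i)) (nat_rep (GKinv i) v)) * ?K"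
        using flip_e[OF i(2) v] by (simp only: flip: distrib_right)
      then show "?T (GE i) (hgen 0 (v * y)) + ?T (GF (- i)) (?T (GKinv i) (hgen 0 (v * y)))
          = hgen 0 (?T (GE i) (v * y)) + hgen 0 (?T (GF (- i)) (?T (GKinv i) (v * y)))"
        using v y i by (simp add: simps hv flip_k J_minus del: tpow_rep.simps)
    qed
    have f: "?T (GKinv (- i)) (?T (GF i) (hgen 0 x)) + ?T (GE (- i)) (hgen 0 x)
        = hgen 0 (?T (GKinv (- i)) (?T (GF i) x)) + hgen 0 (?T (GE (- i)) x)" if i: "i \<in> J" "i > 0" for i
    proof (rule ind; (intro lin)?)
      fix v y assume v: "v \<in> tpow J (Suc 0)" and y: "y \<in> tpow J (Suc m')"
      let ?K = "tpow_rep (Suc m') (GKinv (- i)) y"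
      have "nat_rep (GKinv (- i)) (nat_rep (GF i) (hgen 0 v)) * ?K + nat_rep (GE (- i)) (hgen 0 v) * ?K
          = hgen 0 (nat_rep (GKinv (- i)) (nat_rep (GF i) v)) * ?K + hgen 0 (nat_rep (GE (- i)) v) * ?K"
        using flip_f[OF i(2) v] by (simp only: flip: distrib_right)
      \<comment> \<open>The component k_i in the coproduct of f_i, with its two factors in the other
        order.\<close>
      moreover have "nat_rep (GKinv (- i)) (nat_rep (GK i) (hgen 0 v)) = hgen 0 (nat_rep (GKinv (- i)) (nat_rep (GK i) v))"
        using flip_k(1)[OF v, of i] v hv[OF v] i by (simp add: N.Kinv_Kj J_minus)
      ultimately show "?T (GKinv (- i)) (?T (GF i) (hgen 0 (v * y))) + ?T (GE (- i)) (hgen 0 (v * y))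
          = hgen 0 (?T (GKinv (- i)) (?T (GF i) (v * y))) + hgen 0 (?T (GE (- i)) (v * y))"
        using v y i by (simp add: simps hv J_minus del: tpow_rep.simps)
    qed
    have t: "?T (GE 0) (hgen 0 x) + const q * ?T (GF 0) (?T (GKinv 0) (hgen 0 x))
        = hgen 0 (?T (GE 0) x) + const q * hgen 0 (?T (GF 0) (?T (GKinv 0) x))" if i: "0 \<in> J"
    proof (rule ind; (intro lin)?)
      fix v y assume v: "v \<in> tpow J (Suc 0)" and y: "y \<in> tpow J (Suc m')"
      let ?K = "tpow_rep (Suc m') (GKinv 0) y"
      have "nat_rep (GE 0) (hgen 0 v) * ?K + const q * nat_rep (GF 0) (nat_rep (GKinv 0) (hgen 0 v)) * ?K
          = hgen 0 (nat_rep (GE 0) v) * ?K + const q * hgen 0 (nat_rep (GF 0) (nat_rep (GKinv 0) v)) * ?K"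
        using flip_t[OF v] by (simp only: flip: distrib_right)
      then show "?T (GE 0) (hgen 0 (v * y)) + const q * ?T (GF 0) (?T (GKinv 0) (hgen 0 (v * y)))
          = hgen 0 (?T (GE 0) (v * y)) + const q * hgen 0 (?T (GF 0) (?T (GKinv 0) (v * y)))"
        using v y i hv[OF v] by (simp add: simps N.K_Kinv mult.assoc[of "const q"] del: tpow_rep.simps)
    qed
    show ?thesis
      using u unfolding Ui_gens_def
      by (auto simp: m' gens[unfolded m'] hgen_simps k e f t simp del: tpow_rep.simps split: if_splits)
  qed
qed

text \<open>For positive \<open>j\<close> the whole quantum group commutes with the operator. For
  \<open>j = 0\<close> this rests on the generators of the coideal subalgebra, and induction over
  the generated ring carries it over.\<close>

lemma uact_hgen_commute:
  assumes m: "m \<ge> 1" and u: "u \<in> Ui J" and x: "x \<in> tpow J m" and j: "j < m"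
  shows "uact m u (hgen j x) = hgen j (uact m u x)"
proof -
  have tc: "lact (tpow_rep m) a (hgen j x) = hgen j (lact (tpow_rep m) a x)"
    if a: "a \<in> carrier (free_algebra (Ugens J))" and j: "1 \<le> j" "j < m" and x: "x \<in> tpow J m" for a x
  proof -
    interpret qmodule J m "tpow_rep m" by (rule qmodule_tpow_rep[OF m])
    have "foldr (tpow_rep m) us (hgen j x) = hgen j (foldr (tpow_rep m) us x) \<and> foldr (tpow_rep m) us x \<in> tpow J m"
      if "set us \<subseteq> Ugens J" for us
      using that x by (induct us) (auto simp: tpow_rep_hgen_commute[OF _ j] closed)
    then show ?thesis
      using a unfolding lact_def lin_sum[OF lin_hgen] hgen_simps
      by (intro sum.cong refl) (auto simp: carrier_free_algebra)
  qed
  have comm: "u \<in> carrier (UU J) \<and> (\<forall>x\<in>tpow J m. uact m u (hgen j x) = hgen j (uact m u x))"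
    using u unfolding Ui_generate
  proof (induct rule: generate_ring.induct)
    case one
    then show ?case using ring_UU m j by (simp add: uact_one hgen_closed' ring.ring_simprules)
  next
    case (incl h)
    then have h: "h \<in> carrier (UU J)" using Ui_gens_carrier by auto
    then obtain a where a: "a \<in> carrier (free_algebra (Ugens J))" "h = ucls J a" by (rule UU_cases)
    show ?case
    proof (cases "j = 0")
      case True
      then show ?thesis using h flip_uact_gens[OF m incl] by simp
    next
      case False
      then show ?thesis using h tc[OF a(1) _ j] hgen_closed'[OF j] a(2) by (simp add: uact_ucls[OF m])
    qed
  next
    case (a_inv h)
    then show ?case
      using ring_UU hgen_closed'[OF j] by (simp add: uact_hom[OF m, of h J h] lin_uminus[OF lin_hgen] ring.ring_simprules)
  next
    case (eng_add h1 h2)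
    then show ?case
      using ring_UU hgen_closed'[OF j] by (simp add: uact_hom[OF m] hgen_simps ring.ring_simprules)
  next
    case (eng_mult h1 h2)
    then show ?case
      using ring_UU hgen_closed'[OF j] by (simp add: uact_hom[OF m] uact_closed[OF m] ring.ring_simprules)
  qed
  with x show ?thesis by blast
qed

lemma hact_hcls': "m \<ge> 1 \<Longrightarrow> x \<in> tpow J m \<Longrightarrow> hact x (hcls m a) = ract hgen x a"
  using hact_hcls wtI_uminus by blast

lemma uact_hact_commute:
  assumes m: "m \<ge> 1" and u: "u \<in> Ui J" and h: "h \<in> carrier (HB m)" and x: "x \<in> tpow J m"
  shows "uact m u (hact x h) = hact (uact m u x) h"
proof -
  have uc: "u \<in> carrier (UU J)" using u Ui_carrier by blast
  obtain a where a: "a \<in> carrier (free_algebra {..<m})" "h = hcls m a"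
    using h m by (auto simp: carrier_HB)
  have f: "uact m u (fold hgen is x) = fold hgen is (uact m u x) \<and> fold hgen is x \<in> tpow J m"
    if "set is \<subseteq> {..<m}" for "is"
    using that x
  proof (induct "is" arbitrary: x)
    case (Cons i "is")
    then have "hgen i x \<in> tpow J m" "uact m u (hgen i x) = hgen i (uact m u x)"
      by (simp_all add: hgen_closed' uact_hgen_commute[OF m u])
    then show ?case using Cons by simp
  qed simp
  have sum: "uact m u (\<Sum>w\<in>S. const (c w) * y w) = (\<Sum>w\<in>S. const (c w) * uact m u (y w))"
    if "finite S" "\<And>w. w \<in> S \<Longrightarrow> y w \<in> tpow J m" for S :: "nat fword set" and c y
    using that
  proof (induct S)
    case empty
    have "uact m u (const 0 * 0) = const 0 * uact m u 0" by (rule uact_lin(2)[OF m uc _ tpow_0]) simp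
    then show ?case by simp
  next
    case (insert w S)
    then show ?case by (simp add: uact_lin(1)[OF m uc] uact_lin(2)[OF m uc _ tpow_0] tpow_sum)
  qed
  have "uact m u (ract hgen x a) = ract hgen (uact m u x) a"
    unfolding ract_def using a f
    by (subst sum[of "keys a" "\<lambda>w. fold hgen (letters w) x" "lookup a"]) (auto simp: carrier_free_algebra)
  then show ?thesis
    using a m x uact_closed[OF m uc x] by (simp add: hact_hcls')
qed

end

section \<open>Specialization of the generators at 1\<close>

text \<open>The column index is the argument, so that composition of operators becomes the matrix
  product.\<close>

definition mat :: "(tens \<Rightarrow> tens) \<Rightarrow> rat list \<Rightarrow> rat list \<Rightarrow> qf" where
  "mat \<phi> f g = lookup (\<phi> (monomial g)) (Word f)"

definition unit :: "rat \<Rightarrow> rat \<Rightarrow> rat \<Rightarrow> rat \<Rightarrow> rat" where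
  "unit a b x y = of_bool (x = a \<and> y = b)"

lemma Bmat_unit: "Bmat a b = (\<lambda>x y. unit a b x y + unit (- a) (- b) x y)"
  by (simp add: Bmat_def unit_def fun_eq_iff)

lemma lookup_var_mult: "lookup (var b * y) (Word (a # f)) = of_bool (a = b) * lookup y (Word f)"
proof -
  have *: "lin (\<lambda>y. var b * y)" by (intro lin_intros)
  have "lookup (var b * y) (Word (a # f)) = (\<Sum>w\<in>keys y. lookup y w * lookup (var b * monomial (letters w)) (Word (a # f)))"
    by (subst lin_expand[OF *]) (simp add: lookup_sum)
  also have "\<dots> = (\<Sum>w\<in>keys y. if w = Word f then of_bool (a = b) * lookup y w else 0)"
  proof (rule sum.cong[OF refl])
    fix w
    have "letters w = f \<longleftrightarrow> w = Word f" by (cases w) simp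
    then show "lookup y w * lookup (var b * monomial (letters w)) (Word (a # f)) = (if w = Word f then of_bool (a = b) * lookup y w else 0)"
      by (auto simp: lookup_monomial simp flip: monomial_Cons)
  qed
  also have "\<dots> = of_bool (a = b) * lookup y (Word f)"
    by (simp add: in_keys_iff)
  finally show ?thesis .
qed

text \<open>The exponent of the power of \<open>q\<close> by which K_i scales
  \<open>monomial g\<close>.\<close>

definition kexp :: "rat \<Rightarrow> rat list \<Rightarrow> int" where
  "kexp i g = sum_list (map (\<lambda>a. form (alpha i) (eps a)) g)"

lemma reg_of_bool: "reg (of_bool P) (of_bool P)"
  by simp

context weight_index
begin

lemma tpow_rep_K_monomial:
  "m \<ge> 1 \<Longrightarrow> g \<in> words (wtI J) m \<Longrightarrow> tpow_rep m (GK i) (monomial g) = const (q powi kexp i g) * monomial g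
    \<and> tpow_rep m (GKinv i) (monomial g) = const (q powi (- kexp i g)) * monomial g"
proof (induct m arbitrary: g rule: nat_induct_at_least)
  case base
  then obtain a where "g = [a]" by (auto elim: words_1_cases)
  then show ?case by (simp add: kexp_def)
next
  case (Suc m)
  then obtain m' where m': "m = Suc m'" by (cases m) auto
  obtain a g' where g: "g = a # g'" "a \<in> wtI J" "g' \<in> words (wtI J) m"
    using Suc(3) by (rule words_Suc_cases)
  have v: "var a \<in> tpow J (Suc 0)" using g by simp
  note T = tpow_rep_mult[OF v, of m', folded m']
  have kexp: "kexp i (a # g') = form (alpha i) (eps a) + kexp i g'" by (simp add: kexp_def)
  show ?case
    unfolding g monomial_Cons[of a g'] T nat_rep_var nat_basis.simps Suc(2)[OF g(3), THEN conjunct1]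
      Suc(2)[OF g(3), THEN conjunct2] kexp power_int_add[OF disjI1[OF q_neq_0]] minus_add_distrib
    by (simp add: mult.assoc mult_const_left[of "var _"] const_mult_left)
qed

text \<open>At \<open>q = 1\<close> the K operators become the identity and the coproduct becomes
  primitive, so that E_i and F_i act as the derivations that extend their matrix units.\<close>

lemma reg_EF:
  assumes "m \<ge> 1" "f \<in> words (wtI J) m" "g \<in> words (wtI J) m"
  shows "reg (mat (tpow_rep m (GE i)) f g) (deriv m (unit (i - 1/2) (i + 1/2)) f g)"
    and "reg (mat (tpow_rep m (GF i)) f g) (deriv m (unit (i + 1/2) (i - 1/2)) f g)"
proof -
  have "reg (mat (tpow_rep m (GE i)) f g) (deriv m (unit (i - 1/2) (i + 1/2)) f g) \<and>
    reg (mat (tpow_rep m (GF i)) f g) (deriv m (unit (i + 1/2) (i - 1/2)) f g)"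
    using assms
  proof (induct m arbitrary: f g rule: nat_induct_at_least)
    case base
    then obtain a b where fg: "f = [a]" "g = [b]" by (auto elim!: words_1_cases)
    have "mat (tpow_rep 1 (GE i)) f g = of_bool (a = i - 1/2 \<and> b = i + 1/2)"
      unfolding fg mat_def One_nat_def tpow_rep_1 nat_rep_GE by (auto simp: lookup_monomial)
    moreover have "mat (tpow_rep 1 (GF i)) f g = of_bool (a = i + 1/2 \<and> b = i - 1/2)"
      unfolding fg mat_def One_nat_def tpow_rep_1 nat_rep_GF by (auto simp: lookup_monomial)
    moreover have "deriv 1 (unit x y) f g = of_bool (a = x \<and> b = y)" for x y
      unfolding fg One_nat_def by (subst deriv_Suc) (simp_all add: idm_def unit_def)
    ultimately show ?case
      by (simp only: reg_of_bool simp_thms)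
  next
    case (Suc m)
    then obtain m' where m': "m = Suc m'" by (cases m) auto
    obtain a f' where f: "f = a # f'" "a \<in> wtI J" "f' \<in> words (wtI J) m"
      using Suc(3) by (rule words_Suc_cases)
    obtain b g' where g: "g = b # g'" "b \<in> wtI J" "g' \<in> words (wtI J) m"
      using Suc(4) by (rule words_Suc_cases)
    have v: "var b \<in> tpow J (Suc 0)" using g by simp
    note T = tpow_rep_mult[OF v, of m', folded m']
    note K = tpow_rep_K_monomial[OF Suc(1) g(3), THEN conjunct2, of i]
    note IH = Suc(2)[OF f(3) g(3), unfolded mat_def]
    have len: "length f' = m" "length g' = m" using f g by (auto simp: words_length)
    have idm: "(of_bool (Word f' = Word g') :: rat) = idm f' g'" by (simp add: idm_def)
    have E1: "mat (tpow_rep (Suc m) (GE i)) f g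
        = of_bool (a = b) * lookup (tpow_rep m (GE i) (monomial g')) (Word f')
          + of_bool (a = i - 1/2 \<and> b = i + 1/2) * (q powi (- kexp i g') * of_bool (Word f' = Word g'))"
      unfolding f g mat_def monomial_Cons[of b g'] T nat_rep_GE K
      by (auto simp: lookup_add lookup_var_mult mult_const_left[of "var _"] lookup_monomial)
    have E2: "reg (of_bool (a = b) * lookup (tpow_rep m (GE i) (monomial g')) (Word f')
          + of_bool (a = i - 1/2 \<and> b = i + 1/2) * (q powi (- kexp i g') * of_bool (Word f' = Word g')))
        (of_bool (a = b) * deriv m (unit (i - 1/2) (i + 1/2)) f' g'
          + of_bool (a = i - 1/2 \<and> b = i + 1/2) * (1 * of_bool (Word f' = Word g')))"
      using IH by (intro reg_add reg_mult reg_of_bool reg_q_powi) auto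
    have F1: "mat (tpow_rep (Suc m) (GF i)) f g
        = of_bool (a = i + 1/2 \<and> b = i - 1/2) * of_bool (Word f' = Word g')
          + of_bool (a = b) * (q powi form (alpha i) (eps b) * lookup (tpow_rep m (GF i) (monomial g')) (Word f'))"
      unfolding f g mat_def monomial_Cons[of b g'] T nat_rep_GF nat_rep_var nat_basis.simps(3)
      by (auto simp: lookup_add lookup_var_mult mult.assoc[of "const _"] lookup_monomial)
    have F2: "reg (of_bool (a = i + 1/2 \<and> b = i - 1/2) * of_bool (Word f' = Word g')
          + of_bool (a = b) * (q powi form (alpha i) (eps b) * lookup (tpow_rep m (GF i) (monomial g')) (Word f')))
        (of_bool (a = i + 1/2 \<and> b = i - 1/2) * of_bool (Word f' = Word g')
          + of_bool (a = b) * (1 * deriv m (unit (i + 1/2) (i - 1/2)) f' g'))"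
      using IH by (intro reg_add reg_mult reg_of_bool reg_q_powi) auto
    have D: "deriv (Suc m) (unit x y) f g = of_bool (a = b) * deriv m (unit x y) f' g'
        + of_bool (a = x \<and> b = y) * (1 * of_bool (Word f' = Word g'))"
      "deriv (Suc m) (unit x y) f g = of_bool (a = x \<and> b = y) * of_bool (Word f' = Word g')
        + of_bool (a = b) * (1 * deriv m (unit x y) f' g')" for x y
      unfolding f g deriv_Suc[OF len] unit_def[of _ _ a b] by (simp_all add: idm_def)
    show ?case unfolding E1 F1 D(1)[of "i - 1/2"] D(2)[of "i + 1/2"] using E2 F2 by (rule conjI)
  qed
  then show "reg (mat (tpow_rep m (GE i)) f g) (deriv m (unit (i - 1/2) (i + 1/2)) f g)"
    "reg (mat (tpow_rep m (GF i)) f g) (deriv m (unit (i + 1/2) (i - 1/2)) f g)" by auto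
qed

lemma reg_one_mult: "reg x c \<Longrightarrow> reg y 1 \<Longrightarrow> reg (y * x) c"
  using reg_mult[of y 1 x c] by simp

lemma reg_e:
  assumes "m \<ge> 1" "f \<in> words (wtI J) m" "g \<in> words (wtI J) m"
  shows "reg (mat (uact m (ie J i)) f g) (deriv m (Bmat (i - 1/2) (i + 1/2)) f g)"
proof -
  have g: "monomial g \<in> tpow J m" using assms by simp
  have "mat (uact m (ie J i)) f g = mat (tpow_rep m (GE i)) f g + q powi (- kexp i g) * mat (tpow_rep m (GF (- i))) f g"
    using tpow_rep_K_monomial[OF assms(1,3), of i]
    by (simp add: mat_def uact_gens[OF assms(1) g] lookup_add lin_scale[OF lin_tpow_rep])
  moreover have "- i + 1/2 = - (i - 1/2)" "- i - 1/2 = - (i + 1/2)" by simp_all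
  ultimately show ?thesis
    unfolding Bmat_unit deriv_linear(1)
    using reg_add[OF reg_EF(1)[OF assms] reg_one_mult[OF reg_EF(2)[OF assms, of "- i"] reg_q_powi]]
    by (simp only:)
qed

lemma reg_f:
  assumes "m \<ge> 1" "f \<in> words (wtI J) m" "g \<in> words (wtI J) m" "i \<in> J"
  shows "reg (mat (uact m (ifl J i)) f g) (deriv m (Bmat (i + 1/2) (i - 1/2)) f g)"
proof -
  interpret qmodule J m "tpow_rep m" by (rule qmodule_tpow_rep[OF assms(1)])
  have g: "monomial g \<in> tpow J m" using assms by simp
  have "mat (uact m (ifl J i)) f g = (q powi form (alpha (- i)) (alpha i) * q powi (- kexp (- i) g)) * mat (tpow_rep m (GF i)) f g
      + mat (tpow_rep m (GE (- i))) f g"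
    using tpow_rep_K_monomial[OF assms(1,3), of "- i"]
    by (simp add: mat_def uact_gens[OF assms(1) g] lookup_add R_simps Kinv_F[OF J_minus assms(4) g] assms(4) mult.assoc)
  moreover have "- i + 1/2 = - (i - 1/2)" "- i - 1/2 = - (i + 1/2)" by simp_all
  moreover have "reg (q powi form (alpha (- i)) (alpha i) * q powi (- kexp (- i) g)) 1"
    using reg_mult[OF reg_q_powi reg_q_powi] by simp
  ultimately show ?thesis
    unfolding Bmat_unit deriv_linear(1)
    using reg_add[OF reg_one_mult[OF reg_EF(2)[OF assms(1-3)]] reg_EF(1)[OF assms(1-3), of "- i"]]
    by (simp only:)
qed

lemma reg_t:
  assumes "m \<ge> 1" "f \<in> words (wtI J) m" "g \<in> words (wtI J) m"
  shows "reg (mat (uact m (it J)) f g) (deriv m (Bmat (- 1/2) (1/2)) f g)"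
proof -
  have g: "monomial g \<in> tpow J m" using assms by simp
  have "mat (uact m (it J)) f g = mat (tpow_rep m (GE 0)) f g + (q * q powi (- kexp 0 g)) * mat (tpow_rep m (GF 0)) f g"
    using tpow_rep_K_monomial[OF assms(1,3), of 0]
    by (simp add: mat_def uact_gens[OF assms(1) g] lookup_add lin_scale[OF lin_tpow_rep] mult.assoc)
  moreover have "reg (q * q powi (- kexp 0 g)) 1"
    using reg_mult[OF reg_q reg_q_powi] by simp
  ultimately show ?thesis
    unfolding Bmat_unit deriv_linear(1)
    using reg_add[OF reg_EF(1)[OF assms, of 0] reg_one_mult[OF reg_EF(2)[OF assms, of 0]]]
    by simp
qed

lemma deriv_diag:
  "length f = m \<Longrightarrow> length g = m \<Longrightarrow> deriv m (\<lambda>x y. idm x y * d x) f g = idm f g * (sum_list (map d f) :: rat)"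
proof (induct m arbitrary: f g)
  case 0
  then show ?case by simp
next
  case (Suc m)
  then obtain a f' b g' where "f = a # f'" "g = b # g'" by (metis length_Suc_conv)
  with Suc show ?case by (auto simp: deriv_Suc idm_def)
qed

text \<open>The value at 1 of this difference quotient is the derivative of \<open>q powi k\<close>;
  for negative \<open>k\<close> a power of \<open>q\<close> is factored out.\<close>

lemma reg_quantum_integer: "reg ((q powi k - 1) / (q - 1)) (of_int k)"
proof -
  have nat: "reg ((q ^ j - 1) / (q - 1)) (of_nat j)" for j
  proof (induct j)
    case (Suc j)
    have "(q ^ Suc j - 1) / (q - 1) = q * ((q ^ j - 1) / (q - 1)) + 1"
      by (simp add: field_simps)
    then show ?case using reg_add[OF reg_mult[OF reg_q Suc] reg_1] by (simp add: add.commute)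
  qed simp
  show ?thesis
  proof (cases "k \<ge> 0")
    case True
    then show ?thesis using nat[of "nat k"] by (simp add: power_int_def)
  next
    case False
    define j where "j = nat (- k)"
    have k: "k = - int j" using False by (simp add: j_def)
    have "(q powi k - 1) / (q - 1) = - (q powi (- int j) * ((q ^ j - 1) / (q - 1)))"
      unfolding k by (simp add: power_int_minus field_simps)
    then show ?thesis
      using reg_uminus[OF reg_mult[OF reg_q_powi nat]] by (simp add: k)
  qed
qed

text \<open>k_i itself specializes to the identity. The Cartan element is recovered from the
  difference quotient, which still belongs to the span over the field.\<close>

lemma reg_h:
  assumes "m \<ge> 1" "f \<in> words (wtI J) m" "g \<in> words (wtI J) m"
  shows "reg (inverse (q - 1) * (mat (uact m (ik J i)) f g - idm f g))
    (deriv m (\<lambda>x y. Bmat (i - 1/2) (i - 1/2) x y - Bmat (i + 1/2) (i + 1/2) x y) f g)"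
proof -
  have g: "monomial g \<in> tpow J m" using assms by simp
  define k where "k = kexp i g - kexp (- i) g"
  define d :: "rat \<Rightarrow> rat" where "d x = of_bool (x = i - 1/2) + of_bool (- x = i - 1/2) - (of_bool (x = i + 1/2) + of_bool (- x = i + 1/2))" for x
  have "mat (uact m (ik J i)) f g = q powi k * idm f g"
    using tpow_rep_K_monomial[OF assms(1,3), of i] tpow_rep_K_monomial[OF assms(1,3), of "- i"]
    by (simp add: mat_def uact_gens[OF assms(1) g] lin_scale[OF lin_tpow_rep] lookup_monomial idm_def k_def
        power_int_diff power_int_minus field_simps)
  then have "inverse (q - 1) * (mat (uact m (ik J i)) f g - idm f g) = idm f g * ((q powi k - 1) / (q - 1))"
    by (simp add: field_simps)
  moreover have "reg \<dots> (idm f g * of_int k)"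
    by (intro reg_mult reg_quantum_integer) (simp add: idm_def)
  moreover have "idm f g * of_int k = deriv m (\<lambda>x y. Bmat (i - 1/2) (i - 1/2) x y - Bmat (i + 1/2) (i + 1/2) x y) f g"
  proof -
    have "Bmat (i - 1/2) (i - 1/2) x y - Bmat (i + 1/2) (i + 1/2) x y = idm x y * d x" for x y
      by (auto simp: Bmat_def idm_def d_def)
    then have "deriv m (\<lambda>x y. Bmat (i - 1/2) (i - 1/2) x y - Bmat (i + 1/2) (i + 1/2) x y) f g = idm f g * sum_list (map d f)"
      using assms by (simp add: deriv_diag words_length)
    also have "\<dots> = idm f g * sum_list (map d g)" by (auto simp: idm_def)
    also have "sum_list (map d g) = of_int k"
    proof -
      have 1: "a = - i + 1/2 \<longleftrightarrow> - a = i - 1/2" "a = - i - 1/2 \<longleftrightarrow> - a = i + 1/2" for a by auto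
      have "d a = of_int (form (alpha i) (eps a) - form (alpha (- i)) (eps a))" for a
        unfolding d_def form_alpha_eps 1 by simp
      then show ?thesis
        unfolding k_def kexp_def by (induct g) simp_all
    qed
    finally show ?thesis by simp
  qed
  ultimately show ?thesis by simp
qed

end

section \<open>The double centralizer property\<close>

text \<open>The permutation of words to which generator \<open>j\<close> of the Hecke algebra
  specializes, see \<open>reg_hgen\<close>.\<close>

definition act :: "nat \<Rightarrow> rat list \<Rightarrow> rat list" where
  "act j f = (if j = 0 then f[0 := - f ! 0] else f[j - 1 := f ! j, j := f ! (j - 1)])"

lemma length_act [simp]: "length (act j f) = length f"
  by (simp add: act_def)

lemma act_act: "j < length f \<Longrightarrow> act j (act j f) = f"
  by (rule nth_equalityI) (auto simp: act_def nth_list_update)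

lemma act_0_Cons: "act 0 (a # f) = - a # f"
  by (simp add: act_def)

lemma act_pos: "act (Suc (length us)) (us @ a # b # vs) = us @ b # a # vs"
  by (simp add: act_def nth_append list_update_append)

locale tensor_space = weight_index +
  fixes m :: nat
  assumes m: "m \<ge> 1"
begin

abbreviation "V \<equiv> tpow J m"
abbreviation "X \<equiv> words (wtI J) m"

lemma finite_X: "finite X"
  by (simp add: finite_wtI)

lemma expand_V: assumes "x \<in> V" shows "x = (\<Sum>h\<in>X. const (lookup x (Word h)) * monomial h)"
proof (rule poly_mapping_eqI)
  fix w
  have "lookup (\<Sum>h\<in>X. const (lookup x (Word h)) * monomial h) w
      = (\<Sum>h\<in>X. if letters w = h then lookup x w else 0)"
    unfolding lookup_sum by (rule sum.cong) (auto simp: lookup_monomial)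
  also have "\<dots> = (if letters w \<in> X then lookup x w else 0)"
    using finite_X by simp
  also have "\<dots> = lookup x w"
    using assms in_keys_iff[of w x] by (auto simp: tpow_words)
  finally show "lookup x w = lookup (\<Sum>h\<in>X. const (lookup x (Word h)) * monomial h) w" by simp
qed

text \<open>Linearity on \<open>V\<close> only: \<open>uact\<close> and \<open>hact\<close> are
  under control just on the tensor power, where their values on cosets are well defined.\<close>

definition linV :: "(tens \<Rightarrow> tens) \<Rightarrow> bool" where
  "linV \<phi> \<longleftrightarrow> (\<forall>x\<in>V. \<phi> x \<in> V) \<and> (\<forall>x\<in>V. \<forall>y\<in>V. \<phi> (x + y) = \<phi> x + \<phi> y) \<and>
     (\<forall>c. \<forall>x\<in>V. \<phi> (const c * x) = const c * \<phi> x)"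

lemma linV_closed: "linV \<phi> \<Longrightarrow> x \<in> V \<Longrightarrow> \<phi> x \<in> V"
  by (simp add: linV_def)

lemma linV_expand:
  assumes \<phi>: "linV \<phi>" and x: "x \<in> V"
  shows "\<phi> x = (\<Sum>h\<in>X. const (lookup x (Word h)) * \<phi> (monomial h))"
proof -
  have "\<phi> (const 0 * 0) = const 0 * \<phi> 0"
    using \<phi> tpow_0 unfolding linV_def by blast
  then have \<phi>0: "\<phi> 0 = 0" by simp
  have "\<phi> (\<Sum>h\<in>S. const (c h) * monomial h) = (\<Sum>h\<in>S. const (c h) * \<phi> (monomial h))"
    if "finite S" "S \<subseteq> X" for S c
    using that
  proof (induct S)
    case (insert h S)
    then show ?case using \<phi> by (simp add: linV_def tpow_sum subset_iff)
  qed (simp add: \<phi>0)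
  from this[OF finite_X order_refl, of "\<lambda>h. lookup x (Word h)"] show ?thesis
    by (subst (asm) expand_V[OF x, symmetric])
qed

lemma mat_compose:
  assumes "linV \<phi>" "linV \<psi>" "g \<in> X"
  shows "mat (\<lambda>x. \<phi> (\<psi> x)) f g = mm X (mat \<phi>) (mat \<psi>) f g"
proof -
  have "\<psi> (monomial g) \<in> V" using assms by (simp add: linV_closed)
  from linV_expand[OF assms(1) this] show ?thesis
    by (simp add: mat_def mm_def lookup_sum mult.commute)
qed

lemma linV_eqI:
  assumes "linV \<phi>" "linV \<psi>" "\<And>f g. f \<in> X \<Longrightarrow> g \<in> X \<Longrightarrow> mat \<phi> f g = mat \<psi> f g" "x \<in> V"
  shows "\<phi> x = \<psi> x"
proof -
  have "\<phi> (monomial g) = \<psi> (monomial g)" if g: "g \<in> X" for g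
  proof -
    have "\<phi> (monomial g) \<in> V" "\<psi> (monomial g) \<in> V" using assms(1,2) g by (simp_all add: linV_closed)
    note exp = expand_V[OF this(1)] expand_V[OF this(2)]
    have "(\<Sum>h\<in>X. const (lookup (\<phi> (monomial g)) (Word h)) * monomial h)
        = (\<Sum>h\<in>X. const (lookup (\<psi> (monomial g)) (Word h)) * monomial h)"
      using assms(3)[OF _ g] by (intro sum.cong refl) (simp add: mat_def)
    then show ?thesis unfolding exp[symmetric] .
  qed
  then show ?thesis using assms by (simp add: linV_expand[of _ x])
qed

text \<open>Matrices as functions on pairs, extended by 0, which gives them the finite support that
  \<open>specialization_lifting\<close> asks for.\<close>

definition ex :: "(rat list \<Rightarrow> rat list \<Rightarrow> qf) \<Rightarrow> rat list \<times> rat list \<Rightarrow> qf" where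
  "ex M = (\<lambda>(f, g). if f \<in> X \<and> g \<in> X then M f g else 0)"

text \<open>A unital algebra of operators up to equality on \<open>V\<close>, because the operators
  are not restricted to \<open>V\<close>.\<close>

definition op_algebra :: "(tens \<Rightarrow> tens) set \<Rightarrow> bool" where
  "op_algebra \<O> \<longleftrightarrow> (\<forall>\<phi>\<in>\<O>. linV \<phi>) \<and> (\<exists>\<omega>\<in>\<O>. \<forall>x\<in>V. \<omega> x = x) \<and>
     (\<forall>\<phi>\<in>\<O>. \<forall>\<chi>\<in>\<O>. \<exists>\<omega>\<in>\<O>. \<forall>x\<in>V. \<omega> x = \<phi> x + \<chi> x) \<and>
     (\<forall>\<phi>\<in>\<O>. \<forall>c. \<exists>\<omega>\<in>\<O>. \<forall>x\<in>V. \<omega> x = const c * \<phi> x) \<and>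
     (\<forall>\<phi>\<in>\<O>. \<forall>\<chi>\<in>\<O>. \<exists>\<omega>\<in>\<O>. \<forall>x\<in>V. \<omega> x = \<phi> (\<chi> x))"

lemma op_algebra_linV: "op_algebra \<O> \<Longrightarrow> \<phi> \<in> \<O> \<Longrightarrow> linV \<phi>"
  unfolding op_algebra_def by (elim conjE) (erule (1) bspec)

lemma op_algebra_id: "op_algebra \<O> \<Longrightarrow> \<exists>\<omega>\<in>\<O>. \<forall>x\<in>V. \<omega> x = x"
  unfolding op_algebra_def by (elim conjE)

lemma op_algebra_add:
  "op_algebra \<O> \<Longrightarrow> \<phi> \<in> \<O> \<Longrightarrow> \<chi> \<in> \<O> \<Longrightarrow> \<exists>\<omega>\<in>\<O>. \<forall>x\<in>V. \<omega> x = \<phi> x + \<chi> x"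
  unfolding op_algebra_def by (elim conjE) (drule (1) bspec, erule (1) bspec)

lemma op_algebra_scale: "op_algebra \<O> \<Longrightarrow> \<phi> \<in> \<O> \<Longrightarrow> \<exists>\<omega>\<in>\<O>. \<forall>x\<in>V. \<omega> x = const c * \<phi> x"
  unfolding op_algebra_def by (elim conjE) (drule (1) bspec, erule spec)

lemma op_algebra_comp:
  "op_algebra \<O> \<Longrightarrow> \<phi> \<in> \<O> \<Longrightarrow> \<chi> \<in> \<O> \<Longrightarrow> \<exists>\<omega>\<in>\<O>. \<forall>x\<in>V. \<omega> x = \<phi> (\<chi> x)"
  unfolding op_algebra_def by (elim conjE) (drule (1) bspec, erule (1) bspec)

definition mats :: "(tens \<Rightarrow> tens) set \<Rightarrow> (rat list \<times> rat list \<Rightarrow> qf) set" where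
  "mats \<O> = (\<lambda>\<phi>. ex (mat \<phi>)) ` \<O>"

text \<open>The values at 1 of all matrices of the algebra that are regular there, including
  quotients by powers of \<open>q - 1\<close> of operators that vanish at 1.\<close>

definition reduction :: "(tens \<Rightarrow> tens) set \<Rightarrow> (rat list \<Rightarrow> rat list \<Rightarrow> rat) set" where
  "reduction \<O> = {M. \<exists>a\<in>mats \<O>. \<forall>f\<in>X. \<forall>g\<in>X. reg (a (f, g)) (M f g)}"

lemma mats_subspace:
  assumes "op_algebra \<O>"
  shows "(\<lambda>_. 0) \<in> mats \<O>" "a \<in> mats \<O> \<Longrightarrow> b \<in> mats \<O> \<Longrightarrow> (\<lambda>x. a x + b x) \<in> mats \<O>"
    "a \<in> mats \<O> \<Longrightarrow> (\<lambda>x. c * a x) \<in> mats \<O>"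
proof -
  have sc: "(\<lambda>x. c * a x) \<in> mats \<O>" if a: "a \<in> mats \<O>" for a c
  proof -
    obtain \<phi> where \<phi>: "\<phi> \<in> \<O>" "a = ex (mat \<phi>)" using a by (auto simp: mats_def)
    then obtain \<omega> where \<omega>: "\<omega> \<in> \<O>" "\<And>x. x \<in> V \<Longrightarrow> \<omega> x = const c * \<phi> x"
      using op_algebra_scale[OF assms, of \<phi> c] by blast
    have "c * a x = ex (mat \<omega>) x" for x by (cases x) (simp add: \<phi>(2) ex_def mat_def \<omega>(2))
    then have "(\<lambda>x. c * a x) = ex (mat \<omega>)" by (rule ext)
    then show ?thesis using \<omega> by (auto simp: mats_def)
  qed
  then show "a \<in> mats \<O> \<Longrightarrow> (\<lambda>x. c * a x) \<in> mats \<O>" .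
  obtain \<iota> where "\<iota> \<in> \<O>" using op_algebra_id[OF assms] by blast
  then show "(\<lambda>_. 0) \<in> mats \<O>" using sc[of "ex (mat \<iota>)" 0] by (simp add: mats_def)
  assume "a \<in> mats \<O>" "b \<in> mats \<O>"
  then obtain \<phi> \<chi> where \<phi>: "\<phi> \<in> \<O>" "a = ex (mat \<phi>)" "\<chi> \<in> \<O>" "b = ex (mat \<chi>)"
    by (auto simp: mats_def)
  then obtain \<omega> where \<omega>: "\<omega> \<in> \<O>" "\<And>x. x \<in> V \<Longrightarrow> \<omega> x = \<phi> x + \<chi> x"
    using op_algebra_add[OF assms, of \<phi> \<chi>] by blast
  have "a x + b x = ex (mat \<omega>) x" for x by (cases x) (simp add: \<phi>(2,4) ex_def mat_def \<omega>(2) lookup_add)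
  then have "(\<lambda>x. a x + b x) = ex (mat \<omega>)" by (rule ext)
  then show "(\<lambda>x. a x + b x) \<in> mats \<O>" using \<omega> by (auto simp: mats_def)
qed

lemma reductionI: "a \<in> mats \<O> \<Longrightarrow> (\<And>f g. f \<in> X \<Longrightarrow> g \<in> X \<Longrightarrow> reg (a (f, g)) (M f g)) \<Longrightarrow> M \<in> reduction \<O>"
  by (auto simp: reduction_def)

lemma reductionE:
  assumes "M \<in> reduction \<O>"
  obtains \<phi> where "\<phi> \<in> \<O>" "\<And>f g. f \<in> X \<Longrightarrow> g \<in> X \<Longrightarrow> reg (mat \<phi> f g) (M f g)"
  using assms by (auto simp: reduction_def mats_def ex_def)

lemma matrix_algebra_reduction:
  assumes \<O>: "op_algebra \<O>"
  shows "matrix_algebra X (reduction \<O>)"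
proof
  show "finite X" by (rule finite_X)
  show "N \<in> reduction \<O>" if "M \<in> reduction \<O>" "\<And>f g. f \<in> X \<Longrightarrow> g \<in> X \<Longrightarrow> M f g = N f g" for M N
    using that by (simp add: reduction_def)
  show "(\<lambda>f g. M f g + N f g) \<in> reduction \<O>" if MN: "M \<in> reduction \<O>" "N \<in> reduction \<O>" for M N
  proof -
    obtain a b where ab: "a \<in> mats \<O>" "b \<in> mats \<O>"
      and "\<And>f g. f \<in> X \<Longrightarrow> g \<in> X \<Longrightarrow> reg (a (f, g)) (M f g)" "\<And>f g. f \<in> X \<Longrightarrow> g \<in> X \<Longrightarrow> reg (b (f, g)) (N f g)"
      using MN unfolding reduction_def by blast
    then show ?thesis by (intro reductionI[OF mats_subspace(2)[OF \<O> ab]]) (auto intro: reg_add)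
  qed
  show "(\<lambda>f g. c * M f g) \<in> reduction \<O>" if M: "M \<in> reduction \<O>" for M c
  proof -
    obtain a where "a \<in> mats \<O>" "\<And>f g. f \<in> X \<Longrightarrow> g \<in> X \<Longrightarrow> reg (a (f, g)) (M f g)"
      using M unfolding reduction_def by blast
    then show ?thesis
      by (intro reductionI[OF mats_subspace(3)[OF \<O>, of _ "emb c"]]) (auto intro: reg_mult reg_emb)
  qed
  show "mm X M N \<in> reduction \<O>" if MN: "M \<in> reduction \<O>" "N \<in> reduction \<O>" for M N
  proof -
    obtain \<phi> where \<phi>: "\<phi> \<in> \<O>" "\<And>f g. f \<in> X \<Longrightarrow> g \<in> X \<Longrightarrow> reg (mat \<phi> f g) (M f g)"
      by (rule reductionE[OF MN(1)]) (rule that)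
    obtain \<chi> where \<chi>: "\<chi> \<in> \<O>" "\<And>f g. f \<in> X \<Longrightarrow> g \<in> X \<Longrightarrow> reg (mat \<chi> f g) (N f g)"
      by (rule reductionE[OF MN(2)]) (rule that)
    have lin: "linV \<phi>" "linV \<chi>" by (rule op_algebra_linV[OF \<O>], rule \<phi> \<chi>)+
    obtain \<omega> where \<omega>: "\<omega> \<in> \<O>" "\<And>x. x \<in> V \<Longrightarrow> \<omega> x = \<phi> (\<chi> x)"
      using op_algebra_comp[OF \<O> \<phi>(1) \<chi>(1)] by blast
    show ?thesis
    proof (rule reductionI)
      show "ex (mat \<omega>) \<in> mats \<O>" using \<omega> by (auto simp: mats_def)
      fix f g assume fg: "f \<in> X" "g \<in> X"
      have "ex (mat \<omega>) (f, g) = mm X (mat \<phi>) (mat \<chi>) f g"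
        using fg mat_compose[OF lin fg(2), of f] by (simp add: ex_def mat_def \<omega>)
      then show "reg (ex (mat \<omega>) (f, g)) (mm X M N f g)"
        using fg \<phi> \<chi> by (simp add: mm_def reg_sum reg_mult)
    qed
  qed
  show "idm \<in> reduction \<O>"
  proof -
    obtain \<omega> where \<omega>: "\<omega> \<in> \<O>" "\<And>x. x \<in> V \<Longrightarrow> \<omega> x = x" using op_algebra_id[OF \<O>] by blast
    then show ?thesis
      by (intro reductionI[of "ex (mat \<omega>)"]) (auto simp: mats_def ex_def mat_def lookup_monomial idm_def)
  qed
qed

text \<open>This is \<open>specialization_lifting\<close> with the matrices of \<open>\<O>\<close>
  as \<open>A\<close> and the commutant of \<open>\<S>\<close> as \<open>C\<close>. The hypothesis
  \<open>core\<close> is the classical part: a specialization of a matrix commuting with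
  \<open>\<S>\<close> is also one of an operator in \<open>\<O>\<close>.\<close>

lemma centralizer_specialization:
  assumes \<O>: "op_algebra \<O>" and \<S>: "\<And>\<sigma>. \<sigma> \<in> \<S> \<Longrightarrow> linV \<sigma>"
    and comm: "\<And>\<phi> \<sigma> x. \<phi> \<in> \<O> \<Longrightarrow> \<sigma> \<in> \<S> \<Longrightarrow> x \<in> V \<Longrightarrow> \<phi> (\<sigma> x) = \<sigma> (\<phi> x)"
    and core: "\<And>M M'. (\<And>f g. f \<in> X \<Longrightarrow> g \<in> X \<Longrightarrow> reg (M f g) (M' f g)) \<Longrightarrow>
      (\<And>\<sigma> f g. \<sigma> \<in> \<S> \<Longrightarrow> f \<in> X \<Longrightarrow> g \<in> X \<Longrightarrow> mm X M (mat \<sigma>) f g = mm X (mat \<sigma>) M f g) \<Longrightarrow> M' \<in> reduction \<O>"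
    and \<phi>: "linV \<phi>" "\<And>\<sigma> x. \<sigma> \<in> \<S> \<Longrightarrow> x \<in> V \<Longrightarrow> \<phi> (\<sigma> x) = \<sigma> (\<phi> x)"
  shows "\<exists>\<omega>\<in>\<O>. \<forall>x\<in>V. \<phi> x = \<omega> x"
proof -
  define C where "C = {c. (\<forall>x. x \<notin> X \<times> X \<longrightarrow> c x = 0) \<and> (\<forall>\<sigma>\<in>\<S>. \<forall>f\<in>X. \<forall>g\<in>X.
      mm X (\<lambda>f g. c (f, g)) (mat \<sigma>) f g = mm X (mat \<sigma>) (\<lambda>f g. c (f, g)) f g)}"
  have mat_C: "ex (mat \<psi>) \<in> C" if \<psi>: "linV \<psi>" "\<And>\<sigma> x. \<sigma> \<in> \<S> \<Longrightarrow> x \<in> V \<Longrightarrow> \<psi> (\<sigma> x) = \<sigma> (\<psi> x)" for \<psi>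
  proof -
    have "mm X (\<lambda>f g. ex (mat \<psi>) (f, g)) (mat \<sigma>) f g = mm X (mat \<sigma>) (\<lambda>f g. ex (mat \<psi>) (f, g)) f g"
      if "\<sigma> \<in> \<S>" "f \<in> X" "g \<in> X" for \<sigma> f g
    proof -
      have "mm X (\<lambda>f g. ex (mat \<psi>) (f, g)) (mat \<sigma>) f g = mm X (mat \<psi>) (mat \<sigma>) f g"
        using that by (simp add: mm_def ex_def)
      also have "\<dots> = mat (\<lambda>x. \<psi> (\<sigma> x)) f g" using mat_compose[OF \<psi>(1) \<S> that(3)] that by simp
      also have "\<dots> = mat (\<lambda>x. \<sigma> (\<psi> x)) f g" using that by (simp add: mat_def \<psi>(2))
      also have "\<dots> = mm X (mat \<sigma>) (mat \<psi>) f g" using mat_compose[OF \<S> \<psi>(1) that(3)] that by simp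
      also have "\<dots> = mm X (mat \<sigma>) (\<lambda>f g. ex (mat \<psi>) (f, g)) f g"
        using that by (simp add: mm_def ex_def)
      finally show ?thesis .
    qed
    then show ?thesis by (auto simp: C_def ex_def)
  qed
  have "C \<subseteq> mats \<O>"
  proof (rule specialization_lifting[of "X \<times> X"])
    show "finite (X \<times> X)" using finite_X by simp
    show "c x = 0" if "c \<in> C" "x \<notin> X \<times> X" for c x
      using that by (simp only: C_def mem_Collect_eq not_False_eq_True)
    show "mats \<O> \<subseteq> C"
    proof
      fix a assume "a \<in> mats \<O>"
      then obtain \<psi> where \<psi>: "\<psi> \<in> \<O>" "a = ex (mat \<psi>)" by (auto simp: mats_def)
      have "linV \<psi>" by (rule op_algebra_linV[OF \<O> \<psi>(1)])
      then show "a \<in> C" unfolding \<psi>(2) using comm[OF \<psi>(1)] by (rule mat_C)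
    qed
    show "(\<lambda>_. 0) \<in> mats \<O>" by (rule mats_subspace(1)[OF \<O>])
    show "(\<lambda>x. a x + b x) \<in> mats \<O>" if "a \<in> mats \<O>" "b \<in> mats \<O>" for a b
      using that by (rule mats_subspace(2)[OF \<O>])
    show "(\<lambda>x. c * a x) \<in> mats \<O>" if "a \<in> mats \<O>" for c a
      using that by (rule mats_subspace(3)[OF \<O>])
    show "(\<lambda>x. a x + b x) \<in> C" if "a \<in> C" "b \<in> C" for a b
      using that by (simp add: C_def mm_def distrib_left distrib_right sum.distrib)
    show "(\<lambda>x. c * a x) \<in> C" if "a \<in> C" for a c
    proof -
      have "(\<Sum>h\<in>X. c * a (f, h) * mat \<sigma> h g) = c * (\<Sum>h\<in>X. a (f, h) * mat \<sigma> h g)"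
        "(\<Sum>h\<in>X. mat \<sigma> f h * (c * a (h, g))) = c * (\<Sum>h\<in>X. mat \<sigma> f h * a (h, g))" for f g \<sigma>
        by (simp_all add: sum_distrib_left mult_ac)
      then show ?thesis using that by (simp add: C_def mm_def)
    qed
    fix c and c' :: "rat list \<times> rat list \<Rightarrow> rat" assume c: "c \<in> C" "\<And>x. reg (c x) (c' x)"
    have "(\<lambda>f g. c' (f, g)) \<in> reduction \<O>"
      by (rule core[of "\<lambda>f g. c (f, g)"]) (use c in \<open>auto simp: C_def\<close>)
    then obtain a where a: "a \<in> mats \<O>" "\<And>f g. f \<in> X \<Longrightarrow> g \<in> X \<Longrightarrow> reg (a (f, g)) (c' (f, g))"
      by (auto simp: reduction_def)
    have "reg (a x) (c' x)" for x
    proof (cases "x \<in> X \<times> X")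
      case False
      then have "c x = 0" using c(1) unfolding C_def by blast
      then have "c' x = 0" using c(2)[of x] reg_unique[OF _ reg_0] by simp
      moreover have "a x = 0" using a(1) False by (cases x) (auto simp: mats_def ex_def)
      ultimately show ?thesis by simp
    qed (use a(2) in auto)
    with a(1) show "\<exists>a\<in>mats \<O>. \<forall>x. reg (a x) (c' x)" by blast
  qed
  with mat_C[OF \<phi>] have "ex (mat \<phi>) \<in> mats \<O>" by blast
  then obtain \<omega> where \<omega>: "\<omega> \<in> \<O>" "ex (mat \<phi>) = ex (mat \<omega>)" by (auto simp: mats_def)
  have "mat \<phi> f g = mat \<omega> f g" if "f \<in> X" "g \<in> X" for f g
    using fun_cong[OF \<omega>(2), of "(f, g)"] that by (simp add: ex_def)
  then have "\<phi> x = \<omega> x" if "x \<in> V" for x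
    using linV_eqI[OF \<phi>(1) op_algebra_linV[OF \<O> \<omega>(1)] _ that] by blast
  with \<omega>(1) show ?thesis by blast
qed

lemma act_X: "j < m \<Longrightarrow> f \<in> X \<Longrightarrow> act j f \<in> X"
proof -
  assume j: "j < m" and f: "f \<in> X"
  have len: "length f = m" using f by (simp add: words_def)
  have "act j f ! p \<in> wtI J" if "p < m" for p
    using that j words_nth[OF f] wtI_uminus len by (auto simp: act_def nth_list_update)
  then show ?thesis using len by (auto simp: words_def in_set_conv_nth)
qed

lemma linV_hgen: "j < m \<Longrightarrow> linV (hgen j)"
  by (simp add: linV_def hgen_closed' hgen_simps)

lemma linV_uact: "u \<in> Ui J \<Longrightarrow> linV (uact m u)"
  using Ui_carrier by (auto simp: linV_def uact_closed[OF m] uact_lin(1)[OF m] uact_lin(2)[OF m _ _ tpow_0])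

text \<open>At \<open>q = 1\<close> the coefficient \<open>inverse q - q\<close> disappears and
  \<open>inverse q\<close> becomes 1, which leaves a permutation matrix.\<close>

lemma reg_hgen:
  assumes j: "j < m" and f: "f \<in> X" and g: "g \<in> X"
  shows "reg (mat (hgen j) f g) (idm f (act j g))"
proof (cases "j = 0")
  case True
  then show ?thesis by (simp add: mat_def hgen_def act_def lookup_monomial idm_def)
next
  case False
  have len: "length g = m" using g by (simp add: words_def)
  define a b where "a = g ! (j - 1)" and "b = g ! j"
  have h: "hgen j (monomial g) = (if a = b then const (inverse q) * monomial g
      else if a < b then monomial (act j g) else monomial (act j g) + const (inverse q - q) * monomial g)"
    using False by (simp add: hgen_def Let_def act_def a_def b_def)
  have r: "reg (inverse q) 1" using reg_inverse[OF reg_q] by simp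
  consider "a = b" | "a < b" | "b < a" by linarith
  then show ?thesis
  proof cases
    case 1
    have "act j g = g"
      using 1 False len j by (intro nth_equalityI) (auto simp: act_def nth_list_update a_def b_def)
    then show ?thesis using 1 r by (simp add: mat_def h lookup_monomial idm_def)
  next
    case 2
    then show ?thesis by (simp add: mat_def h lookup_monomial idm_def)
  next
    case 3
    have "reg (of_bool (f = act j g) + (inverse q - q) * of_bool (f = g)) (of_bool (f = act j g) + (1 - 1) * of_bool (f = g))"
      by (intro reg_add reg_mult reg_of_bool reg_diff r reg_q)
    moreover have "mat (hgen j) f g = of_bool (f = act j g) + (inverse q - q) * of_bool (f = g)"
      using 3 by (simp add: mat_def h lookup_add lookup_monomial)
    ultimately have "reg (mat (hgen j) f g) (of_bool (f = act j g))" by simp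
    then show ?thesis by (simp add: idm_def of_bool_def)
  qed
qed

lemma W_invariant_act:
  assumes "\<And>j f g. j < m \<Longrightarrow> f \<in> X \<Longrightarrow> g \<in> X \<Longrightarrow> M (act j f) (act j g) = M f g"
  shows "flip_index.W_invariant (wtI J) m M"
proof -
  interpret flip_index "wtI J" m by unfold_locales (simp_all add: finite_wtI wtI_uminus)
  show ?thesis
    unfolding W_invariant_def
  proof (intro conjI allI impI)
    fix us us' a b a' b' vs vs'
    assume f: "us @ a # b # vs \<in> X" and g: "us' @ a' # b' # vs' \<in> X" and len: "length us = length us'"
    have "Suc (length us) < m" using f by (auto simp: words_def)
    from assms[OF this f g] show "M (us @ b # a # vs) (us' @ b' # a' # vs') = M (us @ a # b # vs) (us' @ a' # b' # vs')"
      using act_pos[of us a b vs] act_pos[of us' a' b' vs'] len by simp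
  next
    fix a a' :: rat and vs vs' assume "a # vs \<in> X" "a' # vs' \<in> X"
    from assms[OF _ this, of 0] show "M (- a # vs) (- a' # vs') = M (a # vs) (a' # vs')"
      using m by (simp add: act_0_Cons)
  qed
qed

abbreviation "OU \<equiv> uact m ` Ui J"
abbreviation "OH \<equiv> (\<lambda>h x. hact x h) ` carrier (HB m)"

lemma op_algebra_U: "op_algebra OU"
  unfolding op_algebra_def
proof (intro conjI ballI allI)
  show "linV \<phi>" if "\<phi> \<in> OU" for \<phi> using that linV_uact by auto
  have "ucls J (const 1) \<in> Ui J" by (rule Ui_closed)
  then show "\<exists>\<omega>\<in>OU. \<forall>x\<in>V. \<omega> x = x" using uact_gens(1)[OF m, of _ 1] by (auto intro!: bexI)
  fix \<phi> assume "\<phi> \<in> OU"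
  then obtain u where u: "u \<in> Ui J" "\<phi> = uact m u" by auto
  have uc: "u \<in> carrier (UU J)" using u Ui_carrier by blast
  fix c
  have c: "ucls J (const c) \<in> Ui J" by (rule Ui_closed)
  then have cc: "ucls J (const c) \<in> carrier (UU J)" using Ui_carrier by blast
  have "uact m (ucls J (const c) \<otimes>\<^bsub>UU J\<^esub> u) x = const c * uact m u x" if "x \<in> V" for x
    using uact_hom(2)[OF m cc uc that] uact_gens(1)[OF m uact_closed[OF m uc that]] by simp
  then show "\<exists>\<omega>\<in>OU. \<forall>x\<in>V. \<omega> x = const c * \<phi> x" using Ui_closed(3)[OF c u(1)] u(2) by auto
next
  fix \<phi> \<chi> assume "\<phi> \<in> OU" "\<chi> \<in> OU"
  then obtain u v where u: "u \<in> Ui J" "\<phi> = uact m u" and v: "v \<in> Ui J" "\<chi> = uact m v" by auto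
  have c: "u \<in> carrier (UU J)" "v \<in> carrier (UU J)" using u v Ui_carrier by auto
  show "\<exists>\<omega>\<in>OU. \<forall>x\<in>V. \<omega> x = \<phi> x + \<chi> x"
    using uact_hom(1)[OF m c] Ui_closed(2)[OF u(1) v(1)] u v by auto
  show "\<exists>\<omega>\<in>OU. \<forall>x\<in>V. \<omega> x = \<phi> (\<chi> x)"
    using uact_hom(2)[OF m c] Ui_closed(3)[OF u(1) v(1)] u v by auto
qed

lemma OH_iff: "\<phi> \<in> OH \<longleftrightarrow> (\<exists>a\<in>carrier (free_algebra {..<m}). \<phi> = (\<lambda>x. hact x (hcls m a)))"
  by (auto simp: carrier_HB[OF m])

lemma hact_closed: "a \<in> carrier (free_algebra {..<m}) \<Longrightarrow> x \<in> V \<Longrightarrow> ract hgen x a \<in> V"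
proof -
  assume a: "a \<in> carrier (free_algebra {..<m})" and x: "x \<in> V"
  have "fold hgen us x \<in> V" if "set us \<subseteq> {..<m}" for us
    using that x by (induct us arbitrary: x) (simp_all add: hgen_closed')
  then show ?thesis
    using a unfolding ract_def by (intro tpow_sum tpow_const_mult) (auto simp: carrier_free_algebra)
qed

lemma op_algebra_H: "op_algebra OH"
  unfolding op_algebra_def
proof (intro conjI ballI allI)
  show "linV \<phi>" if "\<phi> \<in> OH" for \<phi>
    using that lin_add[OF lin_ract[OF lin_hgen]] lin_scale[OF lin_ract[OF lin_hgen]] unfolding OH_iff
    by (auto simp: linV_def hact_hcls'[OF m] hact_closed)
  show "\<exists>\<omega>\<in>OH. \<forall>x\<in>V. \<omega> x = x"
    by (rule bexI[of _ "\<lambda>x. hact x (hcls m 1)"]) (auto simp: hact_hcls'[OF m] ract_1 OH_iff simp del: image_iff)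
  fix \<phi> assume "\<phi> \<in> OH"
  then obtain a where a: "a \<in> carrier (free_algebra {..<m})" "\<phi> = (\<lambda>x. hact x (hcls m a))" by (auto simp: OH_iff)
  fix c
  show "\<exists>\<omega>\<in>OH. \<forall>x\<in>V. \<omega> x = const c * \<phi> x"
  proof (rule bexI[of _ "\<lambda>x. hact x (hcls m (const c * a))"])
    show "(\<lambda>x. hact x (hcls m (const c * a))) \<in> OH" unfolding OH_iff using a by auto
  qed (simp add: a hact_hcls'[OF m] ract_scale)
next
  fix \<phi> \<chi> assume "\<phi> \<in> OH" "\<chi> \<in> OH"
  then obtain a b where a: "a \<in> carrier (free_algebra {..<m})" "\<phi> = (\<lambda>x. hact x (hcls m a))"
    and b: "b \<in> carrier (free_algebra {..<m})" "\<chi> = (\<lambda>x. hact x (hcls m b))" unfolding OH_iff by blast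
  show "\<exists>\<omega>\<in>OH. \<forall>x\<in>V. \<omega> x = \<phi> x + \<chi> x"
  proof (rule bexI[of _ "\<lambda>x. hact x (hcls m (a + b))"])
    show "(\<lambda>x. hact x (hcls m (a + b))) \<in> OH" unfolding OH_iff using a b by auto
  qed (simp add: a b hact_hcls'[OF m] ract_add)
  show "\<exists>\<omega>\<in>OH. \<forall>x\<in>V. \<omega> x = \<phi> (\<chi> x)"
  proof (rule bexI[of _ "\<lambda>x. hact x (hcls m (b * a))"])
    show "(\<lambda>x. hact x (hcls m (b * a))) \<in> OH" unfolding OH_iff using a b by auto
  qed (simp add: a b hact_hcls'[OF m] hact_closed ract_mult)
qed

text \<open>The required matrices are the specializations computed in \<open>reg_e\<close>,
  \<open>reg_f\<close>, \<open>reg_h\<close> and \<open>reg_t\<close>; the step from index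
  \<open>a\<close> to \<open>a + 1\<close> belongs to the root \<open>a + 1/2\<close>.\<close>

lemma coideal_algebra_U: "coideal_algebra (wtI J) m (reduction OU) n"
proof -
  interpret matrix_algebra X "reduction OU" by (rule matrix_algebra_reduction[OF op_algebra_U])
  have memI: "M \<in> reduction OU" if "u \<in> Ui J" "\<And>f g. f \<in> X \<Longrightarrow> g \<in> X \<Longrightarrow> reg (mat (uact m u) f g) (M f g)" for u M
    using that by (intro reductionI[of "ex (mat (uact m u))"]) (auto simp: mats_def ex_def)
  have J: "a + 1/2 \<in> J \<and> a + 1/2 > 0" if a: "a \<ge> 0" "a \<in> wtI J" "a + 1 \<in> wtI J" for a
  proof -
    obtain k where k: "k \<le> n" "a = of_nat k - of_nat n / 2" using a(2) by (rule wtI_cases)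
    obtain l where l: "l \<le> n" "a + 1 = of_nat l - of_nat n / 2" using a(3) by (rule wtI_cases)
    have "(of_nat (Suc k) :: rat) = of_nat l" using k l by simp
    then have "k < n" using l by (simp only: of_nat_eq_iff)
    then have "a + 1/2 \<in> J" unfolding J_eq k by blast
    then show ?thesis using a(1) by simp
  qed
  show ?thesis
  proof
    show "wtI J = (\<lambda>k. of_nat k - of_nat n / 2) ` {..n}" by (rule wtI_eq)
    show "1 \<le> n" by (rule n)
    fix a assume a: "a \<ge> 0" "a \<in> wtI J" "a + 1 \<in> wtI J"
    note i = J[OF a, THEN conjunct1] J[OF a, THEN conjunct2]
    have half: "a + 1/2 - 1/2 = a" "a + 1/2 + 1/2 = a + 1" by simp_all
    show "deriv m (Bmat a (a + 1)) \<in> reduction OU"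
      using reg_e[OF m, of _ _ "a + 1/2"] by (intro memI[OF Ui_closed(5)[OF i]]) (simp only: half)
    show "deriv m (Bmat (a + 1) a) \<in> reduction OU"
      using reg_f[OF m _ _ i(1)] by (intro memI[OF Ui_closed(6)[OF i]]) (simp only: half)
    have k: "ex (mat (uact m (ik J (a + 1/2)))) \<in> mats OU"
      using Ui_closed(4)[OF i] by (auto simp: mats_def)
    have "ex (mat (uact m (ucls J (const 1)))) \<in> mats OU"
      using Ui_closed(1)[of 1] by (auto simp: mats_def)
    then have "(\<lambda>x. inverse (q - 1) * (ex (mat (uact m (ik J (a + 1/2)))) x + (-1) * ex (mat (uact m (ucls J (const 1)))) x)) \<in> mats OU"
      by (intro mats_subspace[OF op_algebra_U] k)
    then show "deriv m (\<lambda>x y. Bmat a a x y - Bmat (a + 1) (a + 1) x y) \<in> reduction OU"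
    proof (rule reductionI)
      fix f g assume fg: "f \<in> X" "g \<in> X"
      have "mat (uact m (ucls J (const 1))) f g = idm f g"
        using uact_gens(1)[OF m, of "monomial g" 1] fg by (simp add: mat_def lookup_monomial idm_def)
      then show "reg (inverse (q - 1) * (ex (mat (uact m (ik J (a + 1/2)))) (f, g) + (-1) * ex (mat (uact m (ucls J (const 1)))) (f, g)))
          (deriv m (\<lambda>x y. Bmat a a x y - Bmat (a + 1) (a + 1) x y) f g)"
        using reg_h[OF m fg, of "a + 1/2", unfolded half] fg by (simp add: ex_def)
    qed
  next
    assume "odd n"
    then obtain k where k: "n = 2 * k + 1" by (rule oddE)
    then have "(of_nat n :: rat) = 2 * of_nat k + 1" by simp
    then have "0 = of_nat k - of_nat n / 2 + (1/2 :: rat)" by (simp add: add_divide_distrib)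
    moreover have "k \<in> {..<n}" using k by simp
    ultimately have "0 \<in> J" unfolding J_eq by (rule image_eqI)
    then show "deriv m (Bmat (- 1 / 2) (1 / 2)) \<in> reduction OU"
      using reg_t[OF m] by (intro memI[OF Ui_closed(7)])
  qed
qed

text \<open>At \<open>q = 1\<close> commutation with H_j becomes invariance under
  \<open>act j\<close> in rows and columns, and by \<open>W_invariant_mem\<close> the specialized
  coideal subalgebra contains all invariant matrices.\<close>

lemma U_core:
  assumes reg: "\<And>f g. f \<in> X \<Longrightarrow> g \<in> X \<Longrightarrow> reg (M f g) (M' f g)"
    and comm: "\<And>j f g. j < m \<Longrightarrow> f \<in> X \<Longrightarrow> g \<in> X \<Longrightarrow> mm X M (mat (hgen j)) f g = mm X (mat (hgen j)) M f g"
  shows "M' \<in> reduction OU"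
proof -
  interpret coideal_algebra "wtI J" m "reduction OU" n by (rule coideal_algebra_U)
  show ?thesis
  proof (rule W_invariant_mem, rule W_invariant_act)
    fix j f g assume j: "j < m" and f: "f \<in> X" and g: "g \<in> X"
    have g': "act j g \<in> X" by (rule act_X[OF j g])
    have f': "act j f \<in> X" by (rule act_X[OF j f])
    have len: "length f = m" "length g = m" using f g by (simp_all add: words_def)
    have "reg (mm X M (mat (hgen j)) (act j f) g) (\<Sum>h\<in>X. M' (act j f) h * idm h (act j g))"
      unfolding mm_def using reg j f' g by (intro reg_sum reg_mult reg_hgen) auto
    also have "(\<Sum>h\<in>X. M' (act j f) h * idm h (act j g)) = M' (act j f) (act j g)"
      using mm_idm_right[OF finite_X g', of M' "act j f"] by (simp add: mm_def)
    finally have 1: "reg (mm X M (mat (hgen j)) (act j f) g) (M' (act j f) (act j g))" .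
    have "reg (mm X (mat (hgen j)) M (act j f) g) (\<Sum>h\<in>X. idm (act j f) (act j h) * M' h g)"
      unfolding mm_def using reg j f' g by (intro reg_sum reg_mult reg_hgen) auto
    also have "(\<Sum>h\<in>X. idm (act j f) (act j h) * M' h g) = (\<Sum>h\<in>X. idm f h * M' h g)"
    proof (rule sum.cong[OF refl])
      fix h assume "h \<in> X"
      then have "act j (act j f) = f" "act j (act j h) = h"
        using act_act[of j f] act_act[of j h] j len by (simp_all add: words_length)
      then have "act j f = act j h \<longleftrightarrow> f = h" by metis
      then show "idm (act j f) (act j h) * M' h g = idm f h * M' h g" by (simp add: idm_def)
    qed
    also have "(\<Sum>h\<in>X. idm f h * M' h g) = M' f g"
      using mm_idm_left[OF finite_X f, of M' g] by (simp add: mm_def)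
    finally have "reg (mm X (mat (hgen j)) M (act j f) g) (M' f g)" .
    with 1 show "M' (act j f) (act j g) = M' f g"
      unfolding comm[OF j f' g] by (rule reg_unique)
  qed
qed

text \<open>Every invariant matrix \<open>N\<close> is a specialization of an element of the coideal
  subalgebra, so that \<open>M'\<close> commutes with it. Then \<open>bicommutant\<close> places
  \<open>M'\<close> in the specialized Hecke algebra, which contains the permutation matrices of the
  \<open>act j\<close>.\<close>

lemma H_core:
  assumes reg: "\<And>f g. f \<in> X \<Longrightarrow> g \<in> X \<Longrightarrow> reg (M f g) (M' f g)"
    and comm: "\<And>u f g. u \<in> Ui J \<Longrightarrow> f \<in> X \<Longrightarrow> g \<in> X \<Longrightarrow> mm X M (mat (uact m u)) f g = mm X (mat (uact m u)) M f g"
  shows "M' \<in> reduction OH"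
proof -
  interpret U: coideal_algebra "wtI J" m "reduction OU" n by (rule coideal_algebra_U)
  interpret H: matrix_algebra X "reduction OH" by (rule matrix_algebra_reduction[OF op_algebra_H])
  show ?thesis
  proof (rule H.bicommutant[of "act ` {..<m}"])
    fix s assume "s \<in> act ` {..<m}"
    then obtain j where j: "j < m" "s = act j" by auto
    have inv: "act j (act j f) = f" if "f \<in> X" for f using that j by (intro act_act) (simp add: words_def)
    show "bij_betw s X X"
      unfolding j by (rule bij_betw_byWitness[where f' = "act j"]) (auto simp: inv act_X[OF j(1)])
    have "hcls m (var j) \<in> carrier (HB m)" using j by (auto simp: carrier_HB[OF m])
    then have "ex (mat (\<lambda>x. hact x (hcls m (var j)))) \<in> mats OH" by (auto simp: mats_def)
    then show "(\<lambda>f h. idm (s f) h) \<in> reduction OH"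
    proof (rule reductionI)
      fix f g assume fg: "f \<in> X" "g \<in> X"
      have "act j f = g \<longleftrightarrow> f = act j g" using inv fg by auto
      then have "idm (s f) g = (idm f (act j g) :: rat)" by (simp add: idm_def j)
      then show "reg (ex (mat (\<lambda>x. hact x (hcls m (var j)))) (f, g)) (idm (s f) g)"
        using reg_hgen[OF j(1) fg] fg by (simp add: ex_def mat_def hact_hcls'[OF m] ract_var)
    qed
  next
    fix N :: "rat list \<Rightarrow> rat list \<Rightarrow> rat" and f h
    assume "\<And>s f g. s \<in> act ` {..<m} \<Longrightarrow> f \<in> X \<Longrightarrow> g \<in> X \<Longrightarrow> N (s f) (s g) = N f g" and f: "f \<in> X" and h: "h \<in> X"
    then have "N \<in> reduction OU" by (intro U.W_invariant_mem W_invariant_act) auto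
    then obtain u where u: "u \<in> Ui J" "\<And>f g. f \<in> X \<Longrightarrow> g \<in> X \<Longrightarrow> reg (mat (uact m u) f g) (N f g)"
      by (auto elim!: reductionE)
    have "reg (mm X (mat (uact m u)) M f h) (mm X N M' f h)" "reg (mm X M (mat (uact m u)) f h) (mm X M' N f h)"
      unfolding mm_def using f h u reg by (auto intro!: reg_sum reg_mult)
    then show "mm X N M' f h = mm X M' N f h"
      unfolding comm[OF u(1) f h] by (rule reg_unique)
  qed
qed

lemma endos_linV: "\<phi> \<in> endos V \<Longrightarrow> linV \<phi>"
  by (auto simp: endos_def linV_def)

lemma restrict_endos: "linV \<phi> \<Longrightarrow> restrict \<phi> V \<in> endos V"
  by (auto simp: endos_def linV_def)

lemma compose_restrict:
  assumes "linV \<phi>" "linV \<psi>"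
  shows "compose V (restrict \<phi> V) (restrict \<psi> V) = compose V (restrict \<psi> V) (restrict \<phi> V)
    \<longleftrightarrow> (\<forall>x\<in>V. \<phi> (\<psi> x) = \<psi> (\<phi> x))"
  using assms by (auto simp: compose_def linV_closed restrict_def fun_eq_iff)

lemma OU_OH_commute: "\<phi> \<in> OU \<Longrightarrow> \<sigma> \<in> OH \<Longrightarrow> x \<in> V \<Longrightarrow> \<phi> (\<sigma> x) = \<sigma> (\<phi> x)"
  using uact_hact_commute[OF m] by auto

lemma Ui_image_eq: "Ui_image J m = (\<lambda>\<phi>. restrict \<phi> V) ` OU"
  by (auto simp: Ui_image_def image_image)

lemma HB_image_eq: "HB_image J m = (\<lambda>\<phi>. restrict \<phi> V) ` OH"
  by (auto simp: HB_image_def image_image)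

lemma linV_OU: "\<phi> \<in> OU \<Longrightarrow> linV \<phi>"
  by (rule op_algebra_linV[OF op_algebra_U])

lemma linV_OH: "\<phi> \<in> OH \<Longrightarrow> linV \<phi>"
  by (rule op_algebra_linV[OF op_algebra_H])

lemma linV_hact: "h \<in> carrier (HB m) \<Longrightarrow> linV (\<lambda>x. hact x h)"
  by (rule linV_OH) blast

theorem Ui_image_centralizer: "Ui_image J m = centralizer_in V (HB_image J m)"
proof
  show "Ui_image J m \<subseteq> centralizer_in V (HB_image J m)"
    by (auto simp: Ui_image_def HB_image_def centralizer_in_def restrict_endos compose_restrict
        linV_uact linV_hact uact_hact_commute[OF m])
  show "centralizer_in V (HB_image J m) \<subseteq> Ui_image J m"
  proof
    fix \<phi> assume "\<phi> \<in> centralizer_in V (HB_image J m)"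
    then have \<phi>: "\<phi> \<in> endos V" and c: "\<And>\<psi>. \<psi> \<in> HB_image J m \<Longrightarrow> compose V \<phi> \<psi> = compose V \<psi> \<phi>"
      by (auto simp: centralizer_in_def)
    have ext: "restrict \<phi> V = \<phi>" using \<phi> by (auto simp: endos_def PiE_def extensional_restrict)
    have lin: "linV \<phi>" using \<phi> by (rule endos_linV)
    have "\<exists>\<omega>\<in>OU. \<forall>x\<in>V. \<phi> x = \<omega> x"
    proof (rule centralizer_specialization[OF op_algebra_U, where \<S> = "hgen ` {..<m}"])
      show "linV \<sigma>" if "\<sigma> \<in> hgen ` {..<m}" for \<sigma> using that linV_hgen by auto
      show "\<phi> (\<sigma> x) = \<sigma> (\<phi> x)" if "\<phi> \<in> OU" "\<sigma> \<in> hgen ` {..<m}" "x \<in> V" for \<phi> \<sigma> x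
        using that uact_hgen_commute[OF m] by auto
      show "linV \<phi>" by (rule lin)
      show "\<phi> (\<sigma> x) = \<sigma> (\<phi> x)" if \<sigma>: "\<sigma> \<in> hgen ` {..<m}" and x: "x \<in> V" for \<sigma> x
      proof -
        obtain j where j: "j < m" "\<sigma> = hgen j" using \<sigma> by auto
        have h: "hcls m (var j) \<in> carrier (HB m)" using j by (auto simp: carrier_HB[OF m])
        let ?\<psi> = "\<lambda>x. hact x (hcls m (var j))"
        have "restrict ?\<psi> V \<in> HB_image J m" using h by (auto simp: HB_image_def)
        from c[OF this] have "\<forall>x\<in>V. \<phi> (?\<psi> x) = ?\<psi> (\<phi> x)"
          using compose_restrict[OF lin linV_OH[of ?\<psi>]] h unfolding ext by blast
        then show ?thesis using x j linV_closed[OF lin x] by (simp add: hact_hcls'[OF m] ract_var)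
      qed
    qed (rule U_core, auto)
    then obtain \<omega> where "\<omega> \<in> OU" "restrict \<phi> V = restrict \<omega> V" by (metis restrict_ext)
    then show "\<phi> \<in> Ui_image J m" unfolding ext Ui_image_eq by blast
  qed
qed

theorem HB_image_centralizer: "HB_image J m = centralizer_in V (Ui_image J m)"
proof
  show "HB_image J m \<subseteq> centralizer_in V (Ui_image J m)"
    by (auto simp: Ui_image_def HB_image_def centralizer_in_def restrict_endos compose_restrict
        linV_uact linV_hact uact_hact_commute[OF m])
  show "centralizer_in V (Ui_image J m) \<subseteq> HB_image J m"
  proof
    fix \<phi> assume "\<phi> \<in> centralizer_in V (Ui_image J m)"
    then have \<phi>: "\<phi> \<in> endos V" and c: "\<And>\<psi>. \<psi> \<in> Ui_image J m \<Longrightarrow> compose V \<phi> \<psi> = compose V \<psi> \<phi>"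
      by (auto simp: centralizer_in_def)
    have ext: "restrict \<phi> V = \<phi>" using \<phi> by (auto simp: endos_def PiE_def extensional_restrict)
    have lin: "linV \<phi>" using \<phi> by (rule endos_linV)
    have "\<exists>\<omega>\<in>OH. \<forall>x\<in>V. \<phi> x = \<omega> x"
    proof (rule centralizer_specialization[OF op_algebra_H, where \<S> = OU])
      show "\<phi> (\<sigma> x) = \<sigma> (\<phi> x)" if "\<phi> \<in> OH" "\<sigma> \<in> OU" "x \<in> V" for \<phi> \<sigma> x
        using OU_OH_commute[OF that(2,1,3)] by simp
      show "\<phi> (\<sigma> x) = \<sigma> (\<phi> x)" if \<sigma>: "\<sigma> \<in> OU" and x: "x \<in> V" for \<sigma> x
      proof -
        have "restrict \<sigma> V \<in> Ui_image J m" using \<sigma> unfolding Ui_image_eq by blast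
        from c[OF this] show ?thesis
          using compose_restrict[OF lin linV_OU[OF \<sigma>]] x unfolding ext by blast
      qed
      show "linV \<sigma>" if "\<sigma> \<in> OU" for \<sigma> using that by (rule linV_OU)
      show "linV \<phi>" by (rule lin)
    qed (rule H_core, auto)
    then obtain \<omega> where "\<omega> \<in> OH" "restrict \<phi> V = restrict \<omega> V" by (metis restrict_ext)
    then show "\<phi> \<in> HB_image J m" unfolding ext HB_image_eq by blast
  qed
qed

end

section \<open>Reduced expressions of the longest element\<close>

context weight_index
begin

definition Inv :: "(rat \<Rightarrow> rat) \<Rightarrow> (rat \<times> rat) set" where
  "Inv w = {(a, b). a \<in> wtI J \<and> b \<in> wtI J \<and> a < b \<and> w b < w a}"

lemma finite_Inv [simp]: "finite (Inv w)"
  by (rule finite_subset[of _ "wtI J \<times> wtI J"]) (auto simp: Inv_def finite_wtI)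

abbreviation refl :: "rat \<Rightarrow> rat \<Rightarrow> rat" where
  "refl i \<equiv> transpose (i - 1/2) (i + 1/2)"

lemma refl_permutes: "i \<in> J \<Longrightarrow> refl i permutes wtI J"
  by (intro permutes_swap_id) simp_all

text \<open>No weight lies between \<open>i - 1/2\<close> and \<open>i + 1/2\<close>, so that
  exchanging them affects the order of these two alone.\<close>

lemma refl_mono:
  assumes i: "i \<in> J" and uv: "u \<in> wtI J" "v \<in> wtI J" "\<not> (u = i - 1/2 \<and> v = i + 1/2)" "u < v"
  shows "refl i u < refl i v"
proof -
  define p n where "p = i + 1/2" and "n = i - 1/2"
  have np: "n < p" by (simp add: p_def n_def)
  have c: "c = p \<or> c = n \<or> c < n \<or> p < c" if "c \<in> wtI J" for c
    using wt_cases[OF that i] unfolding p_def n_def by blast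
  have uv': "\<not> (u = n \<and> v = p)" using uv(3) by (simp add: p_def n_def)
  have "transpose n p u < transpose n p v"
    using c[OF uv(1)] c[OF uv(2)] np uv(4) uv' by (auto simp: transpose_def)
  then show ?thesis by (simp add: p_def n_def)
qed

lemma refl_less_iff:
  assumes i: "i \<in> J" and uv: "u \<in> wtI J" "v \<in> wtI J" "{u, v} \<noteq> {i - 1/2, i + 1/2}"
  shows "refl i u < refl i v \<longleftrightarrow> u < v"
proof -
  have "refl i u < refl i v" if "u < v" using refl_mono[OF i uv(1,2)] uv(3) that by auto
  moreover have "refl i v < refl i u" if "v < u" using refl_mono[OF i uv(2,1)] uv(3) that by auto
  ultimately show ?thesis by (cases u v rule: linorder_cases) auto
qed

text \<open>By \<open>refl_less_iff\<close> the reflection changes the order of no other pair of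
  values, so that exactly the pair of preimages of \<open>i - 1/2\<close> and \<open>i + 1/2\<close>
  enters or leaves the inversion set.\<close>

lemma Inv_refl:
  assumes i: "i \<in> J" and w: "w permutes wtI J" and xy: "w x = i - 1/2" "w y = i + 1/2"
  shows "x < y \<Longrightarrow> Inv (refl i \<circ> w) = insert (x, y) (Inv w) \<and> (x, y) \<notin> Inv w"
    and "y < x \<Longrightarrow> Inv w = insert (y, x) (Inv (refl i \<circ> w)) \<and> (y, x) \<notin> Inv (refl i \<circ> w)"
proof -
  have xyI: "x \<in> wtI J" "y \<in> wtI J"
    using permutes_in_image[OF w, of x] permutes_in_image[OF w, of y] xy i by simp_all
  have other: "(a, b) \<in> Inv (refl i \<circ> w) \<longleftrightarrow> (a, b) \<in> Inv w" if "{a, b} \<noteq> {x, y}" for a b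
  proof (cases "a \<in> wtI J \<and> b \<in> wtI J")
    case True
    have "{w b, w a} \<noteq> {w x, w y}"
      using that permutes_inj[OF w] by (auto simp: doubleton_eq_iff inj_eq)
    then have "refl i (w b) < refl i (w a) \<longleftrightarrow> w b < w a"
      using True permutes_in_image[OF w] unfolding xy by (intro refl_less_iff[OF i]) auto
    then show ?thesis by (simp add: Inv_def)
  qed (auto simp: Inv_def)
  have lt: "i - 1/2 < i + 1/2" by simp
  have xw: "(refl i \<circ> w) x = i + 1/2" "(refl i \<circ> w) y = i - 1/2" by (simp_all add: xy)
  have in_w: "(a, b) \<in> Inv w \<longleftrightarrow> a < b \<and> a = y \<and> b = x" if "{a, b} = {x, y}" for a b
    using that xyI xy lt by (auto simp: Inv_def doubleton_eq_iff)
  have in_rw: "(a, b) \<in> Inv (refl i \<circ> w) \<longleftrightarrow> a < b \<and> a = x \<and> b = y" if "{a, b} = {x, y}" for a b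
    using that xyI xw lt unfolding Inv_def by (auto simp del: o_apply simp: doubleton_eq_iff)
  show "x < y \<Longrightarrow> Inv (refl i \<circ> w) = insert (x, y) (Inv w) \<and> (x, y) \<notin> Inv w"
  proof
    assume "x < y"
    show "Inv (refl i \<circ> w) = insert (x, y) (Inv w)"
    proof (rule Set.set_eqI)
      fix z :: "rat \<times> rat"
      obtain a b where z: "z = (a, b)" by (cases z)
      show "z \<in> Inv (refl i \<circ> w) \<longleftrightarrow> z \<in> insert (x, y) (Inv w)"
      proof (cases "{a, b} = {x, y}")
        case True
        then show ?thesis
          unfolding z insert_iff in_w[OF True] in_rw[OF True] using \<open>x < y\<close> by auto
      next
        case False
        then have "(a, b) \<noteq> (x, y)" by auto
        then show ?thesis unfolding z insert_iff other[OF False] by blast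
      qed
    qed
    show "(x, y) \<notin> Inv w" using in_w[of x y] \<open>x < y\<close> by auto
  qed
  show "y < x \<Longrightarrow> Inv w = insert (y, x) (Inv (refl i \<circ> w)) \<and> (y, x) \<notin> Inv (refl i \<circ> w)"
  proof
    assume "y < x"
    show "Inv w = insert (y, x) (Inv (refl i \<circ> w))"
    proof (rule Set.set_eqI)
      fix z :: "rat \<times> rat"
      obtain a b where z: "z = (a, b)" by (cases z)
      show "z \<in> Inv w \<longleftrightarrow> z \<in> insert (y, x) (Inv (refl i \<circ> w))"
      proof (cases "{a, b} = {x, y}")
        case True
        then show ?thesis
          unfolding z insert_iff in_w[OF True] in_rw[OF True] using \<open>y < x\<close> by auto
      next
        case False
        then have "(a, b) \<noteq> (y, x)" by auto
        then show ?thesis unfolding z insert_iff other[OF False] by blast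
      qed
    qed
    show "(y, x) \<notin> Inv (refl i \<circ> w)" using in_rw[of y x] \<open>y < x\<close> by auto
  qed
qed

lemma wprod_Cons: "wprod (i # ws) = refl i \<circ> wprod ws"
  by (simp add: wprod_def)

lemma wprod_permutes: "ws \<in> lists J \<Longrightarrow> wprod ws permutes wtI J"
proof (induct ws)
  case Nil
  have "wprod [] = id" by (simp add: wprod_def)
  then show ?case by (simp only: permutes_id)
next
  case (Cons i ws)
  then show ?case unfolding wprod_Cons by (intro permutes_compose refl_permutes) auto
qed

text \<open>Follows \<open>a\<close> through the reflections, starting with the last letter of the
  word, and counts how often it moves up; each such move costs a factor \<open>- q\<close> in
  \<open>Tw_var\<close>.\<close>

fun ups :: "rat list \<Rightarrow> rat \<Rightarrow> nat" where
  "ups [] a = 0"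
| "ups (i # ws) a = ups ws a + of_bool (wprod ws a = i - 1/2)"

lemma preimages:
  assumes "i \<in> J" "w permutes wtI J"
  obtains x y where "w x = i - 1/2" "w y = i + 1/2" "x \<noteq> y"
proof -
  obtain x y where "w x = i - 1/2" "w y = i + 1/2"
    using permutes_surj[OF assms(2)] by (metis surjD)
  moreover then have "x \<noteq> y" by auto
  ultimately show thesis by (rule that)
qed

text \<open>Each simple reflection creates at most one inversion.\<close>

lemma card_Inv_le_length: "ws \<in> lists J \<Longrightarrow> card (Inv (wprod ws)) \<le> length ws"
proof (induct ws)
  case Nil
  have "Inv (wprod []) = {}" by (auto simp: Inv_def wprod_def)
  then show ?case by simp
next
  case (Cons i ws)
  then have i: "i \<in> J" and w: "wprod ws permutes wtI J" by (auto intro: wprod_permutes)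
  obtain x y where xy: "wprod ws x = i - 1/2" "wprod ws y = i + 1/2" "x \<noteq> y" by (rule preimages[OF i w])
  note Inv = Inv_refl[OF i w xy(1,2)]
  show ?case
  proof (cases "x < y")
    case True
    then show ?thesis using Inv(1) Cons by (simp add: wprod_Cons del: o_apply)
  next
    case False
    then have "card (Inv (wprod ws)) = Suc (card (Inv (wprod (i # ws))))"
      using Inv(2) xy(3) unfolding wprod_Cons by (metis card_insert_disjoint finite_Inv linorder_neqE)
    then show ?thesis using Cons by auto
  qed
qed

text \<open>In a reduced expression every factor creates a new inversion.\<close>

lemma ups_eq_card:
  "ws \<in> lists J \<Longrightarrow> card (Inv (wprod ws)) = length ws \<Longrightarrow> ups ws a = card {b. (a, b) \<in> Inv (wprod ws)}"
proof (induct ws)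
  case Nil
  have "Inv (wprod []) = {}" by (auto simp: Inv_def wprod_def)
  then show ?case by simp
next
  case (Cons i ws)
  then have i: "i \<in> J" and ws: "ws \<in> lists J" and w: "wprod ws permutes wtI J" by (auto intro: wprod_permutes)
  obtain x y where xy: "wprod ws x = i - 1/2" "wprod ws y = i + 1/2" "x \<noteq> y" by (rule preimages[OF i w])
  note Inv = Inv_refl[OF i w xy(1,2)]
  have "x < y"
  proof (rule ccontr)
    assume "\<not> x < y"
    then have "card (Inv (wprod ws)) = Suc (card (Inv (wprod (i # ws))))"
      using Inv(2) xy(3) unfolding wprod_Cons by (metis card_insert_disjoint finite_Inv linorder_neqE)
    then show False using Cons(3) card_Inv_le_length[OF ws] by simp
  qed
  note I = Inv(1)[OF this, folded wprod_Cons]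
  have "card (Inv (wprod ws)) = length ws" using I Cons(3) by simp
  then have IH: "ups ws a = card {b. (a, b) \<in> Inv (wprod ws)}" using Cons(1) ws by simp
  have fin: "finite {b. (a, b) \<in> Inv (wprod ws)}"
    by (rule finite_subset[OF _ finite_wtI]) (auto simp: Inv_def)
  have "wprod ws a = i - 1/2 \<longleftrightarrow> a = x"
    using permutes_inj[OF w] xy(1) by (metis injD)
  moreover have "{b. (a, b) \<in> Inv (wprod (i # ws))} = (if a = x then insert y {b. (a, b) \<in> Inv (wprod ws)} else {b. (a, b) \<in> Inv (wprod ws)})"
    using I by auto
  moreover have "y \<notin> {b. (x, b) \<in> Inv (wprod ws)}" using I by simp
  ultimately show ?case using IH fin by auto
qed

text \<open>A strictly increasing self-map of a finite chain: induction from the bottom shows that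
  nothing moves down, induction from the top that nothing moves up.\<close>

lemma strict_mono_id:
  assumes f: "\<And>a. a \<in> wtI J \<Longrightarrow> f a \<in> wtI J"
    and mono: "\<And>i. i \<in> J \<Longrightarrow> f (i - 1/2) < f (i + 1/2)" and a: "a \<in> wtI J"
  shows "f a = a"
proof -
  define c where "c k = of_nat k - of_nat n / (2 :: rat)" for k
  have cI: "c k \<in> wtI J" if "k \<le> n" for k using that by (auto simp: wtI_eq c_def)
  have step: "f (c k) < f (c (Suc k))" if "k < n" for k
  proof -
    have "c k + 1/2 \<in> J" using that by (auto simp: J_eq c_def)
    moreover have "c k + 1/2 - 1/2 = c k" "c k + 1/2 + 1/2 = c (Suc k)" by (simp_all add: c_def)
    ultimately show ?thesis using mono[of "c k + 1/2"] by simp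
  qed
  have lower: "c k \<le> f (c k)" if "k \<le> n" for k
    using that
  proof (induct k)
    case 0
    obtain l where "f (c 0) = c l" using f[OF cI[of 0]] by (auto simp: wtI_eq c_def)
    then show ?case by (simp add: c_def)
  next
    case (Suc k)
    obtain l where l: "f (c (Suc k)) = c l" using f[OF cI[OF Suc(2)]] by (auto simp: wtI_eq c_def)
    have "c k < c l" using Suc step[of k] l by simp
    then show ?case unfolding l by (simp add: c_def)
  qed
  have upper: "f (c (n - k)) \<le> c (n - k)" if "k \<le> n" for k
    using that
  proof (induct k)
    case 0
    obtain l where "f (c n) = c l" "l \<le> n" using f[OF cI[of n]] by (auto simp: wtI_eq c_def)
    then show ?case by (simp add: c_def)
  next
    case (Suc k)
    have e: "n - k = Suc (n - Suc k)" using Suc(2) by simp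
    obtain l where l: "f (c (n - Suc k)) = c l" using f[OF cI[of "n - Suc k"]] by (auto simp: wtI_eq c_def)
    have "f (c (n - Suc k)) < f (c (n - k))" using step[of "n - Suc k"] Suc(2) by (simp add: e)
    then have "c l < c (n - k)" using Suc l by simp
    then show ?case unfolding l e by (simp add: c_def)
  qed
  obtain k where "k \<le> n" "a = c k" using a by (auto simp: wtI_eq c_def)
  then show ?thesis using lower[of k] upper[of "n - k"] by simp
qed

text \<open>If some simple reflection removes an inversion, induction applies. Otherwise the inverse
  of \<open>w\<close> is strictly increasing on the weights, and \<open>w\<close> is the
  identity.\<close>

lemma reduced_word_exists:
  "w permutes wtI J \<Longrightarrow> \<exists>ws\<in>lists J. wprod ws = w \<and> length ws = card (Inv w)"
proof (induct "card (Inv w)" arbitrary: w rule: less_induct)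
  case less
  show ?case
  proof (cases "\<exists>i x y. i \<in> J \<and> w x = i - 1/2 \<and> w y = i + 1/2 \<and> y < x")
    case True
    then obtain i x y where i: "i \<in> J" "w x = i - 1/2" "w y = i + 1/2" "y < x" by blast
    note Inv = Inv_refl(2)[OF i(1) less(2) i(2-4)]
    have card: "card (Inv w) = Suc (card (Inv (refl i \<circ> w)))"
      using Inv by (metis card_insert_disjoint finite_Inv)
    have "refl i \<circ> w permutes wtI J" by (intro permutes_compose less refl_permutes i)
    then obtain ws where ws: "ws \<in> lists J" "wprod ws = refl i \<circ> w" "length ws = card (Inv (refl i \<circ> w))"
      using less(1)[of "refl i \<circ> w"] card by auto
    have "wprod (i # ws) = w" unfolding wprod_Cons ws(2) by (simp add: fun_eq_iff)
    then show ?thesis using ws i(1) card by (intro bexI[of _ "i # ws"]) auto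
  next
    case False
    define v where "v = inv_into UNIV w"
    have v: "w (v a) = a" "v (w a) = a" for a unfolding v_def by (simp_all add: permutes_inverses[OF less(2)])
    have vp: "v permutes wtI J" unfolding v_def by (rule permutes_inv[OF less(2)])
    have "v (i - 1/2) < v (i + 1/2)" if "i \<in> J" for i
    proof -
      have "v (i - 1/2) \<noteq> v (i + 1/2)"
      proof
        assume "v (i - 1/2) = v (i + 1/2)"
        then have "i - 1/2 = i + 1/2" using v(1) by metis
        then show False by simp
      qed
      moreover have "\<not> v (i + 1/2) < v (i - 1/2)" using False that v(1) by blast
      ultimately show ?thesis by simp
    qed
    then have "v a = a" if "a \<in> wtI J" for a
      using that permutes_in_image[OF vp] by (intro strict_mono_id) auto
    then have "v a = a" for a using permutes_not_in[OF vp] by blast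
    then have w: "w = id" using v(1) by (metis eq_id_iff)
    have "Inv id = {}" by (auto simp: Inv_def)
    then show ?thesis unfolding w by (intro bexI[of _ "[]"]) (simp_all add: wprod_def)
  qed
qed

text \<open>Comparison with negation shows that a longest \<open>w\<close> inverts all pairs, so
  that \<open>- w\<close> is increasing on the weights and hence the identity there. The index
  \<open>a\<close> then passes each of the \<open>n / 2 - a\<close> larger indices once.\<close>

lemma reduced_longest:
  assumes ws: "reduced_longest J ws" and a: "a \<in> wtI J"
  shows "wprod ws a = - a" "of_nat (ups ws a) = of_nat n / 2 - a"
proof -
  define w where "w = wprod ws"
  define \<rho> where "\<rho> a = (if a \<in> wtI J then - a else a)" for a
  have ws': "ws \<in> lists J" "length ws = wlength J w" "\<And>v. v \<in> weyl_group J \<Longrightarrow> wlength J v \<le> wlength J w"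
    using ws by (auto simp: reduced_longest_def w_def)
  have "bij_betw \<rho> (wtI J) (wtI J)"
    by (rule bij_betw_byWitness[where f' = \<rho>]) (auto simp: \<rho>_def wtI_uminus)
  then have \<rho>: "\<rho> permutes wtI J" by (rule bij_imp_permutes) (simp add: \<rho>_def)
  obtain v where v: "v \<in> lists J" "wprod v = \<rho>" using reduced_word_exists[OF \<rho>] by blast
  have "\<exists>k. \<exists>ws\<in>lists J. wprod ws = \<rho> \<and> length ws = k" using v by blast
  from LeastI_ex[OF this] obtain v' where v': "v' \<in> lists J" "wprod v' = \<rho>" "length v' = wlength J \<rho>"
    by (auto simp: wlength_def)
  \<comment> \<open>The inequalities form a closed chain: \<open>card (Inv \<rho>)\<close>,
    \<open>wlength J \<rho>\<close>, \<open>length ws\<close>, \<open>card (Inv w)\<close> and again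
    \<open>card (Inv \<rho>)\<close>.\<close>
  have 1: "card (Inv \<rho>) \<le> wlength J \<rho>" using card_Inv_le_length[OF v'(1)] v' by simp
  have "\<rho> \<in> weyl_group J" using v by (auto simp: weyl_group_def)
  with ws'(3) have 2: "wlength J \<rho> \<le> length ws" using ws'(2) by simp
  have w: "w permutes wtI J" unfolding w_def by (rule wprod_permutes[OF ws'(1)])
  have 3: "length ws \<le> card (Inv w)"
    unfolding ws'(2) wlength_def using reduced_word_exists[OF w] by (intro Least_le) auto
  have Inv_\<rho>: "Inv \<rho> = {(a, b). a \<in> wtI J \<and> b \<in> wtI J \<and> a < b}" by (auto simp: Inv_def \<rho>_def)
  have sub: "Inv w \<subseteq> Inv \<rho>" unfolding Inv_\<rho> by (auto simp: Inv_def)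
  have 4: "card (Inv w) \<le> card (Inv \<rho>)" by (rule card_mono[OF finite_Inv sub])
  have eq: "Inv w = Inv \<rho>" using 1 2 3 4 by (intro card_subset_eq[OF finite_Inv sub]) simp
  have len: "card (Inv w) = length ws" using 1 2 3 4 eq by simp
  have "- w a = a" if "a \<in> wtI J" for a
  proof (rule strict_mono_id[OF _ _ that])
    show "- w a \<in> wtI J" if "a \<in> wtI J" for a
      using permutes_in_image[OF w] that wtI_uminus by simp
    show "- w (i - 1/2) < - w (i + 1/2)" if "i \<in> J" for i
    proof -
      have "(i - 1/2, i + 1/2) \<in> Inv w" unfolding eq Inv_\<rho> using that by simp
      then show ?thesis by (simp add: Inv_def)
    qed
  qed
  then show "wprod ws a = - a" using a by (metis minus_minus w_def)
  obtain k where k: "k \<le> n" "a = of_nat k - of_nat n / 2" using a by (rule wtI_cases)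
  have "{b. (a, b) \<in> Inv w} = (\<lambda>l. of_nat l - of_nat n / 2) ` {k<..n}"
    unfolding eq Inv_\<rho> using a by (auto simp: wtI_eq k(2))
  moreover have "inj_on (\<lambda>l. of_nat l - of_nat n / (2 :: rat)) {k<..n}" by (auto simp: inj_on_def)
  ultimately have "card {b. (a, b) \<in> Inv w} = n - k" by (simp add: card_image)
  then have "ups ws a = n - k" using ups_eq_card[OF ws'(1), of a] len by (simp add: w_def)
  then show "of_nat (ups ws a) = of_nat n / 2 - a" using k by (simp add: of_nat_diff)
qed

section \<open>The braid group operators on the natural module\<close>

lemma qint_1: "qint (Suc 0) = 1"
  using q_minus_inverse by (auto simp: qint_def)

lemma divpow_0: "divpow f 0 x = x"
  by (simp add: divpow_def)

lemma divpow_1: "divpow f (Suc 0) x = f x"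
  by (simp add: divpow_def qint_1)

lemma divpow_vanish:
  assumes "lin f" "f (f x) = 0" "k \<ge> 2" shows "divpow f k x = 0"
proof -
  have k: "k = (k - 2) + 2" using assms(3) by simp
  have "(f ^^ k) x = (f ^^ (k - 2)) ((f ^^ 2) x)" by (subst k) (simp only: funpow_add o_apply)
  also have "\<dots> = 0" using assms(2) lin_0[OF lin_funpow[OF assms(1)]] by (simp add: numeral_2_eq_2)
  finally show ?thesis by (simp add: divpow_def)
qed

text \<open>On the natural module the squares of E_i and F_i vanish, so that only divided powers
  with exponents 0 and 1 contribute.\<close>

lemma Top_var:
  "Top i (var e) = const ((- q) ^ of_bool (e = i - 1/2)) * var (refl i e)"
proof -
  let ?c = "\<lambda>(a, b, c). - int a + int b - int c = form (eps e) (alpha i)"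
  let ?S = "{0, Suc 0} \<times> {0, Suc 0} \<times> {0, Suc 0}"
  \<comment> \<open>Scalar multiples of basis vectors: E_i and F_i preserve this set and their
    squares vanish on it, whether or not \<open>i\<close> belongs to \<open>J\<close>.\<close>
  define Q where "Q = range (\<lambda>(c, b :: rat). const c * var b)"
  have EE: "nat_rep (GE i) (nat_rep (GE i) x) = 0" "nat_rep (GF i) (nat_rep (GF i) x) = 0"
    if x: "x \<in> Q" for x
  proof -
    obtain c b where x: "x = const c * var b" using x by (auto simp: Q_def)
    have "i - 1/2 \<noteq> i + 1/2" "i + 1/2 \<noteq> i - 1/2" by simp_all
    then show "nat_rep (GE i) (nat_rep (GE i) x) = 0" "nat_rep (GF i) (nat_rep (GF i) x) = 0"
      unfolding x nat_simps nat_rep_GE nat_rep_GF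
      by (auto simp: nat_rep_GE nat_rep_GF nat_simps simp del: nat_rep_var)
  qed
  have range0: "(0 :: tens) \<in> Q" unfolding Q_def by (rule range_eqI[of _ _ "(0, 0)"]) simp
  have rangeI: "const c * var b \<in> Q" for c and b :: rat
    unfolding Q_def by (rule range_eqI[of _ _ "(c, b)"]) simp
  have closed: "nat_rep (GE i) x \<in> Q" "nat_rep (GF i) x \<in> Q"
    if x: "x \<in> Q" for x
  proof -
    obtain c b where x: "x = const c * var b" using x by (auto simp: Q_def)
    show "nat_rep (GE i) x \<in> Q" "nat_rep (GF i) x \<in> Q"
      unfolding x nat_simps nat_rep_GE nat_rep_GF using range0 rangeI by simp_all
  qed
  have small: "k = 0 \<or> k = Suc 0 \<or> k \<ge> 2" for k :: nat by linarith
  have dp: "(divpow (nat_rep g) k x \<in> Q) \<and> (k \<ge> 2 \<longrightarrow> divpow (nat_rep g) k x = 0)"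
    if "x \<in> Q" "g = GE i \<or> g = GF i" for g k x
    using small[of k] that EE[OF that(1)] closed[OF that(1)] range0
    by (auto simp: divpow_0 divpow_1 divpow_vanish[OF lin_nat_rep])
  have dp0: "divpow (nat_rep g) k 0 = 0" for g k
    by (simp add: divpow_def lin_0[OF lin_funpow[OF lin_nat_rep]])
  have var: "var e \<in> Q" using rangeI[of 1 e] by simp
  have vanish: "p \<in> ?S" if "Tterm i p (var e) \<noteq> 0" for p
  proof -
    obtain a b c where p: "p = (a, b, c)" by (cases p)
    have *: "divpow (nat_rep (GE i)) a (divpow (nat_rep (GF i)) b (divpow (nat_rep (GE i)) c (var e))) \<noteq> 0"
      using that by (auto simp: p Tterm_def)
    have C: "divpow (nat_rep (GE i)) c (var e) \<in> Q" using dp[OF var] by blast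
    have B: "divpow (nat_rep (GF i)) b (divpow (nat_rep (GE i)) c (var e)) \<in> Q"
      using dp[OF C] by blast
    have "\<not> c \<ge> 2" using * dp[OF var, of "GE i" c] dp0 by auto
    moreover have "\<not> b \<ge> 2" using * dp[OF C, of "GF i" b] dp0 by auto
    moreover have "\<not> a \<ge> 2" using * dp[OF B, of "GE i" a] by auto
    ultimately show ?thesis using small[of a] small[of b] small[of c] by (auto simp: p)
  qed
  have "Top i (var e) = (\<Sum>p | ?c p \<and> Tterm i p (var e) \<noteq> 0. Tterm i p (var e))"
    by (simp add: Top_def)
  also have "\<dots> = (\<Sum>p\<in>{p \<in> ?S. ?c p}. Tterm i p (var e))"
  proof (rule sum.mono_neutral_left)
    have "finite ?S" by simp
    then show "finite {p \<in> ?S. ?c p}" by (rule finite_subset[rotated]) blast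
    show "{p. ?c p \<and> Tterm i p (var e) \<noteq> 0} \<subseteq> {p \<in> ?S. ?c p}" using vanish by blast
    show "\<forall>p\<in>{p \<in> ?S. ?c p} - {p. ?c p \<and> Tterm i p (var e) \<noteq> 0}. Tterm i p (var e) = 0" by blast
  qed
  also have "\<dots> = const ((- q) ^ of_bool (e = i - 1/2)) * var (refl i e)"
  proof -
    have form: "form (eps e) (alpha i) = of_bool (e = i - 1/2) - of_bool (e = i + 1/2)"
      by (simp only: form_eps lookup_alpha)
    have ne: "i - 1/2 \<noteq> i + 1/2" by simp
    note T = Tterm_def divpow_0 divpow_1 nat_simps nat_rep_GE nat_rep_GF
    consider "e = i + 1/2" | "e = i - 1/2" | "e \<noteq> i + 1/2" "e \<noteq> i - 1/2" by blast
    then show ?thesis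
    proof cases
      case 1
      have "e \<noteq> i - 1/2" unfolding 1 using ne by metis
      then have f: "form (eps e) (alpha i) = - 1" unfolding form using 1 by (simp only: of_bool_eq) simp
      \<comment> \<open>Three terms have the right weight; with v the vector of index
        \<open>i - 1/2\<close> they are v, v and - v.\<close>
      have "{p \<in> ?S. ?c p} = {(Suc 0, 0, 0), (0, 0, Suc 0), (Suc 0, Suc 0, Suc 0)}"
        unfolding f by auto
      moreover have "Tterm i (Suc 0, 0, 0) (var e) = var (i - 1/2)" "Tterm i (0, 0, Suc 0) (var e) = var (i - 1/2)"
        "Tterm i (Suc 0, Suc 0, Suc 0) (var e) = - var (i - 1/2)"
        unfolding 1 by (simp_all add: T const_uminus del: nat_rep_var)
      moreover have "refl i e = i - 1/2" "e \<noteq> i - 1/2" unfolding 1 by (simp_all add: transpose_def)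
      ultimately show ?thesis by simp
    next
      case 2
      have "e \<noteq> i + 1/2" unfolding 2 using ne by metis
      then have f: "form (eps e) (alpha i) = 1" unfolding form using 2 by (simp only: of_bool_eq) simp
      have "{p \<in> ?S. ?c p} = {(0, Suc 0, 0)}"
        unfolding f by auto
      moreover have "Tterm i (0, Suc 0, 0) (var e) = const (- q) * var (i + 1/2)"
        unfolding 2 by (simp add: T del: nat_rep_var)
      moreover have "refl i e = i + 1/2" unfolding 2 by (simp add: transpose_def)
      ultimately show ?thesis using 2 by simp
    next
      case 3
      have f: "form (eps e) (alpha i) = 0" unfolding form using 3 by (simp only: of_bool_eq diff_self)
      have "{p \<in> ?S. ?c p} = {(0, 0, 0), (Suc 0, Suc 0, 0), (0, Suc 0, Suc 0)}"
        unfolding f by auto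
      moreover have "Tterm i (0, 0, 0) (var e) = var e" "Tterm i (Suc 0, Suc 0, 0) (var e) = 0" "Tterm i (0, Suc 0, Suc 0) (var e) = 0"
        using 3 by (simp_all add: T del: nat_rep_var)
      moreover have "refl i e = e" using 3 by (simp add: transpose_def)
      ultimately show ?thesis using 3 by simp
    qed
  qed
  finally show ?thesis .
qed

lemma lin_Top: "lin (Top i)"
  by (simp add: Top_def)

lemma lin_Tw: "lin (Tw ws)"
proof (induct ws)
  case Nil
  then show ?case by (simp add: Tw_def lin_def)
next
  case (Cons i ws)
  have "Tw (i # ws) = (\<lambda>x. Top i (Tw ws x))" by (simp add: Tw_def fun_eq_iff)
  then show ?case using lin_compose[OF lin_Top Cons] by simp
qed

lemma Tw_var: "Tw ws (var a) = const ((- q) ^ ups ws a) * var (wprod ws a)"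
proof (induct ws)
  case Nil
  then show ?case by (simp add: Tw_def wprod_def)
next
  case (Cons i ws)
  have "Tw (i # ws) (var a) = Top i (Tw ws (var a))" by (simp add: Tw_def)
  also have "\<dots> = const ((- q) ^ ups (i # ws) a) * var (wprod (i # ws) a)"
    unfolding Cons lin_scale[OF lin_Top] Top_var const_mult_left wprod_Cons ups.simps power_add o_apply ..
  finally show ?case .
qed

text \<open>With \<open>n / 2\<close> as the largest index s, the longest element contributes the
  power \<open>s - a\<close> of \<open>- q\<close>, and the rescaling at \<open>- a\<close> has the
  opposite exponent. This exponent is an integer, so that the floor changes nothing.\<close>

lemma zeta_Tw_var:
  assumes "reduced_longest J ws" "a \<in> wtI J"
  shows "zeta J (Tw ws (var a)) = var (- a)"
proof -
  have Max: "Max (wtI J) = of_nat n / 2"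
    by (rule Max_eqI) (auto simp: finite_wtI wtI_eq)
  have "of_int (int (ups ws a)) = of_nat n / 2 - a" using reduced_longest(2)[OF assms] by simp
  then have "- Max (wtI J) - (- a) = of_int (- int (ups ws a))" by (simp add: Max)
  then have fl: "\<lfloor>- Max (wtI J) - (- a)\<rfloor> = - int (ups ws a)" by (simp only: floor_of_int)
  have "zeta J (Tw ws (var a)) = const ((- q) ^ ups ws a) * zeta J (var (- a))"
    unfolding Tw_var reduced_longest(1)[OF assms] by (rule lin_scale) (simp add: zeta_def)
  also have "zeta J (var (- a)) = const ((- q) powi \<lfloor>- Max (wtI J) - (- a)\<rfloor>) * var (- a)"
    by (simp add: zeta_def)
  finally show ?thesis
    unfolding fl by (simp add: const_mult_left power_int_minus flip: power_int_of_nat)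
qed

end

section \<open>The bar involution of the quantum group\<close>

lemma ev_emb: "qf_bar (emb c) = emb c"
proof -
  have "emb c = to_fract [:c:] / to_fract 1" by (simp add: emb_def)
  then have "qf_bar (emb c) = ev [:c:] / ev 1" using qf_bar_quot[of 1 "[:c:]"] by simp
  then show ?thesis by (simp add: ev_pCons one_pCons)
qed

lemma qf_bar_ev_eq: "qf_bar (ev p) = to_fract p"
proof (induct p)
  case (pCons a p)
  have "to_fract (pCons a p) = emb a + q * to_fract p"
    by (simp add: map_poly_pCons flip: to_fract_poly)
  then show ?case
    using pCons by (simp add: ev_pCons qf_bar_add qf_bar_mult qf_bar_inverse ev_emb)
qed simp

lemma qf_bar_bar [simp]: "qf_bar (qf_bar x) = x"
proof -
  obtain a b where x: "x = to_fract a / to_fract b" "b \<noteq> 0" by (rule fract_cases)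
  show ?thesis
    unfolding x(1) qf_bar_quot[OF x(2)] by (simp only: divide_inverse qf_bar_mult qf_bar_inverse qf_bar_ev_eq)
qed

lemma falg_bar_superset:
  assumes "finite S" "keys x \<subseteq> S"
  shows "falg_bar x = (\<Sum>w\<in>S. const (qf_bar (lookup x w)) * monomial (map gen_bar (letters w)))"
  unfolding falg_bar_def
  by (rule sum.mono_neutral_left) (use assms in \<open>auto simp: in_keys_iff\<close>)

lemma falg_bar_add: "falg_bar (x + y) = falg_bar x + falg_bar y"
proof -
  let ?S = "keys x \<union> keys y"
  show ?thesis
    using keys_add[of x y]
    by (simp add: falg_bar_superset[of ?S] lookup_add qf_bar_add const_add distrib_right sum.distrib)
qed

lemma falg_bar_scale: "falg_bar (const c * x) = const (qf_bar c) * falg_bar x"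
  using keys_const_mult[of c x]
  by (simp add: falg_bar_superset[of "keys x"] sum_distrib_left qf_bar_mult const_mult mult.assoc)

lemma falg_bar_monomial: "falg_bar (monomial u) = monomial (map gen_bar u)"
  by (simp add: falg_bar_def monomial_def)

lemma falg_bar_0 [simp]: "falg_bar 0 = 0"
  by (simp add: falg_bar_def)

lemma falg_bar_uminus: "falg_bar (- x) = - falg_bar x"
  using falg_bar_add[of x "- x"] by (simp add: eq_neg_iff_add_eq_0 add.commute)

lemma falg_bar_diff: "falg_bar (x - y) = falg_bar x - falg_bar y"
  using falg_bar_add[of x "- y"] by (simp add: falg_bar_uminus)

lemma falg_bar_sum: "falg_bar (\<Sum>i\<in>A. f i) = (\<Sum>i\<in>A. falg_bar (f i))"
  by (induct A rule: infinite_finite_induct) (simp_all add: falg_bar_add)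

lemma falg_bar_1 [simp]: "falg_bar 1 = 1"
  using falg_bar_monomial[of "[]"] by (simp add: monomial_Nil)

lemma falg_bar_const: "falg_bar (const c) = const (qf_bar c)"
  using falg_bar_scale[of c 1] by simp

lemma falg_bar_mult: "falg_bar (x * y) = falg_bar x * falg_bar y"
proof -
  have 1: "falg_bar (monomial u * y) = monomial (map gen_bar u) * falg_bar y" for u
  proof -
    have "monomial u * y = (\<Sum>w\<in>keys y. const (lookup y w) * monomial (u @ letters w))"
      by (subst falg_eq_sum[of y]) (simp only: sum_distrib_left mult_const_left[of "monomial u"] monomial_append)
    then have "falg_bar (monomial u * y)
        = (\<Sum>w\<in>keys y. const (qf_bar (lookup y w)) * monomial (map gen_bar u @ map gen_bar (letters w)))"
      by (simp only: falg_bar_sum falg_bar_scale falg_bar_monomial map_append)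
    also have "\<dots> = monomial (map gen_bar u) * falg_bar y"
      by (simp only: falg_bar_def[of y] sum_distrib_left mult_const_left[of "monomial (map gen_bar u)"] monomial_append)
    finally show ?thesis .
  qed
  have "falg_bar (x * y) = falg_bar (\<Sum>w\<in>keys x. const (lookup x w) * (monomial (letters w) * y))"
    by (subst falg_eq_sum[of x]) (simp add: sum_distrib_right mult.assoc)
  also have "\<dots> = falg_bar x * falg_bar y"
    by (simp add: falg_bar_sum falg_bar_scale 1 falg_bar_def[of x] sum_distrib_right mult.assoc)
  finally show ?thesis .
qed

lemma falg_bar_power: "falg_bar (x ^ n) = falg_bar x ^ n"
  by (induct n) (simp_all add: falg_bar_mult)

lemma gen_bar_bar: "gen_bar (gen_bar g) = g"
  by (cases g) simp_all

lemma falg_bar_bar: "falg_bar (falg_bar x) = x"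
proof -
  have "falg_bar (falg_bar x) = (\<Sum>w\<in>keys x. const (lookup x w) * monomial (letters w))"
    by (simp add: falg_bar_def[of x] falg_bar_sum falg_bar_scale falg_bar_monomial comp_def gen_bar_bar)
  then show ?thesis by (simp flip: falg_eq_sum)
qed

lemma gen_bar_Ugens: "g \<in> Ugens J \<Longrightarrow> gen_bar g \<in> Ugens J"
  by (cases g) simp_all

lemma falg_bar_closed:
  assumes "x \<in> carrier (free_algebra (Ugens J))" shows "falg_bar x \<in> carrier (free_algebra (Ugens J))"
  using assms gen_bar_Ugens unfolding falg_bar_def
  by (intro free_sum free_mult free_const) (fastforce simp: carrier_free_algebra)

lemmas falg_bar_simps = falg_bar_add falg_bar_diff falg_bar_uminus falg_bar_mult falg_bar_power falg_bar_monomial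
  falg_bar_const qf_bar_add qf_bar_diff qf_bar_mult qf_bar_inverse qf_bar_powi

abbreviation (input) "UI \<equiv> U.I"

lemma UI_rel: "a \<in> Urels J \<Longrightarrow> a \<in> UI J"
  using U.rels_I by blast

text \<open>Most relators are fixed by the bar map or exchanged with one another. Those on
  conjugation by K_i turn into conjugation by its inverse and have to be derived modulo the
  ideal.\<close>

lemma falg_bar_rel:
  assumes "a \<in> Urels J" shows "falg_bar a \<in> UI J"
proof -
  have rel: "xK i * xKinv i - 1 \<in> UI J" "xKinv i * xK i - 1 \<in> UI J" if "i \<in> J" for i
  proof -
    have "a \<in> {xK i * xKinv i - 1 | i. i \<in> J} \<or> a \<in> {xKinv i * xK i - 1 | i. i \<in> J} \<Longrightarrow> a \<in> Urels J" for a
      unfolding Urels_def by (elim disjE) (simp_all only: Un_iff simp_thms)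
    then show "xK i * xKinv i - 1 \<in> UI J" "xKinv i * xK i - 1 \<in> UI J" using that UI_rel by blast+
  qed
  \<comment> \<open>If \<open>Y\<close> is an eigenvector of conjugation by K_i modulo the ideal, it
    is one for the inverse conjugation, with the inverse eigenvalue.\<close>
  have conj: "xKinv i * Y * xK i - const (inverse c) * Y \<in> UI J"
    if i: "i \<in> J" and Y: "Y \<in> carrier (free_algebra (Ugens J))" and c: "c \<noteq> 0"
      and r: "xK i * Y * xKinv i - const c * Y \<in> UI J" for i Y c
  proof -
    let ?K = "xK i" and ?L = "xKinv i"
    have KL: "?K \<in> carrier (free_algebra (Ugens J))" "?L \<in> carrier (free_algebra (Ugens J))" using i by simp_all
    have "?L * (?K * Y * ?L - const c * Y) * ?K \<in> UI J"
      by (rule U.I_right[OF KL(1) U.I_left[OF KL(2) r]])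
    moreover have "(?L * ?K - 1) * (Y * ?L * ?K) \<in> UI J"
      using KL Y by (intro U.I_right rel i) simp
    moreover have "Y * (?L * ?K - 1) \<in> UI J"
      using Y by (intro U.I_left rel i)
    ultimately have "?L * (?K * Y * ?L - const c * Y) * ?K - (?L * ?K - 1) * (Y * ?L * ?K) - Y * (?L * ?K - 1) \<in> UI J"
      by (intro U.I_diff)
    then have "const (- inverse c) * (?L * (?K * Y * ?L - const c * Y) * ?K - (?L * ?K - 1) * (Y * ?L * ?K) - Y * (?L * ?K - 1)) \<in> UI J"
      by (rule U.I_left[OF free_const])
    moreover have "?L * (?K * Y * ?L - const c * Y) * ?K - (?L * ?K - 1) * (Y * ?L * ?K) - Y * (?L * ?K - 1)
        = Y - const c * (?L * Y * ?K)"
      by (simp add: algebra_simps mult_const_left[of "xKinv i"])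
    moreover have "const (- inverse c) * (Y - const c * Z) = Z - const (inverse c) * Y" for Z
      using c by (simp add: right_diff_distrib const_mult_left const_uminus)
    ultimately show ?thesis by (simp only:)
  qed
  from assms consider
    i where "i \<in> J" "a = xK i * xKinv i - 1" | i where "i \<in> J" "a = xKinv i * xK i - 1"
    | (KK) i j where "i \<in> J" "j \<in> J" "a = xK i * xK j - xK j * xK i"
    | (KE) i j where "i \<in> J" "j \<in> J" "a = xK i * xE j * xKinv i - const (q powi form (alpha i) (alpha j)) * xE j"
    | (KF) i j where "i \<in> J" "j \<in> J" "a = xK i * xF j * xKinv i - const (q powi (- form (alpha i) (alpha j))) * xF j"
    | (EF) i j where "i \<in> J" "j \<in> J" "a = xE i * xF j - xF j * xE i -
        (if i = j then const (1 / (q - inverse q)) * (xK i - xKinv i) else 0)"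
    | (self) "falg_bar a = a"
  proof -
    assume *: "\<And>i. i \<in> J \<Longrightarrow> a = xK i * xKinv i - 1 \<Longrightarrow> thesis" "\<And>i. i \<in> J \<Longrightarrow> a = xKinv i * xK i - 1 \<Longrightarrow> thesis"
      "\<And>i j. i \<in> J \<Longrightarrow> j \<in> J \<Longrightarrow> a = xK i * xK j - xK j * xK i \<Longrightarrow> thesis"
      "\<And>i j. i \<in> J \<Longrightarrow> j \<in> J \<Longrightarrow> a = xK i * xE j * xKinv i - const (q powi form (alpha i) (alpha j)) * xE j \<Longrightarrow> thesis"
      "\<And>i j. i \<in> J \<Longrightarrow> j \<in> J \<Longrightarrow> a = xK i * xF j * xKinv i - const (q powi (- form (alpha i) (alpha j))) * xF j \<Longrightarrow> thesis"
      "\<And>i j. i \<in> J \<Longrightarrow> j \<in> J \<Longrightarrow> a = xE i * xF j - xF j * xE i -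
        (if i = j then const (1 / (q - inverse q)) * (xK i - xKinv i) else 0) \<Longrightarrow> thesis"
      "falg_bar a = a \<Longrightarrow> thesis"
    have bar: "falg_bar (xE i) = xE i" "falg_bar (xF i) = xF i" for i
      by (simp_all add: falg_bar_monomial)
    have c: "falg_bar (const (q + inverse q)) = const (q + inverse q)"
      by (simp add: falg_bar_const qf_bar_add qf_bar_inverse add.commute)
    show thesis
      using assms unfolding Urels_def
      apply (elim UnE CollectE exE conjE)
      apply ((erule (2) *(3-6) | erule (1) *(1,2)))+
      by (rule *(7), simp only: falg_bar_add falg_bar_diff falg_bar_mult falg_bar_power bar c)+
  qed
  then show ?thesis
  proof cases
    case (1 i)
    then show ?thesis using rel by (simp add: falg_bar_simps)
  next
    case (2 i)
    then show ?thesis using rel by (simp add: falg_bar_simps)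
  next
    case (KK i j)
    let ?K = "xK i" and ?L = "xKinv i" and ?M = "xK j" and ?N = "xKinv j"
    have c: "?K \<in> carrier (free_algebra (Ugens J))" "?L \<in> carrier (free_algebra (Ugens J))"
      "?M \<in> carrier (free_algebra (Ugens J))" "?N \<in> carrier (free_algebra (Ugens J))" using KK by simp_all
    have r1: "?L * ?M * ?K - ?M \<in> UI J"
      using conj[OF KK(1) c(3), of 1] UI_rel[of "?K * ?M - ?M * ?K" J]
    proof -
      have "?K * ?M - ?M * ?K \<in> UI J" using UI_rel[OF assms] KK(3) by simp
      then have "(?K * ?M - ?M * ?K) * ?L + ?M * (?K * ?L - 1) \<in> UI J"
        using c rel(1)[OF KK(1)] by (intro U.I_add U.I_right U.I_left)
      then have "?K * ?M * ?L - const 1 * ?M \<in> UI J" by (simp add: algebra_simps)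
      from conj[OF KK(1) c(3) _ this] show ?thesis by simp
    qed
    \<comment> \<open>The four elements of the ideal are chosen to telescope to the commutator of
      the inverses of K_i and K_j.\<close>
    have "?N * ((?L * ?M * ?K - ?M) * ?L) * ?N \<in> UI J"
      using c r1 by (intro U.I_right U.I_left)
    moreover have "?N * ?L * (?M * (?K * ?L - 1) * ?N) \<in> UI J"
      using c rel(1)[OF KK(1)] by (intro U.I_left U.I_right) simp_all
    moreover have "?N * ?L * (?M * ?N - 1) \<in> UI J"
      using c rel(1)[OF KK(2)] by (intro U.I_left) simp_all
    moreover have "(?N * ?M - 1) * (?L * ?N) \<in> UI J"
      using c rel(2)[OF KK(2)] by (intro U.I_right) simp_all
    ultimately have "?N * ((?L * ?M * ?K - ?M) * ?L) * ?N - ?N * ?L * (?M * (?K * ?L - 1) * ?N) - ?N * ?L * (?M * ?N - 1)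
        + (?N * ?M - 1) * (?L * ?N) \<in> UI J"
      by (intro U.I_add U.I_diff)
    then have "- (?N * ((?L * ?M * ?K - ?M) * ?L) * ?N - ?N * ?L * (?M * (?K * ?L - 1) * ?N) - ?N * ?L * (?M * ?N - 1)
        + (?N * ?M - 1) * (?L * ?N)) \<in> UI J"
      by (rule U.I_uminus)
    moreover have "- (?N * ((?L * ?M * ?K - ?M) * ?L) * ?N - ?N * ?L * (?M * (?K * ?L - 1) * ?N) - ?N * ?L * (?M * ?N - 1)
        + (?N * ?M - 1) * (?L * ?N)) = ?L * ?N - ?N * ?L"
      by (simp add: algebra_simps)
    ultimately show ?thesis using KK by (simp add: falg_bar_simps flip: monomial_append)
  next
    case (KE i j)
    have "xK i * xE j * xKinv i - const (q powi form (alpha i) (alpha j)) * xE j \<in> UI J"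
      using UI_rel[OF assms] KE by simp
    from conj[OF KE(1) _ _ this] KE show ?thesis
      by (simp add: falg_bar_simps power_int_minus flip: monomial_append)
  next
    case (KF i j)
    have "xK i * xF j * xKinv i - const (q powi (- form (alpha i) (alpha j))) * xF j \<in> UI J"
      using UI_rel[OF assms] KF by simp
    from conj[OF KF(1) _ _ this] KF show ?thesis
      by (simp add: falg_bar_simps power_int_minus flip: monomial_append)
  next
    case (EF i j)
    \<comment> \<open>The denominator and the difference of K_i and its inverse both change sign, so
      that the relator is fixed.\<close>
    have "1 / (inverse q - q) = - (1 / (q - inverse q))"
      by (simp flip: divide_minus_right)
    then have "falg_bar a = a"
      by (simp add: EF falg_bar_simps divide_inverse const_uminus algebra_simps)
    then show ?thesis using UI_rel[OF assms] by simp
  next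
    case self
    then show ?thesis using UI_rel[OF assms] by simp
  qed
qed

lemma falg_bar_I: assumes "a \<in> UI J" shows "falg_bar a \<in> UI J"
proof -
  define Z where "Z = {a \<in> carrier (free_algebra (Ugens J)). falg_bar a \<in> UI J}"
  have "ideal Z (free_algebra (Ugens J))"
    by (rule free_idealI)
      (auto simp: Z_def falg_bar_simps falg_bar_closed U.I_0 intro: U.I_add U.I_uminus U.I_left U.I_right)
  moreover have "Urels J \<subseteq> Z"
    using U.rels falg_bar_rel by (auto simp: Z_def)
  ultimately have "UI J \<subseteq> Z" by (rule U.I_minimal)
  then show ?thesis using assms by (auto simp: Z_def)
qed

lemma U_bar_ucls: "U_bar (ucls J a) = ucls J (falg_bar a)"
proof
  show "U_bar (ucls J a) \<subseteq> ucls J (falg_bar a)"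
    unfolding U_bar_def ucls_def U.pclass_eq using falg_bar_I by (auto simp: falg_bar_add)
  show "ucls J (falg_bar a) \<subseteq> U_bar (ucls J a)"
  proof
    fix x assume "x \<in> ucls J (falg_bar a)"
    then obtain i where i: "i \<in> UI J" "x = i + falg_bar a" unfolding ucls_def U.pclass_eq by auto
    then have "x = falg_bar (falg_bar i + a)" by (simp add: falg_bar_add falg_bar_bar)
    then show "x \<in> U_bar (ucls J a)"
      unfolding U_bar_def ucls_def U.pclass_eq using falg_bar_I[OF i(1)] by blast
  qed
qed

section \<open>The quasi-K-matrix on the natural module\<close>

lemma lact_zero: "(\<And>w. w \<in> keys a \<Longrightarrow> foldr R (letters w) x = 0) \<Longrightarrow> lact R a x = 0"
  by (simp add: lact_def)

lemma uact_finsum: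
  assumes "finite A" "f \<in> A \<rightarrow> carrier (UU J)" "m \<ge> 1" "x \<in> tpow J m"
  shows "uact m (finsum (UU J) f A) x = (\<Sum>a\<in>A. uact m (f a) x)"
proof -
  interpret ring "UU J" by (rule ring_UU)
  show ?thesis
    using assms
  proof (induct A rule: finite_induct)
    case empty
    then show ?case by (simp add: ucls_zero uact_ucls lact_0)
  next
    case (insert a A)
    then have "f a \<in> carrier (UU J)" "f \<in> A \<rightarrow> carrier (UU J)" by auto
    then show ?case using insert by (simp add: uact_hom)
  qed
qed

lemma foldr_nat_rep_closed: "set ws \<subseteq> Ugens J \<Longrightarrow> x \<in> tpow J (Suc 0) \<Longrightarrow> foldr nat_rep ws x \<in> tpow J (Suc 0)"
  by (induct ws) (simp_all add: nat_rep_closed)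

context weight_index
begin

lemma uact_1_ucls: "x \<in> tpow J (Suc 0) \<Longrightarrow> uact (Suc 0) (ucls J a) x = lact nat_rep a x"
  using uact_ucls[of "Suc 0" x J a] by (simp add: tpow_rep_1)

lemma F_word: "foldr nat_rep (map GF is) (var a) \<in> {0, var (a + of_nat (length is))}"
proof (induct "is")
  case (Cons i "is")
  have "nat_rep (GF i) (var b) \<in> {0, var (b + 1)}" for b
    using nat_basis.simps(2)[of i b] by simp
  moreover have "a + of_nat (length is) + 1 = a + of_nat (length (i # is))" by simp
  ultimately have "nat_rep (GF i) (var (a + of_nat (length is))) \<in> {0, var (a + of_nat (length (i # is)))}"
    by metis
  then show ?case using Cons by (auto simp only: list.map foldr.simps o_apply nat_simps)
qed simp


lemma finite_J: "finite J"
  by (subst J_eq) simp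

lemma finite_roots: "finite {\<mu>. set_mset \<mu> \<subseteq> J \<and> size \<mu> < N}"
proof (rule finite_subset)
  show "{\<mu>. set_mset \<mu> \<subseteq> J \<and> size \<mu> < N} \<subseteq> mset ` {xs. set xs \<subseteq> J \<and> length xs \<le> N}"
  proof
    fix \<mu> assume *: "\<mu> \<in> {\<mu>. set_mset \<mu> \<subseteq> J \<and> size \<mu> < N}"
    obtain xs where "mset xs = \<mu>" using ex_mset by blast
    then show "\<mu> \<in> mset ` {xs. set xs \<subseteq> J \<and> length xs \<le> N}" using * by (intro image_eqI[of _ _ xs]) auto
  qed
  show "finite (mset ` {xs. set xs \<subseteq> J \<and> length xs \<le> N})"
    by (intro finite_imageI finite_lists_length_le finite_J)
qed

lemma F_word_vanish:
  assumes "set is \<subseteq> J" "a \<in> wtI J" "a + of_nat (length is) \<notin> wtI J"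
  shows "foldr nat_rep (map GF is) (var a) = 0"
proof -
  have "set (map GF is) \<subseteq> Ugens J" using assms(1) by auto
  then have "foldr nat_rep (map GF is) (var a) \<in> tpow J (Suc 0)"
    using assms(2) by (intro foldr_nat_rep_closed) simp_all
  then show ?thesis using F_word[of "is" a] assms(3) by auto
qed

lemma wtI_bounds: "a \<in> wtI J \<Longrightarrow> - of_nat n / 2 \<le> a \<and> a \<le> of_nat n / 2"
  by (auto simp: wtI_eq field_simps)

text \<open>Each F raises the index by 1, and more than \<open>n\<close> of them exceed the width of
  \<open>wtI J\<close>.\<close>

lemma F_word_long:
  assumes "set is \<subseteq> J" "n < length is" "x \<in> tpow J (Suc 0)"
  shows "foldr nat_rep (map GF is) x = 0"
proof (rule lin_eq_var[OF lin_foldr[OF lin_nat_rep] lin_zero assms(3)])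
  fix a assume a: "a \<in> wtI J"
  have "of_nat n < (of_nat (length is) :: rat)" using assms(2) by simp
  then have "a + of_nat (length is) \<notin> wtI J"
    using wtI_bounds[OF a] wtI_bounds[of "a + of_nat (length is)"] by linarith
  then show "foldr nat_rep (map GF is) (var a) = 0" using assms(1) a by (intro F_word_vanish)
qed

text \<open>The F part of every monomial acts first and is too long. Hence congruences modulo
  \<open>U_ge J (Suc n)\<close> become equalities on the natural module, which eliminates the
  completion.\<close>

lemma uact_U_ge:
  assumes "v \<in> U_ge J (Suc n)" "x \<in> tpow J (Suc 0)"
  shows "uact (Suc 0) v x = 0"
proof -
  obtain b where b: "v = ucls J b" "letters ` keys b \<subseteq> {map GE is @ ks @ map GF js | is ks js.
     set is \<subseteq> J \<and> set ks \<subseteq> GK ` J \<union> GKinv ` J \<and> set js \<subseteq> J \<and> length js \<ge> Suc n}"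
    using assms(1) by (auto simp: U_ge_def mspan_def)
  have "lact nat_rep b x = 0"
  proof (rule lact_zero)
    fix w assume "w \<in> keys b"
    from subsetD[OF b(2) imageI[OF this]] obtain "is" ks js
      where "letters w = map GE is @ ks @ map GF js" "set js \<subseteq> J" "n < length js"
      by (auto simp: Suc_le_eq)
    then show "foldr nat_rep (letters w) x = 0"
      using F_word_long[of js x] assms(2) by (simp add: lin_0[OF lin_foldr[OF lin_nat_rep]])
  qed
  then show ?thesis by (simp add: b(1) uact_1_ucls[OF assms(2)])
qed

text \<open>The extra factor \<open>K\<^sub>i\<^sup>2\<close> acts trivially on the image or the source of the neighbouring \<open>F\<close>.\<close>

lemma nat_rep_bar:
  assumes x: "x \<in> tpow J (Suc 0)"
  shows "i > 0 \<Longrightarrow> nat_rep (GF (- i)) (nat_rep (GK i) x) = nat_rep (GF (- i)) (nat_rep (GKinv i) x)"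
    "i > 0 \<Longrightarrow> nat_rep (GK (- i)) (nat_rep (GF i) x) = nat_rep (GKinv (- i)) (nat_rep (GF i) x)"
    "const (inverse q) * nat_rep (GF 0) (nat_rep (GK 0) x) = const q * nat_rep (GF 0) (nat_rep (GKinv 0) x)"
proof -
  note K = nat_rep_GK nat_rep_GKinv nat_rep_GF nat_simps
  show "nat_rep (GF (- i)) (nat_rep (GK i) x) = nat_rep (GF (- i)) (nat_rep (GKinv i) x)" if "i > 0"
    by (rule lin_eq_var[OF _ _ x]; (intro lin_nat_intros)?)
      (use that in \<open>simp add: K del: nat_rep_var\<close>)
  show "nat_rep (GK (- i)) (nat_rep (GF i) x) = nat_rep (GKinv (- i)) (nat_rep (GF i) x)" if "i > 0"
    by (rule lin_eq_var[OF _ _ x]; (intro lin_nat_intros)?)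
      (use that in \<open>simp add: K del: nat_rep_var\<close>)
  show "const (inverse q) * nat_rep (GF 0) (nat_rep (GK 0) x) = const q * nat_rep (GF 0) (nat_rep (GKinv 0) x)"
    by (rule lin_eq_var[OF _ _ x]; (intro lin_nat_intros)?)
      (simp add: K const_mult_left power_int_minus del: nat_rep_var)
qed

lemma uact_U_bar:
  assumes "i > 0" "x \<in> tpow J (Suc 0)"
  shows "uact (Suc 0) (U_bar (ie J i)) x = uact (Suc 0) (ie J i) x"
    "uact (Suc 0) (U_bar (ifl J i)) x = uact (Suc 0) (ifl J i) x"
  using assms nat_rep_bar[OF assms(2)]
  by (simp_all add: ie_def ifl_def U_bar_ucls falg_bar_simps uact_1_ucls lact_simps lact_mult)

lemma uact_U_bar_t:
  assumes "x \<in> tpow J (Suc 0)"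
  shows "uact (Suc 0) (U_bar (it J)) x = uact (Suc 0) (it J) x"
  using nat_rep_bar[OF assms]
  by (simp add: it_def U_bar_ucls falg_bar_simps uact_1_ucls assms lact_simps lact_mult)

lemma uact_natural:
  shows "i > 0 \<Longrightarrow> a \<in> wtI J \<Longrightarrow> uact (Suc 0) (ie J i) (var a) =
      (if a = i + 1/2 then var (i - 1/2) else 0) + (if - a = i + 1/2 then var (- (i - 1/2)) else 0)"
    and "i > 0 \<Longrightarrow> a \<in> wtI J \<Longrightarrow> uact (Suc 0) (ifl J i) (var a) =
      (if a = i - 1/2 then var (i + 1/2) else 0) + (if - a = i - 1/2 then var (- (i + 1/2)) else 0)"
    and "a \<in> wtI J \<Longrightarrow> uact (Suc 0) (it J) (var a) = (if a = 1/2 \<or> - a = 1/2 then var (- a) else 0)"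
  using nat_e[of i a] nat_f[of i a] nat_t[of a]
  by (simp_all add: uact_gens tpow_rep_1 del: nat_rep_var)

lemma Uminus_wt_word:
  assumes "set_mset \<mu> \<subseteq> J" "v \<in> Uminus_wt J \<mu>"
  obtains b where "v = ucls J b" "b \<in> carrier (free_algebra (Ugens J))"
    "\<And>w. w \<in> keys b \<Longrightarrow> \<exists>is. letters w = map GF is \<and> set is \<subseteq> J \<and> length is = size \<mu>"
proof -
  obtain b where b: "v = ucls J b" "letters ` keys b \<subseteq> {map GF is | is. mset is = \<mu>}"
    using assms(2) by (auto simp: Uminus_wt_def mspan_def)
  have *: "\<exists>is. letters w = map GF is \<and> set is \<subseteq> J \<and> length is = size \<mu>" if w: "w \<in> keys b" for w
  proof -
    from subsetD[OF b(2) imageI[OF w]] obtain "is" where "letters w = map GF is" "mset is = \<mu>" by blast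
    then show ?thesis using assms(1) by (metis set_mset_mset size_mset)
  qed
  then have "b \<in> carrier (free_algebra (Ugens J))"
    by (fastforce simp: carrier_free_algebra)
  then show thesis using that b(1) * by blast
qed

context
  fixes psi \<Upsilon>
  assumes psi: "is_iota_bar J psi" and K: "is_quasi_K J psi \<Upsilon>"
begin

lemma Upsilon_wt: "set_mset \<mu> \<subseteq> J \<Longrightarrow> \<Upsilon> \<mu> \<in> Uminus_wt J \<mu>"
  using K by (simp add: is_quasi_K_def)

lemma Upsilon_carrier: "set_mset \<mu> \<subseteq> J \<Longrightarrow> \<Upsilon> \<mu> \<in> carrier (UU J)"
  using Uminus_wt_word[OF _ Upsilon_wt] by (metis carrier_UU imageI)

lemma uact_Upsilon_long:
  assumes "set_mset \<mu> \<subseteq> J" "n < size \<mu>" "x \<in> tpow J (Suc 0)" shows "uact (Suc 0) (\<Upsilon> \<mu>) x = 0"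
proof -
  obtain b where b: "\<Upsilon> \<mu> = ucls J b"
    "\<And>w. w \<in> keys b \<Longrightarrow> \<exists>is. letters w = map GF is \<and> set is \<subseteq> J \<and> length is = size \<mu>"
    using Uminus_wt_word[OF assms(1) Upsilon_wt[OF assms(1)]] by metis
  show ?thesis
    unfolding b(1) uact_1_ucls[OF assms(3)]
    by (rule lact_zero) (use b(2) F_word_long assms in metis)
qed

text \<open>\<open>n / 2\<close> is the largest index, and no F can raise it.\<close>

lemma uact_Upsilon_top:
  assumes "set_mset \<mu> \<subseteq> J" "\<mu> \<noteq> {#}" shows "uact (Suc 0) (\<Upsilon> \<mu>) (var (of_nat n / 2)) = 0"
proof -
  have top: "of_nat n / 2 \<in> wtI J" by (auto simp: wtI_eq intro!: image_eqI[of _ _ n])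
  obtain b where b: "\<Upsilon> \<mu> = ucls J b"
    "\<And>w. w \<in> keys b \<Longrightarrow> \<exists>is. letters w = map GF is \<and> set is \<subseteq> J \<and> length is = size \<mu>"
    using Uminus_wt_word[OF assms(1) Upsilon_wt[OF assms(1)]] by metis
  have "lact nat_rep b (var (of_nat n / 2)) = 0"
  proof (rule lact_zero)
    fix w assume "w \<in> keys b"
    then obtain "is" where w: "letters w = map GF is" "set is \<subseteq> J" "length is = size \<mu>" using b(2) by blast
    have "0 < (of_nat (length is) :: rat)" using assms(2) w(3) by (simp add: nonempty_has_size)
    then have "of_nat n / 2 + of_nat (length is) \<notin> wtI J" using wtI_bounds by fastforce
    then show "foldr nat_rep (letters w) (var (of_nat n / 2)) = 0"
      unfolding w(1) using w(2) top by (intro F_word_vanish)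
  qed
  then show ?thesis using top by (simp add: b(1) uact_1_ucls)
qed

lemma partial_carrier: "partial J \<Upsilon> k \<in> carrier (UU J)"
proof -
  interpret ring "UU J" by (rule ring_UU)
  show ?thesis unfolding partial_def by (rule finsum_closed) (use Upsilon_carrier in auto)
qed

lemma uact_partial:
  assumes "x \<in> tpow J (Suc 0)"
  shows "uact (Suc 0) (partial J \<Upsilon> k) x = (\<Sum>\<mu> | set_mset \<mu> \<subseteq> J \<and> size \<mu> < k. uact (Suc 0) (\<Upsilon> \<mu>) x)"
  unfolding partial_def using assms Upsilon_carrier by (intro uact_finsum finite_roots) auto

text \<open>Components of height above \<open>n\<close> act by 0, so that a partial sum, an element
  of the quantum group itself, acts like the whole series.\<close>

lemma quasi_K_act_partial:
  assumes x: "x \<in> tpow J (Suc 0)" and k: "n < k"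
  shows "quasi_K_act J \<Upsilon> (Suc 0) x = uact (Suc 0) (partial J \<Upsilon> k) x"
  unfolding quasi_K_act_def uact_partial[OF x]
proof (rule sum.mono_neutral_left[OF finite_roots])
  show "{\<mu>. set_mset \<mu> \<subseteq> J \<and> uact (Suc 0) (\<Upsilon> \<mu>) x \<noteq> 0} \<subseteq> {\<mu>. set_mset \<mu> \<subseteq> J \<and> size \<mu> < k}"
    using uact_Upsilon_long[OF _ _ x] k by (auto simp: not_less[symmetric] dest: order_less_le_trans)
qed blast

lemma quasi_K_act_add:
  assumes "x \<in> tpow J (Suc 0)" "y \<in> tpow J (Suc 0)"
  shows "quasi_K_act J \<Upsilon> (Suc 0) (x + y) = quasi_K_act J \<Upsilon> (Suc 0) x + quasi_K_act J \<Upsilon> (Suc 0) y"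
  using assms uact_lin(1)[OF _ partial_carrier, of "Suc 0"] by (simp add: quasi_K_act_partial[of _ "Suc n"])

lemma quasi_K_act_top: "quasi_K_act J \<Upsilon> (Suc 0) (var (of_nat n / 2)) = var (of_nat n / 2)"
proof -
  have top: "var (of_nat n / 2) \<in> tpow J (Suc 0)" by (auto simp: wtI_eq intro!: image_eqI[of _ _ n])
  have one: "uact (Suc 0) (\<Upsilon> {#}) (var (of_nat n / 2)) = var (of_nat n / 2)"
    using K uact_one[OF _ top] by (simp add: is_quasi_K_def)
  have "quasi_K_act J \<Upsilon> (Suc 0) (var (of_nat n / 2)) = (\<Sum>\<mu>\<in>{{#}}. uact (Suc 0) (\<Upsilon> \<mu>) (var (of_nat n / 2)))"
    unfolding quasi_K_act_def
    by (rule sum.mono_neutral_left) (use uact_Upsilon_top in auto)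
  then show ?thesis using one by simp
qed

text \<open>On the natural module the intertwining property becomes an exact identity with
  \<open>psi u = u\<close> on one side and \<open>U_bar u\<close> on the other, and
  \<open>U_bar u\<close> acts there as \<open>u\<close> does.\<close>

lemma quasi_K_act_commute:
  assumes u: "u \<in> Ui J" "psi u = u" and bar: "U_bar u \<in> carrier (UU J)"
    "\<And>y. y \<in> tpow J (Suc 0) \<Longrightarrow> uact (Suc 0) (U_bar u) y = uact (Suc 0) u y"
    and x: "x \<in> tpow J (Suc 0)"
  shows "uact (Suc 0) u (quasi_K_act J \<Upsilon> (Suc 0) x) = quasi_K_act J \<Upsilon> (Suc 0) (uact (Suc 0) u x)"
proof -
  have uc: "u \<in> carrier (UU J)" using u Ui_carrier by blast
  obtain n0 where "\<forall>k\<ge>n0. u \<otimes>\<^bsub>UU J\<^esub> partial J \<Upsilon> k \<ominus>\<^bsub>UU J\<^esub> partial J \<Upsilon> k \<otimes>\<^bsub>UU J\<^esub> U_bar u \<in> U_ge J (Suc n)"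
    using K u unfolding is_quasi_K_def Uhat_eq_def by metis
  then obtain k where k: "n < k" "u \<otimes>\<^bsub>UU J\<^esub> partial J \<Upsilon> k \<ominus>\<^bsub>UU J\<^esub> partial J \<Upsilon> k \<otimes>\<^bsub>UU J\<^esub> U_bar u \<in> U_ge J (Suc n)"
    by (metis max.cobounded1 max.cobounded2 Suc_le_eq)
  interpret ring "UU J" by (rule ring_UU)
  note P = partial_carrier[of k]
  have "uact (Suc 0) u (uact (Suc 0) (partial J \<Upsilon> k) x) = uact (Suc 0) (partial J \<Upsilon> k) (uact (Suc 0) (U_bar u) x)"
    using uact_U_ge[OF k(2) x] uact_hom[of "Suc 0" _ J, OF _ _ _ x] uc bar(1) P by simp
  then show ?thesis
    using bar(2)[OF x] k(1) x uact_closed[OF _ uc x] by (simp add: quasi_K_act_partial)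
qed

lemma quasi_K_act_gens:
  assumes x: "x \<in> tpow J (Suc 0)"
  shows "i \<in> J \<Longrightarrow> i > 0 \<Longrightarrow> uact (Suc 0) (ie J i) (quasi_K_act J \<Upsilon> (Suc 0) x) = quasi_K_act J \<Upsilon> (Suc 0) (uact (Suc 0) (ie J i) x)"
    "i \<in> J \<Longrightarrow> i > 0 \<Longrightarrow> uact (Suc 0) (ifl J i) (quasi_K_act J \<Upsilon> (Suc 0) x) = quasi_K_act J \<Upsilon> (Suc 0) (uact (Suc 0) (ifl J i) x)"
    "0 \<in> J \<Longrightarrow> uact (Suc 0) (it J) (quasi_K_act J \<Upsilon> (Suc 0) x) = quasi_K_act J \<Upsilon> (Suc 0) (uact (Suc 0) (it J) x)"
proof -
  have bar: "U_bar (ucls J a) \<in> carrier (UU J)" if "a \<in> carrier (free_algebra (Ugens J))" for a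
    using falg_bar_closed[OF that] by (simp add: U_bar_ucls carrier_UU)
  have c: "U_bar (ie J i) \<in> carrier (UU J)" "U_bar (ifl J i) \<in> carrier (UU J)" if "i \<in> J"
    using that J_minus unfolding ie_def ifl_def by (simp_all add: bar)
  have t: "U_bar (it J) \<in> carrier (UU J)" if "0 \<in> J"
    using that unfolding it_def by (simp add: bar)
  have psi_eq: "i \<in> J \<Longrightarrow> i > 0 \<Longrightarrow> psi (ie J i) = ie J i" "i \<in> J \<Longrightarrow> i > 0 \<Longrightarrow> psi (ifl J i) = ifl J i"
    "0 \<in> J \<Longrightarrow> psi (it J) = it J"
    using psi by (simp_all add: is_iota_bar_def)
  show "i \<in> J \<Longrightarrow> i > 0 \<Longrightarrow> uact (Suc 0) (ie J i) (quasi_K_act J \<Upsilon> (Suc 0) x) = quasi_K_act J \<Upsilon> (Suc 0) (uact (Suc 0) (ie J i) x)"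
    by (rule quasi_K_act_commute) (simp_all add: Ui_closed psi_eq c uact_U_bar x)
  show "i \<in> J \<Longrightarrow> i > 0 \<Longrightarrow> uact (Suc 0) (ifl J i) (quasi_K_act J \<Upsilon> (Suc 0) x) = quasi_K_act J \<Upsilon> (Suc 0) (uact (Suc 0) (ifl J i) x)"
    by (rule quasi_K_act_commute) (simp_all add: Ui_closed psi_eq c uact_U_bar x)
  show "0 \<in> J \<Longrightarrow> uact (Suc 0) (it J) (quasi_K_act J \<Upsilon> (Suc 0) x) = quasi_K_act J \<Upsilon> (Suc 0) (uact (Suc 0) (it J) x)"
    by (rule quasi_K_act_commute) (simp_all add: Ui_closed psi_eq t uact_U_bar_t x)
qed

text \<open>Descending induction from the largest index. The step from \<open>a\<close> to
  \<open>a - 1\<close> is made by e of index \<open>a - 1/2\<close> if \<open>a > 1/2\<close>, by t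
  if \<open>a = 1/2\<close>, and by f of index \<open>1/2 - a\<close> if
  \<open>a \<le> 0\<close>.\<close>

lemma quasi_K_act_var:
  assumes "k \<le> n" shows "quasi_K_act J \<Upsilon> (Suc 0) (var (of_nat n / 2 - of_nat k)) = var (of_nat n / 2 - of_nat k)"
  using assms
proof (induct k rule: less_induct)
  case (less k)
  let ?Y = "quasi_K_act J \<Upsilon> (Suc 0)"
  show ?case
  proof (cases k)
    case 0
    then show ?thesis using quasi_K_act_top by simp
  next
    case (Suc j)
    define a where "a = of_nat n / 2 - (of_nat j :: rat)"
    have Ya: "?Y (var a) = var a" using less Suc by (simp add: a_def)
    have a: "a \<in> wtI J"
      unfolding wtI_eq a_def using less(2) Suc by (intro image_eqI[of _ _ "n - j"]) (simp_all add: of_nat_diff)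
    have i1: "a - 1/2 \<in> J"
      unfolding J_eq a_def using less(2) Suc by (intro image_eqI[of _ _ "n - Suc j"]) (simp_all add: of_nat_diff)
    have i2: "1/2 - a \<in> J"
      unfolding J_eq a_def using less(2) Suc by (intro image_eqI[of _ _ j]) simp_all
    have "?Y (var (a - 1)) = var (a - 1)"
    proof -
      \<comment> \<open>Integrality of \<open>2 * a\<close> excludes the values strictly between 0
        and 1/2, so that the three cases are exhaustive.\<close>
      have "2 * a = of_int (int n - 2 * int j)" by (simp add: a_def)
      then obtain z where z: "2 * a = of_int z" by blast
      have "z \<ge> 2 \<or> z = 1 \<or> z \<le> 0" by linarith
      then have "of_int z \<ge> (2 :: rat) \<or> of_int z = (1 :: rat) \<or> of_int z \<le> (0 :: rat)" by auto
      then consider "a > 1/2" | "a = 1/2" | "a \<le> 0" unfolding z[symmetric] by linarith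
      then show ?thesis
      proof cases
        case 1
        then have "uact (Suc 0) (ie J (a - 1/2)) (var a) = var (a - 1)"
          using a by (simp add: uact_natural)
        then show ?thesis using quasi_K_act_gens(1)[of "var a" "a - 1/2"] 1 i1 a Ya by simp
      next
        case 2
        have "uact (Suc 0) (it J) (var a) = var (- a)" using 2 a by (simp add: uact_natural)
        moreover have "- a = a - 1" using 2 by simp
        ultimately have "uact (Suc 0) (it J) (var a) = var (a - 1)" by (simp only:)
        moreover have "0 \<in> J" using i1 2 by simp
        ultimately show ?thesis using quasi_K_act_gens(3)[of "var a"] a Ya by simp
      next
        case 3
        have e: "uact (Suc 0) (ifl J (1/2 - a)) (var a) = (if a = 0 then var 1 else 0) + var (a - 1)"
          using a 3 by (simp add: uact_natural)
        have Yf: "?Y ((if a = 0 then var 1 else 0) + var (a - 1)) = (if a = 0 then var 1 else 0) + var (a - 1)"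
          using quasi_K_act_gens(2)[of "var a" "1/2 - a"] 3 i2 a Ya by (simp add: e)
        have a': "a - 1 \<in> wtI J"
          unfolding wtI_eq a_def using less(2) Suc by (intro image_eqI[of _ _ "n - k"]) (simp_all add: of_nat_diff)
        show ?thesis
        proof (cases "a = 0")
          case True
          then have j: "of_nat n = (2 * of_nat j :: rat)" by (simp add: a_def)
          then have "n = 2 * j" by (metis of_nat_eq_iff of_nat_mult of_nat_numeral)
          \<comment> \<open>For \<open>a = 0\<close> the operator also produces
            \<open>var 1\<close>, which has the smaller number \<open>j - 1\<close> in the induction
            and is therefore already fixed.\<close>
          then have "?Y (var 1) = var 1"
            using less(1)[of "j - 1"] Suc n by (cases j) simp_all
          moreover have "1 \<in> wtI J" using a' wtI_uminus True by fastforce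
          ultimately show ?thesis
            using Yf True a' by (simp add: quasi_K_act_add)
        next
          case False
          then show ?thesis using Yf by simp
        qed
      qed
    qed
    then show ?thesis by (simp add: a_def Suc algebra_simps)
  qed
qed

lemma quasi_K_act_id: "x \<in> tpow J (Suc 0) \<Longrightarrow> quasi_K_act J \<Upsilon> (Suc 0) x = x"
proof -
  assume x: "x \<in> tpow J (Suc 0)"
  obtain b where b: "partial J \<Upsilon> (Suc n) = ucls J b" using partial_carrier by (rule UU_cases)
  have eq: "quasi_K_act J \<Upsilon> (Suc 0) y = lact nat_rep b y" if "y \<in> tpow J (Suc 0)" for y
    using that by (simp add: quasi_K_act_partial[of _ "Suc n"] b uact_1_ucls)
  have "lact nat_rep b x = x"
  proof (rule lin_eq_var[OF lin_lact[OF lin_nat_rep] lin_id x])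
    fix a assume a: "a \<in> wtI J"
    then obtain k where k: "k \<le> n" "a = of_nat k - of_nat n / 2" by (rule wtI_cases)
    then have "a = of_nat n / 2 - of_nat (n - k)" by (simp add: of_nat_diff)
    then have "quasi_K_act J \<Upsilon> (Suc 0) (var a) = var a" using quasi_K_act_var[of "n - k"] by simp
    then show "lact nat_rep b (var a) = var a" using eq a by simp
  qed
  then show ?thesis using eq[OF x] by simp
qed

section \<open>The map \<open>TT\<close> and the action of s_0\<close>

context
  fixes ws
  assumes ws: "reduced_longest J ws"
begin

lemma TT_eq_flip: assumes x: "x \<in> tpow J (Suc 0)" shows "TT J \<Upsilon> ws x = hgen 0 x"
proof -
  have "zeta J (Tw ws x) = hgen 0 x"
  proof (rule lin_eq_var[OF _ _ x])
    show "lin (\<lambda>x. zeta J (Tw ws x))" by (rule lin_compose[OF _ lin_Tw]) (simp add: zeta_def)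
  qed (simp_all add: zeta_Tw_var[OF ws] hgen_0_var)
  then show ?thesis
    using quasi_K_act_id[of "hgen 0 x"] hgen_closed'[of 0 "Suc 0" x] x by (simp add: TT_def)
qed

lemma TT_bij: "bij_betw (TT J \<Upsilon> ws) (tpow J (Suc 0)) (tpow J (Suc 0))"
proof -
  have "bij_betw (hgen 0) (tpow J (Suc 0)) (tpow J (Suc 0))"
    by (rule bij_betw_byWitness[where f' = "hgen 0"]) (use hgen_0_0[of "Suc 0"] hgen_closed'[of 0 "Suc 0"] in auto)
  then show ?thesis using bij_betw_cong[of "tpow J (Suc 0)" "TT J \<Upsilon> ws" "hgen 0"] TT_eq_flip by blast
qed

text \<open>On the natural module \<open>TT\<close> is the flip, an involution, so that it is its
  own inverse.\<close>

lemma inv_TT: assumes x: "x \<in> tpow J (Suc 0)" shows "inv_into (tpow J (Suc 0)) (TT J \<Upsilon> ws) x = hgen 0 x"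
proof (rule inv_into_f_eq[OF bij_betw_imp_inj_on[OF TT_bij]])
  show "hgen 0 x \<in> tpow J (Suc 0)" using hgen_closed'[of 0 "Suc 0"] x by simp
  then show "TT J \<Upsilon> ws (hgen 0 x) = x" using hgen_0_0[OF _ x] by (simp add: TT_eq_flip)
qed

lemma inv_TT_tensor:
  assumes m: "m \<ge> 1" and x: "x \<in> tpow J m"
  shows "tmap 1 (inv_into (tpow J (Suc 0)) (TT J \<Upsilon> ws)) id x = hact x (hcls m (var 0))"
proof -
  have "tmap 1 (inv_into (tpow J (Suc 0)) (TT J \<Upsilon> ws)) id x = hgen 0 x"
  proof (rule lin_eq_tpow[OF lin_tmap lin_hgen x])
    fix f assume "f \<in> words (wtI J) m"
    then obtain a g where f: "f = a # g" "a \<in> wtI J" using m by (cases f) (auto simp: words_def)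
    then show "tmap 1 (inv_into (tpow J (Suc 0)) (TT J \<Upsilon> ws)) id (monomial f) = hgen 0 (monomial f)"
      by (simp add: tmap_def inv_TT hgen_0 hgen_0_var flip: monomial_Cons)
  qed
  then show ?thesis using hact_hcls'[OF m x] by (simp add: ract_var)
qed

end

end

end

section \<open>The two families of index sets\<close>

lemma weight_index_II_A: "1 \<le> r \<Longrightarrow> weight_index (II_A r) (2 * r)"
proof
  have "{- int r .. int r - 1} = (\<lambda>k. int k - int r) ` {..<2 * r}"
  proof (intro equalityI subsetI)
    fix k assume "k \<in> {- int r .. int r - 1}"
    then show "k \<in> (\<lambda>k. int k - int r) ` {..<2 * r}" by (intro image_eqI[of _ _ "nat (k + int r)"]) auto
  qed auto
  then show "II_A r = (\<lambda>k. of_nat k - of_nat (2 * r) / 2 + 1/2) ` {..<2 * r}"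
    by (simp add: II_A_def image_image)
qed simp

lemma weight_index_II_B: "weight_index (II_B r) (2 * r + 1)"
proof
  have "{- int r .. int r} = (\<lambda>k. int k - int r) ` {..<2 * r + 1}"
  proof (intro equalityI subsetI)
    fix k assume "k \<in> {- int r .. int r}"
    then show "k \<in> (\<lambda>k. int k - int r) ` {..<2 * r + 1}" by (intro image_eqI[of _ _ "nat (k + int r)"]) auto
  qed auto
  then show "II_B r = (\<lambda>k. of_nat k - of_nat (2 * r + 1) / 2 + 1/2) ` {..<2 * r + 1}"
    by (simp add: II_B_def image_image add_divide_distrib)
qed simp

theorem theorem3p4:
  fixes r m :: nat and J :: "rat set"
  assumes "(1 \<le> r \<and> J = II_A r) \<or> J = II_B r"
    and "1 \<le> m"
  shows
    "(\<forall>psi \<Upsilon> ws. is_iota_bar J psi \<and> is_quasi_K J psi \<Upsilon> \<and> reduced_longest J ws \<longrightarrow>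
        bij_betw (TT J \<Upsilon> ws) (tpow J 1) (tpow J 1) \<and>
        (\<forall>x\<in>tpow J m. tmap 1 (inv_into (tpow J 1) (TT J \<Upsilon> ws)) id x = hact x (hcls m (var 0)))) \<and>
     (\<forall>u\<in>Ui J. \<forall>h\<in>carrier (HB m). \<forall>x\<in>tpow J m. uact m u (hact x h) = hact (uact m u x) h) \<and>
     Ui_image J m = centralizer_in (tpow J m) (HB_image J m) \<and>
     HB_image J m = centralizer_in (tpow J m) (Ui_image J m)"
proof -
  obtain n where "weight_index J n"
    using assms(1) weight_index_II_A weight_index_II_B by blast
  then interpret tensor_space J n m
    using assms(2) by (simp add: tensor_space_def tensor_space_axioms_def)
  show ?thesis
    using TT_bij inv_TT_tensor[OF _ _ _ assms(2)] uact_hact_commute[OF assms(2)]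
      Ui_image_centralizer HB_image_centralizer
    by (auto simp only: One_nat_def)
qed

end
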